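(* Let $\mathcal{C}$ be a finite tensor category and let $\mathcal{M}$ be an exact left $\mathcal{C}$-module category. Then the map $$\mathfrak{Top}(\mathcal{M})\to\mathfrak{Quo}(A_{\mathcal{M}}),\quad \mathcal{S}\mapsto A_{\mathcal{S}}=\int_{X\in\mathcal{S}}\underline{\mathrm{Hom}}(X,X)$$ (where $A_{\mathcal{S}}$ is a quotient of $A_{\mathcal{M}}$ via the canonical morphism $\phi_{\mathcal{M}|\mathcal{S}}:A_{\mathcal{M}}\to A_{\mathcal{S}}$) preserves the order, i.e. $\mathcal{S}_1\supset\mathcal{S}_2$ implies $A_{\mathcal{S}_1}\ge A_{\mathcal{S}_2}$. If, moreover, $\mathcal{M}$ is indecomposable, then this map reflects the order, i.e. $A_{\mathcal{S}_1}\ge A_{\mathcal{S}_2}$ implies $\mathcal{S}_1\supset\mathcal{S}_2$.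
   Context: $k$ is an algebraically closed field. A finite abelian category is a $k$-linear category equivalent to finite-dimensional left modules over a finite-dimensional $k$-algebra. A finite tensor category is a rigid monoidal category $\mathcal{C}$ that is finite abelian, with $k$-linear tensor product in each variable and simple unit. A finite left $\mathcal{C}$-module category is a left $\mathcal{C}$-module category that is finite abelian with action $\otimes$ $k$-linear and right exact in each variable; it is exact if $P\otimes M$ is projective for all projective $P\in\mathcal{C}$ and all $M\in\mathcal{M}$; it is indecomposable if it is nonzero and not a direct sum of two nonzero $\mathcal{C}$-module full subcategories. The internal Hom $\underline{\mathrm{Hom}}(M,-)$ is a right adjoint of $X\mapsto X\otimes M$, $\mathcal{C}\to\mathcal{M}$, extended to a functor $\mathcal{M}^{\mathrm{op}}\times\mathcal{M}\to\mathcal{C}$. A full subcategory of an abelian category is topologizing if it is closed under finite direct sums and subquotients; $\mathfrak{Top}(\mathcal{M})$ is the class of topologizing full subcategories of $\mathcal{M}$, ordered by inclusion. For $\mathcal{S}\in\mathfrak{Top}(\mathcal{M})$, $A_{\mathcal{S}}$ denotes the end of $\mathcal{S}^{\mathrm{op}}\times\mathcal{S}\to\mathcal{C}$, $(X,X')\mapsto\underline{\mathrm{Hom}}(X,X')$ (which exists), with universal dinatural transformation $\pi_{\mathcal{S}}(X):A_{\mathcal{S}}\to\underline{\mathrm{Hom}}(X,X)$. For $\mathcal{S}_1\supset\mathcal{S}_2$, $\phi_{\mathcal{S}_1|\mathcal{S}_2}:A_{\mathcal{S}_1}\to A_{\mathcal{S}_2}$ is the unique morphism with $\pi_{\mathcal{S}_2}(X)\circ\phi_{\mathcal{S}_1|\mathcal{S}_2}=\pi_{\mathcal{S}_1}(X)$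 for all $X\in\mathcal{S}_2$. $\mathfrak{Quo}(Y)$ is the set of quotient objects of an object $Y$, with $Q_1\ge Q_2$ if there is a morphism $Q_1\to Q_2$ compatible with the quotient morphisms from $Y$. *)

theory Defs
  imports "HOL-Computational_Algebra.Computational_Algebra" "Jordan_Normal_Form.Matrix"
begin

section \<open>Categories, functors, natural isomorphisms\<close>

record ('o, 'a) category =
  Obj :: "'o set"
  Arr :: "'a set"
  Dom :: "'a \<Rightarrow> 'o"
  Cod :: "'a \<Rightarrow> 'o"
  Id :: "'o \<Rightarrow> 'a"
  Cmp :: "'a \<Rightarrow> 'a \<Rightarrow> 'a" (infixr \<open>\<cdot>\<index>\<close> 70)

definition Hom :: "('o, 'a, 'z) category_scheme \<Rightarrow> 'o \<Rightarrow> 'o \<Rightarrow> 'a set" where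
  "Hom C X Y = {f \<in> Arr C. Dom C f = X \<and> Cod C f = Y}"

locale category =
  fixes C :: "('o, 'a, 'z) category_scheme" (structure)
  assumes dom_obj: "f \<in> Arr C \<Longrightarrow> Dom C f \<in> Obj C"
    and cod_obj: "f \<in> Arr C \<Longrightarrow> Cod C f \<in> Obj C"
    and id_hom: "X \<in> Obj C \<Longrightarrow> Id C X \<in> Hom C X X"
    and cmp_hom: "f \<in> Hom C X Y \<Longrightarrow> g \<in> Hom C Y Z \<Longrightarrow> g \<cdot> f \<in> Hom C X Z"
    and cmp_assoc: "f \<in> Hom C W X \<Longrightarrow> g \<in> Hom C X Y \<Longrightarrow> h \<in> Hom C Y Z
      \<Longrightarrow> (h \<cdot> g) \<cdot> f = h \<cdot> (g \<cdot> f)"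
    and cmp_id_left: "f \<in> Hom C X Y \<Longrightarrow> Id C Y \<cdot> f = f"
    and cmp_id_right: "f \<in> Hom C X Y \<Longrightarrow> f \<cdot> Id C X = f"

definition op_cat :: "('o, 'a, 'z) category_scheme \<Rightarrow> ('o, 'a) category" where
  "op_cat C = \<lparr>Obj = Obj C, Arr = Arr C, Dom = Cod C, Cod = Dom C, Id = Id C,
     Cmp = (\<lambda>g f. f \<cdot>\<^bsub>C\<^esub> g)\<rparr>"

definition prod_cat :: "('o, 'a, 'y) category_scheme \<Rightarrow> ('p, 'b, 'z) category_scheme
    \<Rightarrow> ('o \<times> 'p, 'a \<times> 'b) category" where
  "prod_cat A B = \<lparr>Obj = Obj A \<times> Obj B, Arr = Arr A \<times> Arr B,
     Dom = map_prod (Dom A) (Dom B), Cod = map_prod (Cod A) (Cod B),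
     Id = map_prod (Id A) (Id B),
     Cmp = (\<lambda>(g, g') (f, f'). (g \<cdot>\<^bsub>A\<^esub> f, g' \<cdot>\<^bsub>B\<^esub> f'))\<rparr>"

definition full_subcat :: "('o, 'a, 'z) category_scheme \<Rightarrow> 'o set \<Rightarrow> ('o, 'a) category" where
  "full_subcat C S = \<lparr>Obj = S, Arr = {f \<in> Arr C. Dom C f \<in> S \<and> Cod C f \<in> S},
     Dom = Dom C, Cod = Cod C, Id = Id C, Cmp = Cmp C\<rparr>"

locale cat_functor = A: category A + B: category B
  for A :: "('o, 'a, 'y) category_scheme" and B :: "('p, 'b, 'z) category_scheme" +
  fixes Fo :: "'o \<Rightarrow> 'p" and Fa :: "'a \<Rightarrow> 'b"
  assumes map_obj: "X \<in> Obj A \<Longrightarrow> Fo X \<in> Obj B"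
    and map_hom: "f \<in> Hom A X Y \<Longrightarrow> Fa f \<in> Hom B (Fo X) (Fo Y)"
    and map_id: "X \<in> Obj A \<Longrightarrow> Fa (Id A X) = Id B (Fo X)"
    and map_cmp: "f \<in> Hom A X Y \<Longrightarrow> g \<in> Hom A Y Z \<Longrightarrow> Fa (g \<cdot>\<^bsub>A\<^esub> f) = Fa g \<cdot>\<^bsub>B\<^esub> Fa f"

definition iso_arr :: "('o, 'a, 'z) category_scheme \<Rightarrow> 'a \<Rightarrow> bool" where
  "iso_arr C f \<longleftrightarrow> f \<in> Arr C \<and>
     (\<exists>g \<in> Hom C (Cod C f) (Dom C f).
        g \<cdot>\<^bsub>C\<^esub> f = Id C (Dom C f) \<and> f \<cdot>\<^bsub>C\<^esub> g = Id C (Cod C f))"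

definition inv_arr :: "('o, 'a, 'z) category_scheme \<Rightarrow> 'a \<Rightarrow> 'a" where
  "inv_arr C f = (THE g. g \<in> Hom C (Cod C f) (Dom C f) \<and>
     g \<cdot>\<^bsub>C\<^esub> f = Id C (Dom C f) \<and> f \<cdot>\<^bsub>C\<^esub> g = Id C (Cod C f))"

definition mono_arr :: "('o, 'a, 'z) category_scheme \<Rightarrow> 'a \<Rightarrow> bool" where
  "mono_arr C f \<longleftrightarrow> f \<in> Arr C \<and>
     (\<forall>W \<in> Obj C. \<forall>g \<in> Hom C W (Dom C f). \<forall>h \<in> Hom C W (Dom C f).
        f \<cdot>\<^bsub>C\<^esub> g = f \<cdot>\<^bsub>C\<^esub> h \<longrightarrow> g = h)"

definition epi_arr :: "('o, 'a, 'z) category_scheme \<Rightarrow> 'a \<Rightarrow> bool" where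
  "epi_arr C f \<longleftrightarrow> f \<in> Arr C \<and>
     (\<forall>W \<in> Obj C. \<forall>g \<in> Hom C (Cod C f) W. \<forall>h \<in> Hom C (Cod C f) W.
        g \<cdot>\<^bsub>C\<^esub> f = h \<cdot>\<^bsub>C\<^esub> f \<longrightarrow> g = h)"

definition zero_object :: "('o, 'a, 'z) category_scheme \<Rightarrow> 'o \<Rightarrow> bool" where
  "zero_object C Z \<longleftrightarrow> Z \<in> Obj C \<and>
     (\<forall>X \<in> Obj C. (\<exists>!f. f \<in> Hom C X Z) \<and> (\<exists>!f. f \<in> Hom C Z X))"

definition projective_object :: "('o, 'a, 'z) category_scheme \<Rightarrow> 'o \<Rightarrow> bool" where
  "projective_object C P \<longleftrightarrow> P \<in> Obj C \<and>
     (\<forall>e f. epi_arr C e \<and> f \<in> Hom C P (Cod C e) \<longrightarrow>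
        (\<exists>g \<in> Hom C P (Dom C e). e \<cdot>\<^bsub>C\<^esub> g = f))"

definition simple_object :: "('o, 'a, 'z) category_scheme \<Rightarrow> 'o \<Rightarrow> bool" where
  "simple_object C X \<longleftrightarrow> X \<in> Obj C \<and> \<not> zero_object C X \<and>
     (\<forall>i. mono_arr C i \<and> Cod C i = X \<longrightarrow> zero_object C (Dom C i) \<or> iso_arr C i)"

definition natural_iso :: "('o, 'a, 'y) category_scheme \<Rightarrow> ('p, 'b, 'z) category_scheme
    \<Rightarrow> ('o \<Rightarrow> 'p) \<Rightarrow> ('a \<Rightarrow> 'b) \<Rightarrow> ('o \<Rightarrow> 'p) \<Rightarrow> ('a \<Rightarrow> 'b) \<Rightarrow> ('o \<Rightarrow> 'b) \<Rightarrow> bool" where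
  "natural_iso A B Fo Fa Go Ga t \<longleftrightarrow>
     cat_functor A B Fo Fa \<and> cat_functor A B Go Ga \<and>
     (\<forall>X \<in> Obj A. t X \<in> Hom B (Fo X) (Go X) \<and> iso_arr B (t X)) \<and>
     (\<forall>f \<in> Arr A. Ga f \<cdot>\<^bsub>B\<^esub> t (Dom A f) = t (Cod A f) \<cdot>\<^bsub>B\<^esub> Fa f)"

section \<open>Linear categories\<close>

record ('k, 'o, 'a) lincat = "('o, 'a) category" +
  AddA :: "'a \<Rightarrow> 'a \<Rightarrow> 'a"
  ZeroA :: "'o \<Rightarrow> 'o \<Rightarrow> 'a"
  ScaleA :: "'k \<Rightarrow> 'a \<Rightarrow> 'a"

definition scalars :: "'k::field ring" where
  "scalars = \<lparr>carrier = UNIV, mult = (*), one = 1, zero = 0, add = (+)\<rparr>"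

text \<open>The fields \<open>mult\<close> and \<open>one\<close> exist only because the \<open>module\<close> record of HOL-Algebra extends
  that of rings; the locale \<open>module\<close> does not constrain them.\<close>

definition hom_space :: "('k, 'o, 'a, 'z) lincat_scheme \<Rightarrow> 'o \<Rightarrow> 'o \<Rightarrow> ('k, 'a) module" where
  "hom_space C X Y = \<lparr>carrier = Hom C X Y, mult = undefined, one = undefined,
     zero = ZeroA C X Y, add = AddA C, smult = ScaleA C\<rparr>"

locale linear_category = category C
  for C :: "('k::field, 'o, 'a, 'z) lincat_scheme" (structure) +
  assumes hom_space_module:
      "X \<in> Obj C \<Longrightarrow> Y \<in> Obj C \<Longrightarrow> module (scalars :: 'k ring) (hom_space C X Y)"
    and cmp_add_left: "f \<in> Hom C X Y \<Longrightarrow> g \<in> Hom C Y Z \<Longrightarrow> g' \<in> Hom C Y Z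
      \<Longrightarrow> (AddA C g g') \<cdot> f = AddA C (g \<cdot> f) (g' \<cdot> f)"
    and cmp_add_right: "f \<in> Hom C X Y \<Longrightarrow> f' \<in> Hom C X Y \<Longrightarrow> g \<in> Hom C Y Z
      \<Longrightarrow> g \<cdot> (AddA C f f') = AddA C (g \<cdot> f) (g \<cdot> f')"
    and cmp_scale_left: "f \<in> Hom C X Y \<Longrightarrow> g \<in> Hom C Y Z
      \<Longrightarrow> (ScaleA C c g) \<cdot> f = ScaleA C c (g \<cdot> f)"
    and cmp_scale_right: "f \<in> Hom C X Y \<Longrightarrow> g \<in> Hom C Y Z
      \<Longrightarrow> g \<cdot> (ScaleA C c f) = ScaleA C c (g \<cdot> f)"

locale linear_functor = A: linear_category A + B: linear_category B + cat_functor A B Fo Fa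
  for A :: "('k::field, 'o, 'a, 'y) lincat_scheme" and B :: "('k, 'p, 'b, 'z) lincat_scheme"
    and Fo :: "'o \<Rightarrow> 'p" and Fa :: "'a \<Rightarrow> 'b" +
  assumes map_add: "f \<in> Hom A X Y \<Longrightarrow> f' \<in> Hom A X Y \<Longrightarrow> Fa (AddA A f f') = AddA B (Fa f) (Fa f')"
    and map_scale: "f \<in> Hom A X Y \<Longrightarrow> Fa (ScaleA A c f) = ScaleA B c (Fa f)"

definition linear_equivalent :: "('k::field, 'o, 'a, 'y) lincat_scheme
    \<Rightarrow> ('k, 'p, 'b, 'z) lincat_scheme \<Rightarrow> bool" where
  "linear_equivalent A B \<longleftrightarrow>
     (\<exists>Fo Fa Go Ga t s. linear_functor A B Fo Fa \<and> linear_functor B A Go Ga \<and>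
        natural_iso A A id id (Go \<circ> Fo) (Ga \<circ> Fa) t \<and>
        natural_iso B B (Fo \<circ> Go) (Fa \<circ> Ga) id id s)"

definition is_cokernel :: "('k, 'o, 'a, 'z) lincat_scheme \<Rightarrow> 'a \<Rightarrow> 'a \<Rightarrow> bool" where
  "is_cokernel C f c \<longleftrightarrow> f \<in> Arr C \<and> c \<in> Arr C \<and> Dom C c = Cod C f \<and>
     c \<cdot>\<^bsub>C\<^esub> f = ZeroA C (Dom C f) (Cod C c) \<and>
     (\<forall>W \<in> Obj C. \<forall>g \<in> Hom C (Cod C f) W. g \<cdot>\<^bsub>C\<^esub> f = ZeroA C (Dom C f) W \<longrightarrow>
        (\<exists>!h. h \<in> Hom C (Cod C c) W \<and> h \<cdot>\<^bsub>C\<^esub> c = g))"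

text \<open>In an abelian category \<open>X \<rightarrow> Y \<rightarrow> Z \<rightarrow> 0\<close> is exact iff the second arrow is a cokernel of
  the first.\<close>

definition right_exact :: "('k, 'o, 'a, 'y) lincat_scheme \<Rightarrow> ('l, 'p, 'b, 'z) lincat_scheme
    \<Rightarrow> ('o \<Rightarrow> 'p) \<Rightarrow> ('a \<Rightarrow> 'b) \<Rightarrow> bool" where
  "right_exact A B Fo Fa \<longleftrightarrow> cat_functor A B Fo Fa \<and>
     (\<forall>f c. is_cokernel A f c \<longrightarrow> is_cokernel B (Fa f) (Fa c))"

definition is_direct_sum :: "('k, 'o, 'a, 'z) lincat_scheme \<Rightarrow> 'o \<Rightarrow> 'o \<Rightarrow> 'o \<Rightarrow> bool" where
  "is_direct_sum C X Y Z \<longleftrightarrow> X \<in> Obj C \<and> Y \<in> Obj C \<and> Z \<in> Obj C \<and>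
     (\<exists>i \<in> Hom C X Z. \<exists>j \<in> Hom C Y Z. \<exists>p \<in> Hom C Z X. \<exists>q \<in> Hom C Z Y.
        p \<cdot>\<^bsub>C\<^esub> i = Id C X \<and> q \<cdot>\<^bsub>C\<^esub> j = Id C Y \<and>
        p \<cdot>\<^bsub>C\<^esub> j = ZeroA C Y X \<and> q \<cdot>\<^bsub>C\<^esub> i = ZeroA C X Y \<and>
        AddA C (i \<cdot>\<^bsub>C\<^esub> p) (j \<cdot>\<^bsub>C\<^esub> q) = Id C Z)"

section \<open>Finite-dimensional modules and finite abelian categories\<close>

text \<open>Finite-dimensional algebras and modules are taken in coordinates: an algebra has underlying
  vector space \<open>k\<^sup>n\<close>, and a module has underlying space \<open>k\<^sup>m\<close> and is given by a representation by
  \<open>m \<times> m\<close> matrices. Choosing bases, every finite-dimensional algebra is isomorphic to one of this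
  form, and the inclusion of these modules into all finite-dimensional left modules is an
  equivalence.\<close>

definition fd_algebra :: "nat \<Rightarrow> ('k::field, 'k vec) module \<Rightarrow> bool" where
  "fd_algebra n A \<longleftrightarrow>
     carrier A = carrier_vec n \<and> add A = (+) \<and> zero A = 0\<^sub>v n \<and> smult A = (\<cdot>\<^sub>v) \<and> ring A \<and>
     (\<forall>c. \<forall>a \<in> carrier A. \<forall>b \<in> carrier A.
        (c \<odot>\<^bsub>A\<^esub> a) \<otimes>\<^bsub>A\<^esub> b = c \<odot>\<^bsub>A\<^esub> (a \<otimes>\<^bsub>A\<^esub> b) \<and>
        a \<otimes>\<^bsub>A\<^esub> (c \<odot>\<^bsub>A\<^esub> b) = c \<odot>\<^bsub>A\<^esub> (a \<otimes>\<^bsub>A\<^esub> b))"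

type_synonym 'k fdmod = "nat \<times> ('k vec \<Rightarrow> 'k mat)"

definition is_fdmod :: "('k::field, 'k vec) module \<Rightarrow> 'k fdmod \<Rightarrow> bool" where
  "is_fdmod A = (\<lambda>(m, r).
     (\<forall>a \<in> carrier A. r a \<in> carrier_mat m m) \<and>
     (\<forall>a \<in> carrier A. \<forall>b \<in> carrier A. r (a \<oplus>\<^bsub>A\<^esub> b) = r a + r b) \<and>
     (\<forall>c. \<forall>a \<in> carrier A. r (c \<odot>\<^bsub>A\<^esub> a) = c \<cdot>\<^sub>m r a) \<and>
     (\<forall>a \<in> carrier A. \<forall>b \<in> carrier A. r (a \<otimes>\<^bsub>A\<^esub> b) = r a * r b) \<and>
     r \<one>\<^bsub>A\<^esub> = 1\<^sub>m m)"

definition fdmod_arr :: "('k::field, 'k vec) module \<Rightarrow> 'k fdmod \<times> 'k mat \<times> 'k fdmod \<Rightarrow> bool" where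
  "fdmod_arr A = (\<lambda>((m, r), T, (m', r')).
     is_fdmod A (m, r) \<and> is_fdmod A (m', r') \<and> T \<in> carrier_mat m' m \<and>
     (\<forall>a \<in> carrier A. T * r a = r' a * T))"

text \<open>An arrow is a triple of domain, intertwining matrix and codomain.\<close>

definition fdmod_cat :: "('k::field, 'k vec) module
    \<Rightarrow> ('k, 'k fdmod, 'k fdmod \<times> 'k mat \<times> 'k fdmod) lincat" where
  "fdmod_cat A = \<lparr>
     Obj = {V. is_fdmod A V},
     Arr = {f. fdmod_arr A f},
     Dom = (\<lambda>(V, T, W). V),
     Cod = (\<lambda>(V, T, W). W),
     Id = (\<lambda>V. (V, 1\<^sub>m (fst V), V)),
     Cmp = (\<lambda>(V', T', W') (V, T, W). (V, T' * T, W')),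
     AddA = (\<lambda>(V, T, W) (V', T', W'). (V, T + T', W)),
     ZeroA = (\<lambda>V W. (V, 0\<^sub>m (fst W) (fst V), W)),
     ScaleA = (\<lambda>c (V, T, W). (V, c \<cdot>\<^sub>m T, W))\<rparr>"

definition finite_abelian_category :: "('k::field, 'o, 'a, 'z) lincat_scheme \<Rightarrow> bool" where
  "finite_abelian_category C \<longleftrightarrow> linear_category C \<and>
     (\<exists>n (A :: ('k, 'k vec) module). fd_algebra n A \<and> linear_equivalent C (fdmod_cat A))"

section \<open>Finite tensor categories\<close>

record ('k, 'o, 'a) moncat = "('k, 'o, 'a) lincat" +
  TenO :: "'o \<Rightarrow> 'o \<Rightarrow> 'o"
  TenA :: "'a \<Rightarrow> 'a \<Rightarrow> 'a"
  UnitO :: 'o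
  Assoc :: "'o \<Rightarrow> 'o \<Rightarrow> 'o \<Rightarrow> 'a" \<comment> \<open>\<open>(X \<otimes> Y) \<otimes> Z \<rightarrow> X \<otimes> (Y \<otimes> Z)\<close>\<close>
  LUnit :: "'o \<Rightarrow> 'a" \<comment> \<open>\<open>1 \<otimes> X \<rightarrow> X\<close>\<close>
  RUnit :: "'o \<Rightarrow> 'a" \<comment> \<open>\<open>X \<otimes> 1 \<rightarrow> X\<close>\<close>

locale monoidal_category = category C
  for C :: "('k, 'o, 'a, 'z) moncat_scheme" (structure) +
  assumes tensor_functor: "cat_functor (prod_cat C C) C
      (\<lambda>(X, Y). TenO C X Y) (\<lambda>(f, g). TenA C f g)"
    and unit_obj: "UnitO C \<in> Obj C"
    and assoc_natural: "natural_iso (prod_cat C (prod_cat C C)) C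
      (\<lambda>(X, Y, Z). TenO C (TenO C X Y) Z) (\<lambda>(f, g, h). TenA C (TenA C f g) h)
      (\<lambda>(X, Y, Z). TenO C X (TenO C Y Z)) (\<lambda>(f, g, h). TenA C f (TenA C g h))
      (\<lambda>(X, Y, Z). Assoc C X Y Z)"
    and lunit_natural: "natural_iso C C
      (\<lambda>X. TenO C (UnitO C) X) (\<lambda>f. TenA C (Id C (UnitO C)) f) id id (LUnit C)"
    and runit_natural: "natural_iso C C
      (\<lambda>X. TenO C X (UnitO C)) (\<lambda>f. TenA C f (Id C (UnitO C))) id id (RUnit C)"
    and pentagon: "W \<in> Obj C \<Longrightarrow> X \<in> Obj C \<Longrightarrow> Y \<in> Obj C \<Longrightarrow> Z \<in> Obj C \<Longrightarrow>
      TenA C (Id C W) (Assoc C X Y Z) \<cdot> Assoc C W (TenO C X Y) Z \<cdot> TenA C (Assoc C W X Y) (Id C Z)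
      = Assoc C W X (TenO C Y Z) \<cdot> Assoc C (TenO C W X) Y Z"
    and triangle: "X \<in> Obj C \<Longrightarrow> Y \<in> Obj C \<Longrightarrow>
      TenA C (Id C X) (LUnit C Y) \<cdot> Assoc C X (UnitO C) Y = TenA C (RUnit C X) (Id C Y)"

text \<open>\<open>is_dual_pair C L X ev coev\<close>: \<open>L\<close> is a left dual of \<open>X\<close>, equivalently \<open>X\<close> is a right dual
  of \<open>L\<close>, with \<open>ev : L \<otimes> X \<rightarrow> 1\<close> and \<open>coev : 1 \<rightarrow> X \<otimes> L\<close>. The zigzag identities are stated as
  equalities of arrows \<open>1 \<otimes> X \<rightarrow> X\<close> and \<open>L \<otimes> 1 \<rightarrow> L\<close>.\<close>

definition is_dual_pair ::
    "('k, 'o, 'a, 'z) moncat_scheme \<Rightarrow> 'o \<Rightarrow> 'o \<Rightarrow> 'a \<Rightarrow> 'a \<Rightarrow> bool" where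
  "is_dual_pair C L X ev coev \<longleftrightarrow> L \<in> Obj C \<and> X \<in> Obj C \<and>
     ev \<in> Hom C (TenO C L X) (UnitO C) \<and> coev \<in> Hom C (UnitO C) (TenO C X L) \<and>
     RUnit C X \<cdot>\<^bsub>C\<^esub> TenA C (Id C X) ev \<cdot>\<^bsub>C\<^esub> Assoc C X L X \<cdot>\<^bsub>C\<^esub> TenA C coev (Id C X)
       = LUnit C X \<and>
     LUnit C L \<cdot>\<^bsub>C\<^esub> TenA C ev (Id C L) \<cdot>\<^bsub>C\<^esub> inv_arr C (Assoc C L X L) \<cdot>\<^bsub>C\<^esub> TenA C (Id C L) coev
       = RUnit C L"

definition rigid :: "('k, 'o, 'a, 'z) moncat_scheme \<Rightarrow> bool" where
  "rigid C \<longleftrightarrow> (\<forall>X \<in> Obj C.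
     (\<exists>L ev coev. is_dual_pair C L X ev coev) \<and> (\<exists>R ev coev. is_dual_pair C X R ev coev))"

locale finite_tensor_category = monoidal_category C
  for C :: "('k::field, 'o, 'a, 'z) moncat_scheme" (structure) +
  assumes finite_abelian: "finite_abelian_category C"
    and tensor_linear_right: "X \<in> Obj C \<Longrightarrow>
      linear_functor C C (\<lambda>Y. TenO C X Y) (\<lambda>g. TenA C (Id C X) g)"
    and tensor_linear_left: "Y \<in> Obj C \<Longrightarrow>
      linear_functor C C (\<lambda>X. TenO C X Y) (\<lambda>f. TenA C f (Id C Y))"
    and rigid: "rigid C"
    and unit_simple: "simple_object C (UnitO C)"

section \<open>Module categories\<close>

record ('k, 'co, 'ca, 'o, 'a) modcat = "('k, 'o, 'a) lincat" +
  ActO :: "'co \<Rightarrow> 'o \<Rightarrow> 'o"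
  ActA :: "'ca \<Rightarrow> 'a \<Rightarrow> 'a"
  MAssoc :: "'co \<Rightarrow> 'co \<Rightarrow> 'o \<Rightarrow> 'a" \<comment> \<open>\<open>(X \<otimes> Y) \<otimes> M \<rightarrow> X \<otimes> (Y \<otimes> M)\<close>\<close>
  MUnit :: "'o \<Rightarrow> 'a" \<comment> \<open>\<open>1 \<otimes> M \<rightarrow> M\<close>\<close>

locale module_category = C: monoidal_category C + M: category M
  for C :: "('k, 'co, 'ca, 'y) moncat_scheme"
    and M :: "('l, 'co, 'ca, 'o, 'a, 'z) modcat_scheme" +
  assumes action_functor: "cat_functor (prod_cat C M) M
      (\<lambda>(X, N). ActO M X N) (\<lambda>(f, g). ActA M f g)"
    and massoc_natural: "natural_iso (prod_cat C (prod_cat C M)) M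
      (\<lambda>(X, Y, N). ActO M (TenO C X Y) N) (\<lambda>(f, g, h). ActA M (TenA C f g) h)
      (\<lambda>(X, Y, N). ActO M X (ActO M Y N)) (\<lambda>(f, g, h). ActA M f (ActA M g h))
      (\<lambda>(X, Y, N). MAssoc M X Y N)"
    and munit_natural: "natural_iso M M
      (\<lambda>N. ActO M (UnitO C) N) (\<lambda>g. ActA M (Id C (UnitO C)) g) id id (MUnit M)"
    and mpentagon: "X \<in> Obj C \<Longrightarrow> Y \<in> Obj C \<Longrightarrow> Z \<in> Obj C \<Longrightarrow> N \<in> Obj M \<Longrightarrow>
      ActA M (Id C X) (MAssoc M Y Z N) \<cdot>\<^bsub>M\<^esub> MAssoc M X (TenO C Y Z) N
          \<cdot>\<^bsub>M\<^esub> ActA M (Assoc C X Y Z) (Id M N)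
      = MAssoc M X Y (ActO M Z N) \<cdot>\<^bsub>M\<^esub> MAssoc M (TenO C X Y) Z N"
    and mtriangle: "X \<in> Obj C \<Longrightarrow> N \<in> Obj M \<Longrightarrow>
      ActA M (Id C X) (MUnit M N) \<cdot>\<^bsub>M\<^esub> MAssoc M X (UnitO C) N = ActA M (RUnit C X) (Id M N)"

locale finite_module_category = module_category C M
  for C :: "('k::field, 'co, 'ca, 'y) moncat_scheme"
    and M :: "('k, 'co, 'ca, 'o, 'a, 'z) modcat_scheme" +
  assumes finite_abelian: "finite_abelian_category M"
    and action_linear_right: "X \<in> Obj C \<Longrightarrow>
      linear_functor M M (\<lambda>N. ActO M X N) (\<lambda>g. ActA M (Id C X) g)"
    and action_linear_left: "N \<in> Obj M \<Longrightarrow>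
      linear_functor C M (\<lambda>X. ActO M X N) (\<lambda>f. ActA M f (Id M N))"
    and action_right_exact_right: "X \<in> Obj C \<Longrightarrow>
      right_exact M M (\<lambda>N. ActO M X N) (\<lambda>g. ActA M (Id C X) g)"
    and action_right_exact_left: "N \<in> Obj M \<Longrightarrow>
      right_exact C M (\<lambda>X. ActO M X N) (\<lambda>f. ActA M f (Id M N))"

locale exact_module_category = finite_module_category C M
  for C :: "('k::field, 'co, 'ca, 'y) moncat_scheme"
    and M :: "('k, 'co, 'ca, 'o, 'a, 'z) modcat_scheme" +
  assumes action_projective: "projective_object C P \<Longrightarrow> N \<in> Obj M \<Longrightarrow>
      projective_object M (ActO M P N)"

definition module_full_subcat :: "('k, 'co, 'ca, 'y) moncat_scheme
    \<Rightarrow> ('l, 'co, 'ca, 'o, 'a, 'z) modcat_scheme \<Rightarrow> 'o set \<Rightarrow> bool" where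
  "module_full_subcat C M S \<longleftrightarrow> S \<subseteq> Obj M \<and> (\<forall>X \<in> Obj C. \<forall>N \<in> S. ActO M X N \<in> S)"

text \<open>\<open>M\<close> is the direct sum of the full subcategories on \<open>S\<close> and \<open>T\<close>, i.e. the functor
  \<open>(N, N') \<mapsto> N \<oplus> N'\<close> from \<open>S \<times> T\<close> to \<open>M\<close> is an equivalence: it is fully faithful iff there are no
  nonzero arrows between \<open>S\<close> and \<open>T\<close>, and the last clause is essential surjectivity.\<close>

definition is_direct_sum_cat :: "('k, 'o, 'a, 'z) lincat_scheme \<Rightarrow> 'o set \<Rightarrow> 'o set \<Rightarrow> bool" where
  "is_direct_sum_cat M S T \<longleftrightarrow> S \<subseteq> Obj M \<and> T \<subseteq> Obj M \<and>
     (\<forall>N \<in> S. \<forall>N' \<in> T. Hom M N N' = {ZeroA M N N'} \<and> Hom M N' N = {ZeroA M N' N}) \<and>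
     (\<forall>L \<in> Obj M. \<exists>N \<in> S. \<exists>N' \<in> T. is_direct_sum M N N' L)"

definition indecomposable :: "('k, 'co, 'ca, 'y) moncat_scheme
    \<Rightarrow> ('l, 'co, 'ca, 'o, 'a, 'z) modcat_scheme \<Rightarrow> bool" where
  "indecomposable C M \<longleftrightarrow> (\<exists>N \<in> Obj M. \<not> zero_object M N) \<and>
     \<not> (\<exists>S T. module_full_subcat C M S \<and> module_full_subcat C M T \<and>
          (\<exists>N \<in> S. \<not> zero_object M N) \<and> (\<exists>N \<in> T. \<not> zero_object M N) \<and>
          is_direct_sum_cat M S T)"

text \<open>An internal Hom with its structure: \<open>Ho\<close>, \<open>Ha\<close> are the object and arrow parts of a functor
  \<open>M\<^sup>o\<^sup>p \<times> M \<rightarrow> C\<close>, and \<open>adj X N L\<close> is the adjunction bijection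
  \<open>Hom M (X \<otimes> N) L \<rightarrow> Hom C X (Ho N L)\<close>. Its naturality in \<open>X\<close> and \<open>L\<close> says that \<open>Ho N\<close> is right
  adjoint to \<open>X \<mapsto> X \<otimes> N\<close>; naturality in \<open>N\<close> determines the extension to a functor of two
  variables.\<close>

locale internal_hom = module_category C M
  for C :: "('k, 'co, 'ca, 'y) moncat_scheme"
    and M :: "('l, 'co, 'ca, 'o, 'a, 'z) modcat_scheme" +
  fixes Ho :: "'o \<Rightarrow> 'o \<Rightarrow> 'co" and Ha :: "'a \<Rightarrow> 'a \<Rightarrow> 'ca"
    and adj :: "'co \<Rightarrow> 'o \<Rightarrow> 'o \<Rightarrow> 'a \<Rightarrow> 'ca"
  assumes ihom_functor: "cat_functor (prod_cat (op_cat M) M) C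
      (\<lambda>(N, L). Ho N L) (\<lambda>(f, g). Ha f g)"
    and adj_bij: "X \<in> Obj C \<Longrightarrow> N \<in> Obj M \<Longrightarrow> L \<in> Obj M \<Longrightarrow>
      bij_betw (adj X N L) (Hom M (ActO M X N) L) (Hom C X (Ho N L))"
    and adj_natural: "h \<in> Hom C X' X \<Longrightarrow> f \<in> Hom M N' N \<Longrightarrow> g \<in> Hom M L L' \<Longrightarrow>
      t \<in> Hom M (ActO M X N) L \<Longrightarrow>
      adj X' N' L' (g \<cdot>\<^bsub>M\<^esub> t \<cdot>\<^bsub>M\<^esub> ActA M h f) = Ha f g \<cdot>\<^bsub>C\<^esub> adj X N L t \<cdot>\<^bsub>C\<^esub> h"

section \<open>Ends, topologizing subcategories, quotient objects\<close>

text \<open>\<open>Fo\<close>, \<open>Fa\<close> are the object and arrow parts of a functor \<open>S\<^sup>o\<^sup>p \<times> S \<rightarrow> C\<close>.\<close>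

definition is_dinatural :: "('o, 'a, 'y) category_scheme \<Rightarrow> ('p, 'b, 'z) category_scheme
    \<Rightarrow> ('o \<Rightarrow> 'o \<Rightarrow> 'p) \<Rightarrow> ('a \<Rightarrow> 'a \<Rightarrow> 'b) \<Rightarrow> 'p \<Rightarrow> ('o \<Rightarrow> 'b) \<Rightarrow> bool" where
  "is_dinatural S C Fo Fa E p \<longleftrightarrow> E \<in> Obj C \<and>
     (\<forall>X \<in> Obj S. p X \<in> Hom C E (Fo X X)) \<and>
     (\<forall>X \<in> Obj S. \<forall>Y \<in> Obj S. \<forall>f \<in> Hom S X Y.
        Fa (Id S X) f \<cdot>\<^bsub>C\<^esub> p X = Fa f (Id S Y) \<cdot>\<^bsub>C\<^esub> p Y)"

definition is_end :: "('o, 'a, 'y) category_scheme \<Rightarrow> ('p, 'b, 'z) category_scheme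
    \<Rightarrow> ('o \<Rightarrow> 'o \<Rightarrow> 'p) \<Rightarrow> ('a \<Rightarrow> 'a \<Rightarrow> 'b) \<Rightarrow> 'p \<Rightarrow> ('o \<Rightarrow> 'b) \<Rightarrow> bool" where
  "is_end S C Fo Fa E p \<longleftrightarrow> is_dinatural S C Fo Fa E p \<and>
     (\<forall>E' p'. is_dinatural S C Fo Fa E' p' \<longrightarrow>
        (\<exists>!h. h \<in> Hom C E' E \<and> (\<forall>X \<in> Obj S. p X \<cdot>\<^bsub>C\<^esub> h = p' X)))"

definition is_subquotient :: "('o, 'a, 'z) category_scheme \<Rightarrow> 'o \<Rightarrow> 'o \<Rightarrow> bool" where
  "is_subquotient C Y X \<longleftrightarrow>
     (\<exists>i e. mono_arr C i \<and> Cod C i = X \<and> epi_arr C e \<and> Dom C e = Dom C i \<and> Cod C e = Y)"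

text \<open>Closure under finite direct sums includes the empty one, i.e. zero objects. Full subcategories
  are identified with their sets of objects; closure under subquotients makes these sets closed
  under isomorphism.\<close>

definition Topologizing :: "('k, 'o, 'a, 'z) lincat_scheme \<Rightarrow> 'o set set" where
  "Topologizing M = {S. S \<subseteq> Obj M \<and>
     (\<forall>Z. zero_object M Z \<longrightarrow> Z \<in> S) \<and>
     (\<forall>X \<in> S. \<forall>Y \<in> S. \<forall>Z. is_direct_sum M X Y Z \<longrightarrow> Z \<in> S) \<and>
     (\<forall>X \<in> S. \<forall>Y. is_subquotient M Y X \<longrightarrow> Y \<in> S)}"

text \<open>For ends \<open>A S\<close> with projections \<open>p S\<close>, the canonical arrow from \<open>A S1\<close> to \<open>A S2\<close>, where
  \<open>S2 \<subseteq> S1\<close>.\<close>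

definition end_restriction :: "('o, 'a, 'z) category_scheme \<Rightarrow> ('x set \<Rightarrow> 'o)
    \<Rightarrow> ('x set \<Rightarrow> 'x \<Rightarrow> 'a) \<Rightarrow> 'x set \<Rightarrow> 'x set \<Rightarrow> 'a" where
  "end_restriction C A p S1 S2 =
     (THE h. h \<in> Hom C (A S1) (A S2) \<and> (\<forall>X \<in> S2. p S2 X \<cdot>\<^bsub>C\<^esub> h = p S1 X))"

text \<open>A quotient object of \<open>Y\<close> is represented by its quotient arrow, an epimorphism out of \<open>Y\<close>.
  Two representatives give the same quotient object iff each is \<open>quo_ge\<close> the other.\<close>

definition Quo :: "('o, 'a, 'z) category_scheme \<Rightarrow> 'o \<Rightarrow> 'a set" where
  "Quo C Y = {q. epi_arr C q \<and> Dom C q = Y}"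

definition quo_ge :: "('o, 'a, 'z) category_scheme \<Rightarrow> 'a \<Rightarrow> 'a \<Rightarrow> bool" where
  "quo_ge C q1 q2 \<longleftrightarrow> (\<exists>h \<in> Hom C (Cod C q1) (Cod C q2). h \<cdot>\<^bsub>C\<^esub> q1 = q2)"

end

theory Submission
  imports Defs "Jordan_Normal_Form.Char_Poly"
begin

text \<open>An arrow \<open>V \<rightarrow> A\<^sub>S\<close> is the same as a natural family \<open>V \<otimes> X \<rightarrow> X\<close>, \<open>X \<in> S\<close>. Hence the canonical
  arrow \<open>A\<^sub>M \<rightarrow> A\<^sub>S\<close> is an epimorphism as soon as, for \<open>P\<close> projective in the tensor category, every
  natural family \<open>P \<otimes> X \<rightarrow> X\<close> on \<open>S\<close> extends to the whole module category. The functor \<open>P \<otimes> -\<close> is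
  exact with projective values. By Zorn's lemma it suffices to add one object \<open>N\<close> of minimal dimension
  outside \<open>S\<close>. Such an \<open>N\<close> has a largest proper subobject \<open>N'\<close> and a largest proper quotient, with
  simple kernel \<open>Y\<close>. A lift of the family to \<open>N\<close> can be corrected because \<open>P \<otimes> N' \<rightarrow> P \<otimes> N\<close> splits; it
  propagates to the topologizing subcategory generated by \<open>S\<close> and \<open>N\<close> because, the field being
  algebraically closed, \<open>Y\<close> has only scalar endomorphisms.

  For the converse, an object \<open>N\<close> of minimal dimension in \<open>S\<^sub>2\<close> and outside \<open>S\<^sub>1\<close> carries, for a suitable
  \<open>P\<close>, a nonzero arrow \<open>P \<otimes> N \<rightarrow> P \<otimes> (N/N') \<rightarrow> Y \<rightarrow> N\<close> compatible with the zero family on \<open>S\<^sub>1\<close>; its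
  extension to all objects contradicts a factorization of the quotient for \<open>S\<^sub>2\<close> through that for \<open>S\<^sub>1\<close>.
  Indecomposability provides the epimorphism \<open>P \<otimes> (N/N') \<rightarrow> Y\<close>: since tensoring with a projective object
  splits every short exact sequence, the quotients of the objects \<open>V \<otimes> X\<close>, for a fixed \<open>X \<noteq> 0\<close>, form a
  direct summand of the module category.\<close>

section \<open>Linear algebra over a field\<close>

text \<open>The obstacle in adding one object \<open>N\<close> is that the new value has to satisfy
  conditions from two sides: against arrows from \<open>S\<close> into \<open>N\<close> and against
  arrows from \<open>N\<close> into \<open>S\<close>. Minimal dimension puts every proper subobject
  and quotient of \<open>N\<close> into \<open>S\<close>, and closure of \<open>S\<close> under sums
  and subquotients then makes all arrows of the first kind pass through one subobject and all of the
  second kind through one quotient. Two equations remain, and the error in one of them can be moved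
  into the simple kernel of that quotient, where the other equation does not see it. Kernels,
  images, enough projectives and a dimension are extracted from the equivalence with modules:
  everything is read off a full-rank factorization of the matrix of an arrow, and only a short list
  of consequences is carried on. Rigidity and exactness meet in a projective \<open>P\<close>: duals
  make tensoring with \<open>P\<close> preserve monomorphisms, and projective values split the
  resulting sequences. The same splitting, for a projective object covering the unit, decides
  membership questions in the study of indecomposability: they are settled after tensoring and
  carried back along a natural epimorphism.\<close>

lemma assoc_mult_mat_dim:
  "dim_col A = dim_row B \<Longrightarrow> dim_col B = dim_row C \<Longrightarrow> (A * B) * C = A * (B * (C :: 'k::semiring_0 mat))"
  by (rule assoc_mult_mat) auto

text \<open>Side conditions in terms of dimensions let \<open>simp\<close> move all brackets to the
  right once the carriers are known.\<close>

lemmas mat_assoc = assoc_mult_mat_dim carrier_matD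

text \<open>Gaussian elimination, one pivot at a time: subtracting the rank-one matrix
  \<open>u i * v j\<close> through a nonzero entry clears the pivot row, so the number of nonzero
  rows decreases. The functionals \<open>\<beta>\<close> and \<open>\<gamma>\<close>, dual to the
  columns \<open>b\<close> and the rows \<open>c\<close>, are carried through the induction because
  they become one-sided inverses.\<close>

lemma rank_factorization_entries:
  fixes T :: "nat \<Rightarrow> nat \<Rightarrow> 'k::field"
  shows "\<exists>(r::nat) b c \<beta> \<gamma>. (\<forall>i<m. \<forall>j<n. T i j = (\<Sum>l<r. b l i * c l j)) \<and>
    (\<forall>k<r. \<forall>l<r. (\<Sum>i<m. \<beta> k i * b l i) = (if k = l then 1 else 0)) \<and>
    (\<forall>k<r. \<forall>l<r. (\<Sum>j<n. c k j * \<gamma> l j) = (if k = l then 1 else (0::'k)))"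
proof (induction "card {i. i < m \<and> (\<exists>j<n. T i j \<noteq> 0)}" arbitrary: T rule: less_induct)
  case less
  show ?case
  proof (cases "\<exists>i<m. \<exists>j<n. T i j \<noteq> 0")
    case False
    then show ?thesis by (intro exI[where x="0::nat"] exI[where x="\<lambda>_ _. 0::'k"]) simp
  next
    case True
    then obtain i0 j0 where ij: "i0 < m" "j0 < n" "T i0 j0 \<noteq> 0" by blast
    define a where "a = T i0 j0"
    have a0: "a \<noteq> 0" using ij by (simp add: a_def)
    define u where "u i = T i j0" for i
    define v where "v j = T i0 j / a" for j
    define T1 where "T1 i j = T i j - u i * v j" for i j
    have ui0: "u i0 = a" and vj0: "v j0 = 1" using a0 by (auto simp: u_def v_def a_def)
    have T1i0: "T1 i0 j = 0" for j using a0 by (simp add: T1_def ui0 v_def)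
    have T1j0: "T1 i j0 = 0" for i by (simp add: T1_def vj0 u_def)
    have sub: "{i. i < m \<and> (\<exists>j<n. T1 i j \<noteq> 0)} \<subset> {i. i < m \<and> (\<exists>j<n. T i j \<noteq> 0)}"
    proof (rule psubsetI)
      have "T1 i j = 0" if "\<forall>j<n. T i j = 0" "j < n" for i j
        using that ij by (simp add: T1_def u_def)
      then show "{i. i < m \<and> (\<exists>j<n. T1 i j \<noteq> 0)} \<subseteq> {i. i < m \<and> (\<exists>j<n. T i j \<noteq> 0)}"
        by blast
      have "i0 \<in> {i. i < m \<and> (\<exists>j<n. T i j \<noteq> 0)}" using ij by auto
      moreover have "i0 \<notin> {i. i < m \<and> (\<exists>j<n. T1 i j \<noteq> 0)}" by (simp add: T1i0)
      ultimately show "{i. i < m \<and> (\<exists>j<n. T1 i j \<noteq> 0)} \<noteq> {i. i < m \<and> (\<exists>j<n. T i j \<noteq> 0)}"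
        by blast
    qed
    have "finite {i. i < m \<and> (\<exists>j<n. T i j \<noteq> 0)}" by simp
    from less[OF psubset_card_mono[OF this sub]]
    obtain r :: nat and b c \<beta> \<gamma> where
      T1: "\<And>i j. i < m \<Longrightarrow> j < n \<Longrightarrow> T1 i j = (\<Sum>l<r. b l i * c l j)"
      and \<beta>: "\<And>k l. k < r \<Longrightarrow> l < r \<Longrightarrow> (\<Sum>i<m. \<beta> k i * b l i) = (if k = l then 1 else 0)"
      and \<gamma>: "\<And>k l. k < r \<Longrightarrow> l < r \<Longrightarrow> (\<Sum>j<n. c k j * \<gamma> l j) = (if k = l then 1 else 0)"
      by blast
    \<comment> \<open>Row \<open>i0\<close> of \<open>T1\<close> is zero, and pairing it with
      \<open>\<gamma> l\<close> isolates \<open>b l i0\<close>. So the functionals can be altered at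
      \<open>i0\<close> without changing their values on the old columns.\<close>
    have bi0: "b l i0 = 0" if l: "l < r" for l
    proof -
      have "(\<Sum>j<n. T1 i0 j * \<gamma> l j) = (\<Sum>j<n. \<Sum>k<r. b k i0 * (c k j * \<gamma> l j))"
        by (rule sum.cong) (auto simp: T1 ij sum_distrib_right mult.assoc)
      also have "\<dots> = (\<Sum>k<r. b k i0 * (\<Sum>j<n. c k j * \<gamma> l j))"
        by (subst sum.swap) (simp add: sum_distrib_left)
      also have "\<dots> = (\<Sum>k<r. if k = l then b k i0 else 0)"
        by (rule sum.cong) (auto simp: \<gamma> l)
      also have "\<dots> = b l i0" using l by simp
      finally show ?thesis by (simp add: T1i0)
    qed
    have cj0: "c l j0 = 0" if l: "l < r" for l
    proof -
      have "(\<Sum>i<m. \<beta> l i * T1 i j0) = (\<Sum>i<m. \<Sum>k<r. (\<beta> l i * b k i) * c k j0)"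
        by (rule sum.cong) (auto simp: T1 ij sum_distrib_left mult.assoc)
      also have "\<dots> = (\<Sum>k<r. (\<Sum>i<m. \<beta> l i * b k i) * c k j0)"
        by (subst sum.swap) (simp add: sum_distrib_right)
      also have "\<dots> = (\<Sum>k<r. if l = k then c k j0 else 0)"
        by (rule sum.cong) (auto simp: \<beta> l)
      also have "\<dots> = c l j0" using l by simp
      finally show ?thesis by (simp add: T1j0)
    qed
    define b2 where "b2 l = (if l = r then u else b l)" for l
    define c2 where "c2 l = (if l = r then v else c l)" for l
    \<comment> \<open>The functional for the new column \<open>u\<close> evaluates at the pivot row
      and divides by the pivot \<open>a = u i0\<close>; the old ones are shifted at
      \<open>i0\<close> just enough to vanish on \<open>u\<close>. In \<open>\<gamma>2\<close> no
      division occurs because \<open>v j0 = 1\<close>.\<close>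
    define \<beta>2 where "\<beta>2 k i = (if k = r then if i = i0 then 1/a else 0
      else \<beta> k i - (if i = i0 then (\<Sum>i<m. \<beta> k i * u i) / a else 0))" for k i
    define \<gamma>2 where "\<gamma>2 k j = (if k = r then if j = j0 then 1 else 0
      else \<gamma> k j - (if j = j0 then (\<Sum>j<n. v j * \<gamma> k j) else 0))" for k j
    have d1: "(\<Sum>i<m. (if i = i0 then x else 0) * f i) = x * f i0" for x and f :: "nat \<Rightarrow> 'k"
      using ij by (simp add: if_distrib[of "\<lambda>x. x * _"] cong: if_cong)
    have d2: "(\<Sum>j<n. f j * (if j = j0 then x else 0)) = f j0 * x" for x and f :: "nat \<Rightarrow> 'k"
      using ij by (simp add: if_distrib[of "\<lambda>x. _ * x"] cong: if_cong)
    have "T i j = (\<Sum>l<Suc r. b2 l i * c2 l j)" if "i < m" "j < n" for i j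
    proof -
      have "(\<Sum>l<r. b2 l i * c2 l j) = T1 i j"
        unfolding T1[OF that] by (rule sum.cong) (auto simp: b2_def c2_def)
      then show ?thesis by (simp add: b2_def c2_def T1_def)
    qed
    moreover have "(\<Sum>i<m. \<beta>2 k i * b2 l i) = (if k = l then 1 else 0)"
      if kl: "k < Suc r" "l < Suc r" for k l
      using kl a0
      by (cases "k = r"; cases "l = r")
        (auto simp: \<beta>2_def b2_def left_diff_distrib sum_subtractf d1 bi0 ui0 \<beta>)
    moreover have "(\<Sum>j<n. c2 k j * \<gamma>2 l j) = (if k = l then 1 else 0)"
      if kl: "k < Suc r" "l < Suc r" for k l
      using kl a0
      by (cases "k = r"; cases "l = r")
        (auto simp: \<gamma>2_def c2_def right_diff_distrib sum_subtractf d2 cj0 vj0 \<gamma>)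
    ultimately show ?thesis by blast
  qed
qed

text \<open>The columns of \<open>B\<close> form a basis of the image of \<open>T\<close>, and
  \<open>C\<close> has the same kernel as \<open>T\<close>. With the explicit one-sided inverses,
  kernels, cokernels and images of arrows can be described by matrices alone.\<close>

lemma rank_factorization:
  fixes T :: "'k::field mat"
  assumes "T \<in> carrier_mat m n"
  obtains r B C B' C' where "B \<in> carrier_mat m r" "C \<in> carrier_mat r n"
    "B' \<in> carrier_mat r m" "C' \<in> carrier_mat n r" "T = B * C" "B' * B = 1\<^sub>m r" "C * C' = 1\<^sub>m r"
proof -
  from rank_factorization_entries[of m n "\<lambda>i j. T $$ (i, j)"]
  obtain r :: nat and b c \<beta> \<gamma> where
    T: "\<And>i j. i < m \<Longrightarrow> j < n \<Longrightarrow> T $$ (i, j) = (\<Sum>l<r. b l i * c l j)"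
    and \<beta>: "\<And>k l. k < r \<Longrightarrow> l < r \<Longrightarrow> (\<Sum>i<m. \<beta> k i * b l i) = (if k = l then 1 else 0)"
    and \<gamma>: "\<And>k l. k < r \<Longrightarrow> l < r \<Longrightarrow> (\<Sum>j<n. c k j * \<gamma> l j) = (if k = l then 1 else 0)"
    by blast
  show ?thesis
  proof (rule that)
    show "mat m r (\<lambda>(i, l). b l i) \<in> carrier_mat m r" "mat r n (\<lambda>(l, j). c l j) \<in> carrier_mat r n"
      "mat r m (\<lambda>(l, i). \<beta> l i) \<in> carrier_mat r m" "mat n r (\<lambda>(j, l). \<gamma> l j) \<in> carrier_mat n r"
      by auto
    show "T = mat m r (\<lambda>(i, l). b l i) * mat r n (\<lambda>(l, j). c l j)"
      using assms T by (intro eq_matI) (auto simp: scalar_prod_def lessThan_atLeast0)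
    show "mat r m (\<lambda>(l, i). \<beta> l i) * mat m r (\<lambda>(i, l). b l i) = 1\<^sub>m r"
      using \<beta> by (intro eq_matI) (auto simp: scalar_prod_def lessThan_atLeast0)
    show "mat r n (\<lambda>(l, j). c l j) * mat n r (\<lambda>(j, l). \<gamma> l j) = 1\<^sub>m r"
      using \<gamma> by (intro eq_matI) (auto simp: scalar_prod_def lessThan_atLeast0)
  qed
qed

lemma idempotent_split:
  fixes e :: "'k::field mat"
  assumes e: "e \<in> carrier_mat n n" and idem: "e * e = e"
  obtains r K D where "K \<in> carrier_mat n r" "D \<in> carrier_mat r n" "e = K * D" "D * K = 1\<^sub>m r"
proof -
  obtain r B C B' C' where c: "B \<in> carrier_mat n r" "C \<in> carrier_mat r n"
    "B' \<in> carrier_mat r n" "C' \<in> carrier_mat n r" and eq: "e = B * C" "B' * B = 1\<^sub>m r" "C * C' = 1\<^sub>m r"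
    using rank_factorization[OF e] by metis
  \<comment> \<open>Idempotence reads \<open>B * C * (B * C) = B * C\<close>; cancelling
    \<open>B\<close> on the left by \<open>B'\<close> and \<open>C\<close> on the right by
    \<open>C'\<close> leaves \<open>C * B = 1\<close>.\<close>
  have "C * B = (B' * B) * (C * B) * (C * C')"
    unfolding eq(2,3) using c by simp
  also have "\<dots> = B' * (B * C * (B * C)) * C'"
    using c by (simp add: mat_assoc)
  also have "\<dots> = B' * (B * C) * C'"
    using idem unfolding eq(1) by (rule arg_cong)
  also have "\<dots> = (B' * B) * (C * C')"
    using c by (simp add: mat_assoc)
  also have "\<dots> = 1\<^sub>m r" unfolding eq(2,3) by simp
  finally show ?thesis by (rule that[OF c(1,2) eq(1)])
qed

text \<open>Padding with zeros makes both matrices square of size \<open>b\<close>. There a left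
  inverse is also a right inverse, yet for \<open>a < b\<close> the product in the other order has a
  zero at position \<open>(a, a)\<close>.\<close>

lemma left_inverse_dim_le:
  fixes L S :: "'k::field mat"
  assumes L: "L \<in> carrier_mat b a" and S: "S \<in> carrier_mat a b" and LS: "L * S = 1\<^sub>m b"
  shows "b \<le> a"
proof (rule ccontr)
  assume "\<not> b \<le> a"
  then have ab: "a < b" by simp
  define L' where "L' = mat b b (\<lambda>(i, j). if j < a then L $$ (i, j) else 0)"
  define S' where "S' = mat b b (\<lambda>(i, j). if i < a then S $$ (i, j) else 0)"
  have c: "L' \<in> carrier_mat b b" "S' \<in> carrier_mat b b" by (auto simp: L'_def S'_def)
  have "L' * S' = 1\<^sub>m b"
  proof (rule eq_matI)
    fix i j assume ij: "i < dim_row (1\<^sub>m b :: 'k mat)" "j < dim_col (1\<^sub>m b :: 'k mat)"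
    have "(L' * S') $$ (i, j) = (\<Sum>k\<in>{0..<b}. if k < a then L $$ (i, k) * S $$ (k, j) else 0)"
      using ij by (simp add: L'_def S'_def scalar_prod_def) (rule sum.cong, auto)
    also have "\<dots> = (\<Sum>k\<in>{0..<a}. L $$ (i, k) * S $$ (k, j))"
      using ab by (intro sum.mono_neutral_cong_right) auto
    also have "\<dots> = (L * S) $$ (i, j)"
      using ij L S by (simp add: scalar_prod_def)
    finally show "(L' * S') $$ (i, j) = 1\<^sub>m b $$ (i, j)" by (simp add: LS)
  qed (auto simp: L'_def S'_def)
  then have "S' * L' = 1\<^sub>m b" by (rule mat_mult_left_right_inverse[OF c])
  then have "(S' * L') $$ (a, a) = 1" using ab by simp
  moreover have "(S' * L') $$ (a, a) = 0"
    using ab by (simp add: S'_def L'_def scalar_prod_def)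
  ultimately show False by simp
qed

text \<open>Supplies the biproduct structure behind \<open>direct_sum_exists\<close>, where block
  matrices are handled through these equations alone.\<close>

lemma block_injections:
  obtains i1 i2 p1 p2 :: "'k::field mat" where
    "i1 \<in> carrier_mat (a + b) a" "i2 \<in> carrier_mat (a + b) b"
    "p1 \<in> carrier_mat a (a + b)" "p2 \<in> carrier_mat b (a + b)"
    "p1 * i1 = 1\<^sub>m a" "p2 * i2 = 1\<^sub>m b" "p1 * i2 = 0\<^sub>m a b" "p2 * i1 = 0\<^sub>m b a"
    "i1 * p1 + i2 * p2 = 1\<^sub>m (a + b)"
proof
  let ?i1 = "mat (a + b) a (\<lambda>(i, j). if i = j then 1 else 0) :: 'k mat"
  let ?i2 = "mat (a + b) b (\<lambda>(i, j). if i = a + j then 1 else 0) :: 'k mat"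
  let ?p1 = "mat a (a + b) (\<lambda>(i, j). if i = j then 1 else 0) :: 'k mat"
  let ?p2 = "mat b (a + b) (\<lambda>(i, j). if j = a + i then 1 else 0) :: 'k mat"
  show "?i1 \<in> carrier_mat (a + b) a" "?i2 \<in> carrier_mat (a + b) b"
    "?p1 \<in> carrier_mat a (a + b)" "?p2 \<in> carrier_mat b (a + b)" by auto
  have d: "(\<Sum>k\<in>A. (if i = k then x else 0) * f k) = (if i \<in> A then x * f i else 0)"
    if "finite A" for A i x and f :: "nat \<Rightarrow> 'k"
    using that by (simp add: if_distrib[of "\<lambda>x. x * _"] cong: if_cong)
  have d': "(\<Sum>k\<in>A. (if k = i then x else 0) * f k) = (if i \<in> A then x * f i else 0)"
    if "finite A" for A i x and f :: "nat \<Rightarrow> 'k"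
    using that by (simp add: if_distrib[of "\<lambda>x. x * _"] cong: if_cong)
  show "?p1 * ?i1 = 1\<^sub>m a" "?p1 * ?i2 = 0\<^sub>m a b"
     by (rule eq_matI; simp add: scalar_prod_def d)+
  show "?p2 * ?i2 = 1\<^sub>m b" "?p2 * ?i1 = 0\<^sub>m b a"
     by (rule eq_matI; simp add: scalar_prod_def d')+
  have d2: "(\<Sum>k = 0..<b. (if i = a + k then 1 else 0) * (if j = a + k then 1 else (0::'k)))
     = (if a \<le> i \<and> i < a + b \<and> i = j then 1 else 0)" for i j
  proof (cases "a \<le> i")
    case True
    then obtain l where "i = a + l" using le_Suc_ex by blast
    then show ?thesis by (auto simp: d)
  next
    case False
    then show ?thesis by (auto intro!: sum.neutral)
  qed
  have d1: "(\<Sum>k = 0..<a. (if i = k then 1 else 0) * (if k = j then 1 else (0::'k)))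
     = (if i < a \<and> i = j then 1 else 0)" for i j
    by (simp add: d)
  show "?i1 * ?p1 + ?i2 * ?p2 = 1\<^sub>m (a + b)"
  proof (rule eq_matI)
    fix i j assume ij: "i < dim_row (1\<^sub>m (a + b) :: 'k mat)" "j < dim_col (1\<^sub>m (a + b) :: 'k mat)"
    have "(?i1 * ?p1 + ?i2 * ?p2) $$ (i, j)
        = (\<Sum>k = 0..<a. (if i = k then 1 else 0) * (if k = j then 1 else 0))
        + (\<Sum>k = 0..<b. (if i = a + k then 1 else 0) * (if j = a + k then 1 else 0))"
      using ij by (simp add: scalar_prod_def)
    also have "\<dots> = 1\<^sub>m (a + b) $$ (i, j)"
      unfolding d1 d2 using ij by (cases "i < a") auto
    finally show "(?i1 * ?p1 + ?i2 * ?p2) $$ (i, j) = 1\<^sub>m (a + b) $$ (i, j)" .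
  qed auto
qed

text \<open>Algebraic closedness enters here: as \<open>0 < n\<close>, the characteristic polynomial
  has positive degree and hence a root \<open>c\<close>, and the matrix shifted by \<open>c\<close>
  has determinant zero.\<close>

lemma exists_singular_shift:
  fixes T :: "'k::alg_closed_field mat"
  assumes T: "T \<in> carrier_mat n n" and n: "0 < n"
  obtains c where "\<And>S. S \<in> carrier_mat n n \<Longrightarrow> S * (T - c \<cdot>\<^sub>m 1\<^sub>m n) \<noteq> 1\<^sub>m n"
proof -
  have "degree (char_poly T) > 0" using degree_monic_char_poly[OF T] n by simp
  then obtain c where "poly (char_poly T) c = 0" using alg_closed_imp_poly_has_root by blast
  then have "det (char_matrix T c) = 0"
    using eigenvalue_root_char_poly[OF T] eigenvalue_det[OF T] by simp
  moreover have "char_matrix T c = T - c \<cdot>\<^sub>m 1\<^sub>m n"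
    unfolding char_matrix_def using T by (intro eq_matI) auto
  ultimately have d: "det (T - c \<cdot>\<^sub>m 1\<^sub>m n) = 0" by simp
  have "S * (T - c \<cdot>\<^sub>m 1\<^sub>m n) \<noteq> 1\<^sub>m n" if S: "S \<in> carrier_mat n n" for S
  proof
    assume "S * (T - c \<cdot>\<^sub>m 1\<^sub>m n) = 1\<^sub>m n"
    then have "det S * det (T - c \<cdot>\<^sub>m 1\<^sub>m n) = 1"
      using det_mult[OF S, of "T - c \<cdot>\<^sub>m 1\<^sub>m n"] T by (simp add: minus_carrier_mat)
    then show False by (simp add: d)
  qed
  then show ?thesis using that by blast
qed

section \<open>Linear categories\<close>

context category
begin

lemma Hom_iff: "f \<in> Hom C X Y \<longleftrightarrow> f \<in> Arr C \<and> Dom C f = X \<and> Cod C f = Y"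
  by (simp add: Hom_def)

lemma hom_obj: "f \<in> Hom C X Y \<Longrightarrow> X \<in> Obj C" "f \<in> Hom C X Y \<Longrightarrow> Y \<in> Obj C"
  using dom_obj cod_obj by (auto simp: Hom_iff)

lemma cmp_arr:
  assumes "f \<in> Arr C" "g \<in> Arr C" "Cod C f = Dom C g"
  shows "g \<cdot> f \<in> Arr C" "Dom C (g \<cdot> f) = Dom C f" "Cod C (g \<cdot> f) = Cod C g"
  using cmp_hom[of f "Dom C f" "Cod C f" g "Cod C g"] assms by (auto simp: Hom_iff)

lemma id_arr:
  assumes "X \<in> Obj C"
  shows "Id C X \<in> Arr C" "Dom C (Id C X) = X" "Cod C (Id C X) = X"
  using id_hom[OF assms] by (auto simp: Hom_iff)

lemma assoc_arr:
  "f \<in> Arr C \<Longrightarrow> g \<in> Arr C \<Longrightarrow> h \<in> Arr C \<Longrightarrow> Cod C f = Dom C g \<Longrightarrow> Cod C g = Dom C h \<Longrightarrow>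
    (h \<cdot> g) \<cdot> f = h \<cdot> (g \<cdot> f)"
  by (rule cmp_assoc) (auto simp: Hom_iff)

lemma id_left_arr: "f \<in> Arr C \<Longrightarrow> Cod C f = Y \<Longrightarrow> Id C Y \<cdot> f = f"
  by (rule cmp_id_left) (auto simp: Hom_iff)

lemma id_right_arr: "f \<in> Arr C \<Longrightarrow> Dom C f = X \<Longrightarrow> f \<cdot> Id C X = f"
  by (rule cmp_id_right) (auto simp: Hom_iff)

lemmas cat_simps = Hom_iff cmp_arr id_arr assoc_arr id_left_arr id_right_arr dom_obj cod_obj

lemma monoD: "mono_arr C f \<Longrightarrow> f \<in> Hom C X Y \<Longrightarrow> g \<in> Hom C W X \<Longrightarrow> h \<in> Hom C W X \<Longrightarrow>
    f \<cdot> g = f \<cdot> h \<Longrightarrow> g = h"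
  unfolding mono_arr_def using hom_obj(1)[of g W X] by (auto simp: Hom_iff)

lemma epiD: "epi_arr C f \<Longrightarrow> f \<in> Hom C X Y \<Longrightarrow> g \<in> Hom C Y W \<Longrightarrow> h \<in> Hom C Y W \<Longrightarrow>
    g \<cdot> f = h \<cdot> f \<Longrightarrow> g = h"
  unfolding epi_arr_def using hom_obj(2)[of g Y W] by (auto simp: Hom_iff)

lemma isoE:
  assumes "iso_arr C f" "f \<in> Hom C X Y"
  obtains g where "g \<in> Hom C Y X" "g \<cdot> f = Id C X" "f \<cdot> g = Id C Y"
  using assms unfolding iso_arr_def by (auto simp: Hom_iff)

lemma isoI:
  "f \<in> Hom C X Y \<Longrightarrow> g \<in> Hom C Y X \<Longrightarrow> g \<cdot> f = Id C X \<Longrightarrow> f \<cdot> g = Id C Y \<Longrightarrow> iso_arr C f"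
  unfolding iso_arr_def by (auto simp: Hom_iff)

lemma split_mono:
  assumes f: "f \<in> Hom C X Y" and r: "r \<in> Hom C Y X" and rf: "r \<cdot> f = Id C X"
  shows "mono_arr C f"
  unfolding mono_arr_def
proof (intro conjI ballI impI)
  fix W g h assume "W \<in> Obj C" "g \<in> Hom C W (Dom C f)" "h \<in> Hom C W (Dom C f)" and eq: "f \<cdot> g = f \<cdot> h"
  then have gh: "g \<in> Hom C W X" "h \<in> Hom C W X" using f by (auto simp: Hom_iff)
  have "g = (r \<cdot> f) \<cdot> g" unfolding rf using gh by (simp add: cat_simps)
  also have "\<dots> = (r \<cdot> f) \<cdot> h" using gh f r eq by (simp add: cmp_assoc)
  also have "\<dots> = h" unfolding rf using gh by (simp add: cat_simps)
  finally show "g = h" .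
qed (use f in \<open>auto simp: Hom_iff\<close>)

lemma split_epi:
  assumes f: "f \<in> Hom C X Y" and r: "r \<in> Hom C Y X" and fr: "f \<cdot> r = Id C Y"
  shows "epi_arr C f"
  unfolding epi_arr_def
proof (intro conjI ballI impI)
  fix W g h assume "W \<in> Obj C" "g \<in> Hom C (Cod C f) W" "h \<in> Hom C (Cod C f) W" and eq: "g \<cdot> f = h \<cdot> f"
  then have gh: "g \<in> Hom C Y W" "h \<in> Hom C Y W" using f by (auto simp: Hom_iff)
  have "g = g \<cdot> (f \<cdot> r)" unfolding fr using gh by (simp add: cat_simps)
  also have "\<dots> = h \<cdot> (f \<cdot> r)" 
    using cmp_assoc[OF r f gh(1)] cmp_assoc[OF r f gh(2)] eq by simp
  also have "\<dots> = h" unfolding fr using gh by (simp add: cat_simps)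
  finally show "g = h" .
qed (use f in \<open>auto simp: Hom_iff\<close>)

lemma
  assumes "iso_arr C f"
  shows iso_mono: "mono_arr C f" and iso_epi: "epi_arr C f"
proof -
  have f: "f \<in> Hom C (Dom C f) (Cod C f)" using assms unfolding Hom_iff iso_arr_def by blast
  obtain g where g: "g \<in> Hom C (Cod C f) (Dom C f)" "g \<cdot> f = Id C (Dom C f)" "f \<cdot> g = Id C (Cod C f)"
    by (rule isoE[OF assms f])
  show "mono_arr C f" by (rule split_mono[OF f g(1,2)])
  show "epi_arr C f" by (rule split_epi[OF f g(1,3)])
qed

lemma mono_cmp:
  assumes "mono_arr C f" "mono_arr C g" "f \<in> Hom C X Y" "g \<in> Hom C Y Z"
  shows "mono_arr C (g \<cdot> f)"
  unfolding mono_arr_def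
proof (intro conjI ballI impI)
  show "g \<cdot> f \<in> Arr C" using assms by (simp add: cat_simps)
  fix W a b assume "W \<in> Obj C" "a \<in> Hom C W (Dom C (g \<cdot> f))" "b \<in> Hom C W (Dom C (g \<cdot> f))"
    and eq: "(g \<cdot> f) \<cdot> a = (g \<cdot> f) \<cdot> b"
  then have ab: "a \<in> Hom C W X" "b \<in> Hom C W X" using assms by (auto simp: cat_simps)
  have "g \<cdot> (f \<cdot> a) = g \<cdot> (f \<cdot> b)" using eq ab assms(3,4) by (simp add: cmp_assoc)
  then have "f \<cdot> a = f \<cdot> b"
    by (rule monoD[OF assms(2,4) cmp_hom[OF ab(1) assms(3)] cmp_hom[OF ab(2) assms(3)]])
  then show "a = b" by (rule monoD[OF assms(1,3) ab])
qed

lemma epi_cmp: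
  assumes "epi_arr C f" "epi_arr C g" "f \<in> Hom C X Y" "g \<in> Hom C Y Z"
  shows "epi_arr C (g \<cdot> f)"
  unfolding epi_arr_def
proof (intro conjI ballI impI)
  show "g \<cdot> f \<in> Arr C" using assms by (simp add: cat_simps)
  fix W a b assume "W \<in> Obj C" "a \<in> Hom C (Cod C (g \<cdot> f)) W" "b \<in> Hom C (Cod C (g \<cdot> f)) W"
    and eq: "a \<cdot> (g \<cdot> f) = b \<cdot> (g \<cdot> f)"
  then have ab: "a \<in> Hom C Z W" "b \<in> Hom C Z W" using assms by (auto simp: cat_simps)
  have "(a \<cdot> g) \<cdot> f = (b \<cdot> g) \<cdot> f" using eq ab assms(3,4) by (simp add: cmp_assoc)
  then have "a \<cdot> g = b \<cdot> g"
    by (rule epiD[OF assms(1,3) cmp_hom[OF assms(4) ab(1)] cmp_hom[OF assms(4) ab(2)]])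
  then show "a = b" by (rule epiD[OF assms(2,4) ab])
qed

lemma mono_factor:
  assumes "mono_arr C (g \<cdot> f)" "f \<in> Hom C X Y" "g \<in> Hom C Y Z"
  shows "mono_arr C f"
  unfolding mono_arr_def
proof (intro conjI ballI impI)
  show "f \<in> Arr C" using assms by (simp add: Hom_iff)
  fix W a b assume "W \<in> Obj C" "a \<in> Hom C W (Dom C f)" "b \<in> Hom C W (Dom C f)" and eq: "f \<cdot> a = f \<cdot> b"
  then have ab: "a \<in> Hom C W X" "b \<in> Hom C W X" using assms by (auto simp: Hom_iff)
  have "(g \<cdot> f) \<cdot> a = (g \<cdot> f) \<cdot> b" using eq ab assms(2,3) by (simp add: cmp_assoc)
  then show "a = b" by (rule monoD[OF assms(1) cmp_hom[OF assms(2,3)] ab])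
qed

lemma epi_factor:
  assumes "epi_arr C (g \<cdot> f)" "f \<in> Hom C X Y" "g \<in> Hom C Y Z"
  shows "epi_arr C g"
  unfolding epi_arr_def
proof (intro conjI ballI impI)
  show "g \<in> Arr C" using assms by (simp add: Hom_iff)
  fix W a b assume "W \<in> Obj C" "a \<in> Hom C (Cod C g) W" "b \<in> Hom C (Cod C g) W" and eq: "a \<cdot> g = b \<cdot> g"
  then have ab: "a \<in> Hom C Z W" "b \<in> Hom C Z W" using assms by (auto simp: Hom_iff)
  have "a \<cdot> (g \<cdot> f) = b \<cdot> (g \<cdot> f)"
    using eq cmp_assoc[OF assms(2,3) ab(1)] cmp_assoc[OF assms(2,3) ab(2)] by simp
  then show "a = b" by (rule epiD[OF assms(1) cmp_hom[OF assms(2,3)] ab])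
qed

end

section \<open>Subtraction and zero arrows\<close>

context linear_category
begin

text \<open>Hom spaces come with addition, zero and scaling, so subtraction is built from scaling by
  \<open>-1\<close>.\<close>

definition diff_arr :: "'a \<Rightarrow> 'a \<Rightarrow> 'a" where
  "diff_arr f g = AddA C f (ScaleA C (-1) g)"

lemma zero_hom: "X \<in> Obj C \<Longrightarrow> Y \<in> Obj C \<Longrightarrow> ZeroA C X Y \<in> Hom C X Y"
proof -
  assume "X \<in> Obj C" "Y \<in> Obj C"
  then interpret md: module "scalars :: 'k ring" "hom_space C X Y"
    by (rule hom_space_module)
  show ?thesis using md.zero_closed by (simp add: hom_space_def)
qed

lemma
  assumes f: "f \<in> Hom C X Y" and g: "g \<in> Hom C X Y"
  shows add_hom: "AddA C f g \<in> Hom C X Y"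
    and add_commute: "AddA C f g = AddA C g f"
    and scale_hom: "ScaleA C c f \<in> Hom C X Y"
    and add_zero: "AddA C f (ZeroA C X Y) = f"
    and add_scale: "ScaleA C (c + c') f = AddA C (ScaleA C c f) (ScaleA C c' f)"
    and scale_one: "ScaleA C 1 f = f"
    and scale_0: "ScaleA C 0 f = ZeroA C X Y"
proof -
  interpret md: module "scalars :: 'k ring" "hom_space C X Y"
    using hom_space_module hom_obj[OF f] by simp
  show "AddA C f g \<in> Hom C X Y" "AddA C f g = AddA C g f"
    "ScaleA C c f \<in> Hom C X Y" "AddA C f (ZeroA C X Y) = f"
    "ScaleA C (c + c') f = AddA C (ScaleA C c f) (ScaleA C c' f)"
    "ScaleA C 1 f = f"
    "ScaleA C 0 f = ZeroA C X Y"
    using md.a_closed[of f g] md.a_comm[of f g] md.smult_closed[of c f] md.r_zero[of f]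
      md.smult_l_distr[of c c' f] md.smult_one[of f] md.smult_l_null[of f] f g
    by (simp_all add: hom_space_def scalars_def)
qed

lemma add_assoc:
  assumes "f \<in> Hom C X Y" "g \<in> Hom C X Y" "h \<in> Hom C X Y"
  shows "AddA C (AddA C f g) h = AddA C f (AddA C g h)"
proof -
  interpret md: module "scalars :: 'k ring" "hom_space C X Y"
    using hom_space_module hom_obj[OF assms(1)] by simp
  show ?thesis using md.a_assoc[of f g h] assms by (simp add: hom_space_def)
qed

lemma add_neg: "f \<in> Hom C X Y \<Longrightarrow> AddA C f (ScaleA C (-1) f) = ZeroA C X Y"
  using add_scale[of f X Y f 1 "-1"] by (simp add: scale_one scale_0)

lemma diff_hom: "f \<in> Hom C X Y \<Longrightarrow> g \<in> Hom C X Y \<Longrightarrow> diff_arr f g \<in> Hom C X Y"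
  by (simp add: diff_arr_def add_hom scale_hom)

lemma diff_self: "f \<in> Hom C X Y \<Longrightarrow> diff_arr f f = ZeroA C X Y"
  by (simp add: diff_arr_def add_neg)

lemma add_diff: 
  assumes "f \<in> Hom C X Y" "g \<in> Hom C X Y"
  shows "AddA C g (diff_arr f g) = f"
proof -
  have s: "ScaleA C (-1) g \<in> Hom C X Y" using assms scale_hom by blast
  have "AddA C g (diff_arr f g) = AddA C (AddA C f (ScaleA C (-1) g)) g"
    unfolding diff_arr_def using assms s add_commute add_hom by metis
  also have "\<dots> = AddA C f (AddA C g (ScaleA C (-1) g))"
    using assms s add_assoc add_commute by metis
  finally show ?thesis using assms add_neg add_zero by metis
qed

lemma diff_zero_iff:
  assumes "f \<in> Hom C X Y" "g \<in> Hom C X Y"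
  shows "diff_arr f g = ZeroA C X Y \<longleftrightarrow> f = g"
  using add_diff[OF assms] add_zero[OF assms(2,2)] diff_self assms by metis

lemma cmp_zero_left:
  assumes "f \<in> Hom C X Y" "Z \<in> Obj C"
  shows "ZeroA C Y Z \<cdot> f = ZeroA C X Z"
proof -
  have z: "ZeroA C Y Z \<in> Hom C Y Z" using assms hom_obj zero_hom by blast
  show ?thesis
    using cmp_scale_left[OF assms(1) z, of 0] scale_0[OF z z] scale_0[OF cmp_hom[OF assms(1) z]
      cmp_hom[OF assms(1) z]]
    by simp
qed

lemma cmp_zero_right:
  assumes "f \<in> Hom C X Y" "W \<in> Obj C"
  shows "f \<cdot> ZeroA C W X = ZeroA C W Y"
proof -
  have z: "ZeroA C W X \<in> Hom C W X" using assms hom_obj zero_hom by blast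
  show ?thesis
    using cmp_scale_right[OF z assms(1), of 0] scale_0[OF z z] scale_0[OF cmp_hom[OF z assms(1)]
      cmp_hom[OF z assms(1)]]
    by simp
qed

lemma cmp_diff_left:
  assumes "f \<in> Hom C X Y" "g \<in> Hom C Y Z" "h \<in> Hom C Y Z"
  shows "diff_arr g h \<cdot> f = diff_arr (g \<cdot> f) (h \<cdot> f)"
  unfolding diff_arr_def
  using cmp_add_left[OF assms(1,2) scale_hom[OF assms(3,3)]] cmp_scale_left[OF assms(1,3)] by simp

lemma cmp_diff_right:
  assumes "f \<in> Hom C X Y" "g \<in> Hom C X Y" "h \<in> Hom C Y Z"
  shows "h \<cdot> diff_arr f g = diff_arr (h \<cdot> f) (h \<cdot> g)"
  unfolding diff_arr_def
  using cmp_add_right[OF assms(1) scale_hom[OF assms(2,2)] assms(3)] cmp_scale_right[OF assms(2,3)] by simp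

text \<open>Serves to cancel a correction: once the defect of an arrow is subtracted, the intended
  value remains.\<close>

lemma diff_diff: 
  assumes "f \<in> Hom C X Y" "g \<in> Hom C X Y"
  shows "diff_arr f (diff_arr f g) = g"
proof -
  let ?d = "diff_arr f g"
  have d: "?d \<in> Hom C X Y" using assms diff_hom by blast
  have s: "ScaleA C (-1) ?d \<in> Hom C X Y" using d scale_hom by blast
  have "AddA C f (ScaleA C (-1) ?d) = AddA C (AddA C g ?d) (ScaleA C (-1) ?d)"
    using add_diff[OF assms] by simp
  also have "\<dots> = g"
    using add_assoc[OF assms(2) d s] add_neg[OF d] add_zero[OF assms(2,2)] by simp
  finally show ?thesis by (simp add: diff_arr_def)
qed

text \<open>Composition is linear, so comparing two arrows after \<open>f\<close> amounts to testing
  their difference against zero.\<close>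

lemma mono_zeroI:
  assumes "f \<in> Hom C X Y" "\<And>W g. g \<in> Hom C W X \<Longrightarrow> f \<cdot> g = ZeroA C W Y \<Longrightarrow> g = ZeroA C W X"
  shows "mono_arr C f"
  unfolding mono_arr_def
proof (intro conjI ballI impI)
  show "f \<in> Arr C" using assms by (simp add: Hom_iff)
  fix W g h assume "g \<in> Hom C W (Dom C f)" "h \<in> Hom C W (Dom C f)" and eq: "f \<cdot> g = f \<cdot> h"
  then have gh: "g \<in> Hom C W X" "h \<in> Hom C W X" using assms(1) by (auto simp: Hom_iff)
  have "f \<cdot> diff_arr g h = ZeroA C W Y"
    using cmp_diff_right[OF gh assms(1)] eq diff_self cmp_hom gh assms(1) by metis
  then show "g = h" using assms(2) diff_hom[OF gh] diff_zero_iff[OF gh] by blast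
qed

lemma epi_zeroI:
  assumes "f \<in> Hom C X Y" "\<And>W g. g \<in> Hom C Y W \<Longrightarrow> g \<cdot> f = ZeroA C X W \<Longrightarrow> g = ZeroA C Y W"
  shows "epi_arr C f"
  unfolding epi_arr_def
proof (intro conjI ballI impI)
  show "f \<in> Arr C" using assms by (simp add: Hom_iff)
  fix W g h assume "g \<in> Hom C (Cod C f) W" "h \<in> Hom C (Cod C f) W" and eq: "g \<cdot> f = h \<cdot> f"
  then have gh: "g \<in> Hom C Y W" "h \<in> Hom C Y W" using assms(1) by (auto simp: Hom_iff)
  have "diff_arr g h \<cdot> f = ZeroA C X W"
    using cmp_diff_left[OF assms(1) gh] eq diff_self cmp_hom gh assms(1) by metis
  then show "g = h" using assms(2) diff_hom[OF gh] diff_zero_iff[OF gh] by blast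
qed

lemma mono_zeroD:
  assumes "mono_arr C f" "f \<in> Hom C X Y" "g \<in> Hom C W X" "f \<cdot> g = ZeroA C W Y"
  shows "g = ZeroA C W X"
  using monoD[OF assms(1-3), of "ZeroA C W X"] assms zero_hom cmp_zero_right hom_obj by metis

lemma epi_zeroD:
  assumes "epi_arr C f" "f \<in> Hom C X Y" "g \<in> Hom C Y W" "g \<cdot> f = ZeroA C X W"
  shows "g = ZeroA C Y W"
  using epiD[OF assms(1-3), of "ZeroA C Y W"] assms zero_hom cmp_zero_left hom_obj by metis

lemma zero_object_iff: "zero_object C X \<longleftrightarrow> X \<in> Obj C \<and> Id C X = ZeroA C X X"
proof
  assume "zero_object C X"
  then show "X \<in> Obj C \<and> Id C X = ZeroA C X X"
    unfolding zero_object_def using id_hom zero_hom by blast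
next
  assume X: "X \<in> Obj C \<and> Id C X = ZeroA C X X"
  then have "f = ZeroA C W X" if "f \<in> Hom C W X" for f W
    using cmp_id_left[OF that] cmp_zero_left[OF that] by simp
  moreover have "f = ZeroA C X W" if "f \<in> Hom C X W" for f W
    using X cmp_id_right[OF that] cmp_zero_right[OF that] by simp
  ultimately show "zero_object C X"
    unfolding zero_object_def using X zero_hom by metis
qed

lemma zero_object_hom:
  assumes "zero_object C X" 
  shows "f \<in> Hom C W X \<Longrightarrow> f = ZeroA C W X" "f \<in> Hom C X W \<Longrightarrow> f = ZeroA C X W"
  using assms hom_obj zero_hom unfolding zero_object_def by metis+

end

section \<open>Finite abelian categories as categories of matrices\<close>

text \<open>When \<open>Q * P = 1\<close>, the matrix \<open>1 - P * Q\<close> is the projection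
  complementary to \<open>P * Q\<close>. For \<open>P\<close>, \<open>Q\<close> taken from a
  factorization it projects onto a kernel or along an image.\<close>

lemma
  fixes P :: "'k::field mat"
  assumes "P \<in> carrier_mat n r" "Q \<in> carrier_mat r n"
  shows compl_mult_left: "G \<in> carrier_mat n m \<Longrightarrow> (1\<^sub>m n - P * Q) * G = G - P * (Q * G)"
    and compl_mult_right: "H \<in> carrier_mat m n \<Longrightarrow> H * (1\<^sub>m n - P * Q) = H - (H * P) * Q"
proof -
  assume G: "G \<in> carrier_mat n m"
  have "(1\<^sub>m n - P * Q) * G = 1\<^sub>m n * G - (P * Q) * G"
    using assms G by (intro minus_mult_distrib_mat) auto
  then show "(1\<^sub>m n - P * Q) * G = G - P * (Q * G)"
    using assms G by (simp add: mat_assoc)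
next
  assume H: "H \<in> carrier_mat m n"
  have "H * (1\<^sub>m n - P * Q) = H * 1\<^sub>m n - H * (P * Q)"
    using assms H by (intro mult_minus_distrib_mat) auto
  then show "H * (1\<^sub>m n - P * Q) = H - (H * P) * Q"
    using assms H by (simp add: mat_assoc)
qed

lemma minus_zero_mat: "G \<in> carrier_mat n m \<Longrightarrow> G - 0\<^sub>m n m = (G :: 'k::field mat)"
  by (intro eq_matI) auto

lemma compl_idempotent:
  fixes P :: "'k::field mat"
  assumes P: "P \<in> carrier_mat n r" and Q: "Q \<in> carrier_mat r n" and QP: "Q * P = 1\<^sub>m r"
  shows "(1\<^sub>m n - P * Q) * (1\<^sub>m n - P * Q) = 1\<^sub>m n - P * Q"
proof -
  have c: "1\<^sub>m n - P * Q \<in> carrier_mat n n" using P Q by (intro minus_carrier_mat) auto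
  have "Q * (1\<^sub>m n - P * Q) = Q - (Q * P) * Q"
    by (rule compl_mult_right[OF P Q Q])
  also have "\<dots> = 0\<^sub>m r n" unfolding QP using Q by simp
  finally have "P * (Q * (1\<^sub>m n - P * Q)) = 0\<^sub>m n n" using P by simp
  then show ?thesis
    using compl_mult_left[OF P Q c] minus_zero_mat[OF c] by simp
qed

text \<open>The compression of an action to a subspace given by \<open>K\<close> with linear
  retraction \<open>D\<close> is multiplicative as soon as the inserted \<open>K * D\<close> can be
  removed from a product. Stability of the column space of \<open>K\<close> removes it on one side,
  stability of the kernel of \<open>D\<close> on the other, so the same lemma covers submodules and
  quotient modules.\<close>

lemma fdmod_restrict:
  fixes A :: "('k::field, 'k vec) module"
  assumes V: "is_fdmod A (m, \<rho>)" and ring: "ring A" 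
    and smult: "\<And>c a. a \<in> carrier A \<Longrightarrow> c \<odot>\<^bsub>A\<^esub> a \<in> carrier A"
    and K: "K \<in> carrier_mat m r" and D: "D \<in> carrier_mat r m" and DK: "D * K = 1\<^sub>m r"
    and stable: "(\<forall>a\<in>carrier A. K * (D * (\<rho> a * K)) = \<rho> a * K) \<or>
      (\<forall>a\<in>carrier A. D * (\<rho> a * (K * D)) = D * \<rho> a)"
  shows "is_fdmod A (r, \<lambda>a. D * (\<rho> a * K))"
proof -
  have c: "\<rho> a \<in> carrier_mat m m" if "a \<in> carrier A" for a using V that by (auto simp: is_fdmod_def)
  have cK: "\<rho> a * K \<in> carrier_mat m r" if "a \<in> carrier A" for a using c[OF that] K by (rule mult_carrier_mat)
  have "D * (\<rho> (a \<oplus>\<^bsub>A\<^esub> b) * K) = D * (\<rho> a * K) + D * (\<rho> b * K)" if "a \<in> carrier A"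
    "b \<in> carrier A" for a b
  proof -
    have "\<rho> (a \<oplus>\<^bsub>A\<^esub> b) * K = \<rho> a * K + \<rho> b * K"
      using V that add_mult_distrib_mat[OF c c K] by (auto simp: is_fdmod_def)
    then show ?thesis using mult_add_distrib_mat[OF D cK[OF that(1)] cK[OF that(2)]] by simp
  qed
  moreover have "D * (\<rho> (s \<odot>\<^bsub>A\<^esub> a) * K) = s \<cdot>\<^sub>m (D * (\<rho> a * K))" if "a \<in> carrier A" for a s
  proof -
    have "\<rho> (s \<odot>\<^bsub>A\<^esub> a) * K = s \<cdot>\<^sub>m (\<rho> a * K)"
      using V that mult_smult_assoc_mat[OF c K] by (auto simp: is_fdmod_def)
    then show ?thesis using mult_smult_distrib[OF D cK[OF that]] by simp
  qed
  moreover have "D * (\<rho> (a \<otimes>\<^bsub>A\<^esub> b) * K) = (D * (\<rho> a * K)) * (D * (\<rho> b * K))"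
    if ab: "a \<in> carrier A" "b \<in> carrier A" for a b
  proof -
    have e: "\<rho> (a \<otimes>\<^bsub>A\<^esub> b) = \<rho> a * \<rho> b" using V ab by (auto simp: is_fdmod_def)
    note dims = c[OF ab(1), THEN carrier_matD(1)] c[OF ab(1), THEN carrier_matD(2)]
      c[OF ab(2), THEN carrier_matD(1)] c[OF ab(2), THEN carrier_matD(2)]
      carrier_matD[OF K] carrier_matD[OF D]
    show ?thesis
    proof (cases "\<forall>a\<in>carrier A. K * (D * (\<rho> a * K)) = \<rho> a * K")
      case True
      then show ?thesis using ab by (simp add: e assoc_mult_mat_dim dims)
    next
      case False
      then have "D * \<rho> a = D * (\<rho> a * (K * D))" using stable ab by auto
      then have "(D * \<rho> a) * (\<rho> b * K) = (D * (\<rho> a * (K * D))) * (\<rho> b * K)" by (rule arg_cong)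
      then show ?thesis by (simp add: e assoc_mult_mat_dim dims)
    qed
  qed
  moreover have "D * (\<rho> \<one>\<^bsub>A\<^esub> * K) = 1\<^sub>m r"
    using V K DK by (simp add: is_fdmod_def)
  ultimately show ?thesis
    using c K D unfolding is_fdmod_def by auto
qed

text \<open>A fully faithful, essentially surjective functor to modules in coordinates, unpacked
  into dimension \<open>d\<close>, action \<open>rho\<close> and matrix \<open>mt\<close>. Essential
  surjectivity is expressed by a pair of mutually inverse matrices, so that no second category
  appears.\<close>

locale matrix_model = linear_category C
  for C :: "('k::field, 'o, 'a, 'z) lincat_scheme" (structure) +
  fixes n :: nat and A :: "('k, 'k vec) module" and d :: "'o \<Rightarrow> nat"
    and rho :: "'o \<Rightarrow> 'k vec \<Rightarrow> 'k mat" and mt :: "'a \<Rightarrow> 'k mat"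
  assumes alg: "fd_algebra n A"
    and rho_mod: "X \<in> Obj C \<Longrightarrow> is_fdmod A (d X, rho X)"
    and mt_carrier: "f \<in> Hom C X Y \<Longrightarrow> mt f \<in> carrier_mat (d Y) (d X)"
    and mt_rho: "f \<in> Hom C X Y \<Longrightarrow> a \<in> carrier A \<Longrightarrow> mt f * rho X a = rho Y a * mt f"
    and mt_cmp: "f \<in> Hom C X Y \<Longrightarrow> g \<in> Hom C Y Z \<Longrightarrow> mt (g \<cdot> f) = mt g * mt f"
    and mt_id: "X \<in> Obj C \<Longrightarrow> mt (Id C X) = 1\<^sub>m (d X)"
    and mt_add: "f \<in> Hom C X Y \<Longrightarrow> g \<in> Hom C X Y \<Longrightarrow> mt (AddA C f g) = mt f + mt g"
    and mt_scale: "f \<in> Hom C X Y \<Longrightarrow> mt (ScaleA C c f) = c \<cdot>\<^sub>m mt f"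
    and mt_faithful: "f \<in> Hom C X Y \<Longrightarrow> g \<in> Hom C X Y \<Longrightarrow> mt f = mt g \<Longrightarrow> f = g"
    and mt_full: "X \<in> Obj C \<Longrightarrow> Y \<in> Obj C \<Longrightarrow> T \<in> carrier_mat (d Y) (d X) \<Longrightarrow>
      (\<And>a. a \<in> carrier A \<Longrightarrow> T * rho X a = rho Y a * T) \<Longrightarrow> \<exists>f\<in>Hom C X Y. mt f = T"
    and mt_ess: "is_fdmod A (m, r) \<Longrightarrow> \<exists>X\<in>Obj C. \<exists>S S'. S \<in> carrier_mat m (d X) \<and>
      S' \<in> carrier_mat (d X) m \<and> S * S' = 1\<^sub>m m \<and> S' * S = 1\<^sub>m (d X) \<and>
      (\<forall>a\<in>carrier A. S * rho X a = r a * S)"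
begin

lemma rho_carrier: "X \<in> Obj C \<Longrightarrow> a \<in> carrier A \<Longrightarrow> rho X a \<in> carrier_mat (d X) (d X)"
  using rho_mod by (fastforce simp: is_fdmod_def)

lemma A_ring: "ring A"
  using alg by (simp add: fd_algebra_def)

lemma A_smult: "a \<in> carrier A \<Longrightarrow> c \<odot>\<^bsub>A\<^esub> a \<in> carrier A"
  using alg by (auto simp: fd_algebra_def)

lemma mt_zero:
  assumes "X \<in> Obj C" "Y \<in> Obj C"
  shows "mt (ZeroA C X Y) = 0\<^sub>m (d Y) (d X)"
proof -
  have z: "ZeroA C X Y \<in> Hom C X Y" using assms zero_hom by blast
  have "mt (ZeroA C X Y) = 0 \<cdot>\<^sub>m mt (ZeroA C X Y)"
    using mt_scale[OF z, of 0] scale_0[OF z z] by simp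
  also have "\<dots> = 0\<^sub>m (d Y) (d X)" using mt_carrier[OF z] by (intro eq_matI) auto
  finally show ?thesis .
qed

text \<open>\<open>L\<close> is just a matrix and need not come from an arrow; cancelling on
  matrices is enough because \<open>mt\<close> is faithful.\<close>

lemma left_inverse_mono:
  assumes z: "z \<in> Hom C Z X" and L: "L \<in> carrier_mat (d Z) (d X)" and Lz: "L * mt z = 1\<^sub>m (d Z)"
  shows "mono_arr C z"
  unfolding mono_arr_def
proof (intro conjI ballI impI)
  show "z \<in> Arr C" using z by (simp add: Hom_iff)
  fix W g h assume "g \<in> Hom C W (Dom C z)" "h \<in> Hom C W (Dom C z)" and eq: "z \<cdot> g = z \<cdot> h"
  then have gh: "g \<in> Hom C W Z" "h \<in> Hom C W Z" using z by (auto simp: Hom_iff)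
  note c = mt_carrier[OF z] mt_carrier[OF gh(1)] mt_carrier[OF gh(2)]
  have "mt z * mt g = mt z * mt h" using mt_cmp[OF gh(1) z] mt_cmp[OF gh(2) z] eq by simp
  then have "L * (mt z * mt g) = L * (mt z * mt h)" by simp
  then have "(L * mt z) * mt g = (L * mt z) * mt h" using c L by (simp add: mat_assoc)
  then show "g = h" unfolding Lz using c mt_faithful[OF gh] by simp
qed

lemma right_inverse_epi:
  assumes z: "z \<in> Hom C X Z" and R: "R \<in> carrier_mat (d X) (d Z)" and zR: "mt z * R = 1\<^sub>m (d Z)"
  shows "epi_arr C z"
  unfolding epi_arr_def
proof (intro conjI ballI impI)
  show "z \<in> Arr C" using z by (simp add: Hom_iff)
  fix W g h assume "g \<in> Hom C (Cod C z) W" "h \<in> Hom C (Cod C z) W" and eq: "g \<cdot> z = h \<cdot> z"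
  then have gh: "g \<in> Hom C Z W" "h \<in> Hom C Z W" using z by (auto simp: Hom_iff)
  note c = mt_carrier[OF z] mt_carrier[OF gh(1)] mt_carrier[OF gh(2)]
  have "mt g * mt z = mt h * mt z" using mt_cmp[OF z gh(1)] mt_cmp[OF z gh(2)] eq by simp
  then have "(mt g * mt z) * R = (mt h * mt z) * R" by simp
  then have "mt g * (mt z * R) = mt h * (mt z * R)" using c R by (simp add: mat_assoc)
  then show "g = h" unfolding zR using c mt_faithful[OF gh] by simp
qed

text \<open>The factor is forced to have matrix \<open>L * mt g\<close>. It commutes with the action
  automatically, because \<open>z\<close> and \<open>g\<close> do and \<open>z\<close> is injective
  on vectors.\<close>

lemma factor_left:
  assumes z: "z \<in> Hom C Z X" and L: "L \<in> carrier_mat (d Z) (d X)" and Lz: "L * mt z = 1\<^sub>m (d Z)"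
    and g: "g \<in> Hom C W X" and eq: "mt z * (L * mt g) = mt g"
  obtains h where "h \<in> Hom C W Z" "z \<cdot> h = g" "mt h = L * mt g"
proof -
  note c = mt_carrier[OF z] mt_carrier[OF g] L
  have "(L * mt g) * rho W a = rho Z a * (L * mt g)" if a: "a \<in> carrier A" for a
  proof -
    note c' = c rho_carrier[OF hom_obj(1)[OF g] a] rho_carrier[OF hom_obj(1)[OF z] a] rho_carrier[OF hom_obj(2)[OF z] a]
    have "(L * mt g) * rho W a = L * (rho X a * mt g)"
      using c' mt_rho[OF g a] by (simp add: mat_assoc)
    also have "\<dots> = L * (rho X a * (mt z * (L * mt g)))" unfolding eq ..
    also have "\<dots> = L * ((rho X a * mt z) * (L * mt g))"
      using c' by (simp add: mat_assoc)
    also have "\<dots> = L * ((mt z * rho Z a) * (L * mt g))" using mt_rho[OF z a] by simp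
    also have "\<dots> = (L * mt z) * (rho Z a * (L * mt g))"
      using c' by (simp add: mat_assoc)
    also have "\<dots> = rho Z a * (L * mt g)" unfolding Lz using c' by simp
    finally show ?thesis .
  qed
  then obtain h where h: "h \<in> Hom C W Z" "mt h = L * mt g"
    using mt_full[OF hom_obj(1)[OF g] hom_obj(1)[OF z], of "L * mt g"] c by auto
  moreover have "z \<cdot> h = g"
    using mt_faithful[OF cmp_hom[OF h(1) z] g] mt_cmp[OF h(1) z] h(2) eq by simp
  ultimately show ?thesis using that by blast
qed

lemma factor_right:
  assumes z: "z \<in> Hom C X Z" and R: "R \<in> carrier_mat (d X) (d Z)" and zR: "mt z * R = 1\<^sub>m (d Z)"
    and g: "g \<in> Hom C X W" and eq: "(mt g * R) * mt z = mt g"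
  obtains h where "h \<in> Hom C Z W" "h \<cdot> z = g" "mt h = mt g * R"
proof -
  note c = mt_carrier[OF z] mt_carrier[OF g] R
  have "(mt g * R) * rho Z a = rho W a * (mt g * R)" if a: "a \<in> carrier A" for a
  proof -
    note c' = c rho_carrier[OF hom_obj(2)[OF g] a] rho_carrier[OF hom_obj(1)[OF z] a] rho_carrier[OF hom_obj(2)[OF z] a]
    have "rho W a * (mt g * R) = (mt g * rho X a) * R"
      using c' mt_rho[OF g a] by (simp add: mat_assoc)
    also have "\<dots> = (((mt g * R) * mt z) * rho X a) * R" unfolding eq ..
    also have "\<dots> = ((mt g * R) * (mt z * rho X a)) * R"
      using c' by (simp add: mat_assoc)
    also have "\<dots> = ((mt g * R) * (rho Z a * mt z)) * R" using mt_rho[OF z a] by simp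
    also have "\<dots> = ((mt g * R) * rho Z a) * (mt z * R)"
      using c' by (simp add: mat_assoc)
    also have "\<dots> = (mt g * R) * rho Z a" unfolding zR using c' by simp
    finally show ?thesis by simp
  qed
  then obtain h where h: "h \<in> Hom C Z W" "mt h = mt g * R"
    using mt_full[OF hom_obj(2)[OF z] hom_obj(2)[OF g], of "mt g * R"] c by auto
  moreover have "h \<cdot> z = g"
    using mt_faithful[OF cmp_hom[OF z h(1)] g] mt_cmp[OF z h(1)] h(2) eq by simp
  ultimately show ?thesis using that by blast
qed

text \<open>A stable subspace becomes an object: essential surjectivity replaces the compressed
  module by an isomorphic one coming from \<open>C\<close>, at the price of the change of basis
  \<open>S\<close>. The retraction \<open>L\<close> is in general only linear.\<close>

lemma sub_realize:
  assumes X: "X \<in> Obj C" and K: "K \<in> carrier_mat (d X) r" and D: "D \<in> carrier_mat r (d X)"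
    and DK: "D * K = 1\<^sub>m r" and stable: "\<And>a. a \<in> carrier A \<Longrightarrow> K * (D * (rho X a * K)) = rho X a * K"
  obtains Z z L where "z \<in> Hom C Z X" "L \<in> carrier_mat (d Z) (d X)" "L * mt z = 1\<^sub>m (d Z)" "mt z * L = K * D"
    "mono_arr C z"
proof -
  have "is_fdmod A (r, \<lambda>a. D * (rho X a * K))"
    using fdmod_restrict[OF rho_mod[OF X] A_ring A_smult K D DK] stable by blast
  from mt_ess[OF this] obtain Z S S' where Z: "Z \<in> Obj C" and S: "S \<in> carrier_mat r (d Z)"
    and S': "S' \<in> carrier_mat (d Z) r" and SS': "S * S' = 1\<^sub>m r" "S' * S = 1\<^sub>m (d Z)"
    and eq: "\<And>a. a \<in> carrier A \<Longrightarrow> S * rho Z a = D * (rho X a * K) * S" by blast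
  have "(K * S) * rho Z a = rho X a * (K * S)" if a: "a \<in> carrier A" for a
  proof -
    note c = K D S rho_carrier[OF X a] rho_carrier[OF Z a]
    have "(K * S) * rho Z a = K * (S * rho Z a)" using c by (simp add: mat_assoc)
    also have "\<dots> = (K * (D * (rho X a * K))) * S"
      unfolding eq[OF a] using c by (simp add: mat_assoc)
    also have "\<dots> = rho X a * (K * S)"
      unfolding stable[OF a] using c by (simp add: mat_assoc)
    finally show ?thesis .
  qed
  moreover have "K * S \<in> carrier_mat (d X) (d Z)" using K S by simp
  ultimately obtain z where z: "z \<in> Hom C Z X" "mt z = K * S"
    using mt_full[OF Z X, of "K * S"] by blast
  have "(S' * D) * mt z = S' * ((D * K) * S)"
    unfolding z(2) using K S D S' by (simp add: mat_assoc)
  also have "\<dots> = 1\<^sub>m (d Z)" unfolding DK using S SS' by simp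
  finally have 1: "(S' * D) * mt z = 1\<^sub>m (d Z)" .
  have "mt z * (S' * D) = K * ((S * S') * D)"
    unfolding z(2) using K S D S' by (simp add: mat_assoc)
  also have "\<dots> = K * D" unfolding SS' using D by simp
  finally have 2: "mt z * (S' * D) = K * D" .
  have L: "S' * D \<in> carrier_mat (d Z) (d X)" using S' D by simp
  show ?thesis by (rule that[OF z(1) L 1 2 left_inverse_mono[OF z(1) L 1]])
qed

text \<open>Dual to \<open>sub_realize\<close>: here the kernel of \<open>D\<close> is stable, and
  \<open>K\<close> is a linear section of the quotient map.\<close>

lemma quot_realize:
  assumes X: "X \<in> Obj C" and K: "K \<in> carrier_mat (d X) r" and D: "D \<in> carrier_mat r (d X)"
    and DK: "D * K = 1\<^sub>m r" and stable: "\<And>a. a \<in> carrier A \<Longrightarrow> D * (rho X a * (K * D)) = D * rho X a"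
  obtains Z z R where "z \<in> Hom C X Z" "R \<in> carrier_mat (d X) (d Z)" "mt z * R = 1\<^sub>m (d Z)" "R * mt z = K * D"
    "epi_arr C z"
proof -
  have "is_fdmod A (r, \<lambda>a. D * (rho X a * K))"
    using fdmod_restrict[OF rho_mod[OF X] A_ring A_smult K D DK] stable by blast
  from mt_ess[OF this] obtain Z S S' where Z: "Z \<in> Obj C" and S: "S \<in> carrier_mat r (d Z)"
    and S': "S' \<in> carrier_mat (d Z) r" and SS': "S * S' = 1\<^sub>m r" "S' * S = 1\<^sub>m (d Z)"
    and eq: "\<And>a. a \<in> carrier A \<Longrightarrow> S * rho Z a = D * (rho X a * K) * S" by blast
  have "(S' * D) * rho X a = rho Z a * (S' * D)" if a: "a \<in> carrier A" for a
  proof -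
    note c = K D S S' rho_carrier[OF X a] rho_carrier[OF Z a]
    have "rho Z a * (S' * D) = (S' * S) * (rho Z a * (S' * D))" unfolding SS' using c by simp
    also have "\<dots> = S' * ((S * rho Z a) * (S' * D))" using c by (simp add: mat_assoc)
    also have "\<dots> = S' * (D * (rho X a * (K * ((S * S') * D))))"
      unfolding eq[OF a] using c by (simp add: mat_assoc)
    also have "\<dots> = S' * (D * rho X a)"
      unfolding SS' using stable[OF a] D by simp
    also have "\<dots> = (S' * D) * rho X a" using c by (simp add: mat_assoc)
    finally show ?thesis by simp
  qed
  moreover have "S' * D \<in> carrier_mat (d Z) (d X)" using D S' by simp
  ultimately obtain z where z: "z \<in> Hom C X Z" "mt z = S' * D"
    using mt_full[OF X Z, of "S' * D"] by blast
  have "mt z * (K * S) = S' * ((D * K) * S)"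
    unfolding z(2) using K S D S' by (simp add: mat_assoc)
  also have "\<dots> = 1\<^sub>m (d Z)" unfolding DK using S SS' by simp
  finally have 1: "mt z * (K * S) = 1\<^sub>m (d Z)" .
  have "(K * S) * mt z = K * ((S * S') * D)"
    unfolding z(2) using K S D S' by (simp add: mat_assoc)
  also have "\<dots> = K * D" unfolding SS' using D by simp
  finally have 2: "(K * S) * mt z = K * D" .
  have R: "K * S \<in> carrier_mat (d X) (d Z)" using K S by simp
  show ?thesis by (rule that[OF z(1) R 1 2 right_inverse_epi[OF z(1) R 1]])
qed


text \<open>As \<open>B\<close> is injective, \<open>f\<close> and \<open>D\<close> have the same
  kernel, and \<open>1 - D' * D\<close> projects onto it; splitting this idempotent gives the
  inclusion. The factorization is a parameter so that a caller can relate the kernel to matrices it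
  already holds.\<close>

lemma kernel_data:
  assumes f: "f \<in> Hom C X Y" and B: "B \<in> carrier_mat (d Y) r" and C: "D \<in> carrier_mat r (d X)"
    and B': "B' \<in> carrier_mat r (d Y)" and C': "D' \<in> carrier_mat (d X) r"
    and fBC: "mt f = B * D" and B'B: "B' * B = 1\<^sub>m r" and CC': "D * D' = 1\<^sub>m r"
  obtains K k L where "k \<in> Hom C K X" "L \<in> carrier_mat (d K) (d X)" "L * mt k = 1\<^sub>m (d K)"
    "mt k * L = 1\<^sub>m (d X) - D' * D" "mono_arr C k" "f \<cdot> k = ZeroA C K Y"
    "\<And>W g. g \<in> Hom C W X \<Longrightarrow> f \<cdot> g = ZeroA C W Y \<Longrightarrow> \<exists>h\<in>Hom C W K. k \<cdot> h = g"
proof -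
  let ?e = "1\<^sub>m (d X) - D' * D"
  have X: "X \<in> Obj C" and Y: "Y \<in> Obj C" using hom_obj[OF f] by auto
  have ec: "?e \<in> carrier_mat (d X) (d X)" using C C' by (intro minus_carrier_mat) auto
  obtain s K D0 where K: "K \<in> carrier_mat (d X) s" and D0: "D0 \<in> carrier_mat s (d X)"
    and KD: "?e = K * D0" and DK: "D0 * K = 1\<^sub>m s"
    by (rule idempotent_split[OF ec compl_idempotent[OF C' C CC']])
  have De: "D * ?e = 0\<^sub>m r (d X)"
    unfolding compl_mult_right[OF C' C C] CC' using C by simp
  have killed: "D * G = 0\<^sub>m r m" if G: "G \<in> carrier_mat (d X) m" and "mt f * G = 0\<^sub>m (d Y) m" for G m
  proof -
    have "(B' * B) * (D * G) = B' * (mt f * G)"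
      unfolding fBC using B C B' G by (simp add: mat_assoc)
    then show ?thesis unfolding that(2) B'B using B' C G by simp
  qed
  \<comment> \<open>Whatever \<open>f\<close> kills is fixed by the projection. Applied to
    \<open>rho X a * K\<close> this gives stability of the kernel, applied to \<open>mt g\<close>
    the universal property.\<close>
  have absorb: "K * (D0 * G) = G" if G: "G \<in> carrier_mat (d X) m" and "mt f * G = 0\<^sub>m (d Y) m" for G m
  proof -
    have "K * (D0 * G) = ?e * G" unfolding KD using K D0 G by (simp add: mat_assoc)
    also have "\<dots> = G"
      unfolding compl_mult_left[OF C' C G] killed[OF that] using C' G by (simp add: minus_zero_mat)
    finally show ?thesis .
  qed
  have "D * K = (D * ?e) * K" unfolding KD using DK C K D0 by (simp add: mat_assoc)
  then have DK0: "D * K = 0\<^sub>m r s" unfolding De using K by simp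
  have fK: "mt f * K = 0\<^sub>m (d Y) s" unfolding fBC using B C K DK0 by (simp add: mat_assoc)
  have "K * (D0 * (rho X a * K)) = rho X a * K" if a: "a \<in> carrier A" for a
  proof (rule absorb)
    note c = mt_carrier[OF f] rho_carrier[OF X a] rho_carrier[OF Y a] K
    show "rho X a * K \<in> carrier_mat (d X) s" using c by simp
    have "mt f * (rho X a * K) = (mt f * rho X a) * K" using c by (simp add: mat_assoc)
    also have "\<dots> = rho Y a * (mt f * K)" unfolding mt_rho[OF f a] using c by (simp add: mat_assoc)
    also have "\<dots> = 0\<^sub>m (d Y) s" unfolding fK using c by simp
    finally show "mt f * (rho X a * K) = 0\<^sub>m (d Y) s" .
  qed
  then obtain Z z L where z: "z \<in> Hom C Z X" and L: "L \<in> carrier_mat (d Z) (d X)" "L * mt z = 1\<^sub>m (d Z)"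
    and zL: "mt z * L = K * D0" and mono: "mono_arr C z"
    using sub_realize[OF X K D0 DK] by metis
  note cz = mt_carrier[OF z] and cf = mt_carrier[OF f]
  have "mt f * mt z = mt f * ((mt z * L) * mt z)" using cz L by (simp add: mat_assoc)
  also have "\<dots> = (mt f * K) * (D0 * mt z)" unfolding zL using cf K D0 cz by (simp add: mat_assoc)
  also have "\<dots> = 0\<^sub>m (d Y) (d Z)" unfolding fK using D0 cz by simp
  finally have "f \<cdot> z = ZeroA C Z Y"
    using mt_faithful[OF cmp_hom[OF z f] zero_hom] mt_cmp[OF z f] mt_zero hom_obj[OF z] Y by simp
  moreover have "\<exists>h\<in>Hom C W Z. z \<cdot> h = g" if g: "g \<in> Hom C W X" and 0: "f \<cdot> g = ZeroA C W Y" for W g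
  proof -
    have cg: "mt g \<in> carrier_mat (d X) (d W)" by (rule mt_carrier[OF g])
    have "mt f * mt g = 0\<^sub>m (d Y) (d W)"
      using mt_cmp[OF g f] 0 mt_zero hom_obj[OF g] Y by simp
    note a = absorb[OF cg this]
    have "mt z * (L * mt g) = (K * D0) * mt g"
      unfolding zL[symmetric] using cz L(1) cg by (simp add: mat_assoc)
    also have "\<dots> = mt g" using a K D0 cg by (simp add: mat_assoc)
    finally have a: "mt z * (L * mt g) = mt g" .
    from factor_left[OF z L g a] show ?thesis by blast
  qed
  ultimately show ?thesis using that[OF z L _ mono] zL KD by simp
qed

text \<open>The image of \<open>f\<close> is the column space of \<open>B\<close>, so the cokernel
  is the quotient by it, cut out by the idempotent \<open>1 - B * B'\<close>.\<close>

lemma cokernel_data: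
  assumes f: "f \<in> Hom C X Y" and B: "B \<in> carrier_mat (d Y) r" and C: "D \<in> carrier_mat r (d X)"
    and B': "B' \<in> carrier_mat r (d Y)" and C': "D' \<in> carrier_mat (d X) r"
    and fBC: "mt f = B * D" and B'B: "B' * B = 1\<^sub>m r" and CC': "D * D' = 1\<^sub>m r"
  obtains Q c R where "c \<in> Hom C Y Q" "R \<in> carrier_mat (d Y) (d Q)" "mt c * R = 1\<^sub>m (d Q)"
    "R * mt c = 1\<^sub>m (d Y) - B * B'" "epi_arr C c" "c \<cdot> f = ZeroA C X Q"
    "\<And>W g. g \<in> Hom C Y W \<Longrightarrow> g \<cdot> f = ZeroA C X W \<Longrightarrow> \<exists>h\<in>Hom C Q W. h \<cdot> c = g"
proof -
  let ?e = "1\<^sub>m (d Y) - B * B'"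
  have X: "X \<in> Obj C" and Y: "Y \<in> Obj C" using hom_obj[OF f] by auto
  have ec: "?e \<in> carrier_mat (d Y) (d Y)" using B B' by (intro minus_carrier_mat) auto
  obtain s K D0 where K: "K \<in> carrier_mat (d Y) s" and D0: "D0 \<in> carrier_mat s (d Y)"
    and KD: "?e = K * D0" and DK: "D0 * K = 1\<^sub>m s"
    by (rule idempotent_split[OF ec compl_idempotent[OF B B' B'B]])
  have eB: "?e * B = 0\<^sub>m (d Y) r"
    unfolding compl_mult_left[OF B B' B] B'B using B by simp
  have killed: "G * B = 0\<^sub>m m r" if G: "G \<in> carrier_mat m (d Y)" and "G * mt f = 0\<^sub>m m (d X)" for G m
  proof -
    have "(G * B) * (D * D') = (G * mt f) * D'"
      unfolding fBC using B C C' G by (simp add: mat_assoc)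
    then show ?thesis unfolding that(2) CC' using B C' G by simp
  qed
  have absorb: "(G * K) * D0 = G" if G: "G \<in> carrier_mat m (d Y)" and "G * mt f = 0\<^sub>m m (d X)" for G m
  proof -
    have "(G * K) * D0 = G * ?e" unfolding KD using K D0 G by (simp add: mat_assoc)
    also have "\<dots> = G"
      unfolding compl_mult_right[OF B B' G] killed[OF that] using B' G by (simp add: minus_zero_mat)
    finally show ?thesis .
  qed
  have "D0 * B = (D0 * K) * (D0 * B)" unfolding DK using D0 B by simp
  also have "\<dots> = D0 * (?e * B)" unfolding KD using B K D0 by (simp add: mat_assoc)
  finally have DB0: "D0 * B = 0\<^sub>m s r" unfolding eB using D0 by simp
  have "D0 * mt f = (D0 * B) * D" unfolding fBC using B C D0 by (simp add: mat_assoc)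
  then have Df: "D0 * mt f = 0\<^sub>m s (d X)" unfolding DB0 using C by simp
  have "D0 * (rho Y a * (K * D0)) = D0 * rho Y a" if a: "a \<in> carrier A" for a
  proof -
    note c = mt_carrier[OF f] rho_carrier[OF X a] rho_carrier[OF Y a] K D0
    have "(D0 * rho Y a) * mt f = D0 * (mt f * rho X a)"
      unfolding mt_rho[OF f a] using c by (simp add: mat_assoc)
    also have "\<dots> = (D0 * mt f) * rho X a" using c by (simp add: mat_assoc)
    also have "\<dots> = 0\<^sub>m s (d X)" unfolding Df using c by simp
    finally have "((D0 * rho Y a) * K) * D0 = D0 * rho Y a"
      using c by (intro absorb) auto
    then show ?thesis using c by (simp add: mat_assoc)
  qed
  then obtain Z z R where z: "z \<in> Hom C Y Z" and R: "R \<in> carrier_mat (d Y) (d Z)" "mt z * R = 1\<^sub>m (d Z)"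
    and Rz: "R * mt z = K * D0" and epi: "epi_arr C z"
    using quot_realize[OF Y K D0 DK] by metis
  note cz = mt_carrier[OF z] and cf = mt_carrier[OF f]
  have "mt z * mt f = (mt z * R) * (mt z * mt f)" unfolding R(2) using cz cf by simp
  also have "\<dots> = mt z * ((R * mt z) * mt f)" using cz cf R(1) by (simp add: mat_assoc)
  also have "\<dots> = (mt z * K) * (D0 * mt f)" unfolding Rz using cf K D0 cz by (simp add: mat_assoc)
  also have "\<dots> = 0\<^sub>m (d Z) (d X)" unfolding Df using K cz by simp
  finally have "z \<cdot> f = ZeroA C X Z"
    using mt_faithful[OF cmp_hom[OF f z] zero_hom] mt_cmp[OF f z] mt_zero hom_obj[OF z] X by simp
  moreover have "\<exists>h\<in>Hom C Z W. h \<cdot> z = g" if g: "g \<in> Hom C Y W" and 0: "g \<cdot> f = ZeroA C X W" for W g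
  proof -
    have cg: "mt g \<in> carrier_mat (d W) (d Y)" by (rule mt_carrier[OF g])
    have "mt g * mt f = 0\<^sub>m (d W) (d X)"
      using mt_cmp[OF f g] 0 mt_zero hom_obj[OF g] X by simp
    note a = absorb[OF cg this]
    have "(mt g * R) * mt z = mt g * (K * D0)"
      unfolding Rz[symmetric] using cz R(1) cg by (simp add: mat_assoc)
    also have "\<dots> = mt g" using a K D0 cg by (simp add: mat_assoc)
    finally have a: "(mt g * R) * mt z = mt g" .
    from factor_right[OF z R g a] show ?thesis by blast
  qed
  ultimately show ?thesis using that[OF z R _ epi] Rz KD by simp
qed

end

section \<open>Biproducts and projective objects\<close>

context linear_category
begin

lemma direct_sumE:
  assumes "is_direct_sum C X Y Z"
  obtains i j p q where "i \<in> Hom C X Z" "j \<in> Hom C Y Z" "p \<in> Hom C Z X" "q \<in> Hom C Z Y"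
    "p \<cdot> i = Id C X" "q \<cdot> j = Id C Y" "p \<cdot> j = ZeroA C Y X" "q \<cdot> i = ZeroA C X Y"
    "AddA C (i \<cdot> p) (j \<cdot> q) = Id C Z"
  using assms unfolding is_direct_sum_def by blast

lemma direct_sum_expand_left:
  assumes "i \<in> Hom C X Z" "j \<in> Hom C Y Z" "p \<in> Hom C Z X" "q \<in> Hom C Z Y"
    "AddA C (i \<cdot> p) (j \<cdot> q) = Id C Z" "g \<in> Hom C W Z"
  shows "AddA C (i \<cdot> (p \<cdot> g)) (j \<cdot> (q \<cdot> g)) = g"
proof -
  have "AddA C (i \<cdot> (p \<cdot> g)) (j \<cdot> (q \<cdot> g)) = AddA C (i \<cdot> p) (j \<cdot> q) \<cdot> g"
    using cmp_add_left[OF assms(6) cmp_hom[OF assms(3,1)] cmp_hom[OF assms(4,2)]]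
      cmp_assoc[OF assms(6,3,1)] cmp_assoc[OF assms(6,4,2)] by simp
  then show ?thesis unfolding assms(5) using assms(6) cmp_id_left by simp
qed

lemma direct_sum_expand_right:
  assumes "i \<in> Hom C X Z" "j \<in> Hom C Y Z" "p \<in> Hom C Z X" "q \<in> Hom C Z Y"
    "AddA C (i \<cdot> p) (j \<cdot> q) = Id C Z" "g \<in> Hom C Z W"
  shows "AddA C ((g \<cdot> i) \<cdot> p) ((g \<cdot> j) \<cdot> q) = g"
proof -
  have "AddA C ((g \<cdot> i) \<cdot> p) ((g \<cdot> j) \<cdot> q) = g \<cdot> AddA C (i \<cdot> p) (j \<cdot> q)"
    using cmp_add_right[OF cmp_hom[OF assms(3,1)] cmp_hom[OF assms(4,2)] assms(6)]
      cmp_assoc[OF assms(3,1,6)] cmp_assoc[OF assms(4,2,6)] by simp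
  then show ?thesis unfolding assms(5) using assms(6) cmp_id_right by simp
qed

lemma copair_exists:
  assumes ijpq: "i \<in> Hom C X Z" "j \<in> Hom C Y Z" "p \<in> Hom C Z X" "q \<in> Hom C Z Y"
    and eq: "p \<cdot> i = Id C X" "q \<cdot> j = Id C Y" "p \<cdot> j = ZeroA C Y X" "q \<cdot> i = ZeroA C X Y"
    and f: "f \<in> Hom C X W" and g: "g \<in> Hom C Y W"
  obtains h where "h \<in> Hom C Z W" "h \<cdot> i = f" "h \<cdot> j = g" "h = AddA C (f \<cdot> p) (g \<cdot> q)"
proof
  let ?h = "AddA C (f \<cdot> p) (g \<cdot> q)"
  have fp: "f \<cdot> p \<in> Hom C Z W" and gq: "g \<cdot> q \<in> Hom C Z W"
    using cmp_hom ijpq f g by blast+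
  show "?h \<in> Hom C Z W" using add_hom fp gq by blast
  have "?h \<cdot> i = AddA C (f \<cdot> (p \<cdot> i)) (g \<cdot> (q \<cdot> i))"
    using cmp_add_left[OF ijpq(1) fp gq] cmp_assoc[OF ijpq(1,3) f] cmp_assoc[OF ijpq(1,4) g] by simp
  also have "\<dots> = f"
    unfolding eq using f cmp_id_right[OF f] cmp_zero_right[OF g hom_obj(1)[OF f]] add_zero[OF f f] by simp
  finally show "?h \<cdot> i = f" .
  have "?h \<cdot> j = AddA C (f \<cdot> (p \<cdot> j)) (g \<cdot> (q \<cdot> j))"
    using cmp_add_left[OF ijpq(2) fp gq] cmp_assoc[OF ijpq(2,3) f] cmp_assoc[OF ijpq(2,4) g] by simp
  also have "\<dots> = AddA C (ZeroA C Y W) g"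
    unfolding eq using cmp_id_right[OF g] cmp_zero_right[OF f hom_obj(1)[OF g]] by simp
  also have "\<dots> = g"
    using add_commute[OF zero_hom g] add_zero[OF g g] hom_obj[OF g] by simp
  finally show "?h \<cdot> j = g" .
qed simp

lemma pair_exists:
  assumes ijpq: "i \<in> Hom C X Z" "j \<in> Hom C Y Z" "p \<in> Hom C Z X" "q \<in> Hom C Z Y"
    and eq: "p \<cdot> i = Id C X" "q \<cdot> j = Id C Y" "p \<cdot> j = ZeroA C Y X" "q \<cdot> i = ZeroA C X Y"
    and f: "f \<in> Hom C W X" and g: "g \<in> Hom C W Y"
  obtains h where "h \<in> Hom C W Z" "p \<cdot> h = f" "q \<cdot> h = g" "h = AddA C (i \<cdot> f) (j \<cdot> g)"
proof
  let ?h = "AddA C (i \<cdot> f) (j \<cdot> g)"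
  have fp: "i \<cdot> f \<in> Hom C W Z" and gq: "j \<cdot> g \<in> Hom C W Z"
    using cmp_hom ijpq f g by blast+
  show "?h \<in> Hom C W Z" using add_hom fp gq by blast
  have "p \<cdot> ?h = AddA C ((p \<cdot> i) \<cdot> f) ((p \<cdot> j) \<cdot> g)"
    using cmp_add_right[OF fp gq ijpq(3)] cmp_assoc[OF f ijpq(1,3)] cmp_assoc[OF g ijpq(2,3)] by simp
  also have "\<dots> = f"
    unfolding eq using f cmp_id_left[OF f] cmp_zero_left[OF g hom_obj(2)[OF f]] add_zero[OF f f] by simp
  finally show "p \<cdot> ?h = f" .
  have "q \<cdot> ?h = AddA C ((q \<cdot> i) \<cdot> f) ((q \<cdot> j) \<cdot> g)"
    using cmp_add_right[OF fp gq ijpq(4)] cmp_assoc[OF f ijpq(1,4)] cmp_assoc[OF g ijpq(2,4)] by simp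
  also have "\<dots> = AddA C (ZeroA C W Y) g"
    unfolding eq using cmp_id_left[OF g] cmp_zero_left[OF f hom_obj(2)[OF g]] by simp
  also have "\<dots> = g"
    using add_commute[OF zero_hom g] add_zero[OF g g] hom_obj[OF g] by simp
  finally show "q \<cdot> ?h = g" .
qed simp

text \<open>An arrow that vanishes after \<open>h\<close> vanishes on both summands of
  \<open>Z\<close>, since \<open>e1\<close> and \<open>e2\<close> are epimorphisms.\<close>

lemma direct_sum_epi:
  assumes T: "is_direct_sum C L1 L2 T" and Z: "is_direct_sum C X Y Z"
    and e1: "e1 \<in> Hom C L1 X" "epi_arr C e1" and e2: "e2 \<in> Hom C L2 Y" "epi_arr C e2"
  obtains h where "h \<in> Hom C T Z" "epi_arr C h"
proof -
  obtain i j p q where ijpq: "i \<in> Hom C L1 T" "j \<in> Hom C L2 T" "p \<in> Hom C T L1" "q \<in> Hom C T L2"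
    and eq: "p \<cdot> i = Id C L1" "q \<cdot> j = Id C L2" "p \<cdot> j = ZeroA C L2 L1" "q \<cdot> i = ZeroA C L1 L2"
    by (rule direct_sumE[OF T])
  obtain i' j' p' q' where ijpq': "i' \<in> Hom C X Z" "j' \<in> Hom C Y Z" "p' \<in> Hom C Z X" "q' \<in> Hom C Z Y"
    and sum': "AddA C (i' \<cdot> p') (j' \<cdot> q') = Id C Z"
    by (rule direct_sumE[OF Z])
  obtain h where h: "h \<in> Hom C T Z" "h \<cdot> i = i' \<cdot> e1" "h \<cdot> j = j' \<cdot> e2"
    by (rule copair_exists[OF ijpq eq cmp_hom[OF e1(1) ijpq'(1)] cmp_hom[OF e2(1) ijpq'(2)]])
  have "epi_arr C h"
  proof (rule epi_zeroI[OF h(1)])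
    fix W g assume g: "g \<in> Hom C Z W" and gh: "g \<cdot> h = ZeroA C T W"
    have WO: "W \<in> Obj C" and ZO: "Z \<in> Obj C" using hom_obj[OF g] by auto
    have "(g \<cdot> i') \<cdot> e1 = (g \<cdot> h) \<cdot> i"
      using cmp_assoc[OF e1(1) ijpq'(1) g] cmp_assoc[OF ijpq(1) h(1) g] h(2) by simp
    also have "\<dots> = ZeroA C L1 W" unfolding gh using cmp_zero_left[OF ijpq(1) WO] .
    finally have z1: "g \<cdot> i' = ZeroA C X W" by (rule epi_zeroD[OF e1(2,1) cmp_hom[OF ijpq'(1) g]])
    have "(g \<cdot> j') \<cdot> e2 = (g \<cdot> h) \<cdot> j"
      using cmp_assoc[OF e2(1) ijpq'(2) g] cmp_assoc[OF ijpq(2) h(1) g] h(3) by simp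
    also have "\<dots> = ZeroA C L2 W" unfolding gh using cmp_zero_left[OF ijpq(2) WO] .
    finally have z2: "g \<cdot> j' = ZeroA C Y W" by (rule epi_zeroD[OF e2(2,1) cmp_hom[OF ijpq'(2) g]])
    have "g = AddA C ((g \<cdot> i') \<cdot> p') ((g \<cdot> j') \<cdot> q')"
      using direct_sum_expand_right[OF ijpq' sum' g] by simp
    also have "\<dots> = AddA C (ZeroA C Z W) (ZeroA C Z W)"
      unfolding z1 z2 using cmp_zero_left[OF ijpq'(3) WO] cmp_zero_left[OF ijpq'(4) WO] by simp
    also have "\<dots> = ZeroA C Z W" using add_zero zero_hom[OF ZO WO] by blast
    finally show "g = ZeroA C Z W" .
  qed
  then show ?thesis using that h(1) by blast
qed

lemma projective_lift:
  assumes "projective_object C P" "epi_arr C e" "e \<in> Hom C X Y" "f \<in> Hom C P Y"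
  obtains g where "g \<in> Hom C P X" "e \<cdot> g = f"
proof -
  have "Dom C e = X" "f \<in> Hom C P (Cod C e)" using assms(3,4) by (simp_all add: Hom_iff)
  then show ?thesis using assms(1,2) that unfolding projective_object_def by blast
qed

lemma projective_direct_sum:
  assumes P: "projective_object C P" and Q: "projective_object C Q" and S: "is_direct_sum C P Q Z"
  shows "projective_object C Z"
  unfolding projective_object_def
proof (intro conjI allI impI)
  show "Z \<in> Obj C" using S by (simp add: is_direct_sum_def)
  fix e f assume ef: "epi_arr C e \<and> f \<in> Hom C Z (Cod C e)"
  then have e: "e \<in> Hom C (Dom C e) (Cod C e)" by (simp add: Hom_iff epi_arr_def)
  obtain i j p q where ijpq: "i \<in> Hom C P Z" "j \<in> Hom C Q Z" "p \<in> Hom C Z P" "q \<in> Hom C Z Q"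
    and eq: "p \<cdot> i = Id C P" "q \<cdot> j = Id C Q" "p \<cdot> j = ZeroA C Q P" "q \<cdot> i = ZeroA C P Q"
    "AddA C (i \<cdot> p) (j \<cdot> q) = Id C Z" using direct_sumE[OF S] by metis
  from ef have f: "f \<in> Hom C Z (Cod C e)" by simp
  obtain g1 where g1: "g1 \<in> Hom C P (Dom C e)" "e \<cdot> g1 = f \<cdot> i"
    using projective_lift[OF P _ e cmp_hom[OF ijpq(1) f]] ef by blast
  obtain g2 where g2: "g2 \<in> Hom C Q (Dom C e)" "e \<cdot> g2 = f \<cdot> j"
    using projective_lift[OF Q _ e cmp_hom[OF ijpq(2) f]] ef by blast
  let ?g = "AddA C (g1 \<cdot> p) (g2 \<cdot> q)"
  have "?g \<in> Hom C Z (Dom C e)"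
    using add_hom[OF cmp_hom[OF ijpq(3) g1(1)] cmp_hom[OF ijpq(4) g2(1)]] .
  moreover have "e \<cdot> ?g = AddA C ((f \<cdot> i) \<cdot> p) ((f \<cdot> j) \<cdot> q)"
    using cmp_add_right[OF cmp_hom[OF ijpq(3) g1(1)] cmp_hom[OF ijpq(4) g2(1)] e]
      cmp_assoc[OF ijpq(3) g1(1) e] cmp_assoc[OF ijpq(4) g2(1) e] g1(2) g2(2) by simp
  ultimately show "\<exists>g\<in>Hom C Z (Dom C e). e \<cdot> g = f"
    using direct_sum_expand_right[OF ijpq eq(5) f] by auto
qed

end

section \<open>Matrices of linear maps\<close>

definition matrix_of_map :: "nat \<Rightarrow> nat \<Rightarrow> ('k vec \<Rightarrow> 'k vec) \<Rightarrow> 'k::field mat" where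
  "matrix_of_map m n h = mat m n (\<lambda>(i, j). h (unit_vec n j) $ i)"

lemma matrix_of_map_carrier: "matrix_of_map m n h \<in> carrier_mat m n"
  by (simp add: matrix_of_map_def)

lemma matrix_of_map_apply:
  fixes h :: "'k::field vec \<Rightarrow> 'k vec"
  assumes h: "\<And>x. x \<in> carrier_vec n \<Longrightarrow> h x \<in> carrier_vec m"
    and add: "\<And>x y. x \<in> carrier_vec n \<Longrightarrow> y \<in> carrier_vec n \<Longrightarrow> h (x + y) = h x + h y"
    and smult: "\<And>c x. x \<in> carrier_vec n \<Longrightarrow> h (c \<cdot>\<^sub>v x) = c \<cdot>\<^sub>v h x"
    and v: "v \<in> carrier_vec n"
  shows "matrix_of_map m n h *\<^sub>v v = h v"
proof (rule eq_vecI)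
  show dim: "dim_vec (matrix_of_map m n h *\<^sub>v v) = dim_vec (h v)"
    using h[OF v] by (simp add: matrix_of_map_def)
  fix i assume "i < dim_vec (h v)"
  then have i: "i < m" using h[OF v] by simp
  \<comment> \<open>Additivity is available for two vectors at a time, so \<open>v\<close> is built
    up coordinate by coordinate through its truncations.\<close>
  have trunc: "h (vec n (\<lambda>l. if l < k then v $ l else 0)) $ i = (\<Sum>j<k. h (unit_vec n j) $ i * v $ j)"
    if "k \<le> n" for k
    using that
  proof (induction k)
    case 0
    have "(vec n (\<lambda>l. if l < 0 then v $ l else 0)) = 0 \<cdot>\<^sub>v v" using v by (intro eq_vecI) auto
    then show ?case using smult[OF v, of 0] h[OF v] i by simp
  next
    case (Suc k)
    have "vec n (\<lambda>l. if l < Suc k then v $ l else 0)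
        = vec n (\<lambda>l. if l < k then v $ l else 0) + v $ k \<cdot>\<^sub>v unit_vec n k"
      using Suc.prems by (intro eq_vecI) (auto simp: less_Suc_eq)
    then have "h (vec n (\<lambda>l. if l < Suc k then v $ l else 0))
        = h (vec n (\<lambda>l. if l < k then v $ l else 0)) + v $ k \<cdot>\<^sub>v h (unit_vec n k)"
      using add[of "vec n (\<lambda>l. if l < k then v $ l else 0)" "v $ k \<cdot>\<^sub>v unit_vec n k"]
        smult[of "unit_vec n k" "v $ k"] by simp
    then show ?case
      using Suc i h[of "unit_vec n k"] h[of "vec n (\<lambda>l. if l < k then v $ l else 0)"]
      by (simp add: mult.commute)
  qed
  have "vec n (\<lambda>l. if l < n then v $ l else 0) = v" using v by (intro eq_vecI) auto
  then have "h v $ i = (\<Sum>j<n. h (unit_vec n j) $ i * v $ j)" using trunc[of n] by simp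
  also have "\<dots> = (matrix_of_map m n h *\<^sub>v v) $ i"
    using i v by (simp add: matrix_of_map_def scalar_prod_def lessThan_atLeast0)
  finally show "(matrix_of_map m n h *\<^sub>v v) $ i = h v $ i" by simp
qed

lemma mat_eq_on_vecs:
  fixes M N :: "'k::field mat"
  assumes M: "M \<in> carrier_mat m n" and N: "N \<in> carrier_mat m n"
    and eq: "\<And>v. v \<in> carrier_vec n \<Longrightarrow> M *\<^sub>v v = N *\<^sub>v v"
  shows "M = N"
proof (rule eq_matI)
  fix i j assume "i < dim_row N" "j < dim_col N"
  then have ij: "i < m" "j < n" using N by auto
  have e: "K $$ (i, j) = (K *\<^sub>v unit_vec n j) $ i" if "K \<in> carrier_mat m n" for K :: "'k mat"
    using that ij by (auto simp: scalar_prod_right_unit)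
  show "M $$ (i, j) = N $$ (i, j)" unfolding e[OF M] e[OF N] using eq[of "unit_vec n j"] by simp
qed (use M N in auto)

section \<open>Monomorphisms, epimorphisms, kernels, images and sums in terms of matrices\<close>

context matrix_model
begin

lemma mt_diff:
  assumes f: "f \<in> Hom C X Y" and g: "g \<in> Hom C X Y"
  shows "mt (diff_arr f g) = mt f - mt g"
proof -
  have s: "ScaleA C (-1) g \<in> Hom C X Y" using scale_hom[OF g g] .
  have "mt (diff_arr f g) = mt f + (-1) \<cdot>\<^sub>m mt g"
    unfolding diff_arr_def using mt_add[OF f s] mt_scale[OF g] by simp
  then show ?thesis using mt_carrier[OF f] mt_carrier[OF g] by (intro eq_matI) auto
qed

text \<open>The kernel arrow of a monomorphism is zero, so the projection \<open>1 - D' * D\<close>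
  onto the kernel vanishes. This turns categorical cancellation into injectivity of the
  matrix.\<close>

lemma mono_left_inverse:
  assumes f: "f \<in> Hom C X Y" and B: "B \<in> carrier_mat (d Y) r" and C: "D \<in> carrier_mat r (d X)"
    and B': "B' \<in> carrier_mat r (d Y)" and C': "D' \<in> carrier_mat (d X) r"
    and fBC: "mt f = B * D" and B'B: "B' * B = 1\<^sub>m r" and CC': "D * D' = 1\<^sub>m r"
    and mono: "mono_arr C f"
  shows "D' * D = 1\<^sub>m (d X)"
proof -
  obtain K k L where k: "k \<in> Hom C K X" and L: "L \<in> carrier_mat (d K) (d X)"
    and kL: "mt k * L = 1\<^sub>m (d X) - D' * D" and fk: "f \<cdot> k = ZeroA C K Y"
    using kernel_data[OF f B C B' C' fBC B'B CC'] by metis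
  have "k = ZeroA C K X" using mono_zeroD[OF mono f k fk] .
  then have "mt k = 0\<^sub>m (d X) (d K)" using mt_zero hom_obj[OF k] by simp
  then have "1\<^sub>m (d X) - D' * D = 0\<^sub>m (d X) (d X)" using kL L by simp
  then have "1\<^sub>m (d X) - D' * D + D' * D = D' * D" using C C' by simp
  moreover have "1\<^sub>m (d X) - D' * D + D' * D = 1\<^sub>m (d X)" using C C' by (intro eq_matI) auto
  ultimately show ?thesis by simp
qed

lemma epi_right_inverse:
  assumes f: "f \<in> Hom C X Y" and B: "B \<in> carrier_mat (d Y) r" and C: "D \<in> carrier_mat r (d X)"
    and B': "B' \<in> carrier_mat r (d Y)" and C': "D' \<in> carrier_mat (d X) r"
    and fBC: "mt f = B * D" and B'B: "B' * B = 1\<^sub>m r" and CC': "D * D' = 1\<^sub>m r"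
    and epi: "epi_arr C f"
  shows "B * B' = 1\<^sub>m (d Y)"
proof -
  obtain K k L where k: "k \<in> Hom C Y K" and L: "L \<in> carrier_mat (d Y) (d K)"
    and kL: "L * mt k = 1\<^sub>m (d Y) - B * B'" and fk: "k \<cdot> f = ZeroA C X K"
    using cokernel_data[OF f B C B' C' fBC B'B CC'] by metis
  have "k = ZeroA C Y K" using epi_zeroD[OF epi f k fk] .
  then have "mt k = 0\<^sub>m (d K) (d Y)" using mt_zero hom_obj[OF k] by simp
  then have "1\<^sub>m (d Y) - B * B' = 0\<^sub>m (d Y) (d Y)" using kL L by simp
  then have "1\<^sub>m (d Y) - B * B' + B * B' = B * B'" using B B' by simp
  moreover have "1\<^sub>m (d Y) - B * B' + B * B' = 1\<^sub>m (d Y)" using B B' by (intro eq_matI) auto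
  ultimately show ?thesis by simp
qed

lemma mono_inverse:
  assumes f: "f \<in> Hom C X Y" and mono: "mono_arr C f"
  obtains L where "L \<in> carrier_mat (d X) (d Y)" "L * mt f = 1\<^sub>m (d X)"
proof -
  obtain r B D B' D' where BC: "B \<in> carrier_mat (d Y) r" "D \<in> carrier_mat r (d X)"
    "B' \<in> carrier_mat r (d Y)" "D' \<in> carrier_mat (d X) r"
    "mt f = B * D" "B' * B = 1\<^sub>m r" "D * D' = 1\<^sub>m r"
    by (rule rank_factorization[OF mt_carrier[OF f]])
  have "(D' * B') * mt f = D' * ((B' * B) * D)"
    unfolding BC(5) using BC(1-4) by (simp add: mat_assoc)
  also have "\<dots> = 1\<^sub>m (d X)" unfolding BC(6) using mono_left_inverse[OF f BC mono] BC(2) by simp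
  finally show ?thesis using that[of "D' * B'"] BC(3,4) by simp
qed

lemma epi_inverse:
  assumes f: "f \<in> Hom C X Y" and epi: "epi_arr C f"
  obtains R where "R \<in> carrier_mat (d X) (d Y)" "mt f * R = 1\<^sub>m (d Y)"
proof -
  obtain r B D B' D' where BC: "B \<in> carrier_mat (d Y) r" "D \<in> carrier_mat r (d X)"
    "B' \<in> carrier_mat r (d Y)" "D' \<in> carrier_mat (d X) r"
    "mt f = B * D" "B' * B = 1\<^sub>m r" "D * D' = 1\<^sub>m r"
    by (rule rank_factorization[OF mt_carrier[OF f]])
  have "mt f * (D' * B') = B * ((D * D') * B')"
    unfolding BC(5) using BC(1-4) by (simp add: mat_assoc)
  also have "\<dots> = 1\<^sub>m (d Y)" unfolding BC(7) using epi_right_inverse[OF f BC epi] BC(3) by simp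
  finally show ?thesis using that[of "D' * B'"] BC(3,4) by simp
qed

text \<open>Factoring the identity through \<open>f\<close> shows that the inverse matrix is itself
  equivariant.\<close>

lemma inverse_iso:
  assumes f: "f \<in> Hom C X Y" and L: "L \<in> carrier_mat (d X) (d Y)"
    and Lf: "L * mt f = 1\<^sub>m (d X)" and fL: "mt f * L = 1\<^sub>m (d Y)"
  shows "iso_arr C f"
proof -
  have Y: "Y \<in> Obj C" using hom_obj[OF f] by simp
  have "mt f * (L * mt (Id C Y)) = mt (Id C Y)" using mt_id[OF Y] L fL by simp
  from factor_left[OF f L Lf id_hom[OF Y] this]
  obtain h where h: "h \<in> Hom C Y X" "f \<cdot> h = Id C Y" "mt h = L * mt (Id C Y)" by metis
  have "mt (h \<cdot> f) = mt (Id C X)"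
    using mt_cmp[OF f h(1)] h(3) mt_id[OF Y] mt_id[OF hom_obj(1)[OF f]] L Lf by simp
  then have "h \<cdot> f = Id C X"
    using mt_faithful[OF cmp_hom[OF f h(1)] id_hom[OF hom_obj(1)[OF f]]] by simp
  then show ?thesis using isoI[OF f h(1)] h(2) by simp
qed

text \<open>With equal dimensions the one-sided inverse matrix is two-sided.\<close>

lemma dim_mono:
  assumes f: "f \<in> Hom C X Y" and mono: "mono_arr C f"
  shows "d X \<le> d Y" "d X = d Y \<Longrightarrow> iso_arr C f"
proof -
  obtain L where L: "L \<in> carrier_mat (d X) (d Y)" "L * mt f = 1\<^sub>m (d X)" using mono_inverse[OF assms] .
  show "d X \<le> d Y" using left_inverse_dim_le[OF L(1) mt_carrier[OF f] L(2)] .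
  show "iso_arr C f" if eq: "d X = d Y"
    using inverse_iso[OF f L] mat_mult_left_right_inverse[of L "d X" "mt f"] L mt_carrier[OF f] eq by simp
qed

lemma dim_epi:
  assumes f: "f \<in> Hom C X Y" and epi: "epi_arr C f"
  shows "d Y \<le> d X" "d Y = d X \<Longrightarrow> iso_arr C f"
proof -
  obtain R where R: "R \<in> carrier_mat (d X) (d Y)" "mt f * R = 1\<^sub>m (d Y)" using epi_inverse[OF assms] .
  show "d Y \<le> d X" using left_inverse_dim_le[OF mt_carrier[OF f] R] .
  show "iso_arr C f" if eq: "d Y = d X"
    using inverse_iso[OF f R(1) _ R(2)] mat_mult_left_right_inverse[of "mt f" "d X" R] R mt_carrier[OF f] eq
      by simp
qed

text \<open>Kernel and normality are produced together, so that an epimorphism is recognised as the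
  cokernel of the very kernel chosen for it.\<close>

lemma kernel_exists:
  assumes f: "f \<in> Hom C X Y"
  shows "\<exists>K k. k \<in> Hom C K X \<and> mono_arr C k \<and> f \<cdot> k = ZeroA C K Y \<and>
      (\<forall>W. \<forall>g\<in>Hom C W X. f \<cdot> g = ZeroA C W Y \<longrightarrow> (\<exists>h\<in>Hom C W K. k \<cdot> h = g)) \<and>
      (epi_arr C f \<longrightarrow> (\<forall>W. \<forall>g\<in>Hom C X W. g \<cdot> k = ZeroA C K W \<longrightarrow> (\<exists>h\<in>Hom C Y W. h \<cdot> f = g)))"
proof -
  obtain r B D B' D' where BC: "B \<in> carrier_mat (d Y) r" "D \<in> carrier_mat r (d X)"
    "B' \<in> carrier_mat r (d Y)" "D' \<in> carrier_mat (d X) r"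
    "mt f = B * D" "B' * B = 1\<^sub>m r" "D * D' = 1\<^sub>m r"
    by (rule rank_factorization[OF mt_carrier[OF f]])
  obtain K k L where k: "k \<in> Hom C K X" and L: "L \<in> carrier_mat (d K) (d X)"
    and kL: "mt k * L = 1\<^sub>m (d X) - D' * D" and mono: "mono_arr C k" and fk: "f \<cdot> k = ZeroA C K Y"
    and univ: "\<And>W g. g \<in> Hom C W X \<Longrightarrow> f \<cdot> g = ZeroA C W Y \<Longrightarrow> \<exists>h\<in>Hom C W K. k \<cdot> h = g"
    using kernel_data[OF f BC] by metis
  have "\<exists>h\<in>Hom C Y W. h \<cdot> f = g"
    if epi: "epi_arr C f" and g: "g \<in> Hom C X W" and gk: "g \<cdot> k = ZeroA C K W" for W g
  proof -
    have cg: "mt g \<in> carrier_mat (d W) (d X)" using mt_carrier[OF g] .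
    let ?R = "D' * B'"
    have R: "?R \<in> carrier_mat (d X) (d Y)" using BC by simp
    have "mt f * ?R = B * ((D * D') * B')"
      unfolding BC(5) using BC(1-4) by (simp add: mat_assoc)
    then have fR: "mt f * ?R = 1\<^sub>m (d Y)" unfolding BC(7) using epi_right_inverse[OF f BC epi] BC(3) by simp
    \<comment> \<open>Since \<open>g\<close> kills the kernel, it kills the projection
      \<open>1 - D' * D\<close>, so \<open>mt g\<close> factors through \<open>D\<close>. The matrix
      of \<open>f\<close> is \<open>B * D\<close> with \<open>B\<close> cancellable, so
      \<open>mt g\<close> also factors through \<open>mt f\<close>, by means of
      \<open>?R\<close>.\<close>
    have "mt g * mt k = 0\<^sub>m (d W) (d K)" using mt_cmp[OF k g] gk mt_zero hom_obj[OF k] hom_obj[OF g] by simp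
    then have "(mt g * mt k) * L = 0\<^sub>m (d W) (d X)" using L by simp
    then have "mt g * (mt k * L) = 0\<^sub>m (d W) (d X)"
      using cg L mt_carrier[OF k] by (simp add: mat_assoc)
    then have z: "mt g - (mt g * D') * D = 0\<^sub>m (d W) (d X)"
      unfolding kL compl_mult_right[OF BC(4,2) cg] .
    have "mt g = (mt g - (mt g * D') * D) + (mt g * D') * D"
      using cg BC(2,4) by (intro eq_matI) auto
    then have e: "mt g = (mt g * D') * D" unfolding z using cg BC(2,4) by simp
    have "(mt g * ?R) * mt f = (mt g * D') * ((B' * B) * D)"
      unfolding BC(5) using cg BC(1-4) by (simp add: mat_assoc)
    also have "\<dots> = mt g" unfolding BC(6) using e BC(2) by simp
    finally show ?thesis using factor_right[OF f R fR g] by blast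
  qed
  note e = this
  show ?thesis
    by (intro exI conjI allI ballI impI, rule k, rule mono, rule fk, erule (1) univ, erule (2) e)
qed

lemma cokernel_exists:
  assumes f: "f \<in> Hom C X Y"
  shows "\<exists>Q c. c \<in> Hom C Y Q \<and> epi_arr C c \<and> c \<cdot> f = ZeroA C X Q \<and>
      (\<forall>W. \<forall>g\<in>Hom C Y W. g \<cdot> f = ZeroA C X W \<longrightarrow> (\<exists>h\<in>Hom C Q W. h \<cdot> c = g)) \<and>
      (mono_arr C f \<longrightarrow> (\<forall>W. \<forall>g\<in>Hom C W Y. c \<cdot> g = ZeroA C W Q \<longrightarrow> (\<exists>h\<in>Hom C W X. f \<cdot> h = g)))"
proof -
  obtain r B D B' D' where BC: "B \<in> carrier_mat (d Y) r" "D \<in> carrier_mat r (d X)"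
    "B' \<in> carrier_mat r (d Y)" "D' \<in> carrier_mat (d X) r"
    "mt f = B * D" "B' * B = 1\<^sub>m r" "D * D' = 1\<^sub>m r"
    by (rule rank_factorization[OF mt_carrier[OF f]])
  obtain Q c R where c: "c \<in> Hom C Y Q" and R: "R \<in> carrier_mat (d Y) (d Q)"
    and Rc: "R * mt c = 1\<^sub>m (d Y) - B * B'" and epi: "epi_arr C c" and cf: "c \<cdot> f = ZeroA C X Q"
    and univ: "\<And>W g. g \<in> Hom C Y W \<Longrightarrow> g \<cdot> f = ZeroA C X W \<Longrightarrow> \<exists>h\<in>Hom C Q W. h \<cdot> c = g"
    using cokernel_data[OF f BC] by metis
  have "\<exists>h\<in>Hom C W X. f \<cdot> h = g"
    if mono: "mono_arr C f" and g: "g \<in> Hom C W Y" and gc: "c \<cdot> g = ZeroA C W Q" for W g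
  proof -
    have cg: "mt g \<in> carrier_mat (d Y) (d W)" using mt_carrier[OF g] .
    let ?L = "D' * B'"
    have L: "?L \<in> carrier_mat (d X) (d Y)" using BC by simp
    have "?L * mt f = D' * ((B' * B) * D)"
      unfolding BC(5) using BC(1-4) by (simp add: mat_assoc)
    then have Lf: "?L * mt f = 1\<^sub>m (d X)" unfolding BC(6) using mono_left_inverse[OF f BC mono] BC(2) by simp
    have "mt c * mt g = 0\<^sub>m (d Q) (d W)" using mt_cmp[OF g c] gc mt_zero hom_obj[OF c] hom_obj[OF g] by simp
    then have "R * (mt c * mt g) = 0\<^sub>m (d Y) (d W)" using R by simp
    then have "(R * mt c) * mt g = 0\<^sub>m (d Y) (d W)"
      using cg R mt_carrier[OF c] by (simp add: mat_assoc)
    then have z: "mt g - B * (B' * mt g) = 0\<^sub>m (d Y) (d W)"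
      unfolding Rc compl_mult_left[OF BC(1,3) cg] .
    have "mt g = (mt g - B * (B' * mt g)) + B * (B' * mt g)"
      using cg BC(1,3) by (intro eq_matI) auto
    then have e: "mt g = B * (B' * mt g)" unfolding z using cg BC(1,3) by simp
    have "mt f * (?L * mt g) = B * ((D * D') * (B' * mt g))"
      unfolding BC(5) using cg BC(1-4) by (simp add: mat_assoc)
    also have "\<dots> = mt g" unfolding BC(7) using e BC(3) cg by simp
    finally show ?thesis using factor_left[OF f L Lf g] by blast
  qed
  note e = this
  show ?thesis
    by (intro exI conjI allI ballI impI, rule c, rule epi, rule cf, erule (1) univ, erule (2) e)
qed

text \<open>The image is the column space of \<open>B\<close>, realised as a subobject; the
  remaining factor \<open>e\<close> is an epimorphism because it has the linear right inverse
  \<open>D' * (B' * mt m)\<close>.\<close>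

lemma image_exists:
  assumes f: "f \<in> Hom C X Y"
  obtains I e m where "e \<in> Hom C X I" "epi_arr C e" "m \<in> Hom C I Y" "mono_arr C m" "m \<cdot> e = f"
proof -
  have X: "X \<in> Obj C" and Y: "Y \<in> Obj C" using hom_obj[OF f] by auto
  obtain r B D B' D' where BC: "B \<in> carrier_mat (d Y) r" "D \<in> carrier_mat r (d X)"
    "B' \<in> carrier_mat r (d Y)" "D' \<in> carrier_mat (d X) r"
    "mt f = B * D" "B' * B = 1\<^sub>m r" "D * D' = 1\<^sub>m r"
    by (rule rank_factorization[OF mt_carrier[OF f]])
  have "B * (B' * (rho Y a * B)) = rho Y a * B" if a: "a \<in> carrier A" for a
  proof -
    note c = mt_carrier[OF f] rho_carrier[OF X a] rho_carrier[OF Y a] BC(1-4)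
    \<comment> \<open>Since \<open>B = mt f * D'\<close>, the columns of \<open>B\<close> are values
      of \<open>f\<close>, and equivariance of \<open>f\<close> keeps them in the image.\<close>
    have "rho Y a * B = rho Y a * (B * (D * D'))" unfolding BC(7) using c by simp
    also have "\<dots> = (rho Y a * mt f) * D'" unfolding BC(5) using c by (simp add: mat_assoc)
    also have "\<dots> = (mt f * rho X a) * D'" unfolding mt_rho[OF f a] ..
    also have "\<dots> = B * (D * (rho X a * D'))" unfolding BC(5) using c by (simp add: mat_assoc)
    finally have e: "rho Y a * B = B * (D * (rho X a * D'))" .
    have "B * (B' * (rho Y a * B)) = B * ((B' * B) * (D * (rho X a * D')))"
      unfolding e using c by (simp add: mat_assoc)
    also have "\<dots> = rho Y a * B" unfolding BC(6) e using c by simp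
    finally show ?thesis .
  qed
  then obtain I m L where m: "m \<in> Hom C I Y" and L: "L \<in> carrier_mat (d I) (d Y)" "L * mt m = 1\<^sub>m (d I)"
    and mL: "mt m * L = B * B'" and mono: "mono_arr C m"
    using sub_realize[OF Y BC(1,3,6)] by metis
  note c = mt_carrier[OF f] mt_carrier[OF m] L(1) BC(1-4)
  have "mt m * (L * mt f) = (mt m * L) * mt f" using c by (simp add: mat_assoc)
  also have "\<dots> = B * ((B' * B) * D)" unfolding mL BC(5) using c by (simp add: mat_assoc)
  also have "\<dots> = mt f" unfolding BC(6) BC(5) using c by simp
  finally obtain e where e: "e \<in> Hom C X I" "m \<cdot> e = f" "mt e = L * mt f"
    using factor_left[OF m L f] by metis
  have "mt e * (D' * (B' * mt m)) = L * ((B * (D * D')) * (B' * mt m))"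
    unfolding e(3) BC(5) using c by (simp add: mat_assoc)
  also have "\<dots> = L * ((mt m * L) * mt m)" unfolding BC(7) mL using c by (simp add: mat_assoc)
  also have "\<dots> = (L * mt m) * (L * mt m)" using c by (simp add: mat_assoc)
  also have "\<dots> = 1\<^sub>m (d I)" unfolding L(2) by simp
  finally have "epi_arr C e"
    using c by (intro right_inverse_epi[OF e(1), of "D' * (B' * mt m)"]) auto
  then show ?thesis using that e m mono by blast
qed

lemma zero_exists: "\<exists>Z. zero_object C Z"
proof -
  have "is_fdmod A (0, \<lambda>_. 0\<^sub>m 0 0)" unfolding is_fdmod_def by (auto intro!: eq_matI)
  from mt_ess[OF this] obtain Z and S S' :: "'k mat" where Z: "Z \<in> Obj C" "S \<in> carrier_mat 0 (d Z)"
    "S' \<in> carrier_mat (d Z) 0" "S' * S = 1\<^sub>m (d Z)" by blast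
  have "d Z = 0" using left_inverse_dim_le[OF Z(3,2,4)] by simp
  then have "mt (Id C Z) = mt (ZeroA C Z Z)" using mt_id[OF Z(1)] mt_zero[OF Z(1,1)]
    by (simp add: mat_eq_iff)
  then have "Id C Z = ZeroA C Z Z" using mt_faithful[OF id_hom zero_hom] Z(1) by simp
  then show ?thesis using zero_object_iff Z(1) by blast
qed

text \<open>The action is block diagonal, written with inclusions and projections so that every
  module law follows from the biproduct equations. The arrows \<open>i\<close>, \<open>j\<close>,
  \<open>p\<close>, \<open>q\<close> are then transported to an object of \<open>C\<close> along
  \<open>S\<close> and \<open>S'\<close>.\<close>

lemma direct_sum_exists:
  assumes X: "X \<in> Obj C" and Y: "Y \<in> Obj C"
  obtains Z where "is_direct_sum C X Y Z"
proof -
  define a b where "a = d X" and "b = d Y"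
  obtain i1 i2 p1 p2 :: "'k mat" where c: "i1 \<in> carrier_mat (a + b) a" "i2 \<in> carrier_mat (a + b) b"
    "p1 \<in> carrier_mat a (a + b)" "p2 \<in> carrier_mat b (a + b)"
    and eq: "p1 * i1 = 1\<^sub>m a" "p2 * i2 = 1\<^sub>m b" "p1 * i2 = 0\<^sub>m a b" "p2 * i1 = 0\<^sub>m b a"
    and sum: "i1 * p1 + i2 * p2 = 1\<^sub>m (a + b)" by (rule block_injections)
  define r where "r v = i1 * (rho X v * p1) + i2 * (rho Y v * p2)" for v
  have rX: "rho X v \<in> carrier_mat a a" and rY: "rho Y v \<in> carrier_mat b b" if "v \<in> carrier A" for v
    using rho_carrier[OF X that] rho_carrier[OF Y that] by (auto simp: a_def b_def)
  have c1: "i1 * (G * p1) \<in> carrier_mat (a + b) (a + b)" if "G \<in> carrier_mat a a" for G using c that by simp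
  have c2: "i2 * (G * p2) \<in> carrier_mat (a + b) (a + b)" if "G \<in> carrier_mat b b" for G using c that by simp
  have rc: "r v \<in> carrier_mat (a + b) (a + b)" if v: "v \<in> carrier A" for v
    unfolding r_def using c1[OF rX[OF v]] c2[OF rY[OF v]] by simp
  have ri1: "r v * i1 = i1 * rho X v" if v: "v \<in> carrier A" for v
  proof -
    have "r v * i1 = i1 * (rho X v * (p1 * i1)) + i2 * (rho Y v * (p2 * i1))"
      unfolding r_def add_mult_distrib_mat[OF c1[OF rX[OF v]] c2[OF rY[OF v]] c(1)]
      using c rX[OF v] rY[OF v] by (simp add: mat_assoc)
    then show ?thesis unfolding eq using c rX[OF v] rY[OF v] by simp
  qed
  have ri2: "r v * i2 = i2 * rho Y v" if v: "v \<in> carrier A" for v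
  proof -
    have "r v * i2 = i1 * (rho X v * (p1 * i2)) + i2 * (rho Y v * (p2 * i2))"
      unfolding r_def add_mult_distrib_mat[OF c1[OF rX[OF v]] c2[OF rY[OF v]] c(2)]
      using c rX[OF v] rY[OF v] by (simp add: mat_assoc)
    then show ?thesis unfolding eq using c rX[OF v] rY[OF v] by simp
  qed
  have pr1: "p1 * r v = rho X v * p1" if v: "v \<in> carrier A" for v
  proof -
    have "p1 * r v = (p1 * i1) * (rho X v * p1) + (p1 * i2) * (rho Y v * p2)"
      unfolding r_def mult_add_distrib_mat[OF c(3) c1[OF rX[OF v]] c2[OF rY[OF v]]]
      using c rX[OF v] rY[OF v] by (simp add: mat_assoc)
    then show ?thesis unfolding eq using c rX[OF v] rY[OF v] by simp
  qed
  have pr2: "p2 * r v = rho Y v * p2" if v: "v \<in> carrier A" for v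
  proof -
    have "p2 * r v = (p2 * i1) * (rho X v * p1) + (p2 * i2) * (rho Y v * p2)"
      unfolding r_def mult_add_distrib_mat[OF c(4) c1[OF rX[OF v]] c2[OF rY[OF v]]]
      using c rX[OF v] rY[OF v] by (simp add: mat_assoc)
    then show ?thesis unfolding eq using c rX[OF v] rY[OF v] by simp
  qed
  have mX: "is_fdmod A (a, rho X)" and mY: "is_fdmod A (b, rho Y)"
    using rho_mod X Y by (auto simp: a_def b_def)
  have "is_fdmod A (a + b, r)"
    unfolding is_fdmod_def prod.case
  proof (intro conjI ballI allI)
    fix u assume u: "u \<in> carrier A"
    show "r u \<in> carrier_mat (a + b) (a + b)" using rc[OF u] .
    show "r (s \<odot>\<^bsub>A\<^esub> u) = s \<cdot>\<^sub>m r u" for s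
    proof -
      have "rho X (s \<odot>\<^bsub>A\<^esub> u) = s \<cdot>\<^sub>m rho X u" "rho Y (s \<odot>\<^bsub>A\<^esub> u) = s \<cdot>\<^sub>m rho Y u"
        using mX mY u by (auto simp: is_fdmod_def)
      then show ?thesis unfolding r_def
        using mult_smult_assoc_mat[OF rX[OF u] c(3), of s] mult_smult_assoc_mat[OF rY[OF u] c(4), of s]
          mult_smult_distrib[OF c(1) mult_carrier_mat[OF rX[OF u] c(3)], of s]
          mult_smult_distrib[OF c(2) mult_carrier_mat[OF rY[OF u] c(4)], of s]
          add_smult_distrib_left_mat[OF c1[OF rX[OF u]] c2[OF rY[OF u]], of s] by simp
    qed
    fix v assume v: "v \<in> carrier A"
    show "r (u \<oplus>\<^bsub>A\<^esub> v) = r u + r v"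
    proof -
      have "rho X (u \<oplus>\<^bsub>A\<^esub> v) = rho X u + rho X v"
        "rho Y (u \<oplus>\<^bsub>A\<^esub> v) = rho Y u + rho Y v"
        using mX mY u v by (auto simp: is_fdmod_def)
      then have "r (u \<oplus>\<^bsub>A\<^esub> v) = (i1 * (rho X u * p1) + i1 * (rho X v * p1)) + (i2 * (rho Y u * p2) + i2 * (rho Y v * p2))"
        unfolding r_def
        using add_mult_distrib_mat[OF rX[OF u] rX[OF v] c(3)] add_mult_distrib_mat[OF rY[OF u] rY[OF v] c(4)]
          mult_add_distrib_mat[OF c(1) mult_carrier_mat[OF rX[OF u] c(3)] mult_carrier_mat[OF rX[OF v] c(3)]]
          mult_add_distrib_mat[OF c(2) mult_carrier_mat[OF rY[OF u] c(4)] mult_carrier_mat[OF rY[OF v] c(4)]]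
        by simp
      then show ?thesis unfolding r_def
        using c1[OF rX[OF u]] c1[OF rX[OF v]] c2[OF rY[OF u]] c2[OF rY[OF v]]
        by (intro eq_matI) auto
    qed
    show "r (u \<otimes>\<^bsub>A\<^esub> v) = r u * r v"
    proof -
      have e: "rho X (u \<otimes>\<^bsub>A\<^esub> v) = rho X u * rho X v"
        "rho Y (u \<otimes>\<^bsub>A\<^esub> v) = rho Y u * rho Y v"
        using mX mY u v by (auto simp: is_fdmod_def)
      have "r u * r v = r u * (i1 * (rho X v * p1)) + r u * (i2 * (rho Y v * p2))"
        unfolding r_def[of v] by (rule mult_add_distrib_mat[OF rc[OF u] c1[OF rX[OF v]] c2[OF rY[OF v]]])
      also have "\<dots> = (r u * i1) * (rho X v * p1) + (r u * i2) * (rho Y v * p2)"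
        using c rX[OF v] rY[OF v] rc[OF u] by (simp add: mat_assoc)
      also have "\<dots> = r (u \<otimes>\<^bsub>A\<^esub> v)"
        unfolding ri1[OF u] ri2[OF u] r_def[of "u \<otimes>\<^bsub>A\<^esub> v"] e
        using c rX[OF v] rY[OF v] rX[OF u] rY[OF u] by (simp add: mat_assoc)
      finally show ?thesis by simp
    qed
  next
    have "rho X \<one>\<^bsub>A\<^esub> = 1\<^sub>m a" "rho Y \<one>\<^bsub>A\<^esub> = 1\<^sub>m b"
      using mX mY by (auto simp: is_fdmod_def)
    then show "r \<one>\<^bsub>A\<^esub> = 1\<^sub>m (a + b)" unfolding r_def using sum c by simp
  qed
  from mt_ess[OF this] obtain Z S S' where Z: "Z \<in> Obj C" and S: "S \<in> carrier_mat (a + b) (d Z)"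
    and S': "S' \<in> carrier_mat (d Z) (a + b)" and SS': "S * S' = 1\<^sub>m (a + b)" "S' * S = 1\<^sub>m (d Z)"
    and SZ: "\<And>v. v \<in> carrier A \<Longrightarrow> S * rho Z v = r v * S" by blast
  have S'r: "S' * r v = rho Z v * S'" if v: "v \<in> carrier A" for v
  proof -
    note cz = rho_carrier[OF Z v] S S' rc[OF v]
    have "rho Z v * S' = (S' * S) * (rho Z v * S')" unfolding SS' using cz by simp
    also have "\<dots> = S' * ((S * rho Z v) * S')" using cz by (simp add: mat_assoc)
    also have "\<dots> = (S' * r v) * (S * S')" unfolding SZ[OF v] using cz by (simp add: mat_assoc)
    also have "\<dots> = S' * r v" unfolding SS' using cz by simp
    finally show ?thesis by simp
  qed
  have inj: "\<exists>g\<in>Hom C W Z. mt g = S' * G"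
    if W: "W \<in> Obj C" and G: "G \<in> carrier_mat (a + b) (d W)"
      and rG: "\<And>v. v \<in> carrier A \<Longrightarrow> r v * G = G * rho W v" for W G
  proof (rule mt_full[OF W Z])
    show "S' * G \<in> carrier_mat (d Z) (d W)" using S' G by simp
    fix v assume v: "v \<in> carrier A"
    note cz = rho_carrier[OF Z v] rho_carrier[OF W v] S' rc[OF v] G
    have "(S' * G) * rho W v = S' * (G * rho W v)" using cz by (simp add: mat_assoc)
    also have "\<dots> = (S' * r v) * G" unfolding rG[OF v, symmetric] using cz by (simp add: mat_assoc)
    finally show "(S' * G) * rho W v = rho Z v * (S' * G)"
      unfolding S'r[OF v] using cz by (simp add: mat_assoc)
  qed
  have proj: "\<exists>g\<in>Hom C Z W. mt g = G * S"
    if W: "W \<in> Obj C" and G: "G \<in> carrier_mat (d W) (a + b)"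
      and rG: "\<And>v. v \<in> carrier A \<Longrightarrow> G * r v = rho W v * G" for W G
  proof (rule mt_full[OF Z W])
    show "G * S \<in> carrier_mat (d W) (d Z)" using S G by simp
    fix v assume v: "v \<in> carrier A"
    note cz = rho_carrier[OF Z v] rho_carrier[OF W v] S rc[OF v] G
    have "(G * S) * rho Z v = G * (S * rho Z v)" using cz by (simp add: mat_assoc)
    also have "\<dots> = (G * r v) * S" unfolding SZ[OF v] using cz by (simp add: mat_assoc)
    finally show "(G * S) * rho Z v = rho W v * (G * S)"
      unfolding rG[OF v] using cz by (simp add: mat_assoc)
  qed
  obtain i where i: "i \<in> Hom C X Z" "mt i = S' * i1" using inj[OF X _ ri1] c(1) a_def by blast
  obtain j where j: "j \<in> Hom C Y Z" "mt j = S' * i2" using inj[OF Y _ ri2] c(2) b_def by blast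
  obtain p where p: "p \<in> Hom C Z X" "mt p = p1 * S" using proj[OF X _ pr1] c(3) a_def by blast
  obtain q where q: "q \<in> Hom C Z Y" "mt q = p2 * S" using proj[OF Y _ pr2] c(4) b_def by blast
  have core: "(G * S) * (S' * H) = G * H" if "G \<in> carrier_mat k (a + b)" "H \<in> carrier_mat (a + b) l"
    for G H k l
  proof -
    have "(G * S) * (S' * H) = G * ((S * S') * H)"
      using that S S' by (simp add: mat_assoc)
    then show ?thesis unfolding SS' using that by simp
  qed
  have "p \<cdot> i = Id C X"
    using mt_faithful[OF cmp_hom[OF i(1) p(1)] id_hom[OF X]] mt_cmp[OF i(1) p(1)] core[OF c(3) c(1)] eq
    by (simp add: i p mt_id[OF X] a_def)
  moreover have "q \<cdot> j = Id C Y"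
    using mt_faithful[OF cmp_hom[OF j(1) q(1)] id_hom[OF Y]] mt_cmp[OF j(1) q(1)] core[OF c(4) c(2)] eq
    by (simp add: j q mt_id[OF Y] b_def)
  moreover have "p \<cdot> j = ZeroA C Y X"
    using mt_faithful[OF cmp_hom[OF j(1) p(1)] zero_hom[OF Y X]] mt_cmp[OF j(1) p(1)] core[OF c(3) c(2)] eq
    by (simp add: j p mt_zero[OF Y X] a_def b_def)
  moreover have "q \<cdot> i = ZeroA C X Y"
    using mt_faithful[OF cmp_hom[OF i(1) q(1)] zero_hom[OF X Y]] mt_cmp[OF i(1) q(1)] core[OF c(4) c(1)] eq
    by (simp add: i q mt_zero[OF X Y] a_def b_def)
  moreover have "AddA C (i \<cdot> p) (j \<cdot> q) = Id C Z"
  proof (rule mt_faithful)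
    show "AddA C (i \<cdot> p) (j \<cdot> q) \<in> Hom C Z Z" using add_hom cmp_hom i(1) j(1) p(1) q(1) by blast
    show "Id C Z \<in> Hom C Z Z" using id_hom[OF Z] .
    have "mt (AddA C (i \<cdot> p) (j \<cdot> q)) = (S' * i1) * (p1 * S) + (S' * i2) * (p2 * S)"
      using mt_add[OF cmp_hom[OF p(1) i(1)] cmp_hom[OF q(1) j(1)]] mt_cmp[OF p(1) i(1)] mt_cmp[OF q(1) j(1)]
      by (simp add: i j p q)
    also have "\<dots> = S' * ((i1 * p1) * S) + S' * ((i2 * p2) * S)"
      using c S S' by (simp add: mat_assoc)
    also have "\<dots> = S' * ((i1 * p1) * S + (i2 * p2) * S)"
      using mult_add_distrib_mat[OF S', of "(i1 * p1) * S" "d Z" "(i2 * p2) * S"] c S by simp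
    also have "(i1 * p1) * S + (i2 * p2) * S = (i1 * p1 + i2 * p2) * S"
      using add_mult_distrib_mat[of "i1 * p1" "a + b" "a + b" "i2 * p2" S "d Z"] c S by simp
    also have "S' * ((i1 * p1 + i2 * p2) * S) = mt (Id C Z)" unfolding sum using S SS' mt_id[OF Z] by simp
    finally show "mt (AddA C (i \<cdot> p) (j \<cdot> q)) = mt (Id C Z)" .
  qed
  ultimately show ?thesis using that X Y Z i(1) j(1) p(1) q(1) unfolding is_direct_sum_def by blast
qed

end

lemma smult_mat_mult_vec:
  fixes M :: "'k::field mat"
  assumes "M \<in> carrier_mat m n" "x \<in> carrier_vec n"
  shows "(s \<cdot>\<^sub>m M) *\<^sub>v x = s \<cdot>\<^sub>v (M *\<^sub>v x)"
  using assms by (intro eq_vecI) (auto simp: scalar_prod_def sum_distrib_left mult.assoc)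

section \<open>The regular module and enough projectives\<close>

context matrix_model
begin

lemma nonzero_dim:
  assumes X: "X \<in> Obj C" and nz: "\<not> zero_object C X"
  shows "0 < d X"
proof (rule ccontr)
  assume "\<not> 0 < d X"
  then have "mt (Id C X) = mt (ZeroA C X X)" using mt_id[OF X] mt_zero[OF X X] by (simp add: mat_eq_iff)
  then have "Id C X = ZeroA C X X" using mt_faithful[OF id_hom zero_hom] X by simp
  then show False using zero_object_iff X nz by blast
qed

definition regular_rep :: "'k vec \<Rightarrow> 'k mat" where
  "regular_rep v = matrix_of_map n n (\<lambda>x. v \<otimes>\<^bsub>A\<^esub> x)"

text \<open>The module map from the regular module that sends the unit to \<open>x\<close>.\<close>

definition orbit_map :: "'o \<Rightarrow> 'k vec \<Rightarrow> 'k mat" where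
  "orbit_map X x = matrix_of_map (d X) n (\<lambda>v. rho X v *\<^sub>v x)"

lemma A_carrier: "carrier A = carrier_vec n"
  using alg by (simp add: fd_algebra_def)

lemma A_add: "u \<oplus>\<^bsub>A\<^esub> v = u + v"
  using alg by (simp add: fd_algebra_def)

lemma A_smult_eq: "s \<odot>\<^bsub>A\<^esub> v = s \<cdot>\<^sub>v v"
  using alg by (simp add: fd_algebra_def)

lemma A_mult: "u \<in> carrier_vec n \<Longrightarrow> v \<in> carrier_vec n \<Longrightarrow> u \<otimes>\<^bsub>A\<^esub> v \<in> carrier_vec n"
  using ring.ring_simprules(5)[OF A_ring, of u v] by (simp add: A_carrier)

lemma A_one: "\<one>\<^bsub>A\<^esub> \<in> carrier_vec n"
  using ring.ring_simprules(6)[OF A_ring] by (simp add: A_carrier)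

lemma regular_rep_apply:
  assumes u: "u \<in> carrier_vec n" and v: "v \<in> carrier_vec n"
  shows "regular_rep u *\<^sub>v v = u \<otimes>\<^bsub>A\<^esub> v"
  unfolding regular_rep_def
proof (rule matrix_of_map_apply[OF _ _ _ v])
  interpret ring A by (rule A_ring)
  show "u \<otimes>\<^bsub>A\<^esub> x \<in> carrier_vec n" if "x \<in> carrier_vec n" for x using A_mult u that .
  show "u \<otimes>\<^bsub>A\<^esub> (x + y) = u \<otimes>\<^bsub>A\<^esub> x + u \<otimes>\<^bsub>A\<^esub> y"
    if "x \<in> carrier_vec n" "y \<in> carrier_vec n" for x y
    using r_distr[of x y u] that u by (simp add: A_carrier A_add)
  show "u \<otimes>\<^bsub>A\<^esub> (s \<cdot>\<^sub>v x) = s \<cdot>\<^sub>v (u \<otimes>\<^bsub>A\<^esub> x)" if "x \<in> carrier_vec n" for s x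
    using alg that u unfolding fd_algebra_def by (metis A_smult_eq)
qed

lemma regular_rep_carrier: "regular_rep u \<in> carrier_mat n n"
  by (simp add: regular_rep_def matrix_of_map_carrier)

lemma orbit_map_carrier: "orbit_map X x \<in> carrier_mat (d X) n"
  by (simp add: orbit_map_def matrix_of_map_carrier)

lemma orbit_map_apply:
  assumes X: "X \<in> Obj C" and x: "x \<in> carrier_vec (d X)" and v: "v \<in> carrier_vec n"
  shows "orbit_map X x *\<^sub>v v = rho X v *\<^sub>v x"
  unfolding orbit_map_def
proof (rule matrix_of_map_apply[OF _ _ _ v])
  have c: "rho X u \<in> carrier_mat (d X) (d X)" if "u \<in> carrier_vec n" for u
    using rho_carrier[OF X] that by (simp add: A_carrier)
  show "rho X u *\<^sub>v x \<in> carrier_vec (d X)" if "u \<in> carrier_vec n" for u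
    using c[OF that] x by simp
  show "rho X (u + w) *\<^sub>v x = rho X u *\<^sub>v x + rho X w *\<^sub>v x"
    if "u \<in> carrier_vec n" "w \<in> carrier_vec n" for u w
    using rho_mod[OF X] that add_mult_distrib_mat_vec[OF c c x] by (simp add: is_fdmod_def A_carrier A_add)
  show "rho X (s \<cdot>\<^sub>v u) *\<^sub>v x = s \<cdot>\<^sub>v (rho X u *\<^sub>v x)" if u: "u \<in> carrier_vec n" for s u
  proof -
    have "rho X (s \<cdot>\<^sub>v u) = s \<cdot>\<^sub>m rho X u"
      using rho_mod[OF X] u by (auto simp: is_fdmod_def A_carrier A_smult_eq)
    then show ?thesis using smult_mat_mult_vec[OF c[OF u] x, of s] by simp
  qed
qed

lemma regular_rep_mod: "is_fdmod A (n, regular_rep)"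
  unfolding is_fdmod_def prod.case
proof (intro conjI ballI allI)
  interpret ring A by (rule A_ring)
  fix u assume "u \<in> carrier A"
  then have u: "u \<in> carrier_vec n" by (simp add: A_carrier)
  show "regular_rep u \<in> carrier_mat n n" by (rule regular_rep_carrier)
  show "regular_rep (s \<odot>\<^bsub>A\<^esub> u) = s \<cdot>\<^sub>m regular_rep u" for s
  proof (rule mat_eq_on_vecs[of _ n n])
    fix x :: "'k vec" assume x: "x \<in> carrier_vec n"
    have "(s \<odot>\<^bsub>A\<^esub> u) \<otimes>\<^bsub>A\<^esub> x = s \<odot>\<^bsub>A\<^esub> (u \<otimes>\<^bsub>A\<^esub> x)"
      using alg u x unfolding fd_algebra_def by metis
    then show "regular_rep (s \<odot>\<^bsub>A\<^esub> u) *\<^sub>v x = (s \<cdot>\<^sub>m regular_rep u) *\<^sub>v x"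
      using regular_rep_apply[OF u x] regular_rep_apply[of "s \<odot>\<^bsub>A\<^esub> u" x] u x
        smult_mat_mult_vec[OF regular_rep_carrier x, of s u] by (simp add: A_smult_eq)
  qed (use regular_rep_carrier in auto)
  fix v assume "v \<in> carrier A"
  then have v: "v \<in> carrier_vec n" by (simp add: A_carrier)
  show "regular_rep (u \<oplus>\<^bsub>A\<^esub> v) = regular_rep u + regular_rep v"
  proof (rule mat_eq_on_vecs[of _ n n])
    fix x :: "'k vec" assume x: "x \<in> carrier_vec n"
    show "regular_rep (u \<oplus>\<^bsub>A\<^esub> v) *\<^sub>v x = (regular_rep u + regular_rep v) *\<^sub>v x"
      using regular_rep_apply[OF u x] regular_rep_apply[OF v x] regular_rep_apply[of
        "u + v" x] u v x l_distr[of u v x]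
        add_mult_distrib_mat_vec[OF regular_rep_carrier regular_rep_carrier x, of u v]
          by (simp add: A_add A_carrier)
  qed (use regular_rep_carrier in auto)
  show "regular_rep (u \<otimes>\<^bsub>A\<^esub> v) = regular_rep u * regular_rep v"
  proof (rule mat_eq_on_vecs[of _ n n])
    fix x :: "'k vec" assume x: "x \<in> carrier_vec n"
    show "regular_rep (u \<otimes>\<^bsub>A\<^esub> v) *\<^sub>v x = (regular_rep u * regular_rep v) *\<^sub>v x"
      using regular_rep_apply[OF u A_mult[OF v x]] regular_rep_apply[OF v x] regular_rep_apply[OF A_mult[OF u v] x] u v x
        m_assoc[of u v x] assoc_mult_mat_vec[OF regular_rep_carrier regular_rep_carrier x, of u v]
      by (simp add: A_carrier)
  qed (use mult_carrier_mat[OF regular_rep_carrier regular_rep_carrier] regular_rep_carrier in auto)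
next
  interpret ring A by (rule A_ring)
  show "regular_rep \<one>\<^bsub>A\<^esub> = 1\<^sub>m n"
  proof (rule mat_eq_on_vecs[of _ n n])
    fix x :: "'k vec" assume x: "x \<in> carrier_vec n"
    show "regular_rep \<one>\<^bsub>A\<^esub> *\<^sub>v x = 1\<^sub>m n *\<^sub>v x"
      using regular_rep_apply[OF A_one x] x l_one[of x] by (simp add: A_carrier)
  qed (use regular_rep_carrier in auto)
qed

lemma orbit_map_equivariant:
  assumes X: "X \<in> Obj C" and x: "x \<in> carrier_vec (d X)" and u: "u \<in> carrier_vec n"
  shows "orbit_map X x * regular_rep u = rho X u * orbit_map X x"
proof (rule mat_eq_on_vecs[of _ "d X" n])
  fix v :: "'k vec" assume v: "v \<in> carrier_vec n"
  have c: "rho X w \<in> carrier_mat (d X) (d X)" if "w \<in> carrier_vec n" for w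
    using rho_carrier[OF X] that by (simp add: A_carrier)
  have "rho X (u \<otimes>\<^bsub>A\<^esub> v) = rho X u * rho X v"
    using rho_mod[OF X] u v by (simp add: is_fdmod_def A_carrier)
  then show "orbit_map X x * regular_rep u *\<^sub>v v = rho X u * orbit_map X x *\<^sub>v v"
    using assoc_mult_mat_vec[OF orbit_map_carrier regular_rep_carrier v, of X x u] regular_rep_apply[OF u v]
      orbit_map_apply[OF X x A_mult[OF u v]] assoc_mult_mat_vec[OF c[OF u] c[OF v] x]
      assoc_mult_mat_vec[OF c[OF u] orbit_map_carrier v, of x] orbit_map_apply[OF X x v] by simp
qed (use X x u orbit_map_carrier regular_rep_carrier rho_carrier[OF X] in \<open>auto simp: A_carrier intro!: mult_carrier_mat orbit_map_carrier regular_rep_carrier\<close>)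

text \<open>The regular module is free on the vector \<open>e\<close> corresponding to the unit: an
  arrow out of it is determined by its value at \<open>e\<close>, and every value occurs.
  Projectivity follows by lifting this single value along an epimorphism.\<close>

lemma generator_exists:
  obtains G where "projective_object C G"
    "\<And>X x. X \<in> Obj C \<Longrightarrow> x \<in> carrier_vec (d X) \<Longrightarrow>
      \<exists>g\<in>Hom C G X. \<exists>v\<in>carrier_vec (d G). mt g *\<^sub>v v = x"
proof -
  from mt_ess[OF regular_rep_mod] obtain G and S S' :: "'k mat" where G: "G \<in> Obj C"
    and S: "S \<in> carrier_mat n (d G)"
    and S': "S' \<in> carrier_mat (d G) n" and SS': "S * S' = 1\<^sub>m n" "S' * S = 1\<^sub>m (d G)"
    and eq: "\<forall>a\<in>carrier A. S * rho G a = regular_rep a * S" by blast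
  note oneA = A_one
  define e where "e = S' *\<^sub>v \<one>\<^bsub>A\<^esub>"
  have e: "e \<in> carrier_vec (d G)" unfolding e_def using S' oneA by simp
  \<comment> \<open>\<open>e\<close> generates: acting on it by \<open>u\<close> yields the vector
    that corresponds to \<open>u\<close>.\<close>
  have rho_e: "rho G u *\<^sub>v e = S' *\<^sub>v u" if u: "u \<in> carrier_vec n" for u
  proof -
    have c: "rho G u \<in> carrier_mat (d G) (d G)" using rho_carrier[OF G] u by (simp add: A_carrier)
    have "rho G u * S' = (S' * S) * (rho G u * S')" unfolding SS' using c S' by simp
    also have "\<dots> = S' * ((S * rho G u) * S')" using c S S' by (simp add: mat_assoc)
    also have "S * rho G u = regular_rep u * S" using eq u by (simp add: A_carrier)
    also have "S' * ((regular_rep u * S) * S') = S' * (regular_rep u * (S * S'))"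
      using c S S' regular_rep_carrier[of u] by (simp add: mat_assoc)
    also have "\<dots> = S' * regular_rep u" unfolding SS' using regular_rep_carrier[of u] by simp
    finally have r: "rho G u * S' = S' * regular_rep u" .
    interpret ring A by (rule A_ring)
    have "rho G u *\<^sub>v e = (rho G u * S') *\<^sub>v \<one>\<^bsub>A\<^esub>"
      unfolding e_def by (rule assoc_mult_mat_vec[OF c S' oneA, symmetric])
    also have "\<dots> = S' *\<^sub>v (regular_rep u *\<^sub>v \<one>\<^bsub>A\<^esub>)"
      unfolding r by (rule assoc_mult_mat_vec[OF S' regular_rep_carrier oneA])
    also have "\<dots> = S' *\<^sub>v u"
      unfolding regular_rep_apply[OF u oneA] using r_one[of u] u by (simp add: A_carrier)
    finally show ?thesis .
  qed
  have arrow: "\<exists>g\<in>Hom C G X. mt g *\<^sub>v e = x" if X: "X \<in> Obj C" and x: "x \<in> carrier_vec (d X)" for X x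
  proof -
    have cc: "orbit_map X x * S \<in> carrier_mat (d X) (d G)" by (rule mult_carrier_mat[OF orbit_map_carrier S])
    have "(orbit_map X x * S) * rho G u = rho X u * (orbit_map X x * S)" if u: "u \<in> carrier A" for u
    proof -
      note c = rho_carrier[OF G u] rho_carrier[OF X u] S orbit_map_carrier[of X x] regular_rep_carrier[of u]
      have "(orbit_map X x * S) * rho G u = orbit_map X x * (S * rho G u)" using c by (simp add: mat_assoc)
      also have "\<dots> = (orbit_map X x * regular_rep u) * S" using eq u c by (simp add: mat_assoc)
      also have "orbit_map X x * regular_rep u = rho X u * orbit_map X x"
        using orbit_map_equivariant[OF X x] u by (simp add: A_carrier)
      finally show ?thesis using c by (simp add: mat_assoc)
    qed
    then obtain g where g: "g \<in> Hom C G X" "mt g = orbit_map X x * S" using mt_full[OF G X cc] by blast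
    have "mt g *\<^sub>v e = orbit_map X x *\<^sub>v ((S * S') *\<^sub>v \<one>\<^bsub>A\<^esub>)"
      unfolding g(2) e_def
        using assoc_mult_mat_vec[OF orbit_map_carrier S e, of X x] assoc_mult_mat_vec[OF S S' oneA]
      by (simp add: e_def)
    also have "\<dots> = rho X \<one>\<^bsub>A\<^esub> *\<^sub>v x"
      unfolding SS' using orbit_map_apply[OF X x oneA] oneA by simp
    also have "\<dots> = x" using rho_mod[OF X] x by (simp add: is_fdmod_def)
    finally show ?thesis using g(1) by blast
  qed
  have det: "f = g" if f: "f \<in> Hom C G X" and g: "g \<in> Hom C G X" and fg: "mt f *\<^sub>v e = mt g *\<^sub>v e" for f g X
  proof (rule mt_faithful[OF f g])
    have X: "X \<in> Obj C" using hom_obj[OF f] by simp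
    have v: "mt h *\<^sub>v (S' *\<^sub>v u) = rho X u *\<^sub>v (mt h *\<^sub>v e)" if h: "h \<in> Hom C G X"
      and u: "u \<in> carrier_vec n" for h u
    proof -
      have uA: "u \<in> carrier A" using u by (simp add: A_carrier)
      show ?thesis
        using assoc_mult_mat_vec[OF mt_carrier[OF h] rho_carrier[OF G uA] e]
          assoc_mult_mat_vec[OF rho_carrier[OF X uA] mt_carrier[OF h] e] mt_rho[OF h uA] rho_e[OF u] by simp
    qed
    show "mt f = mt g"
    proof (rule mat_eq_on_vecs[OF mt_carrier[OF f] mt_carrier[OF g]])
      fix y :: "'k vec" assume y: "y \<in> carrier_vec (d G)"
      have "y = S' *\<^sub>v (S *\<^sub>v y)" using assoc_mult_mat_vec[OF S' S y] SS' y by simp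
      moreover have "S *\<^sub>v y \<in> carrier_vec n" using S y by simp
      ultimately show "mt f *\<^sub>v y = mt g *\<^sub>v y" using v[OF f] v[OF g] fg by metis
    qed
  qed
  have "projective_object C G"
    unfolding projective_object_def
  proof (intro conjI allI impI)
    show "G \<in> Obj C" using G .
    fix p f assume pf: "epi_arr C p \<and> f \<in> Hom C G (Cod C p)"
    then have p: "p \<in> Hom C (Dom C p) (Cod C p)" and f: "f \<in> Hom C G (Cod C p)"
      by (auto simp: Hom_iff epi_arr_def)
    \<comment> \<open>\<open>R\<close> is a section on vectors; its task is to lift the value at
      \<open>e\<close>.\<close>
    obtain R where R: "R \<in> carrier_mat (d (Dom C p)) (d (Cod C p))" "mt p * R = 1\<^sub>m (d (Cod C p))"
      using epi_inverse[OF p] pf by blast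
    let ?x = "mt f *\<^sub>v e"
    have x: "?x \<in> carrier_vec (d (Cod C p))" using mt_carrier[OF f] e by simp
    obtain g where g: "g \<in> Hom C G (Dom C p)" "mt g *\<^sub>v e = R *\<^sub>v ?x"
      using arrow[OF hom_obj(1)[OF p], of "R *\<^sub>v ?x"] R(1) x by auto
    have "mt (p \<cdot> g) *\<^sub>v e = mt p *\<^sub>v (R *\<^sub>v ?x)"
      using mt_cmp[OF g(1) p] assoc_mult_mat_vec[OF mt_carrier[OF p] mt_carrier[OF g(1)] e] g(2) by simp
    also have "\<dots> = ?x" using assoc_mult_mat_vec[OF mt_carrier[OF p] R(1) x] R(2) x by simp
    finally have "p \<cdot> g = f" by (rule det[OF cmp_hom[OF g(1) p] f])
    then show "\<exists>g\<in>Hom C G (Dom C p). p \<cdot> g = f" using g(1) by blast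
  qed
  then show ?thesis using that arrow e by blast
qed

text \<open>One copy of the generator is used for each basis vector of \<open>X\<close>, and the
  induction adds these copies one at a time. It starts from a copy of \<open>G\<close> with the
  arrow to \<open>X\<close> for the zero vector, which also covers an \<open>X\<close> of dimension
  zero.\<close>

lemma enough_projectives:
  assumes X: "X \<in> Obj C"
  obtains P e where "projective_object C P" "e \<in> Hom C P X" "epi_arr C e"
proof -
  obtain G where G: "projective_object C G"
    and gen: "\<And>x. x \<in> carrier_vec (d X) \<Longrightarrow> \<exists>g\<in>Hom C G X. \<exists>v\<in>carrier_vec (d G). mt g *\<^sub>v v = x"
    by (rule generator_exists) (use X in blast)
  have GO: "G \<in> Obj C" using G by (simp add: projective_object_def)
  have "\<exists>P e. projective_object C P \<and> e \<in> Hom C P X \<and>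
      (\<forall>j<k. \<exists>v\<in>carrier_vec (d P). mt e *\<^sub>v v = unit_vec (d X) j)" if "k \<le> d X" for k
    using that
  proof (induction k)
    case 0
    obtain g where "g \<in> Hom C G X" using gen[of "0\<^sub>v (d X)"] by auto
    then show ?case using G by blast
  next
    case (Suc k)
    then obtain P e where P: "projective_object C P" and e: "e \<in> Hom C P X"
      and IH: "\<And>j. j < k \<Longrightarrow> \<exists>v\<in>carrier_vec (d P). mt e *\<^sub>v v = unit_vec (d X) j" by auto
    obtain g w where g: "g \<in> Hom C G X" and w: "w \<in> carrier_vec (d G)" "mt g *\<^sub>v w = unit_vec (d X) k"
      using gen[of "unit_vec (d X) k"] by auto
    obtain Z where Z: "is_direct_sum C P G Z" using direct_sum_exists[OF hom_obj(1)[OF e] GO] .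
    obtain i j p q where ijpq: "i \<in> Hom C P Z" "j \<in> Hom C G Z" "p \<in> Hom C Z P" "q \<in> Hom C Z G"
      "p \<cdot> i = Id C P" "q \<cdot> j = Id C G" "p \<cdot> j = ZeroA C G P" "q \<cdot> i = ZeroA C P G"
      using direct_sumE[OF Z] by metis
    obtain h where h: "h \<in> Hom C Z X" "h \<cdot> i = e" "h \<cdot> j = g"
      using copair_exists[OF ijpq e g] by metis
    have "\<exists>v\<in>carrier_vec (d Z). mt h *\<^sub>v v = unit_vec (d X) l" if l: "l < Suc k" for l
    proof (cases "l = k")
      case True
      have "mt h *\<^sub>v (mt j *\<^sub>v w) = unit_vec (d X) k"
        using assoc_mult_mat_vec[OF mt_carrier[OF h(1)] mt_carrier[OF ijpq(2)] w(1)]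
          mt_cmp[OF ijpq(2) h(1)] h(3) w(2) by simp
      then show ?thesis using True w(1) mt_carrier[OF ijpq(2)] by (intro bexI[of _ "mt j *\<^sub>v w"]) auto
    next
      case False
      then obtain v where v: "v \<in> carrier_vec (d P)" "mt e *\<^sub>v v = unit_vec (d X) l" using IH[of l] l by auto
      have "mt h *\<^sub>v (mt i *\<^sub>v v) = unit_vec (d X) l"
        using assoc_mult_mat_vec[OF mt_carrier[OF h(1)] mt_carrier[OF ijpq(1)] v(1)]
          mt_cmp[OF ijpq(1) h(1)] h(2) v(2) by simp
      then show ?thesis using v(1) mt_carrier[OF ijpq(1)] by (intro bexI[of _ "mt i *\<^sub>v v"]) auto
    qed
    then show ?case using projective_direct_sum[OF P G Z] h(1) by blast
  qed
  then obtain P e where P: "projective_object C P" and e: "e \<in> Hom C P X"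
    and "\<forall>j<d X. \<exists>v\<in>carrier_vec (d P). mt e *\<^sub>v v = unit_vec (d X) j" by blast
  then obtain v
    where v: "\<And>j. j < d X \<Longrightarrow> v j \<in> carrier_vec (d P)" "\<And>j. j < d X \<Longrightarrow> mt e *\<^sub>v v j = unit_vec (d X) j"
    by metis
  \<comment> \<open>Preimages of the basis vectors are the columns of a right inverse of
    \<open>mt e\<close>.\<close>
  define R where "R = mat (d P) (d X) (\<lambda>(i, j). v j $ i)"
  have R: "R \<in> carrier_mat (d P) (d X)" by (simp add: R_def)
  have "mt e * R = 1\<^sub>m (d X)"
  proof (rule eq_matI)
    fix i j assume "i < dim_row (1\<^sub>m (d X) :: 'k mat)" "j < dim_col (1\<^sub>m (d X) :: 'k mat)"
    then have ij: "i < d X" "j < d X" by auto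
    have "col R j = v j" using ij v(1)[OF ij(2)] by (intro eq_vecI) (auto simp: R_def)
    then have "(mt e * R) $$ (i, j) = (mt e *\<^sub>v v j) $ i"
      using ij R mt_carrier[OF e] by simp
    then show "(mt e * R) $$ (i, j) = 1\<^sub>m (d X) $$ (i, j)" using v(2)[OF ij(2)] ij by simp
  qed (use R mt_carrier[OF e] in auto)
  then have "epi_arr C e" by (rule right_inverse_epi[OF e R])
  then show ?thesis using that P e by blast
qed

end

text \<open>Stated outside the locale \<open>matrix_model\<close>, whose scalars form an arbitrary
  field, since the eigenvalue comes from algebraic closedness.\<close>

lemma matrix_model_eigenvalue:
  fixes C :: "('k::alg_closed_field, 'o, 'a, 'z) lincat_scheme"
  assumes "matrix_model C n A d rho mt" and f: "f \<in> Hom C X X" and nz: "\<not> zero_object C X"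
  shows "\<exists>c. \<not> iso_arr C (linear_category.diff_arr C f (ScaleA C c (Id C X)))"
proof -
  interpret matrix_model C n A d rho mt by fact
  have X: "X \<in> Obj C" using hom_obj[OF f] by simp
  have I: "Id C X \<in> Hom C X X" using id_hom[OF X] .
  obtain c where c: "\<And>S. S \<in> carrier_mat (d X) (d X) \<Longrightarrow> S * (mt f - c \<cdot>\<^sub>m 1\<^sub>m (d X)) \<noteq> 1\<^sub>m (d X)"
    using exists_singular_shift[OF mt_carrier[OF f] nonzero_dim[OF X nz]] by metis
  let ?g = "diff_arr f (ScaleA C c (Id C X))"
  have s: "ScaleA C c (Id C X) \<in> Hom C X X" using scale_hom[OF I I] .
  have g: "?g \<in> Hom C X X" using diff_hom[OF f s] .
  have "\<not> iso_arr C ?g"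
  proof
    assume "iso_arr C ?g"
    then obtain h where h: "h \<in> Hom C X X" "h \<cdot>\<^bsub>C\<^esub> ?g = Id C X" using isoE[OF _ g] by metis
    have "mt h * mt ?g = 1\<^sub>m (d X)" using mt_cmp[OF g h(1)] h(2) mt_id[OF X] by simp
    moreover have "mt ?g = mt f - c \<cdot>\<^sub>m 1\<^sub>m (d X)"
      using mt_diff[OF f s] mt_scale[OF I] mt_id[OF X] by simp
    ultimately show False using c[OF mt_carrier[OF h(1)]] by simp
  qed
  then show ?thesis by blast
qed

section \<open>The abstract interface: abelian categories with a dimension\<close>

text \<open>Collects what is used from here on, with matrices out of sight. The number
  \<open>d\<close> plays the role of length: it drops strictly along monomorphisms (to the source)
  and epimorphisms (to the target) that are not invertible, which drives all minimality and
  maximality arguments. Each kernel comes with normality for the same arrow, and each cokernel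
  likewise.\<close>

locale abelian_category_with_length = linear_category C
  for C :: "('k::field, 'o, 'a, 'z) lincat_scheme" (structure) +
  fixes d :: "'o \<Rightarrow> nat"
  assumes ker_ex: "f \<in> Hom C X Y \<Longrightarrow> \<exists>K k. k \<in> Hom C K X \<and> mono_arr C k \<and> f \<cdot> k = ZeroA C K Y \<and>
      (\<forall>W. \<forall>g\<in>Hom C W X. f \<cdot> g = ZeroA C W Y \<longrightarrow> (\<exists>h\<in>Hom C W K. k \<cdot> h = g)) \<and>
      (epi_arr C f \<longrightarrow> (\<forall>W. \<forall>g\<in>Hom C X W. g \<cdot> k = ZeroA C K W \<longrightarrow> (\<exists>h\<in>Hom C Y W. h \<cdot> f = g)))"
    and coker_ex: "f \<in> Hom C X Y \<Longrightarrow> \<exists>Q c. c \<in> Hom C Y Q \<and> epi_arr C c \<and> c \<cdot> f = ZeroA C X Q \<and>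
      (\<forall>W. \<forall>g\<in>Hom C Y W. g \<cdot> f = ZeroA C X W \<longrightarrow> (\<exists>h\<in>Hom C Q W. h \<cdot> c = g)) \<and>
      (mono_arr C f \<longrightarrow> (\<forall>W. \<forall>g\<in>Hom C W Y. c \<cdot> g = ZeroA C W Q \<longrightarrow> (\<exists>h\<in>Hom C W X. f \<cdot> h = g)))"
    and image_ex: "f \<in> Hom C X Y \<Longrightarrow>
      \<exists>I e m. e \<in> Hom C X I \<and> epi_arr C e \<and> m \<in> Hom C I Y \<and> mono_arr C m \<and> m \<cdot> e = f"
    and mono_dim: "f \<in> Hom C X Y \<Longrightarrow> mono_arr C f \<Longrightarrow> d X \<le> d Y"
    and mono_dim_iso: "f \<in> Hom C X Y \<Longrightarrow> mono_arr C f \<Longrightarrow> d X = d Y \<Longrightarrow> iso_arr C f"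
    and epi_dim: "f \<in> Hom C X Y \<Longrightarrow> epi_arr C f \<Longrightarrow> d Y \<le> d X"
    and epi_dim_iso: "f \<in> Hom C X Y \<Longrightarrow> epi_arr C f \<Longrightarrow> d Y = d X \<Longrightarrow> iso_arr C f"
    and sum_ex: "X \<in> Obj C \<Longrightarrow> Y \<in> Obj C \<Longrightarrow> \<exists>Z. is_direct_sum C X Y Z"
    and zero_ex: "\<exists>Z. zero_object C Z"
    and proj_ex: "X \<in> Obj C \<Longrightarrow> \<exists>P e. projective_object C P \<and> e \<in> Hom C P X \<and> epi_arr C e"
    and eigen_ex: "f \<in> Hom C X X \<Longrightarrow> \<not> zero_object C X \<Longrightarrow>
      \<exists>c. \<not> iso_arr C (diff_arr f (ScaleA C c (Id C X)))"

lemma matrix_model_abelian: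
  fixes C :: "('k::alg_closed_field, 'o, 'a, 'z) lincat_scheme"
  assumes M: "matrix_model C n A d rho mt"
  shows "abelian_category_with_length C d"
proof -
  interpret matrix_model C n A d rho mt by fact
  show ?thesis
  proof
    fix f X Y assume f: "f \<in> Hom C X Y"
    show "\<exists>K k. k \<in> Hom C K X \<and> mono_arr C k \<and> f \<cdot>\<^bsub>C\<^esub> k = ZeroA C K Y \<and>
      (\<forall>W. \<forall>g\<in>Hom C W X. f \<cdot>\<^bsub>C\<^esub> g = ZeroA C W Y \<longrightarrow> (\<exists>h\<in>Hom C W K. k \<cdot>\<^bsub>C\<^esub> h = g)) \<and>
      (epi_arr C f \<longrightarrow> (\<forall>W. \<forall>g\<in>Hom C X W. g \<cdot>\<^bsub>C\<^esub> k = ZeroA C K W \<longrightarrow> (\<exists>h\<in>Hom C Y W. h \<cdot>\<^bsub>C\<^esub> f = g)))"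
      by (rule kernel_exists[OF f])
    show "\<exists>Q c. c \<in> Hom C Y Q \<and> epi_arr C c \<and> c \<cdot>\<^bsub>C\<^esub> f = ZeroA C X Q \<and>
      (\<forall>W. \<forall>g\<in>Hom C Y W. g \<cdot>\<^bsub>C\<^esub> f = ZeroA C X W \<longrightarrow> (\<exists>h\<in>Hom C Q W. h \<cdot>\<^bsub>C\<^esub> c = g)) \<and>
      (mono_arr C f \<longrightarrow> (\<forall>W. \<forall>g\<in>Hom C W Y. c \<cdot>\<^bsub>C\<^esub> g = ZeroA C W Q \<longrightarrow> (\<exists>h\<in>Hom C W X. f \<cdot>\<^bsub>C\<^esub> h = g)))"
      by (rule cokernel_exists[OF f])
    show "\<exists>I e m. e \<in> Hom C X I \<and> epi_arr C e \<and> m \<in> Hom C I Y \<and> mono_arr C m \<and> m \<cdot>\<^bsub>C\<^esub> e = f"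
      by (rule image_exists[OF f]) (intro exI conjI)
    show "d X \<le> d Y" if "mono_arr C f" using dim_mono(1)[OF f that] .
    show "iso_arr C f" if "mono_arr C f" "d X = d Y" using dim_mono(2)[OF f that] .
    show "d Y \<le> d X" if "epi_arr C f" using dim_epi(1)[OF f that] .
    show "iso_arr C f" if "epi_arr C f" "d Y = d X" using dim_epi(2)[OF f that] .
  next
    fix X Y assume X: "X \<in> Obj C" 
    show "\<exists>P e. projective_object C P \<and> e \<in> Hom C P X \<and> epi_arr C e"
      by (rule enough_projectives[OF X]) blast
    assume Y: "Y \<in> Obj C"
    show "\<exists>Z. is_direct_sum C X Y Z"
      by (rule direct_sum_exists[OF X Y]) blast
  next
    show "\<exists>Z. zero_object C Z" by (rule zero_exists)
  next
    fix f X assume "f \<in> Hom C X X" "\<not> zero_object C X"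
    then show "\<exists>c. \<not> iso_arr C (diff_arr f (ScaleA C c (Id C X)))"
      by (rule matrix_model_eigenvalue[OF M])
  qed
qed

section \<open>From an equivalence of categories to coordinates\<close>

lemma fdmod_arr_iff:
  "fdmod_arr A (V, T, W) \<longleftrightarrow> is_fdmod A V \<and> is_fdmod A W \<and> T \<in> carrier_mat (fst W) (fst V) \<and>
    (\<forall>a\<in>carrier A. T * snd V a = snd W a * T)"
  by (cases V; cases W) (simp add: fdmod_arr_def)

lemma fdmod_iso_matrices:
  assumes iso: "iso_arr (fdmod_cat A) h" and h: "h \<in> Hom (fdmod_cat A) V W"
  obtains S S' where "h = (V, S, W)" "S \<in> carrier_mat (fst W) (fst V)" "S' \<in> carrier_mat (fst V) (fst W)"
    "S * S' = 1\<^sub>m (fst W)" "S' * S = 1\<^sub>m (fst V)" "\<forall>a\<in>carrier A. S * snd V a = snd W a * S"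
proof -
  have D: "Dom (fdmod_cat A) h = V" "Cod (fdmod_cat A) h = W" using h by (auto simp: Hom_def)
  obtain g where g: "g \<in> Hom (fdmod_cat A) W V"
    and eq: "g \<cdot>\<^bsub>fdmod_cat A\<^esub> h = Id (fdmod_cat A) V"
    "h \<cdot>\<^bsub>fdmod_cat A\<^esub> g = Id (fdmod_cat A) W"
    using iso unfolding iso_arr_def D by blast
  obtain S where S: "h = (V, S, W)" "fdmod_arr A (V, S, W)" using h
    by (cases h) (auto simp: Hom_def fdmod_cat_def)
  obtain S' where S': "g = (W, S', V)" "fdmod_arr A (W, S', V)" using g
    by (cases g) (auto simp: Hom_def fdmod_cat_def)
  show ?thesis
    by (rule that[OF S(1)]) (use S S' eq in \<open>simp_all add: fdmod_arr_iff fdmod_cat_def\<close>)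
qed

text \<open>The functor of the equivalence becomes the coordinate functor; \<open>mt\<close> drops
  the domain and codomain that an arrow of \<open>fdmod_cat\<close> stores. Its faithfulness comes
  from \<open>t\<close>, and that of the quasi-inverse from \<open>s\<close>.\<close>

lemma finite_abelian_matrix_model:
  fixes C :: "('k::field, 'o, 'a, 'z) lincat_scheme"
  assumes "finite_abelian_category C"
  obtains n A d rho mt where "matrix_model C n A d rho mt"
proof -
  obtain n and A :: "('k, 'k vec) module" where C: "linear_category C" and A: "fd_algebra n A"
    and eq: "linear_equivalent C (fdmod_cat A)"
    using assms unfolding finite_abelian_category_def by blast
  obtain Fo Fa Go Ga t s where F: "linear_functor C (fdmod_cat A) Fo Fa"
    and G: "linear_functor (fdmod_cat A) C Go Ga"
    and t: "natural_iso C C id id (Go \<circ> Fo) (Ga \<circ> Fa) t"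
    and s: "natural_iso (fdmod_cat A) (fdmod_cat A) (Fo \<circ> Go) (Fa \<circ> Ga) id id s"
    using eq unfolding linear_equivalent_def by blast
  interpret F: linear_functor C "fdmod_cat A" Fo Fa by fact
  interpret G: linear_functor "fdmod_cat A" C Go Ga by fact
  define d where "d X = fst (Fo X)" for X
  define rho where "rho X = snd (Fo X)" for X
  define mt where "mt f = fst (snd (Fa f))" for f
  have FO: "is_fdmod A (d X, rho X)" if "X \<in> Obj C" for X
    using F.map_obj[OF that] by (simp add: fdmod_cat_def d_def rho_def)
  have Fa: "Fa f = (Fo X, mt f, Fo Y)" "fdmod_arr A (Fo X, mt f, Fo Y)" if "f \<in> Hom C X Y" for f X Y
    using F.map_hom[OF that] by (cases "Fa f"; auto simp: Hom_def fdmod_cat_def mt_def)+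
  have tiso: "t X \<in> Hom C X (Go (Fo X))" "iso_arr C (t X)" if "X \<in> Obj C" for X
    using t that by (auto simp: natural_iso_def)
  have tnat: "Ga (Fa f) \<cdot>\<^bsub>C\<^esub> t X = t Y \<cdot>\<^bsub>C\<^esub> f" if "f \<in> Hom C X Y" for f X Y
    using t that by (auto simp: natural_iso_def Hom_def)
  have siso: "s V \<in> Hom (fdmod_cat A) (Fo (Go V)) V" "iso_arr (fdmod_cat A) (s V)" if "V \<in> Obj (fdmod_cat A)"
    for V
    using s that by (auto simp: natural_iso_def)
  have snat: "g \<cdot>\<^bsub>fdmod_cat A\<^esub> s V = s W \<cdot>\<^bsub>fdmod_cat A\<^esub> Fa (Ga g)"
    if "g \<in> Hom (fdmod_cat A) V W" for g V W
    using s that by (auto simp: natural_iso_def Hom_def)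
  have faithful: "f = g" if f: "f \<in> Hom C X Y" and g: "g \<in> Hom C X Y" and fg: "Fa f = Fa g" for f g X Y
  proof -
    have Y: "Y \<in> Obj C" using F.A.hom_obj[OF f] by simp
    have "t Y \<cdot>\<^bsub>C\<^esub> f = t Y \<cdot>\<^bsub>C\<^esub> g" using tnat[OF f] tnat[OF g] fg by simp
    then show ?thesis using F.A.monoD[OF F.A.iso_mono[OF tiso(2)[OF Y]] tiso(1)[OF Y] f g] by simp
  qed
  have Gfaithful: "f = g" if f: "f \<in> Hom (fdmod_cat A) X Y" and g: "g \<in> Hom (fdmod_cat A) X Y"
    and fg: "Ga f = Ga g" for f g X Y
  proof -
    have X: "X \<in> Obj (fdmod_cat A)" using F.B.hom_obj[OF f] by simp
    have "f \<cdot>\<^bsub>fdmod_cat A\<^esub> s X = g \<cdot>\<^bsub>fdmod_cat A\<^esub> s X"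
      using snat[OF f] snat[OF g] fg by simp
    then show ?thesis using F.B.epiD[OF F.B.iso_epi[OF siso(2)[OF X]] siso(1)[OF X] f g] by simp
  qed
  have "matrix_model C n A d rho mt"
  proof (intro matrix_model.intro C matrix_model_axioms.intro A FO)
    fix f X Y assume f: "f \<in> Hom C X Y"
    show "mt f \<in> carrier_mat (d Y) (d X)" "\<And>a. a \<in> carrier A \<Longrightarrow> mt f * rho X a = rho Y a * mt f"
      using Fa(2)[OF f] by (simp_all add: fdmod_arr_iff d_def rho_def)
    show "mt (ScaleA C c f) = c \<cdot>\<^sub>m mt f" for c
      using F.map_scale[OF f, of c] Fa(1)[OF f] Fa(1)[OF F.A.scale_hom[OF f f]] by (simp add: fdmod_cat_def)
    show "mt (g \<cdot>\<^bsub>C\<^esub> f) = mt g * mt f" if g: "g \<in> Hom C Y Z" for g Z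
      using F.map_cmp[OF f g] Fa(1)[OF f] Fa(1)[OF g] Fa(1)[OF F.A.cmp_hom[OF f g]]
        by (simp add: fdmod_cat_def)
    fix g assume g: "g \<in> Hom C X Y"
    show "mt (AddA C f g) = mt f + mt g"
      using F.map_add[OF f g] Fa(1)[OF f] Fa(1)[OF g] Fa(1)[OF F.A.add_hom[OF f g]]
        by (simp add: fdmod_cat_def)
    assume "mt f = mt g"
    then show "f = g" using faithful[OF f g] Fa(1)[OF f] Fa(1)[OF g] by simp
  next
    fix X assume X: "X \<in> Obj C"
    show "mt (Id C X) = 1\<^sub>m (d X)"
      using F.map_id[OF X] Fa(1)[OF F.A.id_hom[OF X]] by (simp add: fdmod_cat_def d_def)
  next
    fix X Y T assume X: "X \<in> Obj C" and Y: "Y \<in> Obj C" and T: "T \<in> carrier_mat (d Y) (d X)"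
      and TT: "\<And>a. a \<in> carrier A \<Longrightarrow> T * rho X a = rho Y a * T"
    let ?T = "(Fo X, T, Fo Y)"
    have "fdmod_arr A ?T" using FO[OF X] FO[OF Y] T TT
      by (simp add: fdmod_arr_iff d_def rho_def)
    then have TH: "?T \<in> Hom (fdmod_cat A) (Fo X) (Fo Y)" by (simp add: Hom_def fdmod_cat_def)
    obtain u where u: "u \<in> Hom C (Go (Fo Y)) Y" "u \<cdot>\<^bsub>C\<^esub> t Y = Id C Y"
      "t Y \<cdot>\<^bsub>C\<^esub> u = Id C (Go (Fo Y))"
      using F.A.isoE[OF tiso(2,1)[OF Y]] by metis
    have GT: "Ga ?T \<in> Hom C (Go (Fo X)) (Go (Fo Y))" using G.map_hom[OF TH] .
    let ?h = "Ga ?T \<cdot>\<^bsub>C\<^esub> t X"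
    have h: "?h \<in> Hom C X (Go (Fo Y))" using F.A.cmp_hom[OF tiso(1)[OF X] GT] .
    \<comment> \<open>Fullness: conjugating \<open>Ga ?T\<close> by the isomorphisms
      \<open>t\<close> gives \<open>?f\<close>, so that \<open>Ga\<close> agrees on
      \<open>Fa ?f\<close> and \<open>?T\<close>; faithfulness of \<open>Ga\<close> then identifies
      these two.\<close>
    let ?f = "u \<cdot>\<^bsub>C\<^esub> ?h"
    have f: "?f \<in> Hom C X Y" using F.A.cmp_hom[OF h u(1)] .
    have Ff: "Fa ?f \<in> Hom (fdmod_cat A) (Fo X) (Fo Y)" using F.map_hom[OF f] .
    have "Ga (Fa ?f) \<cdot>\<^bsub>C\<^esub> t X = t Y \<cdot>\<^bsub>C\<^esub> ?f" using tnat[OF f] .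
    also have "\<dots> = (t Y \<cdot>\<^bsub>C\<^esub> u) \<cdot>\<^bsub>C\<^esub> ?h"
      using F.A.cmp_assoc[OF h u(1) tiso(1)[OF Y]] by simp
    also have "\<dots> = ?h" unfolding u(3) using F.A.cmp_id_left[OF h] .
    finally have "Ga (Fa ?f) = Ga ?T"
      using F.A.epiD[OF F.A.iso_epi[OF tiso(2)[OF X]] tiso(1)[OF X] G.map_hom[OF Ff] GT] by simp
    then have "Fa ?f = ?T" using Gfaithful[OF Ff TH] by simp
    then show "\<exists>f\<in>Hom C X Y. mt f = T" using f by (intro bexI[of _ ?f]) (simp_all add: mt_def)
  next
    fix m r assume V: "is_fdmod A (m, r)"
    then have VO: "(m, r) \<in> Obj (fdmod_cat A)" by (simp add: fdmod_cat_def)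
    obtain S S' where "S \<in> carrier_mat m (d (Go (m, r)))" "S' \<in> carrier_mat (d (Go (m, r))) m"
      "S * S' = 1\<^sub>m m" "S' * S = 1\<^sub>m (d (Go (m, r)))" "\<forall>a\<in>carrier A. S * rho (Go (m, r)) a = r a * S"
      by (rule fdmod_iso_matrices[OF siso(2)[OF VO] siso(1)[OF VO]]) (auto simp: d_def rho_def)
    then show "\<exists>X\<in>Obj C. \<exists>S S'. S \<in> carrier_mat m (d X) \<and>
      S' \<in> carrier_mat (d X) m \<and> S * S' = 1\<^sub>m m \<and> S' * S = 1\<^sub>m (d X) \<and>
      (\<forall>a\<in>carrier A. S * rho X a = r a * S)"
      using G.map_obj[OF VO] by blast
  qed
  then show ?thesis by (rule that)
qed

lemma finite_abelian_length:
  fixes C :: "('k::alg_closed_field, 'o, 'a, 'z) lincat_scheme"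
  assumes "finite_abelian_category C"
  obtains d where "abelian_category_with_length C d"
  using finite_abelian_matrix_model[OF assms] matrix_model_abelian by metis

section \<open>Abelian categories with a length function\<close>

context category
begin

lemma id_mono: "X \<in> Obj C \<Longrightarrow> mono_arr C (Id C X)"
  by (rule split_mono[OF id_hom id_hom]) (simp_all add: id_hom cmp_id_left[OF id_hom])

lemma id_epi: "X \<in> Obj C \<Longrightarrow> epi_arr C (Id C X)"
  by (rule split_epi[OF id_hom id_hom]) (simp_all add: id_hom cmp_id_left[OF id_hom])

end

context linear_category
begin

lemma is_cokernel_epi:
  assumes c: "is_cokernel C f c"
  shows "epi_arr C c"
  unfolding epi_arr_def
proof (intro conjI ballI impI)
  show "c \<in> Arr C" using c by (simp add: is_cokernel_def)
  fix W g h assume W: "W \<in> Obj C" and g: "g \<in> Hom C (Cod C c) W" and h: "h \<in> Hom C (Cod C c) W"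
    and eq: "g \<cdot> c = h \<cdot> c"
  have cf: "f \<in> Hom C (Dom C f) (Dom C c)" "c \<in> Hom C (Dom C c) (Cod C c)"
    "c \<cdot> f = ZeroA C (Dom C f) (Cod C c)"
    using c by (auto simp: is_cokernel_def Hom_iff)
  have gc: "g \<cdot> c \<in> Hom C (Cod C f) W" using cmp_hom[OF cf(2) g] c by (simp add: is_cokernel_def)
  have "(g \<cdot> c) \<cdot> f = ZeroA C (Dom C f) W"
    using cmp_assoc[OF cf(1,2) g] cf(3) cmp_zero_right[OF g] hom_obj[OF cf(1)] by simp
  then have "\<exists>!k. k \<in> Hom C (Cod C c) W \<and> k \<cdot> c = g \<cdot> c" using c W gc unfolding is_cokernel_def by blast
  then show "g = h" using g h eq by metis
qed

lemma is_cokernelI: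
  assumes f: "f \<in> Hom C X Y" and c: "c \<in> Hom C Y Q" and cf: "c \<cdot> f = ZeroA C X Q" and epi: "epi_arr C c"
    and univ: "\<And>W g. g \<in> Hom C Y W \<Longrightarrow> g \<cdot> f = ZeroA C X W \<Longrightarrow> \<exists>h\<in>Hom C Q W. h \<cdot> c = g"
  shows "is_cokernel C f c"
proof -
  have e: "f \<in> Arr C" "Dom C f = X" "Cod C f = Y" "c \<in> Arr C" "Dom C c = Y" "Cod C c = Q"
    using f c by (auto simp: Hom_iff)
  have "\<exists>!h. h \<in> Hom C Q W \<and> h \<cdot> c = g" if "g \<in> Hom C Y W" "g \<cdot> f = ZeroA C X W" for W g
    using univ[OF that] epiD[OF epi c] by metis
  then show ?thesis unfolding is_cokernel_def e using e cf by simp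
qed

lemma topologizing_sub:
  assumes "S \<in> Topologizing C" "i \<in> Hom C X Y" "mono_arr C i" "Y \<in> S"
  shows "X \<in> S"
proof -
  have X: "X \<in> Obj C" using hom_obj[OF assms(2)] by simp
  have "is_subquotient C X Y" unfolding is_subquotient_def
    using assms(2,3) id_epi[OF X] id_hom[OF X] by (intro exI[of _ i] exI[of _ "Id C X"]) (simp add: Hom_iff)
  then show ?thesis using assms(1,4) unfolding Topologizing_def by blast
qed

lemma topologizing_quot:
  assumes "S \<in> Topologizing C" "e \<in> Hom C X Y" "epi_arr C e" "X \<in> S"
  shows "Y \<in> S"
proof -
  have X: "X \<in> Obj C" using hom_obj[OF assms(2)] by simp
  have "is_subquotient C Y X" unfolding is_subquotient_def
    using assms(2,3) id_mono[OF X] id_hom[OF X] by (intro exI[of _ "Id C X"] exI[of _ e]) (simp add: Hom_iff)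
  then show ?thesis using assms(1,4) unfolding Topologizing_def by blast
qed

lemma topologizing_obj: "S \<in> Topologizing C \<Longrightarrow> X \<in> S \<Longrightarrow> X \<in> Obj C"
  unfolding Topologizing_def by blast

lemma topologizing_sum: "S \<in> Topologizing C \<Longrightarrow> X \<in> S \<Longrightarrow> Y \<in> S \<Longrightarrow> is_direct_sum C X Y Z \<Longrightarrow> Z \<in> S"
  unfolding Topologizing_def by blast

lemma topologizing_zero: "S \<in> Topologizing C \<Longrightarrow> zero_object C Z \<Longrightarrow> Z \<in> S"
  unfolding Topologizing_def by blast

text \<open>Puts the end over the whole category among those indexed by topologizing
  subcategories.\<close>

lemma Obj_topologizing: "Obj C \<in> Topologizing C"
  unfolding Topologizing_def is_subquotient_def
  by (auto simp: zero_object_def is_direct_sum_def epi_arr_def cod_obj)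

end

context abelian_category_with_length
begin

lemma mono_dim_less: "f \<in> Hom C X Y \<Longrightarrow> mono_arr C f \<Longrightarrow> \<not> iso_arr C f \<Longrightarrow> d X < d Y"
  using mono_dim mono_dim_iso by (metis le_neq_implies_less)

lemma epi_dim_less: "f \<in> Hom C X Y \<Longrightarrow> epi_arr C f \<Longrightarrow> \<not> iso_arr C f \<Longrightarrow> d Y < d X"
  using epi_dim epi_dim_iso by (metis le_neq_implies_less)

lemma mono_epi_iso: "f \<in> Hom C X Y \<Longrightarrow> mono_arr C f \<Longrightarrow> epi_arr C f \<Longrightarrow> iso_arr C f"
  using mono_dim epi_dim mono_dim_iso le_antisym by metis

lemma zero_dim_mono:
  assumes Z: "zero_object C Z" and X: "X \<in> Obj C"
  shows "mono_arr C (ZeroA C Z X)"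
proof (rule mono_zeroI)
  have ZO: "Z \<in> Obj C" using Z by (simp add: zero_object_def)
  show "ZeroA C Z X \<in> Hom C Z X" using zero_hom[OF ZO X] .
  show "g = ZeroA C W Z" if "g \<in> Hom C W Z" for W g using zero_object_hom(1)[OF Z that] .
qed

lemma zero_dim_epi:
  assumes Z: "zero_object C Z" and X: "X \<in> Obj C"
  shows "epi_arr C (ZeroA C X Z)"
proof (rule epi_zeroI)
  have ZO: "Z \<in> Obj C" using Z by (simp add: zero_object_def)
  show "ZeroA C X Z \<in> Hom C X Z" using zero_hom[OF X ZO] .
  show "g = ZeroA C Z W" if "g \<in> Hom C Z W" for W g using zero_object_hom(2)[OF Z that] .
qed

lemma iso_zero_object:
  assumes "iso_arr C f" "f \<in> Hom C X Y" "f = ZeroA C X Y"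
  shows "zero_object C X" "zero_object C Y"
proof -
  obtain g where g: "g \<in> Hom C Y X" "g \<cdot> f = Id C X" "f \<cdot> g = Id C Y" using isoE[OF assms(1,2)] by metis
  have XY: "X \<in> Obj C" "Y \<in> Obj C" using hom_obj[OF assms(2)] by auto
  have "Id C X = ZeroA C X X" using g(2) cmp_zero_right[OF g(1) XY(1)] assms(3) by simp
  then show "zero_object C X" using zero_object_iff XY by simp
  have "Id C Y = ZeroA C Y Y" using g(3) cmp_zero_left[OF g(1) XY(2)] assms(3) by simp
  then show "zero_object C Y" using zero_object_iff XY by simp
qed

lemma epi_zero_object:
  assumes "epi_arr C (ZeroA C X Y)" "X \<in> Obj C" "Y \<in> Obj C"
  shows "zero_object C Y"
proof -
  have "Id C Y = ZeroA C Y Y"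
    using epi_zeroD[OF assms(1) zero_hom[OF assms(2,3)] id_hom[OF assms(3)]]
      cmp_id_left[OF zero_hom[OF assms(2,3)]] by simp
  then show ?thesis using zero_object_iff assms by simp
qed

text \<open>The arrow with components \<open>l\<close> and \<open>f\<close> into the direct sum
  \<open>T\<close> has an image \<open>I\<close> that projects onto \<open>L'\<close>. Maximality
  makes this projection invertible, and the second component, transported along the inverse, is the
  factor of \<open>f\<close>.\<close>

lemma factor_through_max_quotient:
  assumes l: "l \<in> Hom C L L'" "epi_arr C l" and f: "f \<in> Hom C L Y" and T: "is_direct_sum C L' Y T"
    and max: "\<And>I e m. e \<in> Hom C L I \<Longrightarrow> epi_arr C e \<Longrightarrow> m \<in> Hom C I T \<Longrightarrow> mono_arr C m \<Longrightarrow> d I \<le> d L'"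
  shows "\<exists>f'\<in>Hom C L' Y. f' \<cdot> l = f"
proof -
  obtain i j p q where ijpq: "i \<in> Hom C L' T" "j \<in> Hom C Y T" "p \<in> Hom C T L'" "q \<in> Hom C T Y"
    and eq: "p \<cdot> i = Id C L'" "q \<cdot> j = Id C Y" "p \<cdot> j = ZeroA C Y L'" "q \<cdot> i = ZeroA C L' Y"
    by (rule direct_sumE[OF T])
  obtain h where h: "h \<in> Hom C L T" "p \<cdot> h = l" "q \<cdot> h = f" by (rule pair_exists[OF ijpq eq l(1) f])
  obtain I e m where em: "e \<in> Hom C L I" "epi_arr C e" "m \<in> Hom C I T" "mono_arr C m" "m \<cdot> e = h"
    using image_ex[OF h(1)] by blast
  have le: "d I \<le> d L'" using max em by blast
  have pm: "p \<cdot> m \<in> Hom C I L'" using cmp_hom[OF em(3) ijpq(3)] .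
  have pme: "(p \<cdot> m) \<cdot> e = l" using cmp_assoc[OF em(1,3) ijpq(3)] em(5) h(2) by simp
  have "epi_arr C (p \<cdot> m)" using epi_factor[OF _ em(1) pm] pme l(2) by simp
  then have "iso_arr C (p \<cdot> m)" using epi_dim_less[OF pm] le by force
  then obtain v where v: "v \<in> Hom C L' I" "v \<cdot> (p \<cdot> m) = Id C I" using isoE[OF _ pm] by metis
  have qm: "q \<cdot> m \<in> Hom C I Y" using cmp_hom[OF em(3) ijpq(4)] .
  have "((q \<cdot> m) \<cdot> v) \<cdot> l = (q \<cdot> m) \<cdot> (v \<cdot> ((p \<cdot> m) \<cdot> e))" using pme cmp_assoc[OF l(1) v(1) qm] by simp
  also have "\<dots> = (q \<cdot> m) \<cdot> ((v \<cdot> (p \<cdot> m)) \<cdot> e)" using cmp_assoc[OF em(1) pm v(1)] by simp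
  also have "\<dots> = f" unfolding v(2)
    using cmp_id_left[OF em(1)] cmp_assoc[OF em(1,3) ijpq(4)] em(5) h(3) by simp
  finally show ?thesis using cmp_hom[OF v(1) qm] by blast
qed

text \<open>The pullback is the kernel of \<open>e \<cdot> q - f \<cdot> p\<close> on the direct
  sum. The monomorphism \<open>k\<close> into the sum is part of the result because it keeps
  \<open>L\<close> in classes closed under sums and subobjects.\<close>

lemma pullback_exists:
  assumes f: "f \<in> Hom C X Z" and e: "e \<in> Hom C Y Z" and epi: "epi_arr C e"
  obtains L T k a b where "is_direct_sum C X Y T" "k \<in> Hom C L T" "mono_arr C k"
    "a \<in> Hom C L X" "epi_arr C a" "b \<in> Hom C L Y" "f \<cdot> a = e \<cdot> b"
    "\<forall>W. \<forall>g\<in>Hom C W X. \<forall>h\<in>Hom C W Y. f \<cdot> g = e \<cdot> h \<longrightarrow> (\<exists>u\<in>Hom C W L. a \<cdot> u = g \<and> b \<cdot> u = h)"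
    "\<forall>W. \<forall>u\<in>Hom C W L. a \<cdot> u = ZeroA C W X \<longrightarrow> b \<cdot> u = ZeroA C W Y \<longrightarrow> u = ZeroA C W L"
proof -
  have XO: "X \<in> Obj C" and YO: "Y \<in> Obj C" and ZO: "Z \<in> Obj C" using hom_obj[OF f] hom_obj[OF e] by auto
  obtain T where T: "is_direct_sum C X Y T" using sum_ex[OF XO YO] by blast
  obtain i j p q where ijpq: "i \<in> Hom C X T" "j \<in> Hom C Y T" "p \<in> Hom C T X" "q \<in> Hom C T Y"
      and eq: "p \<cdot> i = Id C X" "q \<cdot> j = Id C Y" "p \<cdot> j = ZeroA C Y X" "q \<cdot> i = ZeroA C X Y"
      and sum: "AddA C (i \<cdot> p) (j \<cdot> q) = Id C T"
    by (rule direct_sumE[OF T])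
  have TO: "T \<in> Obj C" using hom_obj[OF ijpq(1)] by simp
  have fp: "f \<cdot> p \<in> Hom C T Z" and eqq: "e \<cdot> q \<in> Hom C T Z" using cmp_hom ijpq f e by blast+
  define \<phi> where "\<phi> = diff_arr (e \<cdot> q) (f \<cdot> p)"
  have \<phi>: "\<phi> \<in> Hom C T Z" unfolding \<phi>_def using diff_hom[OF eqq fp] .
  have \<phi>j: "\<phi> \<cdot> j = e"
  proof -
    have "\<phi> \<cdot> j = diff_arr (e \<cdot> (q \<cdot> j)) (f \<cdot> (p \<cdot> j))"
      unfolding \<phi>_def
        using cmp_diff_left[OF ijpq(2) eqq fp] cmp_assoc[OF ijpq(2,4) e] cmp_assoc[OF ijpq(2,3) f] by simp
    also have "\<dots> = diff_arr e (ZeroA C Y Z)"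
      unfolding eq using cmp_id_right[OF e] cmp_zero_right[OF f YO] by simp
    also have "\<dots> = e"
      using diff_diff[OF e e] diff_self[OF e] by simp
    finally show ?thesis .
  qed
  have \<phi>epi: "epi_arr C \<phi>" using epi_factor[OF _ ijpq(2) \<phi>] \<phi>j epi by simp
  obtain L k where k: "k \<in> Hom C L T" "mono_arr C k" "\<phi> \<cdot> k = ZeroA C L Z"
    and univ: "\<forall>W. \<forall>g\<in>Hom C W T. \<phi> \<cdot> g = ZeroA C W Z \<longrightarrow> (\<exists>h\<in>Hom C W L. k \<cdot> h = g)"
    and couniv: "\<forall>W. \<forall>g\<in>Hom C T W. g \<cdot> k = ZeroA C L W \<longrightarrow> (\<exists>h\<in>Hom C Z W. h \<cdot> \<phi> = g)"
    using ker_ex[OF \<phi>] \<phi>epi by blast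
  have LO: "L \<in> Obj C" using hom_obj[OF k(1)] by simp
  let ?a = "p \<cdot> k" and ?b = "q \<cdot> k"
  have a: "?a \<in> Hom C L X" and b: "?b \<in> Hom C L Y" using cmp_hom[OF k(1)] ijpq by blast+
  have \<phi>g: "\<phi> \<cdot> g = diff_arr (e \<cdot> (q \<cdot> g)) (f \<cdot> (p \<cdot> g))" if g: "g \<in> Hom C W T" for W g
    unfolding \<phi>_def
      using cmp_diff_left[OF g eqq fp] cmp_assoc[OF g ijpq(4) e] cmp_assoc[OF g ijpq(3) f] by simp
  have "f \<cdot> ?a = e \<cdot> ?b"
    using \<phi>g[OF k(1)] k(3) diff_zero_iff[OF cmp_hom[OF b e] cmp_hom[OF a f]] by simp
  \<comment> \<open>If \<open>g \<cdot> ?a\<close> is zero, then \<open>g \<cdot> p\<close> factors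
    through \<open>\<phi>\<close>. Restricted to the summand \<open>Y\<close>, where
    \<open>\<phi>\<close> is the epimorphism \<open>e\<close> and \<open>p\<close> is zero, this
    shows that the factor vanishes, and so does \<open>g\<close>.\<close>
  moreover have "epi_arr C ?a"
  proof (rule epi_zeroI[OF a])
    fix W g assume g: "g \<in> Hom C X W" and ga: "g \<cdot> ?a = ZeroA C L W"
    have WO: "W \<in> Obj C" using hom_obj[OF g] by simp
    have gp: "g \<cdot> p \<in> Hom C T W" using cmp_hom[OF ijpq(3) g] .
    have "(g \<cdot> p) \<cdot> k = ZeroA C L W" using ga cmp_assoc[OF k(1) ijpq(3) g] by simp
    then obtain h where h: "h \<in> Hom C Z W" "h \<cdot> \<phi> = g \<cdot> p" using couniv gp by blast
    have "h \<cdot> e = (g \<cdot> p) \<cdot> j" using h cmp_assoc[OF ijpq(2) \<phi> h(1)] \<phi>j by simp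
    also have "\<dots> = ZeroA C Y W" using cmp_assoc[OF ijpq(2,3) g] eq cmp_zero_right[OF g YO] by simp
    finally have "h = ZeroA C Z W" by (rule epi_zeroD[OF epi e h(1)])
    then have "g \<cdot> p = ZeroA C T W" using h(2) cmp_zero_left[OF \<phi> WO] by simp
    then have "(g \<cdot> p) \<cdot> i = ZeroA C X W" using cmp_zero_left[OF ijpq(1) WO] by simp
    then show "g = ZeroA C X W" using cmp_assoc[OF ijpq(1,3) g] eq cmp_id_right[OF g] by simp
  qed
  moreover have "\<exists>u\<in>Hom C W L. ?a \<cdot> u = g \<and> ?b \<cdot> u = h"
    if g: "g \<in> Hom C W X" and h: "h \<in> Hom C W Y" and fe: "f \<cdot> g = e \<cdot> h" for W g h
  proof -
    obtain s where s: "s \<in> Hom C W T" "p \<cdot> s = g" "q \<cdot> s = h" by (rule pair_exists[OF ijpq eq g h]) 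
    have "\<phi> \<cdot> s = ZeroA C W Z" using \<phi>g[OF s(1)] s fe diff_self[OF cmp_hom[OF h e]] by simp
    then obtain u where u: "u \<in> Hom C W L" "k \<cdot> u = s" using univ s(1) by blast
    then show ?thesis using cmp_assoc[OF u(1) k(1) ijpq(3)] cmp_assoc[OF u(1) k(1) ijpq(4)] s by auto
  qed
  moreover have "u = ZeroA C W L"
    if u: "u \<in> Hom C W L" and au: "?a \<cdot> u = ZeroA C W X" and bu: "?b \<cdot> u = ZeroA C W Y" for W u
  proof -
    have WO: "W \<in> Obj C" using hom_obj[OF u] by simp
    have ku: "k \<cdot> u \<in> Hom C W T" using cmp_hom[OF u k(1)] .
    have "k \<cdot> u = AddA C (i \<cdot> (p \<cdot> (k \<cdot> u))) (j \<cdot> (q \<cdot> (k \<cdot> u)))"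
      using direct_sum_expand_left[OF ijpq sum ku] by simp
    also have "\<dots> = AddA C (ZeroA C W T) (ZeroA C W T)"
      using au bu cmp_assoc[OF u k(1) ijpq(3)] cmp_assoc[OF u k(1) ijpq(4)]
        cmp_zero_right[OF ijpq(1) WO] cmp_zero_right[OF ijpq(2) WO] by simp
    also have "\<dots> = ZeroA C W T" using add_zero zero_hom[OF WO TO] by blast
    finally show ?thesis using mono_zeroD[OF k(2,1) u] by simp
  qed
  ultimately show ?thesis using that[OF T k(1,2) a _ b] by blast
qed

end

section \<open>Minimal objects outside a topologizing subcategory\<close>

text \<open>The hypotheses concern proper subobjects and quotients of \<open>N\<close> instead of
  all objects of smaller dimension. So the locale fits an object that is minimal in the whole
  category as well as one that is minimal inside a second topologizing subcategory.\<close>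

locale minimal_nonmember = abelian_category_with_length C d
  for C :: "('k::field, 'o, 'a, 'z) lincat_scheme" (structure) and d +
  fixes S :: "'o set" and N :: 'o
  assumes S_top: "S \<in> Topologizing C"
    and N_obj: "N \<in> Obj C" and N_notin: "N \<notin> S"
    and N_sub: "i \<in> Hom C L N \<Longrightarrow> mono_arr C i \<Longrightarrow> d L < d N \<Longrightarrow> L \<in> S"
    and N_quot: "e \<in> Hom C N L \<Longrightarrow> epi_arr C e \<Longrightarrow> d L < d N \<Longrightarrow> L \<in> S"
begin

lemma N_nonzero: "\<not> zero_object C N"
  using N_notin topologizing_zero[OF S_top] by blast

text \<open>\<open>N'\<close> is a proper subobject of largest dimension. For \<open>Y\<close> in
  \<open>S\<close>, the image of the sum of \<open>Y\<close> and \<open>N'\<close> in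
  \<open>N\<close> is a quotient of an object of \<open>S\<close>, hence not all of
  \<open>N\<close>; by maximality it is no larger than \<open>N'\<close>, so every arrow from
  \<open>S\<close> lands in \<open>N'\<close>.\<close>

lemma radical_exists:
  obtains N' n where "n \<in> Hom C N' N" "mono_arr C n" "N' \<in> S"
    "\<And>Z f. Z \<in> S \<Longrightarrow> f \<in> Hom C Z N \<Longrightarrow> \<exists>f'\<in>Hom C Z N'. n \<cdot> f' = f"
proof -
  define P where "P = (\<lambda>(L, i). i \<in> Hom C L N \<and> mono_arr C i \<and> d L < d N)"
  obtain Z where Z: "zero_object C Z" using zero_ex by blast
  then have ZO: "Z \<in> Obj C" by (simp add: zero_object_def)
  have z: "ZeroA C Z N \<in> Hom C Z N" "mono_arr C (ZeroA C Z N)"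
    using zero_hom[OF ZO N_obj] zero_dim_mono[OF Z N_obj] by auto
  \<comment> \<open>\<open>N\<close> is nonzero because \<open>S\<close> contains the zero objects,
    so there is a proper subobject to start from.\<close>
  have "\<not> iso_arr C (ZeroA C Z N)" using iso_zero_object(2)[OF _ z(1)] N_nonzero by blast
  then have "P (Z, ZeroA C Z N)" using mono_dim_less[OF z] z by (simp add: P_def)
  moreover have "\<forall>x. P x \<longrightarrow> d (fst x) < d N" by (auto simp: P_def)
  ultimately obtain x where x: "P x" "\<forall>x'. P x' \<longrightarrow> d (fst x') \<le> d (fst x)"
    using ex_has_greatest_nat[of P _ "\<lambda>x. d (fst x)" "d N"] by blast
  obtain N' n where "x = (N', n)" by (cases x)
  then have n: "n \<in> Hom C N' N" "mono_arr C n" "d N' < d N"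
    and max: "\<And>L i. i \<in> Hom C L N \<Longrightarrow> mono_arr C i \<Longrightarrow> d L < d N \<Longrightarrow> d L \<le> d N'"
    using x by (auto simp: P_def)
  have N'S: "N' \<in> S" using N_sub[OF n] .
  have "\<exists>f'\<in>Hom C Y N'. n \<cdot> f' = f" if Y: "Y \<in> S" and f: "f \<in> Hom C Y N" for Y f
  proof -
    obtain T where T: "is_direct_sum C Y N' T" using sum_ex hom_obj[OF f] hom_obj[OF n(1)] by blast
    obtain i j p q where ijpq: "i \<in> Hom C Y T" "j \<in> Hom C N' T" "p \<in> Hom C T Y" "q \<in> Hom C T N'"
      and eq: "p \<cdot> i = Id C Y" "q \<cdot> j = Id C N'" "p \<cdot> j = ZeroA C N' Y" "q \<cdot> i = ZeroA C Y N'"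
      by (rule direct_sumE[OF T])
    obtain h where h: "h \<in> Hom C T N" "h \<cdot> i = f" "h \<cdot> j = n" by (rule copair_exists[OF ijpq eq f n(1)])
    obtain I e m where em: "e \<in> Hom C T I" "epi_arr C e" "m \<in> Hom C I N" "mono_arr C m" "m \<cdot> e = h"
      using image_ex[OF h(1)] by blast
    have TS: "T \<in> S" using topologizing_sum[OF S_top Y N'S T] .
    have "d I < d N"
    proof (rule ccontr)
      assume "\<not> d I < d N"
      then have "iso_arr C m" using mono_dim_less[OF em(3,4)] by blast
      then have "epi_arr C h" using epi_cmp[OF em(2) iso_epi em(1,3)] em(5) by simp
      then show False using topologizing_quot[OF S_top h(1) _ TS] N_notin by blast
    qed
    then have le: "d I \<le> d N'" using max em by blast
    have ej: "e \<cdot> j \<in> Hom C N' I" using cmp_hom[OF ijpq(2) em(1)] .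
    have mej: "m \<cdot> (e \<cdot> j) = n" using cmp_assoc[OF ijpq(2) em(1,3)] em(5) h(3) by simp
    have "mono_arr C (e \<cdot> j)" using mono_factor[OF _ ej em(3)] mej n(2) by simp
    then have "iso_arr C (e \<cdot> j)" using mono_dim_less[OF ej] le by force
    then obtain v where v: "v \<in> Hom C I N'" "(e \<cdot> j) \<cdot> v = Id C I" using isoE[OF _ ej] by metis
    have ei: "e \<cdot> i \<in> Hom C Y I" using cmp_hom[OF ijpq(1) em(1)] .
    have "n \<cdot> (v \<cdot> (e \<cdot> i)) = (m \<cdot> (e \<cdot> j)) \<cdot> (v \<cdot> (e \<cdot> i))" using mej by simp
    also have "\<dots> = m \<cdot> (((e \<cdot> j) \<cdot> v) \<cdot> (e \<cdot> i))"
      using cmp_assoc[OF cmp_hom[OF ei v(1)] ej em(3)] cmp_assoc[OF ei v(1) ej] by simp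
    also have "\<dots> = f" unfolding v(2)
      using cmp_id_left[OF ei] cmp_assoc[OF ijpq(1) em(1,3)] em(5) h(2) by simp
    finally show ?thesis using cmp_hom[OF ei v(1)] by blast
  qed
  then show ?thesis using that n(1,2) N'S by blast
qed

text \<open>\<open>N''\<close> is a proper quotient of largest dimension. Its kernel
  \<open>Y\<close> is simple: dividing \<open>N\<close> by a nonzero subobject \<open>W\<close> of
  \<open>Y\<close> gives a proper quotient that still maps onto \<open>N''\<close>, hence is
  isomorphic to it by maximality, and this forces \<open>W\<close> to be all of
  \<open>Y\<close>.\<close>

lemma coradical_exists:
  obtains N'' y Y i where "y \<in> Hom C N N''" "epi_arr C y" "N'' \<in> S"
    "\<And>Z f. Z \<in> S \<Longrightarrow> f \<in> Hom C N Z \<Longrightarrow> \<exists>f'\<in>Hom C N'' Z. f' \<cdot> y = f"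
    "i \<in> Hom C Y N" "mono_arr C i" "y \<cdot> i = ZeroA C Y N''" "\<not> zero_object C Y"
    "\<And>W g. g \<in> Hom C W N \<Longrightarrow> y \<cdot> g = ZeroA C W N'' \<Longrightarrow> \<exists>h\<in>Hom C W Y. i \<cdot> h = g"
    "\<And>W w. w \<in> Hom C W Y \<Longrightarrow> mono_arr C w \<Longrightarrow> iso_arr C w \<or> zero_object C W"
proof -
  define P where "P = (\<lambda>(L, e). e \<in> Hom C N L \<and> epi_arr C e \<and> d L < d N)"
  obtain Z where Z: "zero_object C Z" using zero_ex by blast
  then have ZO: "Z \<in> Obj C" by (simp add: zero_object_def)
  have z: "ZeroA C N Z \<in> Hom C N Z" "epi_arr C (ZeroA C N Z)"
    using zero_hom[OF N_obj ZO] zero_dim_epi[OF Z N_obj] by auto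
  have "\<not> iso_arr C (ZeroA C N Z)" using iso_zero_object(1)[OF _ z(1)] N_nonzero by blast
  then have "P (Z, ZeroA C N Z)" using epi_dim_less[OF z] z by (simp add: P_def)
  moreover have "\<forall>x. P x \<longrightarrow> d (fst x) < d N" by (auto simp: P_def)
  ultimately obtain x where x: "P x" "\<forall>x'. P x' \<longrightarrow> d (fst x') \<le> d (fst x)"
    using ex_has_greatest_nat[of P _ "\<lambda>x. d (fst x)" "d N"] by blast
  obtain N'' y where "x = (N'', y)" by (cases x)
  then have y: "y \<in> Hom C N N''" "epi_arr C y" "d N'' < d N"
    and max: "\<And>L e. e \<in> Hom C N L \<Longrightarrow> epi_arr C e \<Longrightarrow> d L < d N \<Longrightarrow> d L \<le> d N''"
    using x by (auto simp: P_def)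
  have N''S: "N'' \<in> S" using N_quot[OF y] .
  have fac: "\<exists>f'\<in>Hom C N'' Y. f' \<cdot> y = f" if Y: "Y \<in> S" and f: "f \<in> Hom C N Y" for Y f
  proof -
    obtain T where T: "is_direct_sum C N'' Y T" using sum_ex hom_obj[OF f] hom_obj[OF y(1)] by blast
    show ?thesis
    proof (rule factor_through_max_quotient[OF y(1,2) f T])
      fix I e m assume e: "e \<in> Hom C N I" "epi_arr C e" and m: "m \<in> Hom C I T" "mono_arr C m"
      have "I \<in> S" using topologizing_sub[OF S_top m topologizing_sum[OF S_top N''S Y T]] .
      then have "\<not> iso_arr C e" using N_notin iso_mono topologizing_sub[OF S_top e(1)] by blast
      then show "d I \<le> d N''" using max e epi_dim_less[OF e] by blast
    qed
  qed
  obtain Y i where i: "i \<in> Hom C Y N" "mono_arr C i" "y \<cdot> i = ZeroA C Y N''"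
    and univ: "\<forall>W. \<forall>g\<in>Hom C W N. y \<cdot> g = ZeroA C W N'' \<longrightarrow> (\<exists>h\<in>Hom C W Y. i \<cdot> h = g)"
    using ker_ex[OF y(1)] by blast
  have YO: "Y \<in> Obj C" using hom_obj[OF i(1)] by simp
  have nz: "\<not> zero_object C Y"
  proof
    assume z: "zero_object C Y"
    have "mono_arr C y"
    proof (rule mono_zeroI[OF y(1)])
      fix W g assume g: "g \<in> Hom C W N" and "y \<cdot> g = ZeroA C W N''"
      then obtain h where h: "h \<in> Hom C W Y" "i \<cdot> h = g" using univ by blast
      then show "g = ZeroA C W N"
        using zero_object_hom(1)[OF z h(1)] cmp_zero_right[OF i(1) hom_obj(1)[OF g]] by simp
    qed
    then show False using mono_dim[OF y(1)] y(3) by simp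
  qed
  have simple: "iso_arr C w \<or> zero_object C W" if w: "w \<in> Hom C W Y" "mono_arr C w" for W w
  proof -
    have iw: "i \<cdot> w \<in> Hom C W N" "mono_arr C (i \<cdot> w)"
      using cmp_hom[OF w(1) i(1)] mono_cmp[OF w(2) i(2) w(1) i(1)] by auto
    obtain Q c where c: "c \<in> Hom C N Q" "epi_arr C c" "c \<cdot> (i \<cdot> w) = ZeroA C W Q"
      and cuniv: "\<forall>V. \<forall>g\<in>Hom C N V. g \<cdot> (i \<cdot> w) = ZeroA C W V \<longrightarrow> (\<exists>h\<in>Hom C Q V. h \<cdot> c = g)"
      and cker: "\<forall>V. \<forall>g\<in>Hom C V N. c \<cdot> g = ZeroA C V Q \<longrightarrow> (\<exists>h\<in>Hom C V W. (i \<cdot> w) \<cdot> h = g)"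
      using coker_ex[OF iw(1)] iw(2) by blast
    have WO: "W \<in> Obj C" using hom_obj[OF w(1)] by simp
    show ?thesis
    proof (cases "iso_arr C c")
      case True
      have "i \<cdot> w = ZeroA C W N" using mono_zeroD[OF iso_mono[OF True] c(1) iw(1) c(3)] .
      then have "w = ZeroA C W Y" using mono_zeroD[OF i(2,1) w(1)] by simp
      then have "Id C W = ZeroA C W W"
        using mono_zeroD[OF w(2,1) id_hom[OF WO]] cmp_id_right[OF w(1)] by simp
      then show ?thesis using zero_object_iff WO by simp
    next
      case False
      then have le: "d Q \<le> d N''" using max c epi_dim_less[OF c(1,2)] by blast
      have "y \<cdot> (i \<cdot> w) = ZeroA C W N''"
        using cmp_assoc[OF w(1) i(1) y(1)] i(3) cmp_zero_left[OF w(1) hom_obj(2)[OF y(1)]] by simp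
      then obtain g where g: "g \<in> Hom C Q N''" "g \<cdot> c = y" using cuniv y(1) by blast
      have "epi_arr C g" using epi_factor[OF _ c(1) g(1)] g(2) y(2) by simp
      then have "iso_arr C g" using epi_dim_less[OF g(1)] le by force
      then have gm: "mono_arr C g" by (rule iso_mono)
      have ci: "c \<cdot> i \<in> Hom C Y Q" using cmp_hom[OF i(1) c(1)] .
      have "g \<cdot> (c \<cdot> i) = ZeroA C Y N''" using cmp_assoc[OF i(1) c(1) g(1)] g(2) i(3) by simp
      then have "c \<cdot> i = ZeroA C Y Q" using mono_zeroD[OF gm g(1) ci] by simp
      then obtain v where v: "v \<in> Hom C Y W" "(i \<cdot> w) \<cdot> v = i" using cker i(1) by blast
      have "i \<cdot> (w \<cdot> v) = i \<cdot> Id C Y" using v cmp_assoc[OF v(1) w(1) i(1)] cmp_id_right[OF i(1)] by simp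
      then have "w \<cdot> v = Id C Y" using monoD[OF i(2,1) cmp_hom[OF v(1) w(1)] id_hom[OF YO]] by simp
      then have "epi_arr C w" using split_epi[OF w(1) v(1)] by simp
      then show ?thesis using mono_epi_iso w by blast
    qed
  qed
  show ?thesis
  proof (rule that[OF y(1,2) N''S _ i nz])
    show "\<exists>f'\<in>Hom C N'' Z. f' \<cdot> y = f" if "Z \<in> S" "f \<in> Hom C N Z" for Z f using fac[OF that] .
    show "\<exists>h\<in>Hom C W Y. i \<cdot> h = g" if "g \<in> Hom C W N" "y \<cdot> g = ZeroA C W N''" for W g using univ that by blast
    show "iso_arr C w \<or> zero_object C W" if "w \<in> Hom C W Y" "mono_arr C w" for W w using simple[OF that] .
  qed
qed

end

context abelian_category_with_length
begin

text \<open>Schur's lemma: the image of \<open>f\<close> minus an eigenvalue is zero or all of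
  \<open>Y\<close>, and in the second case the difference would be invertible.\<close>

lemma simple_endo_scalar:
  assumes simple: "\<And>W w. w \<in> Hom C W Y \<Longrightarrow> mono_arr C w \<Longrightarrow> iso_arr C w \<or> zero_object C W"
    and nz: "\<not> zero_object C Y" and f: "f \<in> Hom C Y Y"
  obtains c where "f = ScaleA C c (Id C Y)"
proof -
  have YO: "Y \<in> Obj C" using hom_obj[OF f] by simp
  obtain c where c: "\<not> iso_arr C (diff_arr f (ScaleA C c (Id C Y)))" using eigen_ex[OF f nz] by blast
  let ?g = "diff_arr f (ScaleA C c (Id C Y))"
  have s: "ScaleA C c (Id C Y) \<in> Hom C Y Y" using scale_hom[OF id_hom[OF YO] id_hom[OF YO]] .
  have g: "?g \<in> Hom C Y Y" using diff_hom[OF f s] .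
  obtain I e m where em: "e \<in> Hom C Y I" "epi_arr C e" "m \<in> Hom C I Y" "mono_arr C m" "m \<cdot> e = ?g"
    using image_ex[OF g] by blast
  have "zero_object C I"
  proof (rule ccontr)
    assume "\<not> zero_object C I"
    then have m: "iso_arr C m" using simple[OF em(3,4)] by blast
    then have "epi_arr C ?g" using epi_cmp[OF em(2) iso_epi em(1,3)] em(5) by simp
    then have "iso_arr C ?g" using epi_dim_iso[OF g] by simp
    then show False using c by blast
  qed
  then have "?g = ZeroA C Y Y"
    using zero_object_hom(1)[OF _ em(1)] em(5) cmp_zero_right[OF em(3) YO] by simp
  then have "f = ScaleA C c (Id C Y)" using diff_zero_iff[OF f s] by simp
  then show ?thesis by (rule that)
qed

lemma simple_epi:
  assumes simple: "\<And>W w. w \<in> Hom C W Y \<Longrightarrow> mono_arr C w \<Longrightarrow> iso_arr C w \<or> zero_object C W"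
    and f: "f \<in> Hom C K Y" and nz: "f \<noteq> ZeroA C K Y"
  shows "epi_arr C f"
proof -
  obtain I e m where em: "e \<in> Hom C K I" "epi_arr C e" "m \<in> Hom C I Y" "mono_arr C m" "m \<cdot> e = f"
    using image_ex[OF f] by blast
  have "\<not> zero_object C I"
    using zero_object_hom(1)[OF _ em(1)] em(5) cmp_zero_right[OF em(3) hom_obj(1)[OF f]] nz by auto
  then have "iso_arr C m" using simple[OF em(3,4)] by blast
  then show ?thesis using epi_cmp[OF em(2) iso_epi em(1,3)] em(5) by simp
qed

end

section \<open>Extending natural transformations\<close>

context linear_functor
begin

lemma map_zero:
  assumes "X \<in> Obj A" "Y \<in> Obj A"
  shows "Fa (ZeroA A X Y) = ZeroA B (Fo X) (Fo Y)"
proof -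
  have z: "ZeroA A X Y \<in> Hom A X Y" using A.zero_hom[OF assms] .
  show ?thesis
    using map_scale[OF z, of 0] A.scale_0[OF z z] B.scale_0[OF map_hom[OF z] map_hom[OF z]] by simp
qed

lemma map_direct_sum:
  assumes "is_direct_sum A X Y Z"
  shows "is_direct_sum B (Fo X) (Fo Y) (Fo Z)"
proof -
  obtain i j p q where ijpq: "i \<in> Hom A X Z" "j \<in> Hom A Y Z" "p \<in> Hom A Z X" "q \<in> Hom A Z Y"
    and eq: "p \<cdot>\<^bsub>A\<^esub> i = Id A X" "q \<cdot>\<^bsub>A\<^esub> j = Id A Y"
      "p \<cdot>\<^bsub>A\<^esub> j = ZeroA A Y X" "q \<cdot>\<^bsub>A\<^esub> i = ZeroA A X Y"
    and sum: "AddA A (i \<cdot>\<^bsub>A\<^esub> p) (j \<cdot>\<^bsub>A\<^esub> q) = Id A Z"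
    by (rule A.direct_sumE[OF assms])
  have O: "X \<in> Obj A" "Y \<in> Obj A" "Z \<in> Obj A" using A.hom_obj ijpq by blast+
  have "Fa p \<cdot>\<^bsub>B\<^esub> Fa i = Id B (Fo X)" using map_cmp[OF ijpq(1,3)] eq map_id[OF O(1)] by simp
  moreover have "Fa q \<cdot>\<^bsub>B\<^esub> Fa j = Id B (Fo Y)"
    using map_cmp[OF ijpq(2,4)] eq map_id[OF O(2)] by simp
  moreover have "Fa p \<cdot>\<^bsub>B\<^esub> Fa j = ZeroA B (Fo Y) (Fo X)"
    using map_cmp[OF ijpq(2,3)] eq map_zero[OF O(2,1)] by simp
  moreover have "Fa q \<cdot>\<^bsub>B\<^esub> Fa i = ZeroA B (Fo X) (Fo Y)"
    using map_cmp[OF ijpq(1,4)] eq map_zero[OF O(1,2)] by simp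
  moreover have "AddA B (Fa i \<cdot>\<^bsub>B\<^esub> Fa p) (Fa j \<cdot>\<^bsub>B\<^esub> Fa q) = Id B (Fo Z)"
    using map_add[OF A.cmp_hom[OF ijpq(3,1)] A.cmp_hom[OF ijpq(4,2)]] map_cmp[OF ijpq(3,1)] map_cmp[OF ijpq(4,2)]
      sum map_id[OF O(3)] by simp
  ultimately show ?thesis
    unfolding is_direct_sum_def
      using map_obj O map_hom[OF ijpq(1)] map_hom[OF ijpq(2)] map_hom[OF ijpq(3)] map_hom[OF ijpq(4)]
    by blast
qed

end

section \<open>Natural families and exact functors with projective values\<close>

text \<open>Natural transformations from an endofunctor, restricted to the full subcategory on
  \<open>S\<close>, to the inclusion of that subcategory. The family is a total function whose
  values outside \<open>S\<close> are arbitrary.\<close>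

definition natural_on ::
  "('o, 'a, 'z) category_scheme \<Rightarrow> ('o \<Rightarrow> 'o) \<Rightarrow> ('a \<Rightarrow> 'a) \<Rightarrow> 'o set \<Rightarrow> ('o \<Rightarrow> 'a) \<Rightarrow> bool" where
  "natural_on C Fo Fa S t \<longleftrightarrow> (\<forall>X\<in>S. t X \<in> Hom C (Fo X) X) \<and>
     (\<forall>X\<in>S. \<forall>Y\<in>S. \<forall>f\<in>Hom C X Y. f \<cdot>\<^bsub>C\<^esub> t X = t Y \<cdot>\<^bsub>C\<^esub> Fa f)"

lemma natural_onD:
  assumes "natural_on C Fo Fa S t"
  shows "X \<in> S \<Longrightarrow> t X \<in> Hom C (Fo X) X"
    and "X \<in> S \<Longrightarrow> Y \<in> S \<Longrightarrow> f \<in> Hom C X Y \<Longrightarrow> f \<cdot>\<^bsub>C\<^esub> t X = t Y \<cdot>\<^bsub>C\<^esub> Fa f"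
  using assms unfolding natural_on_def by blast+

text \<open>What the extension argument uses about tensoring with a projective object. In the
  application \<open>F_retract\<close> combines preservation of monomorphisms with the splitting
  provided by the projective value at a cokernel.\<close>

locale exact_projective_functor = abelian_category_with_length C d + F: linear_functor C C Fo Fa
  for C :: "('k::field, 'o, 'a, 'z) lincat_scheme" (structure) and d Fo Fa +
  assumes F_right_exact: "right_exact C C Fo Fa"
    and F_projective: "X \<in> Obj C \<Longrightarrow> projective_object C (Fo X)"
    and F_retract: "j \<in> Hom C X Y \<Longrightarrow> mono_arr C j \<Longrightarrow> \<exists>r\<in>Hom C (Fo Y) (Fo X). r \<cdot> Fa j = Id C (Fo X)"
begin

abbreviation "nat_on \<equiv> natural_on C Fo Fa"

lemma epi_is_cokernel:
  assumes e: "e \<in> Hom C X Y" and epi: "epi_arr C e"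
  obtains K k where "k \<in> Hom C K X" "mono_arr C k" "e \<cdot> k = ZeroA C K Y"
    "is_cokernel C k e" "\<And>W g. g \<in> Hom C W X \<Longrightarrow> e \<cdot> g = ZeroA C W Y \<Longrightarrow> \<exists>h\<in>Hom C W K. k \<cdot> h = g"
proof -
  obtain K k where k: "k \<in> Hom C K X" "mono_arr C k" "e \<cdot> k = ZeroA C K Y"
    and u: "\<forall>W. \<forall>g\<in>Hom C W X. e \<cdot> g = ZeroA C W Y \<longrightarrow> (\<exists>h\<in>Hom C W K. k \<cdot> h = g)"
    and univ: "\<forall>W. \<forall>g\<in>Hom C X W. g \<cdot> k = ZeroA C K W \<longrightarrow> (\<exists>h\<in>Hom C Y W. h \<cdot> e = g)"
    using ker_ex[OF e] epi by blast
  have "is_cokernel C k e" by (rule is_cokernelI[OF k(1) e k(3) epi]) (use univ in blast)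
  then show ?thesis using that[OF k] u by blast
qed

lemma F_epi:
  assumes e: "e \<in> Hom C X Y" and epi: "epi_arr C e"
  shows "epi_arr C (Fa e)"
proof -
  obtain K k where "is_cokernel C k e" by (rule epi_is_cokernel[OF assms])
  then have "is_cokernel C (Fa k) (Fa e)" using F_right_exact by (simp add: right_exact_def)
  then show ?thesis by (rule is_cokernel_epi)
qed

text \<open>Naturality forces the values on quotients of objects on which a natural family is known;
  independence of the chosen presentation is naturality on a pullback.\<close>

lemma extend_to_quotients:
  assumes L: "\<L> \<subseteq> Obj C" and nat: "nat_on \<L> w"
    and sub: "\<And>X Y i. i \<in> Hom C X Y \<Longrightarrow> mono_arr C i \<Longrightarrow> Y \<in> \<L> \<Longrightarrow> X \<in> \<L>"
    and sum: "\<And>X Y Z. X \<in> \<L> \<Longrightarrow> Y \<in> \<L> \<Longrightarrow> is_direct_sum C X Y Z \<Longrightarrow> Z \<in> \<L>"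
    and zero: "\<And>Z. zero_object C Z \<Longrightarrow> Z \<in> \<L>"
  defines "Q \<equiv> {E. \<exists>L\<in>\<L>. \<exists>e\<in>Hom C L E. epi_arr C e}"
  shows "Q \<in> Topologizing C" "\<exists>v. nat_on Q v \<and> (\<forall>X\<in>\<L>. v X = w X)" "\<L> \<subseteq> Q"
proof -
  show LQ: "\<L> \<subseteq> Q"
  proof
    fix X assume X: "X \<in> \<L>"
    then have XO: "X \<in> Obj C" using L by blast
    show "X \<in> Q" unfolding Q_def using X id_hom[OF XO] id_epi[OF XO] by blast
  qed
  show "Q \<in> Topologizing C"
    unfolding Topologizing_def
  proof (intro CollectI conjI allI ballI impI)
    show "Q \<subseteq> Obj C" unfolding Q_def using hom_obj by blast
    show "Z \<in> Q" if "zero_object C Z" for Z using zero[OF that] LQ by blast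
  next
    fix X Y Z assume X: "X \<in> Q" and Y: "Y \<in> Q" and Z: "is_direct_sum C X Y Z"
    obtain L1 e1 where 1: "L1 \<in> \<L>" "e1 \<in> Hom C L1 X" "epi_arr C e1" using X unfolding Q_def by blast
    obtain L2 e2 where 2: "L2 \<in> \<L>" "e2 \<in> Hom C L2 Y" "epi_arr C e2" using Y unfolding Q_def by blast
    obtain T where T: "is_direct_sum C L1 L2 T" using sum_ex 1 2 L by blast
    obtain h where h: "h \<in> Hom C T Z" "epi_arr C h"
      by (rule direct_sum_epi[OF T Z 1(2,3) 2(2,3)])
    then show "Z \<in> Q" unfolding Q_def using sum[OF 1(1) 2(1) T] h by blast
  next
    fix X Y assume X: "X \<in> Q" and "is_subquotient C Y X"
    then obtain m e where me: "mono_arr C m" "Cod C m = X" "epi_arr C e" "Dom C e = Dom C m" "Cod C e = Y"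
      unfolding is_subquotient_def by blast
    define W where "W = Dom C m"
    have m: "m \<in> Hom C W X" and e: "e \<in> Hom C W Y"
      using me by (auto simp: Hom_iff W_def mono_arr_def epi_arr_def)
    obtain L1 e1 where 1: "L1 \<in> \<L>" "e1 \<in> Hom C L1 X" "epi_arr C e1" using X unfolding Q_def by blast
    \<comment> \<open>A subobject of a quotient of \<open>L1\<close> is a quotient of a subobject of
      \<open>L1\<close>, namely of the pullback along \<open>e1\<close>.\<close>
    obtain L2 T k a b where pb: "a \<in> Hom C L2 W" "epi_arr C a" "b \<in> Hom C L2 L1" "m \<cdot> a = e1 \<cdot> b"
      and jm: "\<forall>V. \<forall>u\<in>Hom C V L2. a \<cdot> u = ZeroA C V W \<longrightarrow> b \<cdot> u = ZeroA C V L1 \<longrightarrow> u = ZeroA C V L2"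
      using pullback_exists[OF m 1(2,3)] by metis
    have "mono_arr C b"
    proof (rule mono_zeroI[OF pb(3)])
      fix V u assume u: "u \<in> Hom C V L2" and bu: "b \<cdot> u = ZeroA C V L1"
      have "m \<cdot> (a \<cdot> u) = e1 \<cdot> (b \<cdot> u)" using cmp_assoc[OF u pb(1) m] cmp_assoc[OF u pb(3) 1(2)] pb(4) by simp
      also have "\<dots> = ZeroA C V X" unfolding bu using cmp_zero_right[OF 1(2)] hom_obj[OF u] by simp
      finally have "a \<cdot> u = ZeroA C V W" by (rule mono_zeroD[OF me(1) m cmp_hom[OF u pb(1)]])
      then show "u = ZeroA C V L2" using jm u bu by blast
    qed
    then have "L2 \<in> \<L>" using sub[OF pb(3) _ 1(1)] by blast
    moreover have "epi_arr C (e \<cdot> a)" using epi_cmp[OF pb(2) me(3) pb(1) e] .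
    ultimately show "Y \<in> Q" unfolding Q_def using cmp_hom[OF pb(1) e] by blast
  qed
  have natL: "\<And>X. X \<in> \<L> \<Longrightarrow> w X \<in> Hom C (Fo X) X"
    "\<And>X Y f. X \<in> \<L> \<Longrightarrow> Y \<in> \<L> \<Longrightarrow> f \<in> Hom C X Y \<Longrightarrow> f \<cdot> w X = w Y \<cdot> Fa f"
    using nat unfolding natural_on_def by blast+
  \<comment> \<open>Right exactness makes \<open>Fa e\<close> a cokernel of \<open>Fa k\<close>. The
    composite \<open>e \<cdot> w L1\<close> kills \<open>Fa k\<close> by naturality of
    \<open>w\<close> on the kernel, which belongs to \<open>\<L>\<close>.\<close>
  have ex: "\<exists>v\<in>Hom C (Fo E) E. v \<cdot> Fa e = e \<cdot> w L1"
    if L1: "L1 \<in> \<L>" and e: "e \<in> Hom C L1 E" and epi: "epi_arr C e" for E L1 e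
  proof -
    obtain K k where k: "k \<in> Hom C K L1" "mono_arr C k" "e \<cdot> k = ZeroA C K E" "is_cokernel C k e"
      by (rule epi_is_cokernel[OF e epi])
    have KL: "K \<in> \<L>" using sub[OF k(1,2) L1] .
    have EO: "E \<in> Obj C" and KO: "K \<in> Obj C" using hom_obj[OF k(1)] hom_obj[OF e] by auto
    have ck: "is_cokernel C (Fa k) (Fa e)" using F_right_exact k(4) by (simp add: right_exact_def)
    have ew: "e \<cdot> w L1 \<in> Hom C (Fo L1) E" using cmp_hom[OF natL(1)[OF L1] e] .
    have "(e \<cdot> w L1) \<cdot> Fa k = e \<cdot> (k \<cdot> w K)"
      using cmp_assoc[OF F.map_hom[OF k(1)] natL(1)[OF L1] e] natL(2)[OF KL L1 k(1)] by simp
    also have "\<dots> = ZeroA C (Fo K) E"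
      using cmp_assoc[OF natL(1)[OF KL] k(1) e] k(3) cmp_zero_left[OF natL(1)[OF KL] EO] by simp
    finally have 0: "(e \<cdot> w L1) \<cdot> Fa k = ZeroA C (Fo K) E" .
    have "Dom C (Fa k) = Fo K" "Cod C (Fa k) = Fo L1" "Cod C (Fa e) = Fo E"
      using F.map_hom[OF k(1)] F.map_hom[OF e] by (auto simp: Hom_iff)
    then show ?thesis using ck 0 ew EO unfolding is_cokernel_def by metis
  qed
  \<comment> \<open>A value at \<open>E\<close> may come from any presentation;
    \<open>compat\<close> below compares values that stem from different ones.\<close>
  define good
    where "good E v \<longleftrightarrow> v \<in> Hom C (Fo E) E \<and> (\<exists>L1\<in>\<L>. \<exists>e\<in>Hom C L1 E. epi_arr C e \<and> v \<cdot> Fa e = e \<cdot> w L1)" for E v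
  have compat: "f \<cdot> v1 = v2 \<cdot> Fa f"
    if g1: "good E1 v1" and g2: "good E2 v2" and f: "f \<in> Hom C E1 E2" for E1 E2 v1 v2 f
  proof -
    from g1 obtain L1 e1 where 1: "L1 \<in> \<L>" "e1 \<in> Hom C L1 E1" "epi_arr C e1" "v1 \<cdot> Fa e1 = e1 \<cdot> w L1"
      and v1: "v1 \<in> Hom C (Fo E1) E1" unfolding good_def by blast
    from g2 obtain L2 e2 where 2: "L2 \<in> \<L>" "e2 \<in> Hom C L2 E2" "epi_arr C e2" "v2 \<cdot> Fa e2 = e2 \<cdot> w L2"
      and v2: "v2 \<in> Hom C (Fo E2) E2" unfolding good_def by blast
    have fe: "f \<cdot> e1 \<in> Hom C L1 E2" using cmp_hom[OF 1(2) f] .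
    obtain L3 T k a b where T: "is_direct_sum C L1 L2 T" and k: "k \<in> Hom C L3 T" "mono_arr C k"
      and pb: "a \<in> Hom C L3 L1" "epi_arr C a" "b \<in> Hom C L3 L2" "(f \<cdot> e1) \<cdot> a = e2 \<cdot> b"
      using pullback_exists[OF fe 2(2,3)] by metis
    have L3: "L3 \<in> \<L>" using sub[OF k sum[OF 1(1) 2(1) T]] .
    have ea: "e1 \<cdot> a \<in> Hom C L3 E1" "epi_arr C (e1 \<cdot> a)"
      using cmp_hom[OF pb(1) 1(2)] epi_cmp[OF pb(2) 1(3) pb(1) 1(2)] by auto
    note Fea = F.map_hom[OF ea(1)] F_epi[OF ea]
    have Fcmp: "Fa (e1 \<cdot> a) = Fa e1 \<cdot> Fa a" using F.map_cmp[OF pb(1) 1(2)] .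
    have "(f \<cdot> v1) \<cdot> Fa (e1 \<cdot> a) = f \<cdot> ((v1 \<cdot> Fa e1) \<cdot> Fa a)"
      unfolding Fcmp using cmp_assoc[OF Fea(1) v1 f] Fcmp
        cmp_assoc[OF F.map_hom[OF pb(1)] F.map_hom[OF 1(2)] v1] by simp
    also have "\<dots> = f \<cdot> (e1 \<cdot> (w L1 \<cdot> Fa a))"
      unfolding 1(4) using cmp_assoc[OF F.map_hom[OF pb(1)] natL(1)[OF 1(1)] 1(2)] by simp
    also have "w L1 \<cdot> Fa a = a \<cdot> w L3" using natL(2)[OF L3 1(1) pb(1)] by simp
    also have "f \<cdot> (e1 \<cdot> (a \<cdot> w L3)) = ((f \<cdot> e1) \<cdot> a) \<cdot> w L3"
      using cmp_assoc[OF natL(1)[OF L3] pb(1) fe] cmp_assoc[OF cmp_hom[OF natL(1)[OF L3] pb(1)] 1(2) f]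
        by simp
    also have "\<dots> = e2 \<cdot> (b \<cdot> w L3)" unfolding pb(4) using cmp_assoc[OF natL(1)[OF L3] pb(3) 2(2)] by simp
    also have "\<dots> = e2 \<cdot> (w L2 \<cdot> Fa b)" using natL(2)[OF L3 2(1) pb(3)] by simp
    also have "\<dots> = (v2 \<cdot> Fa e2) \<cdot> Fa b"
      unfolding 2(4) using cmp_assoc[OF F.map_hom[OF pb(3)] natL(1)[OF 2(1)] 2(2)] by simp
    also have "\<dots> = v2 \<cdot> Fa (e2 \<cdot> b)"
      using cmp_assoc[OF F.map_hom[OF pb(3)] F.map_hom[OF 2(2)] v2] F.map_cmp[OF pb(3) 2(2)] by simp
    also have "Fa (e2 \<cdot> b) = Fa f \<cdot> Fa (e1 \<cdot> a)"
      unfolding pb(4)[symmetric] using F.map_cmp[OF ea(1) f] cmp_assoc[OF pb(1) 1(2) f] by simp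
    also have "v2 \<cdot> (Fa f \<cdot> Fa (e1 \<cdot> a)) = (v2 \<cdot> Fa f) \<cdot> Fa (e1 \<cdot> a)"
      using cmp_assoc[OF Fea(1) F.map_hom[OF f] v2] by simp
    finally show ?thesis
      by (rule epiD[OF Fea(2,1) cmp_hom[OF v1 f] cmp_hom[OF F.map_hom[OF f] v2]])
  qed
  have "\<exists>v. good E v" if "E \<in> Q" for E
    using that ex unfolding Q_def good_def by blast
  then obtain v where v: "\<And>E. E \<in> Q \<Longrightarrow> good E (v E)" by metis
  have "nat_on Q v"
    unfolding natural_on_def
  proof (intro conjI ballI)
    show "v X \<in> Hom C (Fo X) X" if "X \<in> Q" for X using v[OF that] by (simp add: good_def)
    show "f \<cdot> v X = v Y \<cdot> Fa f" if "X \<in> Q" "Y \<in> Q" "f \<in> Hom C X Y" for X Y f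
      using compat[OF v v] that by blast
  qed
  moreover have "v X = w X" if X: "X \<in> \<L>" for X
  proof -
    have XO: "X \<in> Obj C" using X L by blast
    note w = natL(1)[OF X]
    have F1: "Fa (Id C X) = Id C (Fo X)" using F.map_id[OF XO] .
    have "w X \<cdot> Fa (Id C X) = Id C X \<cdot> w X"
      unfolding F1 using cmp_id_right[OF w] cmp_id_left[OF w] by simp
    then have gw: "good X (w X)" unfolding good_def using w X id_hom[OF XO] id_epi[OF XO] by blast
    have gv: "good X (v X)" using v LQ X by blast
    then have vX: "v X \<in> Hom C (Fo X) X" by (simp add: good_def)
    have "Id C X \<cdot> v X = w X \<cdot> Fa (Id C X)" using compat[OF gv gw id_hom[OF XO]] .
    then show ?thesis unfolding F1 using cmp_id_right[OF w] cmp_id_left[OF vX] by simp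
  qed
  ultimately show "\<exists>v. nat_on Q v \<and> (\<forall>X\<in>\<L>. v X = w X)" by blast
qed

end

section \<open>Extending a natural family by one object\<close>

locale extension_step = exact_projective_functor C d Fo Fa + minimal_nonmember C d S N
  for C :: "('k::field, 'o, 'a, 'z) lincat_scheme" (structure) and d Fo Fa S N +
  fixes t :: "'o \<Rightarrow> 'a"
  assumes t_nat: "natural_on C Fo Fa S t"
begin

text \<open>Naturality against endomorphisms of \<open>N\<close> is not imposed: it comes out of
  \<open>compatible_lift\<close> for \<open>L = N\<close>, where testing with the identity gives
  \<open>w = u\<close>.\<close>

definition compatible :: "'a \<Rightarrow> bool" where
  "compatible u \<longleftrightarrow> u \<in> Hom C (Fo N) N \<and>
     (\<forall>Z\<in>S. \<forall>f\<in>Hom C N Z. f \<cdot> u = t Z \<cdot> Fa f) \<and>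
     (\<forall>Z\<in>S. \<forall>f\<in>Hom C Z N. f \<cdot> t Z = u \<cdot> Fa f)"

lemmas t_hom = natural_onD(1)[OF t_nat] and t_natural = natural_onD(2)[OF t_nat]

text \<open>Arrows from \<open>N\<close> to \<open>S\<close> factor through \<open>y\<close> and
  arrows from \<open>S\<close> to \<open>N\<close> through \<open>n\<close>, so there are just two
  equations to solve. Projectivity solves the one for \<open>y\<close>; the error in the one for
  \<open>n\<close> has values in \<open>Y\<close>, which \<open>y\<close> kills, so it can be
  subtracted without spoiling the first.\<close>

lemma compatible_exists: "\<exists>u. compatible u"
proof -
  obtain N' n where n: "n \<in> Hom C N' N" "mono_arr C n" "N' \<in> S"
    and nfac: "\<And>Z f. Z \<in> S \<Longrightarrow> f \<in> Hom C Z N \<Longrightarrow> \<exists>f'\<in>Hom C Z N'. n \<cdot> f' = f"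
    using radical_exists by metis
  obtain N'' y Y i where y: "y \<in> Hom C N N''" "epi_arr C y" "N'' \<in> S"
    and yfac: "\<And>Z f. Z \<in> S \<Longrightarrow> f \<in> Hom C N Z \<Longrightarrow> \<exists>f'\<in>Hom C N'' Z. f' \<cdot> y = f"
    and i: "i \<in> Hom C Y N" "mono_arr C i" "y \<cdot> i = ZeroA C Y N''"
    and ker: "\<And>W g. g \<in> Hom C W N \<Longrightarrow> y \<cdot> g = ZeroA C W N'' \<Longrightarrow> \<exists>h\<in>Hom C W Y. i \<cdot> h = g"
    using coradical_exists by metis
  note Fy = F.map_hom[OF y(1)] and Fn = F.map_hom[OF n(1)]
  have yn: "y \<cdot> n \<in> Hom C N' N''" using cmp_hom[OF n(1) y(1)] .
  obtain u where u: "u \<in> Hom C (Fo N) N" "y \<cdot> u = t N'' \<cdot> Fa y"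
    by (rule projective_lift[OF F_projective[OF N_obj] y(2,1) cmp_hom[OF Fy t_hom[OF y(3)]]])
  have uFn: "u \<cdot> Fa n \<in> Hom C (Fo N') N" using cmp_hom[OF Fn u(1)] .
  have nt: "n \<cdot> t N' \<in> Hom C (Fo N') N" using cmp_hom[OF t_hom[OF n(3)] n(1)] .
  have "y \<cdot> (u \<cdot> Fa n) = (t N'' \<cdot> Fa y) \<cdot> Fa n" using cmp_assoc[OF Fn u(1) y(1)] u(2) by simp
  also have "\<dots> = t N'' \<cdot> Fa (y \<cdot> n)"
    using cmp_assoc[OF Fn Fy t_hom[OF y(3)]] F.map_cmp[OF n(1) y(1)] by simp
  also have "\<dots> = y \<cdot> (n \<cdot> t N')"
    using t_natural[OF n(3) y(3) yn] cmp_assoc[OF t_hom[OF n(3)] n(1) y(1)] by simp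
  finally have "y \<cdot> diff_arr (u \<cdot> Fa n) (n \<cdot> t N') = ZeroA C (Fo N') N''"
    using cmp_diff_right[OF uFn nt y(1)] diff_self[OF cmp_hom[OF nt y(1)]] by simp
  then obtain b where b: "b \<in> Hom C (Fo N') Y" "i \<cdot> b = diff_arr (u \<cdot> Fa n) (n \<cdot> t N')"
    using ker diff_hom[OF uFn nt] by blast
  \<comment> \<open>The error is defined on \<open>Fo N'\<close>; composing with the retraction
    extends it to \<open>Fo N\<close>.\<close>
  obtain r where r: "r \<in> Hom C (Fo N) (Fo N')" "r \<cdot> Fa n = Id C (Fo N')" using F_retract[OF n(1,2)] by blast
  have br: "b \<cdot> r \<in> Hom C (Fo N) Y" using cmp_hom[OF r(1) b(1)] .
  have ibr: "i \<cdot> (b \<cdot> r) \<in> Hom C (Fo N) N" using cmp_hom[OF br i(1)] .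
  define v where "v = diff_arr u (i \<cdot> (b \<cdot> r))"
  have v: "v \<in> Hom C (Fo N) N" unfolding v_def using diff_hom[OF u(1) ibr] .
  have yv: "y \<cdot> v = t N'' \<cdot> Fa y"
  proof -
    have "y \<cdot> (i \<cdot> (b \<cdot> r)) = ZeroA C (Fo N) N''"
      using cmp_assoc[OF br i(1) y(1)] i(3) cmp_zero_left[OF br hom_obj(2)[OF y(1)]] by simp
    then have "y \<cdot> v = diff_arr (y \<cdot> u) (ZeroA C (Fo N) N'')"
      unfolding v_def using cmp_diff_right[OF u(1) ibr y(1)] by simp
    also have "\<dots> = y \<cdot> u"
      using diff_diff[OF cmp_hom[OF u(1) y(1)] cmp_hom[OF u(1) y(1)]] diff_self[OF cmp_hom[OF u(1) y(1)]]
        by simp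
    finally show ?thesis using u(2) by simp
  qed
  have vn: "v \<cdot> Fa n = n \<cdot> t N'"
  proof -
    have "(i \<cdot> (b \<cdot> r)) \<cdot> Fa n = i \<cdot> (b \<cdot> (r \<cdot> Fa n))"
      using cmp_assoc[OF Fn br i(1)] cmp_assoc[OF Fn r(1) b(1)] by simp
    also have "\<dots> = diff_arr (u \<cdot> Fa n) (n \<cdot> t N')" unfolding r(2) using cmp_id_right[OF b(1)] b(2) by simp
    finally show ?thesis
      unfolding v_def using cmp_diff_left[OF Fn u(1) ibr] diff_diff[OF uFn nt] by simp
  qed
  have "f \<cdot> v = t Z \<cdot> Fa f" if Z: "Z \<in> S" and f: "f \<in> Hom C N Z" for Z f
  proof -
    obtain f' where f': "f' \<in> Hom C N'' Z" "f' \<cdot> y = f" using yfac[OF Z f] by blast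
    have "f \<cdot> v = f' \<cdot> (t N'' \<cdot> Fa y)" using f' cmp_assoc[OF v y(1) f'(1)] yv by simp
    also have "\<dots> = (t Z \<cdot> Fa f') \<cdot> Fa y"
      using cmp_assoc[OF Fy t_hom[OF y(3)] f'(1)] t_natural[OF y(3) Z f'(1)] by simp
    also have "\<dots> = t Z \<cdot> Fa f"
      using cmp_assoc[OF Fy F.map_hom[OF f'(1)] t_hom[OF Z]] F.map_cmp[OF y(1) f'(1)] f'(2) by simp
    finally show ?thesis .
  qed
  moreover have "f \<cdot> t Z = v \<cdot> Fa f" if Z: "Z \<in> S" and f: "f \<in> Hom C Z N" for Z f
  proof -
    obtain f' where f': "f' \<in> Hom C Z N'" "n \<cdot> f' = f" using nfac[OF Z f] by blast
    note Ff' = F.map_hom[OF f'(1)]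
    have "f \<cdot> t Z = n \<cdot> (t N' \<cdot> Fa f')"
      using f' cmp_assoc[OF t_hom[OF Z] f'(1) n(1)] t_natural[OF Z n(3) f'(1)] by simp
    also have "\<dots> = (v \<cdot> Fa n) \<cdot> Fa f'" using cmp_assoc[OF Ff' t_hom[OF n(3)] n(1)] vn by simp
    also have "\<dots> = v \<cdot> Fa f" using cmp_assoc[OF Ff' Fn v] F.map_cmp[OF f'(1) n(1)] f'(2) by simp
    finally show ?thesis .
  qed
  ultimately show ?thesis using v unfolding compatible_def by blast
qed

text \<open>A quotient in \<open>S\<close> of largest dimension is universal, because
  \<open>S\<close> is closed under sums and subobjects.\<close>

lemma largest_quotient_in_S:
  assumes L: "L \<in> Obj C"
  obtains L' l where "l \<in> Hom C L L'" "epi_arr C l" "L' \<in> S"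
    "\<And>Z f. Z \<in> S \<Longrightarrow> f \<in> Hom C L Z \<Longrightarrow> \<exists>f'\<in>Hom C L' Z. f' \<cdot> l = f"
proof -
  define P where "P = (\<lambda>(L', e). e \<in> Hom C L L' \<and> epi_arr C e \<and> L' \<in> S)"
  obtain Z where Z: "zero_object C Z" using zero_ex by blast
  then have ZO: "Z \<in> Obj C" by (simp add: zero_object_def)
  have "P (Z, ZeroA C L Z)"
    using zero_hom[OF L ZO] zero_dim_epi[OF Z L] topologizing_zero[OF S_top Z] by (simp add: P_def)
  \<comment> \<open>\<open>L\<close> itself may lie in \<open>S\<close>, so the strict bound is the
    successor of its dimension.\<close>
  moreover have "\<forall>x. P x \<longrightarrow> d (fst x) < Suc (d L)" using epi_dim by (fastforce simp: P_def less_Suc_eq_le)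
  ultimately obtain x where x: "P x" "\<forall>x'. P x' \<longrightarrow> d (fst x') \<le> d (fst x)"
    using ex_has_greatest_nat[of P _ "\<lambda>x. d (fst x)" "Suc (d L)"] by blast
  obtain L' l where "x = (L', l)" by (cases x)
  then have l: "l \<in> Hom C L L'" "epi_arr C l" "L' \<in> S"
    and max: "\<And>K e. e \<in> Hom C L K \<Longrightarrow> epi_arr C e \<Longrightarrow> K \<in> S \<Longrightarrow> d K \<le> d L'"
    using x by (auto simp: P_def)
  have "\<exists>f'\<in>Hom C L' Y. f' \<cdot> l = f" if Y: "Y \<in> S" and f: "f \<in> Hom C L Y" for Y f
  proof -
    obtain T where T: "is_direct_sum C L' Y T" using sum_ex hom_obj[OF f] hom_obj[OF l(1)] by blast
    show ?thesis
    proof (rule factor_through_max_quotient[OF l(1,2) f T])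
      fix I e m assume e: "e \<in> Hom C L I" "epi_arr C e" and m: "m \<in> Hom C I T" "mono_arr C m"
      have "I \<in> S" using topologizing_sub[OF S_top m topologizing_sum[OF S_top l(3) Y T]] .
      then show "d I \<le> d L'" using max e by blast
    qed
  qed
  then show ?thesis using that l by blast
qed

text \<open>The defects of a lift along \<open>l\<close> take values in the simple object \<open>ker y\<close>. They are removed one
  arrow \<open>x\<^sub>0 : L \<rightarrow> N\<close> at a time, shrinking the subobject \<open>K\<close> of \<open>ker l\<close> on which arrows to \<open>N\<close> still
  have to be corrected; since \<open>End (ker y)\<close> consists of scalars, an arrow vanishing on the smaller
  subobject is, up to a multiple of \<open>x\<^sub>0\<close>, one vanishing on the larger one.\<close>

lemma compatible_lift:
  assumes u: "compatible u" and L: "L \<in> Obj C"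
  obtains w where "w \<in> Hom C (Fo L) L" "\<And>Z f. Z \<in> S \<Longrightarrow> f \<in> Hom C L Z \<Longrightarrow> f \<cdot> w = t Z \<cdot> Fa f"
    "\<And>x. x \<in> Hom C L N \<Longrightarrow> x \<cdot> w = u \<cdot> Fa x"
proof -
  have uh: "u \<in> Hom C (Fo N) N" using u by (simp add: compatible_def)
  obtain N'' y Y i where y: "y \<in> Hom C N N''" "epi_arr C y" "N'' \<in> S"
    and i: "i \<in> Hom C Y N" "mono_arr C i" "y \<cdot> i = ZeroA C Y N''" and Ynz: "\<not> zero_object C Y"
    and ker: "\<And>W g. g \<in> Hom C W N \<Longrightarrow> y \<cdot> g = ZeroA C W N'' \<Longrightarrow> \<exists>h\<in>Hom C W Y. i \<cdot> h = g"
    and simple: "\<And>W w. w \<in> Hom C W Y \<Longrightarrow> mono_arr C w \<Longrightarrow> iso_arr C w \<or> zero_object C W"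
    using coradical_exists by metis
  have YO: "Y \<in> Obj C" using hom_obj[OF i(1)] by simp
  have IY: "Id C Y \<in> Hom C Y Y" using id_hom[OF YO] .
  obtain L' l where l: "l \<in> Hom C L L'" "epi_arr C l" "L' \<in> S"
    and lfac: "\<And>Z f. Z \<in> S \<Longrightarrow> f \<in> Hom C L Z \<Longrightarrow> \<exists>f'\<in>Hom C L' Z. f' \<cdot> l = f"
    using largest_quotient_in_S[OF L] by metis
  have FLO: "Fo L \<in> Obj C" using F.map_obj[OF L] .
  note Fl = F.map_hom[OF l(1)] and FLproj = F_projective[OF L]
  define tl where "tl = t L' \<cdot> Fa l"
  have tl: "tl \<in> Hom C (Fo L) L'" unfolding tl_def using cmp_hom[OF Fl t_hom[OF l(3)]] .
  \<comment> \<open>Every lift of \<open>tl\<close> along \<open>l\<close> meets all conditions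
    toward \<open>S\<close>, which leaves the arrows to \<open>N\<close>.\<close>
  have to_S: "f \<cdot> w = t Z \<cdot> Fa f"
    if w: "w \<in> Hom C (Fo L) L" "l \<cdot> w = tl" and Z: "Z \<in> S" and f: "f \<in> Hom C L Z" for w Z f
  proof -
    obtain f' where f': "f' \<in> Hom C L' Z" "f' \<cdot> l = f" using lfac[OF Z f] by blast
    have "f \<cdot> w = f' \<cdot> (t L' \<cdot> Fa l)" using f' cmp_assoc[OF w(1) l(1) f'(1)] w(2) by (simp add: tl_def)
    also have "\<dots> = (t Z \<cdot> Fa f') \<cdot> Fa l"
      using cmp_assoc[OF Fl t_hom[OF l(3)] f'(1)] t_natural[OF l(3) Z f'(1)] by simp
    also have "\<dots> = t Z \<cdot> Fa f"
      using cmp_assoc[OF Fl F.map_hom[OF f'(1)] t_hom[OF Z]] F.map_cmp[OF l(1) f'(1)] f'(2) by simp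
    finally show ?thesis .
  qed
  \<comment> \<open>The invariant: \<open>w\<close> is correct for those arrows to \<open>N\<close>
    that vanish on \<open>k\<close>. The recursion stops once every arrow to \<open>N\<close>
    vanishes on \<open>k\<close>.\<close>
  define ok where "ok k w \<longleftrightarrow> w \<in> Hom C (Fo L) L \<and> l \<cdot> w = tl \<and>
    (\<forall>x\<in>Hom C L N. x \<cdot> k = ZeroA C (Dom C k) N \<longrightarrow> x \<cdot> w = u \<cdot> Fa x)" for k w
  have main: "\<exists>w. w \<in> Hom C (Fo L) L \<and> l \<cdot> w = tl \<and> (\<forall>x\<in>Hom C L N. x \<cdot> w = u \<cdot> Fa x)"
    if "k \<in> Hom C K L" "mono_arr C k" "l \<cdot> k = ZeroA C K L'" "ok k w" for K k w
    using that
  proof (induction "d K" arbitrary: K k w rule: less_induct)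
    case less
    note k = less.prems(1-3)
    have Dk: "Dom C k = K" using k(1) by (simp add: Hom_iff)
    have w: "w \<in> Hom C (Fo L) L" "l \<cdot> w = tl"
      and wx: "\<And>x. x \<in> Hom C L N \<Longrightarrow> x \<cdot> k = ZeroA C K N \<Longrightarrow> x \<cdot> w = u \<cdot> Fa x"
      using less.prems(4) by (auto simp: ok_def Dk)
    show ?case
    proof (cases "\<forall>x\<in>Hom C L N. x \<cdot> k = ZeroA C K N")
      case True
      then show ?thesis using w wx by blast
    next
      case False
      then obtain x0 where x0: "x0 \<in> Hom C L N" "x0 \<cdot> k \<noteq> ZeroA C K N" by blast
      have KO: "K \<in> Obj C" using hom_obj[OF k(1)] by simp
      \<comment> \<open>An arrow to \<open>N\<close> followed by \<open>y\<close> factors through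
        \<open>l\<close>, so it vanishes on \<open>K\<close>; restricted to \<open>K\<close>, the
        arrow therefore lands in \<open>Y\<close>.\<close>
      have to_Y: "\<exists>h\<in>Hom C K Y. i \<cdot> h = x \<cdot> k" if x: "x \<in> Hom C L N" for x
      proof (rule ker[OF cmp_hom[OF k(1) x]])
        obtain g where g: "g \<in> Hom C L' N''" "g \<cdot> l = y \<cdot> x" using lfac[OF y(3) cmp_hom[OF x y(1)]] by blast
        have "y \<cdot> (x \<cdot> k) = g \<cdot> (l \<cdot> k)"
          using cmp_assoc[OF k(1) x y(1)] cmp_assoc[OF k(1) l(1) g(1)] g(2) by simp
        also have "\<dots> = ZeroA C K N''" unfolding k(3) using cmp_zero_right[OF g(1) KO] .
        finally show "y \<cdot> (x \<cdot> k) = ZeroA C K N''" .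
      qed
      obtain \<kappa> where \<kappa>: "\<kappa> \<in> Hom C K Y" "i \<cdot> \<kappa> = x0 \<cdot> k" using to_Y[OF x0(1)] by blast
      have "\<kappa> \<noteq> ZeroA C K Y" using \<kappa> x0(2) cmp_zero_right[OF i(1) KO] by auto
      then have \<kappa>epi: "epi_arr C \<kappa>" using simple_epi[OF simple \<kappa>(1)] by blast
      obtain K1 k1 where k1: "k1 \<in> Hom C K1 K" "mono_arr C k1" "\<kappa> \<cdot> k1 = ZeroA C K1 Y"
        and \<kappa>coker: "\<forall>W. \<forall>g\<in>Hom C K W. g \<cdot> k1 = ZeroA C K1 W \<longrightarrow> (\<exists>h\<in>Hom C Y W. h \<cdot> \<kappa> = g)"
        using ker_ex[OF \<kappa>(1)] \<kappa>epi by blast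
      have K1O: "K1 \<in> Obj C" using hom_obj[OF k1(1)] by simp
      have "\<not> iso_arr C k1"
      proof
        assume "iso_arr C k1"
        then have "\<kappa> = ZeroA C K Y" using epi_zeroD[OF iso_epi k1(1) \<kappa>(1) k1(3)] by simp
        then show False using \<open>\<kappa> \<noteq> ZeroA C K Y\<close> by simp
      qed
      then have less_dim: "d K1 < d K" using mono_dim_less[OF k1(1,2)] by blast
      have x0w: "x0 \<cdot> w \<in> Hom C (Fo L) N" using cmp_hom[OF w(1) x0(1)] .
      note Fx0 = F.map_hom[OF x0(1)]
      have ux0: "u \<cdot> Fa x0 \<in> Hom C (Fo L) N" using cmp_hom[OF Fx0 uh] .
      have "y \<cdot> (x0 \<cdot> w) = t N'' \<cdot> Fa (y \<cdot> x0)"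
        using cmp_assoc[OF w(1) x0(1) y(1)] to_S[OF w y(3) cmp_hom[OF x0(1) y(1)]] by simp
      also have "\<dots> = (t N'' \<cdot> Fa y) \<cdot> Fa x0"
        using cmp_assoc[OF Fx0 F.map_hom[OF y(1)] t_hom[OF y(3)]] F.map_cmp[OF x0(1) y(1)] by simp
      also have "t N'' \<cdot> Fa y = y \<cdot> u" using u y unfolding compatible_def by simp
      also have "(y \<cdot> u) \<cdot> Fa x0 = y \<cdot> (u \<cdot> Fa x0)" using cmp_assoc[OF Fx0 uh y(1)] .
      finally have "y \<cdot> diff_arr (x0 \<cdot> w) (u \<cdot> Fa x0) = ZeroA C (Fo L) N''"
        using cmp_diff_right[OF x0w ux0 y(1)] diff_self[OF cmp_hom[OF ux0 y(1)]] by simp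
      then obtain b where b: "b \<in> Hom C (Fo L) Y" "i \<cdot> b = diff_arr (x0 \<cdot> w) (u \<cdot> Fa x0)"
        using ker diff_hom[OF x0w ux0] by blast
      \<comment> \<open>The correction has to change \<open>x0 \<cdot> w\<close> by the defect
        \<open>i \<cdot> b\<close>. On \<open>K\<close> the arrow \<open>x0\<close> is
        \<open>\<kappa>\<close> followed by \<open>i\<close>, and \<open>\<kappa>\<close> is an
        epimorphism to \<open>Y\<close>, so lifting \<open>b\<close> along it provides the
        correction.\<close>
      obtain v where v: "v \<in> Hom C (Fo L) K" "\<kappa> \<cdot> v = b" by (rule projective_lift[OF FLproj \<kappa>epi \<kappa>(1) b(1)])
      have kv: "k \<cdot> v \<in> Hom C (Fo L) L" using cmp_hom[OF v(1) k(1)] .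
      define w1 where "w1 = diff_arr w (k \<cdot> v)"
      have w1: "w1 \<in> Hom C (Fo L) L" unfolding w1_def using diff_hom[OF w(1) kv] .
      \<comment> \<open>The correction has values in \<open>K\<close>, so arrows that vanish on
        \<open>K\<close>, among them \<open>l\<close>, do not notice it.\<close>
      have w1_eq: "f \<cdot> w1 = f \<cdot> w" if f: "f \<in> Hom C L W" and fk: "f \<cdot> k = ZeroA C K W" for f W
      proof -
        have fw: "f \<cdot> w \<in> Hom C (Fo L) W" using cmp_hom[OF w(1) f] .
        have "f \<cdot> (k \<cdot> v) = ZeroA C (Fo L) W"
          using cmp_assoc[OF v(1) k(1) f] fk cmp_zero_left[OF v(1) hom_obj(2)[OF f]] by simp
        then have "f \<cdot> w1 = diff_arr (f \<cdot> w) (ZeroA C (Fo L) W)"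
          unfolding w1_def using cmp_diff_right[OF w(1) kv f] by simp
        also have "\<dots> = f \<cdot> w" using diff_diff[OF fw fw] diff_self[OF fw] by simp
        finally show ?thesis .
      qed
      have lw1: "l \<cdot> w1 = tl" using w1_eq[OF l(1) k(3)] w(2) by simp
      have x0w1: "x0 \<cdot> w1 = u \<cdot> Fa x0"
      proof -
        have "x0 \<cdot> (k \<cdot> v) = i \<cdot> (\<kappa> \<cdot> v)"
          using cmp_assoc[OF v(1) k(1) x0(1)] cmp_assoc[OF v(1) \<kappa>(1) i(1)] \<kappa>(2) by simp
        also have "\<dots> = diff_arr (x0 \<cdot> w) (u \<cdot> Fa x0)" using v(2) b(2) by simp
        finally show ?thesis
          unfolding w1_def using cmp_diff_right[OF w(1) kv x0(1)] diff_diff[OF x0w ux0] by simp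
      qed
      have kk1: "k \<cdot> k1 \<in> Hom C K1 L" "mono_arr C (k \<cdot> k1)"
        using cmp_hom[OF k1(1) k(1)] mono_cmp[OF k1(2) k(2) k1(1) k(1)] by auto
      have lkk1: "l \<cdot> (k \<cdot> k1) = ZeroA C K1 L'"
        using cmp_assoc[OF k1(1) k(1) l(1)] k(3) cmp_zero_left[OF k1(1) hom_obj(2)[OF l(1)]] by simp
      have "x \<cdot> w1 = u \<cdot> Fa x" if x: "x \<in> Hom C L N" and xk: "x \<cdot> (k \<cdot> k1) = ZeroA C K1 N" for x
      proof -
        obtain h where h: "h \<in> Hom C K Y" "i \<cdot> h = x \<cdot> k" using to_Y[OF x] by blast
        have "i \<cdot> (h \<cdot> k1) = ZeroA C K1 N"
          using cmp_assoc[OF k1(1) h(1) i(1)] h(2) cmp_assoc[OF k1(1) k(1) x] xk by simp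
        then have "h \<cdot> k1 = ZeroA C K1 Y" using mono_zeroD[OF i(2,1) cmp_hom[OF k1(1) h(1)]] by simp
        then obtain \<sigma> where \<sigma>: "\<sigma> \<in> Hom C Y Y" "\<sigma> \<cdot> \<kappa> = h" using \<kappa>coker h(1) by blast
        obtain c where c: "\<sigma> = ScaleA C c (Id C Y)" by (rule simple_endo_scalar[OF simple Ynz \<sigma>(1)])
        have h_eq: "h = ScaleA C c \<kappa>"
          using \<sigma>(2) c cmp_scale_left[OF \<kappa>(1) IY] cmp_id_left[OF \<kappa>(1)] by simp
        have sx0: "ScaleA C c x0 \<in> Hom C L N" using scale_hom[OF x0(1,1)] .
        have "ScaleA C c x0 \<cdot> k = ScaleA C c (i \<cdot> \<kappa>)" using cmp_scale_left[OF k(1) x0(1)] \<kappa>(2) by simp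
        also have "\<dots> = x \<cdot> k" using cmp_scale_right[OF \<kappa>(1) i(1)] h_eq h(2) by simp
        finally have "diff_arr x (ScaleA C c x0) \<cdot> k = ZeroA C K N"
          using cmp_diff_left[OF k(1) x sx0] diff_self[OF cmp_hom[OF k(1) x]] by simp
        note dk = this
        let ?x' = "diff_arr x (ScaleA C c x0)"
        have x': "?x' \<in> Hom C L N" using diff_hom[OF x sx0] .
        have x'w: "?x' \<cdot> w1 = u \<cdot> Fa ?x'" using w1_eq[OF x' dk] wx[OF x' dk] by simp
        have sw: "ScaleA C c x0 \<cdot> w1 = u \<cdot> Fa (ScaleA C c x0)"
          using cmp_scale_left[OF w1 x0(1)] x0w1 cmp_scale_right[OF Fx0 uh] F.map_scale[OF x0(1)] by simp
        have x_eq: "x = AddA C (ScaleA C c x0) ?x'" using add_diff[OF x sx0] by simp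
        have "x \<cdot> w1 = AddA C (ScaleA C c x0 \<cdot> w1) (?x' \<cdot> w1)"
          using cmp_add_left[OF w1 sx0 x'] x_eq by simp
        also have "\<dots> = u \<cdot> AddA C (Fa (ScaleA C c x0)) (Fa ?x')"
          unfolding sw x'w using cmp_add_right[OF F.map_hom[OF sx0] F.map_hom[OF x'] uh] by simp
        also have "AddA C (Fa (ScaleA C c x0)) (Fa ?x') = Fa x" using F.map_add[OF sx0 x'] x_eq by simp
        finally show ?thesis .
      qed
      then have "ok (k \<cdot> k1) w1" using w1 lw1 kk1(1) unfolding ok_def by (simp add: Hom_iff)
      then show ?thesis using less.hyps[OF less_dim kk1 lkk1] by blast
    qed
  qed
  obtain w0 where w0: "w0 \<in> Hom C (Fo L) L" "l \<cdot> w0 = tl" by (rule projective_lift[OF FLproj l(2,1) tl])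
  obtain K k where k: "k \<in> Hom C K L" "mono_arr C k" "l \<cdot> k = ZeroA C K L'"
    and kcoker: "\<forall>W. \<forall>g\<in>Hom C L W. g \<cdot> k = ZeroA C K W \<longrightarrow> (\<exists>h\<in>Hom C L' W. h \<cdot> l = g)"
    using ker_ex[OF l(1)] l(2) by blast
  \<comment> \<open>The recursion starts with the whole kernel of \<open>l\<close>: an arrow
    vanishing there comes from \<open>L'\<close>, which lies in \<open>S\<close>, and
    \<open>compatible\<close> covers it.\<close>
  have "x \<cdot> w0 = u \<cdot> Fa x" if x: "x \<in> Hom C L N" and xk: "x \<cdot> k = ZeroA C K N" for x
  proof -
    obtain f where f: "f \<in> Hom C L' N" "f \<cdot> l = x" using kcoker x xk by blast
    have "x \<cdot> w0 = f \<cdot> (t L' \<cdot> Fa l)" using f cmp_assoc[OF w0(1) l(1) f(1)] w0(2) by (simp add: tl_def)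
    also have "\<dots> = (u \<cdot> Fa f) \<cdot> Fa l"
      using cmp_assoc[OF Fl t_hom[OF l(3)] f(1)] u l(3) f(1) unfolding compatible_def by simp
    also have "\<dots> = u \<cdot> Fa x" using cmp_assoc[OF Fl F.map_hom[OF f(1)] uh] F.map_cmp[OF l(1) f(1)] f(2) by simp
    finally show ?thesis .
  qed
  then have "ok k w0" using w0 k(1) unfolding ok_def by (simp add: Hom_iff)
  from main[OF k this] obtain w where w: "w \<in> Hom C (Fo L) L" "l \<cdot> w = tl" "\<forall>x\<in>Hom C L N. x \<cdot> w = u \<cdot> Fa x"
    by blast
  show ?thesis by (rule that[OF w(1) to_S[OF w(1,2)]]) (use w(3) in blast)+
qed

text \<open>Objects whose arrows to \<open>N\<close> and to members of \<open>S\<close> are jointly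
  monic. On them the lifts are unique and hence natural. Expressing this by detection of zero arrows
  gives closure under subobjects and sums without choosing embeddings.\<close>

definition cogenerated :: "'o set" where
  "cogenerated = {L \<in> Obj C. \<forall>W. \<forall>a\<in>Hom C W L. (\<forall>Z\<in>insert N S. \<forall>f\<in>Hom C L Z. f \<cdot> a = ZeroA C W Z) \<longrightarrow>
     a = ZeroA C W L}"

lemma cogenerated_member: "insert N S \<subseteq> cogenerated"
proof
  fix X assume X: "X \<in> insert N S"
  then have XO: "X \<in> Obj C" using N_obj topologizing_obj[OF S_top] by blast
  have "a = ZeroA C W X" if a: "a \<in> Hom C W X"
    and z: "\<forall>Z\<in>insert N S. \<forall>f\<in>Hom C X Z. f \<cdot> a = ZeroA C W Z" for W a
  proof -
    have "Id C X \<cdot> a = ZeroA C W X" using z X id_hom[OF XO] by blast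
    then show ?thesis using cmp_id_left[OF a] by simp
  qed
  then show "X \<in> cogenerated" using XO by (simp add: cogenerated_def)
qed

lemma cogenerated_sub:
  assumes i: "i \<in> Hom C X Y" and mono: "mono_arr C i" and Y: "Y \<in> cogenerated"
  shows "X \<in> cogenerated"
proof -
  have "a = ZeroA C W X" if a: "a \<in> Hom C W X"
    and z: "\<forall>Z\<in>insert N S. \<forall>f\<in>Hom C X Z. f \<cdot> a = ZeroA C W Z" for W a
  proof -
    have "f \<cdot> (i \<cdot> a) = ZeroA C W Z" if "Z \<in> insert N S" "f \<in> Hom C Y Z" for Z f
      using z that cmp_hom[OF i that(2)] cmp_assoc[OF a i that(2)] by auto
    then have "i \<cdot> a = ZeroA C W Y" using Y cmp_hom[OF a i] unfolding cogenerated_def by blast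
    then show ?thesis by (rule mono_zeroD[OF mono i a])
  qed
  then show ?thesis using hom_obj[OF i] by (simp add: cogenerated_def)
qed

lemma cogenerated_sum:
  assumes X: "X \<in> cogenerated" and Y: "Y \<in> cogenerated" and T: "is_direct_sum C X Y T"
  shows "T \<in> cogenerated"
proof -
  obtain i j p q where ijpq: "i \<in> Hom C X T" "j \<in> Hom C Y T" "p \<in> Hom C T X" "q \<in> Hom C T Y"
    and sum: "AddA C (i \<cdot> p) (j \<cdot> q) = Id C T" by (rule direct_sumE[OF T])
  have TO: "T \<in> Obj C" using hom_obj[OF ijpq(1)] by simp
  have "a = ZeroA C W T" if a: "a \<in> Hom C W T"
    and z: "\<forall>Z\<in>insert N S. \<forall>f\<in>Hom C T Z. f \<cdot> a = ZeroA C W Z" for W a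
  proof -
    have WO: "W \<in> Obj C" using hom_obj[OF a] by simp
    have "f \<cdot> (p \<cdot> a) = ZeroA C W Z" if "Z \<in> insert N S" "f \<in> Hom C X Z" for Z f
      using z that cmp_hom[OF ijpq(3) that(2)] cmp_assoc[OF a ijpq(3) that(2)] by auto
    then have pa: "p \<cdot> a = ZeroA C W X" using X cmp_hom[OF a ijpq(3)] unfolding cogenerated_def by blast
    have "f \<cdot> (q \<cdot> a) = ZeroA C W Z" if "Z \<in> insert N S" "f \<in> Hom C Y Z" for Z f
      using z that cmp_hom[OF ijpq(4) that(2)] cmp_assoc[OF a ijpq(4) that(2)] by auto
    then have qa: "q \<cdot> a = ZeroA C W Y" using Y cmp_hom[OF a ijpq(4)] unfolding cogenerated_def by blast
    have "a = AddA C (i \<cdot> (p \<cdot> a)) (j \<cdot> (q \<cdot> a))" using direct_sum_expand_left[OF ijpq sum a] by simp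
    also have "\<dots> = AddA C (ZeroA C W T) (ZeroA C W T)"
      unfolding pa qa using cmp_zero_right[OF ijpq(1) WO] cmp_zero_right[OF ijpq(2) WO] by simp
    also have "\<dots> = ZeroA C W T" using add_zero zero_hom[OF WO TO] by blast
    finally show ?thesis .
  qed
  then show ?thesis using TO by (simp add: cogenerated_def)
qed

text \<open>\<open>compatible_lift\<close> gives a candidate at every object, but the candidates are
  shown to fit together on \<open>cogenerated\<close>, where a difference is detected by arrows to
  \<open>insert N S\<close>. Passing to quotients then produces a topologizing subcategory.\<close>

lemma extend_over_N:
  assumes u: "compatible u"
  obtains S' t' where "S' \<in> Topologizing C" "insert N S \<subseteq> S'" "natural_on C Fo Fa S' t'"
    "\<And>X. X \<in> S \<Longrightarrow> t' X = t X" "t' N = u"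
proof -
  have CO: "cogenerated \<subseteq> Obj C" by (auto simp: cogenerated_def)
  have "\<exists>w. w \<in> Hom C (Fo L) L \<and> (\<forall>Z\<in>S. \<forall>f\<in>Hom C L Z. f \<cdot> w = t Z \<cdot> Fa f) \<and> (\<forall>x\<in>Hom C L N. x \<cdot> w = u \<cdot> Fa x)"
    if "L \<in> Obj C" for L
    by (rule compatible_lift[OF u that]) blast
  then obtain w where w: "\<And>L. L \<in> Obj C \<Longrightarrow> w L \<in> Hom C (Fo L) L"
    and wS: "\<And>L Z f. L \<in> Obj C \<Longrightarrow> Z \<in> S \<Longrightarrow> f \<in> Hom C L Z \<Longrightarrow> f \<cdot> w L = t Z \<cdot> Fa f"
    and wN: "\<And>L x. L \<in> Obj C \<Longrightarrow> x \<in> Hom C L N \<Longrightarrow> x \<cdot> w L = u \<cdot> Fa x" by metis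
  define s where "s Z = (if Z = N then u else t Z)" for Z
  have sh: "s Z \<in> Hom C (Fo Z) Z" if "Z \<in> insert N S" for Z
    using that t_hom u by (auto simp: s_def compatible_def)
  have ws: "f \<cdot> w L = s Z \<cdot> Fa f" if "Z \<in> insert N S" "f \<in> Hom C L Z" for L Z f
    using that wS wN hom_obj[OF that(2)] N_notin by (auto simp: s_def)
  have nat: "nat_on cogenerated w"
    unfolding natural_on_def
  proof (intro conjI ballI)
    show "w X \<in> Hom C (Fo X) X" if "X \<in> cogenerated" for X using w that CO by blast
    fix X Y h assume X: "X \<in> cogenerated" and Y: "Y \<in> cogenerated" and h: "h \<in> Hom C X Y"
    have wX: "w X \<in> Hom C (Fo X) X" and wY: "w Y \<in> Hom C (Fo Y) Y" using w hom_obj[OF h] by auto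
    note Fh = F.map_hom[OF h]
    have hw: "h \<cdot> w X \<in> Hom C (Fo X) Y" and wh: "w Y \<cdot> Fa h \<in> Hom C (Fo X) Y"
      using cmp_hom[OF wX h] cmp_hom[OF Fh wY] by auto
    \<comment> \<open>Followed by any arrow \<open>f\<close> to a member \<open>Z\<close> of
      \<open>insert N S\<close>, both sides of the naturality square become
      \<open>s Z \<cdot> Fa (f \<cdot> h)\<close>.\<close>
    have "f \<cdot> diff_arr (h \<cdot> w X) (w Y \<cdot> Fa h) = ZeroA C (Fo X) Z" if Z: "Z \<in> insert N S"
      and f: "f \<in> Hom C Y Z" for Z f
    proof -
      have "f \<cdot> (h \<cdot> w X) = s Z \<cdot> Fa (f \<cdot> h)"
        using cmp_assoc[OF wX h f] ws[OF Z cmp_hom[OF h f]] by simp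
      also have "\<dots> = (f \<cdot> w Y) \<cdot> Fa h"
        using F.map_cmp[OF h f] cmp_assoc[OF Fh F.map_hom[OF f] sh[OF Z]] ws[OF Z f] by simp
      also have "\<dots> = f \<cdot> (w Y \<cdot> Fa h)" using cmp_assoc[OF Fh wY f] .
      finally show ?thesis using cmp_diff_right[OF hw wh f] diff_self[OF cmp_hom[OF wh f]] by simp
    qed
    then have "diff_arr (h \<cdot> w X) (w Y \<cdot> Fa h) = ZeroA C (Fo X) Y"
      using Y diff_hom[OF hw wh] unfolding cogenerated_def by blast
    then show "h \<cdot> w X = w Y \<cdot> Fa h" using diff_zero_iff[OF hw wh] by simp
  qed
  have w_eq: "w X = s X" if X: "X \<in> insert N S" for X
  proof -
    have XO: "X \<in> Obj C" using X cogenerated_member CO by blast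
    show ?thesis
      using ws[OF X id_hom[OF XO]] cmp_id_left[OF w[OF XO]] F.map_id[OF XO] cmp_id_right[OF sh[OF X]] by simp
  qed
  have zero: "Z \<in> cogenerated" if "zero_object C Z" for Z
    using topologizing_zero[OF S_top that] cogenerated_member by blast
  let ?Q = "{E. \<exists>L\<in>cogenerated. \<exists>e\<in>Hom C L E. epi_arr C e}"
  have ext: "?Q \<in> Topologizing C" "\<exists>v. nat_on ?Q v \<and> (\<forall>X\<in>cogenerated. v X = w X)" "cogenerated \<subseteq> ?Q"
    by (rule extend_to_quotients[OF CO nat];
        (erule (2) cogenerated_sub | erule (2) cogenerated_sum | erule zero))+
  obtain v where v: "nat_on ?Q v" "\<forall>X\<in>cogenerated. v X = w X" using ext(2) by blast
  show ?thesis
  proof (rule that[of ?Q v])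
    show "?Q \<in> Topologizing C" using ext(1) .
    show "insert N S \<subseteq> ?Q" using ext(3) cogenerated_member by blast
    show "nat_on ?Q v" using v(1) .
    show "v X = t X" if "X \<in> S" for X
      using v(2) w_eq[of X] cogenerated_member that N_notin by (auto simp: s_def)
    show "v N = u" using v(2) w_eq[of N] cogenerated_member by (auto simp: s_def)
  qed
qed

end

section \<open>Extension to the whole category\<close>

context exact_projective_functor
begin

text \<open>Zorn's lemma is applied to graphs: a partial family is a set of pairs with topologizing
  domain, so that extension of families is inclusion and the union of a chain is an upper
  bound.\<close>

theorem natural_extension:
  assumes S: "S \<in> Topologizing C" and t: "nat_on S t"
  obtains t' where "nat_on (Obj C) t'" "\<And>X. X \<in> S \<Longrightarrow> t' X = t X"
proof -
  define good where "good g \<longleftrightarrow> Domain g \<in> Topologizing C \<and> (\<lambda>X. (X, t X)) ` S \<subseteq> g \<and>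
    (\<forall>X a. (X, a) \<in> g \<longrightarrow> a \<in> Hom C (Fo X) X) \<and>
    (\<forall>X a Y b. (X, a) \<in> g \<longrightarrow> (Y, b) \<in> g \<longrightarrow> (\<forall>f\<in>Hom C X Y. f \<cdot> a = b \<cdot> Fa f))" for g
  have goodI: "good ((\<lambda>X. (X, s X)) ` R)"
    if "R \<in> Topologizing C" "nat_on R s" "S \<subseteq> R" "\<And>X. X \<in> S \<Longrightarrow> s X = t X" for R s
  proof -
    have "Domain ((\<lambda>X. (X, s X)) ` R) = R" by force
    then show ?thesis using that unfolding good_def natural_on_def by (auto simp: image_iff)
  qed
  have goodD: "Domain g \<in> Topologizing C" "X \<in> S \<Longrightarrow> (X, t X) \<in> g"
    "(X, a) \<in> g \<Longrightarrow> a \<in> Hom C (Fo X) X"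
    "(X, a) \<in> g \<Longrightarrow> (Y, b) \<in> g \<Longrightarrow> f \<in> Hom C X Y \<Longrightarrow> f \<cdot> a = b \<cdot> Fa f" if "good g" for g X a Y b f
    using that unfolding good_def by (simp, blast, simp, simp)
  have goodE: "\<exists>s. nat_on (Domain g) s \<and> (\<forall>X\<in>S. s X = t X) \<and> g = (\<lambda>X. (X, s X)) ` Domain g" if g: "good g"
    for g
  proof -
    note hom = goodD(3)[OF g] and nat = goodD(4)[OF g]
    \<comment> \<open>That a graph is single-valued is naturality at the identity.\<close>
    have uniq: "a = b" if ab: "(X, a) \<in> g" "(X, b) \<in> g" for X a b
    proof -
      have XO: "X \<in> Obj C" using topologizing_obj[OF goodD(1)[OF g]] ab by blast
      show ?thesis using nat[OF ab id_hom[OF XO]] cmp_id_left[OF hom[OF ab(1)]] cmp_id_right[OF hom[OF ab(2)]]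
          F.map_id[OF XO] by simp
    qed
    have "\<forall>X\<in>Domain g. \<exists>a. (X, a) \<in> g" by blast
    from bchoice[OF this] obtain s where s: "\<And>X. X \<in> Domain g \<Longrightarrow> (X, s X) \<in> g" by blast
    have "g = (\<lambda>X. (X, s X)) ` Domain g"
    proof (intro equalityI subsetI)
      fix z assume z: "z \<in> g"
      then obtain X a where Xa: "z = (X, a)" by (cases z)
      then have X: "X \<in> Domain g" using z by blast
      have "a = s X" using uniq z Xa s[OF X] by blast
      then show "z \<in> (\<lambda>X. (X, s X)) ` Domain g" using X Xa by simp
    qed (use s in blast)
    moreover have "s X = t X" if "X \<in> S" for X
    proof -
      have X: "(X, t X) \<in> g" using goodD(2)[OF g that] .
      then have "X \<in> Domain g" by blast
      then show ?thesis using s uniq[OF _ X] by blast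
    qed
    moreover have "nat_on (Domain g) s" unfolding natural_on_def using s hom nat by blast
    ultimately show ?thesis by blast
  qed
  have ne: "{g. good g} \<noteq> {}" using goodI[OF S t] by blast
  have chain: "\<Union>c \<in> {g. good g}" if c: "c \<noteq> {}" "subset.chain {g. good g} c" for c
  proof -
    have cg: "\<And>g. g \<in> c \<Longrightarrow> good g" using c(2) unfolding subset.chain_def by blast
    \<comment> \<open>Conditions involving two pairs are checked inside one member of the
      chain.\<close>
    have two: "\<exists>g\<in>c. x \<in> g \<and> y \<in> g" if xy: "x \<in> \<Union>c" "y \<in> \<Union>c" for x y
    proof -
      obtain g h where gh: "g \<in> c" "x \<in> g" "h \<in> c" "y \<in> h" using xy by blast
      then have "g \<subseteq> h \<or> h \<subseteq> g" using c(2) unfolding subset.chain_def by blast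
      then show ?thesis using gh by blast
    qed
    have top: "Domain (\<Union>c) \<in> Topologizing C"
      unfolding Topologizing_def
    proof (intro CollectI conjI allI ballI impI)
      show "Domain (\<Union>c) \<subseteq> Obj C"
      proof
        fix X assume "X \<in> Domain (\<Union>c)"
        then obtain g where "g \<in> c" "X \<in> Domain g" by blast
        then show "X \<in> Obj C" using topologizing_obj[OF goodD(1)[OF cg]] by blast
      qed
      show "Z \<in> Domain (\<Union>c)" if "zero_object C Z" for Z
      proof -
        obtain g where g: "g \<in> c" using c(1) by blast
        then have "Z \<in> Domain g" using topologizing_zero[OF goodD(1)[OF cg[OF g]] that] by simp
        then show ?thesis using g by blast
      qed
    next
      fix X Y Z assume X: "X \<in> Domain (\<Union>c)" and Y: "Y \<in> Domain (\<Union>c)" and Z: "is_direct_sum C X Y Z"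
      obtain a b where "(X, a) \<in> \<Union>c" "(Y, b) \<in> \<Union>c" using X Y by blast
      then obtain g where g: "g \<in> c" "(X, a) \<in> g" "(Y, b) \<in> g" using two by metis
      have "X \<in> Domain g" "Y \<in> Domain g" using g by blast+
      then have "Z \<in> Domain g" using topologizing_sum[OF goodD(1)[OF cg[OF g(1)]] _ _ Z] by simp
      then show "Z \<in> Domain (\<Union>c)" using g(1) by blast
    next
      fix X Y assume X: "X \<in> Domain (\<Union>c)" and Y: "is_subquotient C Y X"
      obtain g where g: "g \<in> c" "X \<in> Domain g" using X by blast
      have "Domain g \<in> Topologizing C" using goodD(1)[OF cg[OF g(1)]] .
      then have "Y \<in> Domain g" using g(2) Y unfolding Topologizing_def by blast
      then show "Y \<in> Domain (\<Union>c)" using g(1) by blast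
    qed
    have hom: "a \<in> Hom C (Fo X) X" if "(X, a) \<in> \<Union>c" for X a
      using that goodD(3)[OF cg] by blast
    have nat: "f \<cdot> a = b \<cdot> Fa f" if xy: "(X, a) \<in> \<Union>c" "(Y, b) \<in> \<Union>c" and f: "f \<in> Hom C X Y" for X a Y b f
    proof -
      obtain g where "g \<in> c" "(X, a) \<in> g" "(Y, b) \<in> g" using two[OF xy] by blast
      then show ?thesis using goodD(4)[OF cg _ _ f] by blast
    qed
    obtain g where "g \<in> c" using c(1) by blast
    then have "(\<lambda>X. (X, t X)) ` S \<subseteq> \<Union>c" using goodD(2)[OF cg] by blast
    then have "good (\<Union>c)" unfolding good_def
      by (intro conjI top allI impI ballI) (assumption | erule hom | erule (2) nat)+
    then show ?thesis by simp
  qed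
  obtain g where g: "good g" and max: "\<And>h. good h \<Longrightarrow> g \<subseteq> h \<Longrightarrow> h = g"
    using subset_Zorn_nonempty[OF ne chain] by blast
  define R where "R = Domain g"
  have R: "R \<in> Topologizing C" unfolding R_def by (rule goodD(1)[OF g])
  obtain s where s: "nat_on R s" "\<forall>X\<in>S. s X = t X" "g = (\<lambda>X. (X, s X)) ` R" using goodE[OF g] R_def by blast
  have SR: "S \<subseteq> R" unfolding R_def using goodD(2)[OF g] by blast
  have "R = Obj C"
  proof (rule ccontr)
    assume "R \<noteq> Obj C"
    then have "\<exists>N. N \<in> Obj C \<and> N \<notin> R" using topologizing_obj[OF R] by blast
    \<comment> \<open>A missing object of smallest dimension has all its proper subobjects and
      quotients in \<open>R\<close>, so one extension step contradicts maximality.\<close>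
    then obtain N where N: "N \<in> Obj C" "N \<notin> R" and min: "\<And>M. M \<in> Obj C \<Longrightarrow> M \<notin> R \<Longrightarrow> d N \<le> d M"
      using exists_least_iff[of "\<lambda>k. \<exists>N. N \<in> Obj C \<and> N \<notin> R \<and> d N = k"] by (metis not_le)
    have small: "L \<in> R" if "L \<in> Obj C" "d L < d N" for L using min[OF that(1)] that(2) by force
    interpret extension_step C d Fo Fa R N s
    proof
      show "L \<in> R" if "i \<in> Hom C L N" "d L < d N" for i L using small hom_obj[OF that(1)] that(2) by blast
      show "L \<in> R" if "e \<in> Hom C N L" "d L < d N" for e L using small hom_obj[OF that(1)] that(2) by blast
    qed (use R N s(1) in auto)
    obtain u where u: "compatible u" using compatible_exists by blast
    obtain R' s' where R': "R' \<in> Topologizing C" "insert N R \<subseteq> R'" "nat_on R' s'" "\<And>X. X \<in> R \<Longrightarrow> s' X = s X"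
      using extend_over_N[OF u] by metis
    have "good ((\<lambda>X. (X, s' X)) ` R')"
    proof (rule goodI[OF R'(1,3)])
      show "S \<subseteq> R'" using SR R'(2) by blast
      show "s' X = t X" if "X \<in> S" for X using R'(4) s(2) SR that by auto
    qed
    moreover have "g \<subseteq> (\<lambda>X. (X, s' X)) ` R'" unfolding s(3) using R'(2,4) by force
    ultimately have "(\<lambda>X. (X, s' X)) ` R' = g" using max by blast
    moreover have "(N, s' N) \<in> (\<lambda>X. (X, s' X)) ` R'" using R'(2) by blast
    ultimately show False using N(2) unfolding R_def by blast
  qed
  then show ?thesis using that[of s] s by blast
qed

end

section \<open>Exact module categories\<close>

lemma Hom_prod_cat: "Hom (prod_cat A B) (X, Y) (X', Y') = Hom A X X' \<times> Hom B Y Y'"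
  by (auto simp: Hom_def prod_cat_def)

lemma bifunctorD:
  assumes F: "cat_functor (prod_cat A B) D (\<lambda>(X, Y). Fo X Y) (\<lambda>(f, g). Fa f g)"
  shows "X \<in> Obj A \<Longrightarrow> Y \<in> Obj B \<Longrightarrow> Fo X Y \<in> Obj D"
    and "f \<in> Hom A X X' \<Longrightarrow> g \<in> Hom B Y Y' \<Longrightarrow> Fa f g \<in> Hom D (Fo X Y) (Fo X' Y')"
    and "X \<in> Obj A \<Longrightarrow> Y \<in> Obj B \<Longrightarrow> Fa (Id A X) (Id B Y) = Id D (Fo X Y)"
    and "f \<in> Hom A X X' \<Longrightarrow> f' \<in> Hom A X' X'' \<Longrightarrow> g \<in> Hom B Y Y' \<Longrightarrow> g' \<in> Hom B Y' Y'' \<Longrightarrow>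
      Fa (f' \<cdot>\<^bsub>A\<^esub> f) (g' \<cdot>\<^bsub>B\<^esub> g) = Fa f' g' \<cdot>\<^bsub>D\<^esub> Fa f g"
proof -
  interpret cat_functor "prod_cat A B" D "\<lambda>(X, Y). Fo X Y" "\<lambda>(f, g). Fa f g" by fact
  show "X \<in> Obj A \<Longrightarrow> Y \<in> Obj B \<Longrightarrow> Fo X Y \<in> Obj D"
    using map_obj[of "(X, Y)"] by (simp add: prod_cat_def)
  show "f \<in> Hom A X X' \<Longrightarrow> g \<in> Hom B Y Y' \<Longrightarrow> Fa f g \<in> Hom D (Fo X Y) (Fo X' Y')"
    using map_hom[of "(f, g)" "(X, Y)" "(X', Y')"] by (simp add: Hom_prod_cat)
  show "X \<in> Obj A \<Longrightarrow> Y \<in> Obj B \<Longrightarrow> Fa (Id A X) (Id B Y) = Id D (Fo X Y)"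
    using map_id[of "(X, Y)"] by (simp add: prod_cat_def)
  show "f \<in> Hom A X X' \<Longrightarrow> f' \<in> Hom A X' X'' \<Longrightarrow> g \<in> Hom B Y Y' \<Longrightarrow> g' \<in> Hom B Y' Y'' \<Longrightarrow>
      Fa (f' \<cdot>\<^bsub>A\<^esub> f) (g' \<cdot>\<^bsub>B\<^esub> g) = Fa f' g' \<cdot>\<^bsub>D\<^esub> Fa f g"
    using map_cmp[of "(f, g)" "(X, Y)" "(X', Y')" "(f', g')" "(X'', Y'')"]
    by (simp add: Hom_prod_cat) (simp add: prod_cat_def)
qed

locale exact_module_data = exact_module_category C M + C: finite_tensor_category C +
  C: abelian_category_with_length C dC + M: abelian_category_with_length M dM
  for C :: "('k::alg_closed_field, 'co, 'ca, 'y) moncat_scheme"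
    and M :: "('k, 'co, 'ca, 'o, 'a, 'z) modcat_scheme" and dC dM
begin

abbreviation M_cmp (infixr \<open>\<star>\<close> 70) where "g \<star> f \<equiv> g \<cdot>\<^bsub>M\<^esub> f"

lemmas ten_obj = bifunctorD(1)[OF C.tensor_functor] and ten_hom = bifunctorD(2)[OF C.tensor_functor]
  and ten_id = bifunctorD(3)[OF C.tensor_functor] and ten_cmp = bifunctorD(4)[OF C.tensor_functor]
lemmas act_obj = bifunctorD(1)[OF action_functor] and act_hom = bifunctorD(2)[OF action_functor]
  and act_id = bifunctorD(3)[OF action_functor] and act_cmp = bifunctorD(4)[OF action_functor]

lemma massoc:
  assumes "X \<in> Obj C" "Y \<in> Obj C" "N \<in> Obj M"
  shows "MAssoc M X Y N \<in> Hom M (ActO M (TenO C X Y) N) (ActO M X (ActO M Y N))" "iso_arr M (MAssoc M X Y N)"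
proof -
  have "(X, Y, N) \<in> Obj (prod_cat C (prod_cat C M))" using assms by (simp add: prod_cat_def)
  then show "MAssoc M X Y N \<in> Hom M (ActO M (TenO C X Y) N) (ActO M X (ActO M Y N))"
    "iso_arr M (MAssoc M X Y N)"
    using massoc_natural unfolding natural_iso_def by fastforce+
qed

lemma massoc_nat:
  assumes "f \<in> Hom C X X'" "g \<in> Hom C Y Y'" "h \<in> Hom M N N'"
  shows "ActA M f (ActA M g h) \<star> MAssoc M X Y N = MAssoc M X' Y' N' \<star> ActA M (TenA C f g) h"
proof -
  have "(f, g, h) \<in> Arr (prod_cat C (prod_cat C M))"
    "Dom (prod_cat C (prod_cat C M)) (f, g, h) = (X, Y, N)"
      "Cod (prod_cat C (prod_cat C M)) (f, g, h) = (X', Y', N')"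
    using assms by (auto simp: prod_cat_def Hom_def)
  then show ?thesis using massoc_natural unfolding natural_iso_def by fastforce
qed

lemma munit:
  assumes "N \<in> Obj M"
  shows "MUnit M N \<in> Hom M (ActO M (UnitO C) N) N" "iso_arr M (MUnit M N)"
  using munit_natural assms unfolding natural_iso_def by auto

lemma munit_nat:
  assumes "h \<in> Hom M N N'"
  shows "h \<star> MUnit M N = MUnit M N' \<star> ActA M (Id C (UnitO C)) h"
  using munit_natural assms unfolding natural_iso_def Hom_def by auto

lemma lunit:
  assumes "X \<in> Obj C"
  shows "LUnit C X \<in> Hom C (TenO C (UnitO C) X) X" "iso_arr C (LUnit C X)"
  using C.lunit_natural assms unfolding natural_iso_def by auto

lemma runit:
  assumes "X \<in> Obj C"
  shows "RUnit C X \<in> Hom C (TenO C X (UnitO C)) X"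
  using C.runit_natural assms unfolding natural_iso_def by auto

lemma cassoc:
  assumes "X \<in> Obj C" "Y \<in> Obj C" "Z \<in> Obj C"
  shows "Assoc C X Y Z \<in> Hom C (TenO C (TenO C X Y) Z) (TenO C X (TenO C Y Z))"
proof -
  have "(X, Y, Z) \<in> Obj (prod_cat C (prod_cat C C))" using assms by (simp add: prod_cat_def)
  then show ?thesis using C.assoc_natural unfolding natural_iso_def by fastforce
qed

text \<open>Whiskering: \<open>lw\<close> fixes the object of the tensor category, \<open>rw\<close>
  the object of the module category.\<close>

abbreviation lw :: "'co \<Rightarrow> 'a \<Rightarrow> 'a" where "lw V g \<equiv> ActA M (Id C V) g"
abbreviation rw :: "'ca \<Rightarrow> 'o \<Rightarrow> 'a" where "rw f N \<equiv> ActA M f (Id M N)"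

lemma lw_hom: "V \<in> Obj C \<Longrightarrow> g \<in> Hom M N N' \<Longrightarrow> lw V g \<in> Hom M (ActO M V N) (ActO M V N')"
  using act_hom C.id_hom by blast

lemma rw_hom: "f \<in> Hom C V V' \<Longrightarrow> N \<in> Obj M \<Longrightarrow> rw f N \<in> Hom M (ActO M V N) (ActO M V' N)"
  using act_hom M.id_hom by blast

lemma lw_cmp: "V \<in> Obj C \<Longrightarrow> g \<in> Hom M N N' \<Longrightarrow> g' \<in> Hom M N' N'' \<Longrightarrow> lw V (g' \<star> g) = lw V g' \<star> lw V g"
  using act_cmp[OF C.id_hom C.id_hom, of V g N N' g' N''] C.cmp_id_left[OF C.id_hom, of V] by simp

lemma rw_cmp:
  "f \<in> Hom C V V' \<Longrightarrow> f' \<in> Hom C V' V'' \<Longrightarrow> N \<in> Obj M \<Longrightarrow> rw (f' \<cdot>\<^bsub>C\<^esub> f) N = rw f' N \<star> rw f N"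
  using act_cmp[OF _ _ M.id_hom M.id_hom, of f V V' f' V'' N] M.cmp_id_left[OF M.id_hom, of N] by simp

lemma rw_lw: "f \<in> Hom C V V' \<Longrightarrow> g \<in> Hom M N N' \<Longrightarrow> rw f N' \<star> lw V g = ActA M f g"
  using act_cmp[OF C.id_hom, of V f V' g N N' "Id M N'" N'] M.id_hom C.hom_obj M.hom_obj C.cmp_id_right
    M.cmp_id_left
  by metis

lemma lw_rw: "f \<in> Hom C V V' \<Longrightarrow> g \<in> Hom M N N' \<Longrightarrow> lw V' g \<star> rw f N = ActA M f g"
  using act_cmp[of f V V' "Id C V'" V' "Id M N" N N g N'] C.id_hom M.id_hom C.hom_obj M.hom_obj C.cmp_id_left
    M.cmp_id_right
  by metis

end

text \<open>The evaluation \<open>L \<otimes> (V \<otimes> X) \<rightarrow> X\<close> for a left dual \<open>L\<close> of \<open>V\<close>, natural in \<open>X\<close>. Instead of the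
  whole adjunction between \<open>L \<otimes> -\<close> and \<open>V \<otimes> -\<close> only the injectivity of transposition is needed.\<close>

context exact_module_data
begin

lemma dual_evaluation:
  assumes V: "V \<in> Obj C"
  obtains L \<kappa> where "L \<in> Obj C" "\<And>X. X \<in> Obj M \<Longrightarrow> \<kappa> X \<in> Hom M (ActO M L (ActO M V X)) X"
    "\<And>X Y f. f \<in> Hom M X Y \<Longrightarrow> f \<star> \<kappa> X = \<kappa> Y \<star> lw L (lw V f)"
    "\<And>W X g h. X \<in> Obj M \<Longrightarrow> g \<in> Hom M W (ActO M V X) \<Longrightarrow> h \<in> Hom M W (ActO M V X) \<Longrightarrow>
       \<kappa> X \<star> lw L g = \<kappa> X \<star> lw L h \<Longrightarrow> g = h"
proof -
  obtain L ev coev where dual: "is_dual_pair C L V ev coev" using C.rigid V unfolding rigid_def by blast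
  let ?I = "UnitO C"
  have L: "L \<in> Obj C" and ev: "ev \<in> Hom C (TenO C L V) ?I" and coev: "coev \<in> Hom C ?I (TenO C V L)"
    and zz: "RUnit C V \<cdot>\<^bsub>C\<^esub> TenA C (Id C V) ev \<cdot>\<^bsub>C\<^esub> Assoc C V L V \<cdot>\<^bsub>C\<^esub> TenA C coev (Id C V) = LUnit C V"
    using dual unfolding is_dual_pair_def by auto
  have I: "?I \<in> Obj C" by (rule C.unit_obj)
  have VL: "TenO C V L \<in> Obj C" and LV: "TenO C L V \<in> Obj C" using ten_obj V L by auto
  note IV = C.id_hom[OF V] and IL = C.id_hom[OF L]
  have "\<exists>b. b \<in> Hom M (ActO M L (ActO M V X)) (ActO M (TenO C L V) X) \<and>
      b \<star> MAssoc M L V X = Id M (ActO M (TenO C L V) X) \<and> MAssoc M L V X \<star> b = Id M (ActO M L (ActO M V X))"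
    if X: "X \<in> Obj M" for X
    using M.isoE[OF massoc(2,1)[OF L V X]] by metis
  then obtain b where b: "\<And>X. X \<in> Obj M \<Longrightarrow> b X \<in> Hom M (ActO M L (ActO M V X)) (ActO M (TenO C L V) X)"
    and ba: "\<And>X. X \<in> Obj M \<Longrightarrow> b X \<star> MAssoc M L V X = Id M (ActO M (TenO C L V) X)"
    and ab: "\<And>X. X \<in> Obj M \<Longrightarrow> MAssoc M L V X \<star> b X = Id M (ActO M L (ActO M V X))" by metis
  \<comment> \<open>The composite L \<otimes> (V \<otimes> X) \<rightarrow> (L \<otimes> V)
    \<otimes> X \<rightarrow> 1 \<otimes> X \<rightarrow> X.\<close>
  define \<kappa> where "\<kappa> X = MUnit M X \<star> (rw ev X \<star> b X)" for X
  have rwb: "rw ev X \<star> b X \<in> Hom M (ActO M L (ActO M V X)) (ActO M ?I X)" if X: "X \<in> Obj M" for X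
    using M.cmp_hom[OF b[OF X] rw_hom[OF ev X]] .
  have \<kappa>: "\<kappa> X \<in> Hom M (ActO M L (ActO M V X)) X" if X: "X \<in> Obj M" for X
    unfolding \<kappa>_def using M.cmp_hom[OF rwb[OF X] munit(1)[OF X]] .
  have \<kappa>a: "\<kappa> X \<star> MAssoc M L V X = MUnit M X \<star> rw ev X" if X: "X \<in> Obj M" for X
  proof -
    have "\<kappa> X \<star> MAssoc M L V X = MUnit M X \<star> (rw ev X \<star> (b X \<star> MAssoc M L V X))"
      unfolding \<kappa>_def using M.cmp_assoc[OF massoc(1)[OF L V X] rwb[OF X] munit(1)[OF X]]
        M.cmp_assoc[OF massoc(1)[OF L V X] b[OF X] rw_hom[OF ev X]] by simp
    then show ?thesis unfolding ba[OF X] using M.cmp_id_right[OF rw_hom[OF ev X]] by simp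
  qed
  have nat: "f \<star> \<kappa> X = \<kappa> Y \<star> lw L (lw V f)" if f: "f \<in> Hom M X Y" for X Y f
  proof -
    have X: "X \<in> Obj M" and Y: "Y \<in> Obj M" using M.hom_obj[OF f] by auto
    note aX = massoc[OF L V X] and aY = massoc[OF L V Y]
    have lf: "lw L (lw V f) \<in> Hom M (ActO M L (ActO M V X)) (ActO M L (ActO M V Y))"
      using lw_hom[OF L lw_hom[OF V f]] .
    have lf': "lw (TenO C L V) f \<in> Hom M (ActO M (TenO C L V) X) (ActO M (TenO C L V) Y)"
      using lw_hom[OF LV f] .
    \<comment> \<open>Checked after the associator, an isomorphism, because there
      \<open>\<kappa>\<close> becomes \<open>ev\<close> followed by the unit constraint.\<close>
    have "(f \<star> \<kappa> X) \<star> MAssoc M L V X = (f \<star> MUnit M X) \<star> rw ev X"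
      using M.cmp_assoc[OF aX(1) \<kappa>[OF X] f] \<kappa>a[OF X] M.cmp_assoc[OF rw_hom[OF ev X] munit(1)[OF X] f] by simp
    also have "\<dots> = MUnit M Y \<star> (lw ?I f \<star> rw ev X)"
      unfolding munit_nat[OF f] using M.cmp_assoc[OF rw_hom[OF ev X] lw_hom[OF I f] munit(1)[OF Y]] .
    also have "\<dots> = MUnit M Y \<star> (rw ev Y \<star> lw (TenO C L V) f)" unfolding lw_rw[OF ev f] rw_lw[OF ev f] ..
    also have "\<dots> = \<kappa> Y \<star> (MAssoc M L V Y \<star> lw (TenO C L V) f)"
      using M.cmp_assoc[OF lf' rw_hom[OF ev Y] munit(1)[OF Y]] \<kappa>a[OF Y] M.cmp_assoc[OF lf' aY(1) \<kappa>[OF Y]]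
        by simp
    also have "MAssoc M L V Y \<star> lw (TenO C L V) f = lw L (lw V f) \<star> MAssoc M L V X"
      using massoc_nat[OF IL IV f] ten_id[OF L V] by simp
    also have "\<kappa> Y \<star> (lw L (lw V f) \<star> MAssoc M L V X) = (\<kappa> Y \<star> lw L (lw V f)) \<star> MAssoc M L V X"
      using M.cmp_assoc[OF aX(1) lf \<kappa>[OF Y]] by simp
    finally show ?thesis
      by (rule M.epiD[OF M.iso_epi[OF aX(2)] aX(1) M.cmp_hom[OF \<kappa>[OF X] f] M.cmp_hom[OF lf \<kappa>[OF Y]]])
  qed
  have inj: "g = h"
    if X: "X \<in> Obj M" and g: "g \<in> Hom M W (ActO M V X)" and h: "h \<in> Hom M W (ActO M V X)"
      and eq: "\<kappa> X \<star> lw L g = \<kappa> X \<star> lw L h" for W X g h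
  proof -
    let ?VX = "ActO M V X"
    have VX: "?VX \<in> Obj M" using act_obj[OF V X] .
    have W: "W \<in> Obj M" using M.hom_obj[OF g] by simp
    have IX: "Id M X \<in> Hom M X X" using M.id_hom[OF X] .
    have LVX: "ActO M L ?VX \<in> Obj M" using act_obj[OF L VX] .
    \<comment> \<open>Coevaluation followed by \<open>lw V (\<kappa> X)\<close>. By
      \<open>key\<close> the transpose of \<open>u\<close> determines
      \<open>\<theta> \<star> lw ?I u\<close>, so cancelling \<open>\<theta>\<close> recovers
      \<open>u\<close>.\<close>
    define \<theta> where "\<theta> = lw V (\<kappa> X) \<star> (MAssoc M V L ?VX \<star> rw coev ?VX)"
    note a1 = massoc(1)[OF V L VX] and c1 = rw_hom[OF coev VX] and lk = lw_hom[OF V \<kappa>[OF X]]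
    have \<theta>: "\<theta> \<in> Hom M (ActO M ?I ?VX) ?VX" unfolding \<theta>_def using M.cmp_hom[OF M.cmp_hom[OF c1 a1] lk] .
    have key: "lw V (\<kappa> X \<star> lw L u) \<star> (MAssoc M V L W \<star> rw coev W) = \<theta> \<star> lw ?I u"
      if u: "u \<in> Hom M W ?VX" for u
    proof -
      note lu = lw_hom[OF L u] and c2 = rw_hom[OF coev W] and a2 = massoc(1)[OF V L W]
      note vlu = lw_hom[OF V lu] and vlu' = lw_hom[OF VL u] and iu = lw_hom[OF I u]
      have "lw V (\<kappa> X \<star> lw L u) \<star> (MAssoc M V L W \<star> rw coev W)
          = lw V (\<kappa> X) \<star> ((lw V (lw L u) \<star> MAssoc M V L W) \<star> rw coev W)"
        unfolding lw_cmp[OF V lu \<kappa>[OF X]]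
        using M.cmp_assoc[OF M.cmp_hom[OF c2 a2] vlu lk] M.cmp_assoc[OF c2 a2 vlu] by simp
      also have "lw V (lw L u) \<star> MAssoc M V L W = MAssoc M V L ?VX \<star> lw (TenO C V L) u"
        using massoc_nat[OF IV IL u] ten_id[OF V L] by simp
      also have "(MAssoc M V L ?VX \<star> lw (TenO C V L) u) \<star> rw coev W
          = MAssoc M V L ?VX \<star> (rw coev ?VX \<star> lw ?I u)"
        using M.cmp_assoc[OF c2 vlu' a1] lw_rw[OF coev u] rw_lw[OF coev u] by simp
      also have "lw V (\<kappa> X) \<star> (MAssoc M V L ?VX \<star> (rw coev ?VX \<star> lw ?I u)) = \<theta> \<star> lw ?I u"
        unfolding \<theta>_def using M.cmp_assoc[OF iu M.cmp_hom[OF c1 a1] lk] M.cmp_assoc[OF iu c1 a1] by simp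
      finally show ?thesis .
    qed
    note a3 = massoc[OF I V X]
    have IVobj: "TenO C ?I V \<in> Obj C" using ten_obj[OF I V] .
    have tcv: "TenA C coev (Id C V) \<in> Hom C (TenO C ?I V) (TenO C (TenO C V L) V)" using ten_hom[OF coev IV] .
    have tve: "TenA C (Id C V) ev \<in> Hom C (TenO C V (TenO C L V)) (TenO C V ?I)" using ten_hom[OF IV ev] .
    note as = cassoc[OF V L V] and ru = runit[OF V] and lu = lunit[OF V]
    note m1 = C.cmp_hom[OF tcv as] note m2 = C.cmp_hom[OF m1 tve]
    \<comment> \<open>The zigzag identity acting on \<open>X\<close>: the pentagon rearranges the
      brackets, the triangle turns \<open>MUnit\<close> into \<open>RUnit\<close>, and what remains
      is \<open>zz\<close> whiskered with \<open>X\<close>.\<close>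
    have "\<theta> \<star> MAssoc M ?I V X = lw V (\<kappa> X) \<star> (MAssoc M V L ?VX \<star> (rw coev ?VX \<star> MAssoc M ?I V X))"
      unfolding \<theta>_def using M.cmp_assoc[OF a3(1) M.cmp_hom[OF c1 a1] lk] M.cmp_assoc[OF a3(1) c1 a1] by simp
    also have "rw coev ?VX \<star> MAssoc M ?I V X = MAssoc M (TenO C V L) V X \<star> rw (TenA C coev (Id C V)) X"
      using massoc_nat[OF coev IV IX] act_id[OF V X] by simp
    also have "MAssoc M V L ?VX \<star> (MAssoc M (TenO C V L) V X \<star> rw (TenA C coev (Id C V)) X)
       = (MAssoc M V L ?VX \<star> MAssoc M (TenO C V L) V X) \<star> rw (TenA C coev (Id C V)) X"
      using M.cmp_assoc[OF rw_hom[OF tcv X] massoc(1)[OF VL V X] a1] by simp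
    also have "MAssoc M V L ?VX \<star> MAssoc M (TenO C V L) V X
       = lw V (MAssoc M L V X) \<star> MAssoc M V (TenO C L V) X \<star> rw (Assoc C V L V) X"
      using mpentagon[OF V L V X] by simp
    also have "lw V (\<kappa> X) \<star> ((lw V (MAssoc M L V X) \<star> MAssoc M V (TenO C L V) X \<star> rw (Assoc C V L V) X)
         \<star> rw (TenA C coev (Id C V)) X)
       = (lw V (\<kappa> X) \<star> lw V (MAssoc M L V X)) \<star> (MAssoc M V (TenO C L V) X \<star>
         (rw (Assoc C V L V) X \<star> rw (TenA C coev (Id C V)) X))"
    proof -
      note t1 = rw_hom[OF tcv X] and t2 = rw_hom[OF as X] and t3 = massoc(1)[OF V LV X]
        and t4 = lw_hom[OF V massoc(1)[OF L V X]]
      show ?thesis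
        using M.cmp_assoc[OF t1 M.cmp_hom[OF t2 t3] t4] M.cmp_assoc[OF t1 t2 t3]
          M.cmp_assoc[OF t1 M.cmp_hom[OF M.cmp_hom[OF t2 t3] t4] lk]
          M.cmp_assoc[OF M.cmp_hom[OF M.cmp_hom[OF t1 t2] t3] t4 lk] by simp
    qed
    also have "lw V (\<kappa> X) \<star> lw V (MAssoc M L V X) = lw V (MUnit M X) \<star> lw V (rw ev X)"
      using lw_cmp[OF V massoc(1)[OF L V X] \<kappa>[OF X]] \<kappa>a[OF X] lw_cmp[OF V rw_hom[OF ev X] munit(1)[OF X]]
        by simp
    also have "rw (Assoc C V L V) X \<star> rw (TenA C coev (Id C V)) X = rw (Assoc C V L V \<cdot>\<^bsub>C\<^esub> TenA C coev (Id C V)) X"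
      using rw_cmp[OF tcv as X] by simp
    also have "(lw V (MUnit M X) \<star> lw V (rw ev X)) \<star>
        (MAssoc M V (TenO C L V) X \<star> rw (Assoc C V L V \<cdot>\<^bsub>C\<^esub> TenA C coev (Id C V)) X)
       = lw V (MUnit M X) \<star> ((lw V (rw ev X) \<star> MAssoc M V (TenO C L V) X) \<star> rw (Assoc C V L V \<cdot>\<^bsub>C\<^esub> TenA C coev (Id C V)) X)"
      using M.cmp_assoc[OF
        M.cmp_hom[OF rw_hom[OF m1 X] massoc(1)[OF V LV X]] lw_hom[OF V rw_hom[OF ev X]] lw_hom[OF V munit(1)[OF X]]]
        M.cmp_assoc[OF rw_hom[OF m1 X] massoc(1)[OF V LV X] lw_hom[OF V rw_hom[OF ev X]]] by simp
    also have "lw V (rw ev X) \<star> MAssoc M V (TenO C L V) X = MAssoc M V ?I X \<star> rw (TenA C (Id C V) ev) X"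
      by (rule massoc_nat[OF IV ev IX])
    also have "lw V (MUnit M X) \<star> ((MAssoc M V ?I X \<star> rw (TenA C (Id C V) ev) X) \<star> rw (Assoc C V L V \<cdot>\<^bsub>C\<^esub> TenA C coev (Id C V)) X)
       = (lw V (MUnit M X) \<star> MAssoc M V ?I X) \<star> (rw (TenA C (Id C V) ev) X \<star> rw (Assoc C V L V \<cdot>\<^bsub>C\<^esub> TenA C coev (Id C V)) X)"
      using M.cmp_assoc[OF rw_hom[OF m1 X] rw_hom[OF tve X] massoc(1)[OF V I X]]
        M.cmp_assoc[OF
          M.cmp_hom[OF rw_hom[OF m1 X] rw_hom[OF tve X]] massoc(1)[OF V I X] lw_hom[OF V munit(1)[OF X]]]
            by simp
    also have "lw V (MUnit M X) \<star> MAssoc M V ?I X = rw (RUnit C V) X" by (rule mtriangle[OF V X])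
    also have "rw (RUnit C V) X \<star> (rw (TenA C (Id C V) ev) X \<star> rw (Assoc C V L V \<cdot>\<^bsub>C\<^esub> TenA C coev (Id C V)) X) = rw (LUnit C V) X"
      using rw_cmp[OF m1 tve X] rw_cmp[OF m2 ru X] zz by simp
    finally have \<theta>a: "\<theta> \<star> MAssoc M ?I V X = rw (LUnit C V) X" .
    obtain li where li: "li \<in> Hom C V (TenO C ?I V)" "li \<cdot>\<^bsub>C\<^esub> LUnit C V = Id C (TenO C ?I V)"
      using C.isoE[OF lu(2,1)] by metis
    have lmono: "mono_arr M (rw (LUnit C V) X)"
    proof (rule M.split_mono[OF rw_hom[OF lu(1) X] rw_hom[OF li(1) X]])
      show "rw li X \<star> rw (LUnit C V) X = Id M (ActO M (TenO C ?I V) X)"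
        using rw_cmp[OF lu(1) li(1) X] li(2) act_id[OF IVobj X] by simp
    qed
    obtain ai where ai: "ai \<in> Hom M (ActO M ?I ?VX) (ActO M (TenO C ?I V) X)"
      "MAssoc M ?I V X \<star> ai = Id M (ActO M ?I ?VX)"
      using M.isoE[OF a3(2,1)] by metis
    note Ig = lw_hom[OF I g] and Ih = lw_hom[OF I h]
    have red: "\<theta> \<star> u = rw (LUnit C V) X \<star> (ai \<star> u)" if u: "u \<in> Hom M U (ActO M ?I ?VX)" for u U
    proof -
      have "rw (LUnit C V) X \<star> (ai \<star> u) = \<theta> \<star> ((MAssoc M ?I V X \<star> ai) \<star> u)"
        unfolding \<theta>a[symmetric]
          using M.cmp_assoc[OF M.cmp_hom[OF u ai(1)] a3(1) \<theta>] M.cmp_assoc[OF u ai(1) a3(1)] by simp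
      then show ?thesis unfolding ai(2) using M.cmp_id_left[OF u] by simp
    qed
    \<comment> \<open>\<open>\<theta>\<close> is cancelled in stages: the left unit constraint, the
      associator, and finally \<open>MUnit\<close>.\<close>
    have "\<theta> \<star> lw ?I g = \<theta> \<star> lw ?I h" using key[OF g] key[OF h] eq by simp
    then have "ai \<star> lw ?I g = ai \<star> lw ?I h"
      using red[OF Ig] red[OF Ih] M.monoD[OF lmono rw_hom[OF lu(1) X] M.cmp_hom[OF Ig ai(1)]
        M.cmp_hom[OF Ih ai(1)]] by simp
    then have "(MAssoc M ?I V X \<star> ai) \<star> lw ?I g = (MAssoc M ?I V X \<star> ai) \<star> lw ?I h"
      using M.cmp_assoc[OF Ig ai(1) a3(1)] M.cmp_assoc[OF Ih ai(1) a3(1)] by simp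
    then have "lw ?I g = lw ?I h" unfolding ai(2) using M.cmp_id_left[OF Ig] M.cmp_id_left[OF Ih] by simp
    then have "g \<star> MUnit M W = h \<star> MUnit M W" using munit_nat[OF g] munit_nat[OF h] by simp
    then show ?thesis by (rule M.epiD[OF M.iso_epi[OF munit(2)[OF W]] munit(1)[OF W] g h])
  qed
  show ?thesis by (rule that[OF L \<kappa> nat inj])
qed

text \<open>Tensoring with \<open>V\<close> has tensoring with a left dual as left adjoint, so it
  preserves monomorphisms; concretely, transposition turns composition with \<open>lw V f\<close>
  into composition with \<open>f\<close>.\<close>

lemma lw_mono:
  assumes V: "V \<in> Obj C" and f: "f \<in> Hom M X Y" and mono: "mono_arr M f"
  shows "mono_arr M (lw V f)"
proof -
  obtain L \<kappa> where L: "L \<in> Obj C" and \<kappa>: "\<And>X. X \<in> Obj M \<Longrightarrow> \<kappa> X \<in> Hom M (ActO M L (ActO M V X)) X"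
    and nat: "\<And>X Y f. f \<in> Hom M X Y \<Longrightarrow> f \<star> \<kappa> X = \<kappa> Y \<star> lw L (lw V f)"
    and inj: "\<And>W X g h. X \<in> Obj M \<Longrightarrow> g \<in> Hom M W (ActO M V X) \<Longrightarrow> h \<in> Hom M W (ActO M V X) \<Longrightarrow>
       \<kappa> X \<star> lw L g = \<kappa> X \<star> lw L h \<Longrightarrow> g = h"
    using dual_evaluation[OF V] by metis
  have X: "X \<in> Obj M" and Y: "Y \<in> Obj M" using M.hom_obj[OF f] by auto
  note Vf = lw_hom[OF V f]
  show ?thesis
    unfolding mono_arr_def
  proof (intro conjI ballI impI)
    show "lw V f \<in> Arr M" using Vf by (simp add: M.Hom_iff)
    fix W g h assume "W \<in> Obj M" "g \<in> Hom M W (Dom M (lw V f))" "h \<in> Hom M W (Dom M (lw V f))"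
      and eq: "lw V f \<star> g = lw V f \<star> h"
    then have gh: "g \<in> Hom M W (ActO M V X)" "h \<in> Hom M W (ActO M V X)" using Vf by (auto simp: M.Hom_iff)
    have tr: "f \<star> (\<kappa> X \<star> lw L u) = \<kappa> Y \<star> lw L (lw V f \<star> u)" if u: "u \<in> Hom M W (ActO M V X)" for u
      using M.cmp_assoc[OF lw_hom[OF L u] \<kappa>[OF X] f] nat[OF f] lw_cmp[OF L u Vf]
        M.cmp_assoc[OF lw_hom[OF L u] lw_hom[OF L Vf] \<kappa>[OF Y]] by simp
    have "\<kappa> X \<star> lw L g = \<kappa> X \<star> lw L h"
      by (rule M.monoD[OF mono f M.cmp_hom[OF lw_hom[OF L gh(1)] \<kappa>[OF X]]
        M.cmp_hom[OF lw_hom[OF L gh(2)] \<kappa>[OF X]]])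
        (simp add: tr gh eq)
    then show "g = h" by (rule inj[OF X gh])
  qed
qed

text \<open>After tensoring with \<open>P\<close>, the cokernel of \<open>j\<close> is still a
  cokernel and has a projective target, so it is split by some \<open>s\<close>. The idempotent
  complementary to \<open>s \<star> lw P c\<close> has values in the subobject \<open>lw P j\<close>
  and thereby gives the retraction.\<close>

lemma cokernel_split:
  assumes P: "projective_object C P" and j: "j \<in> Hom M X Y" and mono: "mono_arr M j"
  obtains r where "r \<in> Hom M (ActO M P Y) (ActO M P X)" "r \<star> lw P j = Id M (ActO M P X)"
proof -
  have PO: "P \<in> Obj C" using P by (simp add: projective_object_def)
  interpret F: linear_functor M M "\<lambda>N. ActO M P N" "\<lambda>g. lw P g" using action_linear_right[OF PO] .
  obtain Q c where c: "c \<in> Hom M Y Q" "epi_arr M c" "c \<star> j = ZeroA M X Q"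
    and univ: "\<forall>W. \<forall>g\<in>Hom M Y W. g \<star> j = ZeroA M X W \<longrightarrow> (\<exists>h\<in>Hom M Q W. h \<star> c = g)"
    using M.coker_ex[OF j] by blast
  have "is_cokernel M j c" by (rule M.is_cokernelI[OF j c(1,3,2)]) (use univ in blast)
  then have ck: "is_cokernel M (lw P j) (lw P c)"
    using action_right_exact_right[OF PO] by (simp add: right_exact_def)
  have epi: "epi_arr M (lw P c)" by (rule M.is_cokernel_epi[OF ck])
  have XO: "X \<in> Obj M" and QO: "Q \<in> Obj M" and YO: "Y \<in> Obj M"
    using M.hom_obj[OF j] M.hom_obj[OF c(1)] by auto
  note Pj = lw_hom[OF PO j] and Pc = lw_hom[OF PO c(1)]
  have PX: "ActO M P X \<in> Obj M" and PY: "ActO M P Y \<in> Obj M" and PQ: "ActO M P Q \<in> Obj M"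
    using act_obj[OF PO] XO YO QO by auto
  note IY = M.id_hom[OF PY]
  obtain s where s: "s \<in> Hom M (ActO M P Q) (ActO M P Y)" "lw P c \<star> s = Id M (ActO M P Q)"
    by (rule M.projective_lift[OF action_projective[OF P QO] epi Pc M.id_hom[OF PQ]])
  have sc: "s \<star> lw P c \<in> Hom M (ActO M P Y) (ActO M P Y)" using M.cmp_hom[OF Pc s(1)] .
  let ?e = "M.diff_arr (Id M (ActO M P Y)) (s \<star> lw P c)"
  have e: "?e \<in> Hom M (ActO M P Y) (ActO M P Y)" using M.diff_hom[OF IY sc] .
  have "lw P c \<star> (s \<star> lw P c) = lw P c"
    using M.cmp_assoc[OF Pc s(1) Pc] s(2) M.cmp_id_left[OF Pc] by simp
  then have ce: "lw P c \<star> ?e = ZeroA M (ActO M P Y) (ActO M P Q)"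
    using M.cmp_diff_right[OF IY sc Pc] M.cmp_id_right[OF Pc] M.diff_self[OF Pc] by simp
  have Pmono: "mono_arr M (lw P j)" using lw_mono[OF PO j mono] .
  \<comment> \<open>The monomorphism \<open>lw P j\<close> is the kernel of its own cokernel
    \<open>c'\<close>. As \<open>lw P c\<close> is a cokernel of \<open>lw P j\<close> too,
    \<open>c'\<close> factors through it and kills \<open>?e\<close>.\<close>
  obtain D c' where c': "c' \<in> Hom M (ActO M P Y) D" "c' \<star> lw P j = ZeroA M (ActO M P X) D"
    and ker: "\<forall>W. \<forall>g\<in>Hom M W (ActO M P Y). c' \<star> g = ZeroA M W D \<longrightarrow> (\<exists>h\<in>Hom M W (ActO M P X). lw P j \<star> h = g)"
    using M.coker_ex[OF Pj] Pmono by blast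
  have D: "D \<in> Obj M" using M.hom_obj[OF c'(1)] by simp
  have "Dom M (lw P j) = ActO M P X" "Cod M (lw P j) = ActO M P Y" "Cod M (lw P c) = ActO M P Q"
    using Pj Pc by (auto simp: M.Hom_iff)
  then obtain h where h: "h \<in> Hom M (ActO M P Q) D" "h \<star> lw P c = c'"
    using ck c' D unfolding is_cokernel_def by metis
  have "c' \<star> ?e = ZeroA M (ActO M P Y) D"
    using h(2) M.cmp_assoc[OF e Pc h(1)] ce M.cmp_zero_right[OF h(1) PY] by simp
  then obtain r where r: "r \<in> Hom M (ActO M P Y) (ActO M P X)" "lw P j \<star> r = ?e" using ker e by blast
  have "lw P c \<star> lw P j = ZeroA M (ActO M P X) (ActO M P Q)"
    using lw_cmp[OF PO j c(1)] c(3) F.map_zero[OF XO QO] by simp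
  then have "(s \<star> lw P c) \<star> lw P j = ZeroA M (ActO M P X) (ActO M P Y)"
    using M.cmp_assoc[OF Pj Pc s(1)] M.cmp_zero_right[OF s(1) PX] by simp
  then have "?e \<star> lw P j = M.diff_arr (lw P j) (ZeroA M (ActO M P X) (ActO M P Y))"
    using M.cmp_diff_left[OF Pj IY sc] M.cmp_id_left[OF Pj] by simp
  also have "\<dots> = lw P j" using M.diff_diff[OF Pj Pj] M.diff_self[OF Pj] by simp
  finally have "lw P j \<star> (r \<star> lw P j) = lw P j \<star> Id M (ActO M P X)"
    using M.cmp_assoc[OF Pj r(1) Pj] r(2) M.cmp_id_right[OF Pj] by simp
  then have "r \<star> lw P j = Id M (ActO M P X)"
    by (rule M.monoD[OF Pmono Pj M.cmp_hom[OF Pj r(1)] M.id_hom[OF PX]])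
  then show ?thesis using that r(1) by blast
qed

lemma exact_projective_action:
  assumes P: "projective_object C P"
  shows "exact_projective_functor M dM (\<lambda>N. ActO M P N) (\<lambda>g. lw P g)"
proof -
  have PO: "P \<in> Obj C" using P by (simp add: projective_object_def)
  interpret F: linear_functor M M "\<lambda>N. ActO M P N" "\<lambda>g. lw P g" using action_linear_right[OF PO] .
  show ?thesis
  proof
    show "right_exact M M (\<lambda>N. ActO M P N) (\<lambda>g. lw P g)" using action_right_exact_right[OF PO] .
    show "projective_object M (ActO M P X)" if "X \<in> Obj M" for X using action_projective[OF P that] .
    show "\<exists>r\<in>Hom M (ActO M P Y) (ActO M P X). r \<star> lw P j = Id M (ActO M P X)"
      if "j \<in> Hom M X Y" "mono_arr M j" for j X Y
      using cokernel_split[OF P that] by metis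
  qed
qed

text \<open>Right exactness is formulated for cokernels, and every epimorphism is the cokernel of
  its kernel. The same reason gives \<open>lw_epi\<close>.\<close>

lemma rw_epi:
  assumes e: "e \<in> Hom C V W" and epi: "epi_arr C e" and N: "N \<in> Obj M"
  shows "epi_arr M (rw e N)"
proof -
  obtain K k where k: "k \<in> Hom C K V" "e \<cdot>\<^bsub>C\<^esub> k = ZeroA C K W"
    and univ: "\<forall>U. \<forall>g\<in>Hom C V U. g \<cdot>\<^bsub>C\<^esub> k = ZeroA C K U \<longrightarrow> (\<exists>h\<in>Hom C W U. h \<cdot>\<^bsub>C\<^esub> e = g)"
    using C.ker_ex[OF e] epi by blast
  have "is_cokernel C k e" by (rule C.is_cokernelI[OF k(1) e k(2) epi]) (use univ in blast)
  then have "is_cokernel M (rw k N) (rw e N)"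
    using action_right_exact_left[OF N] by (simp add: right_exact_def)
  then show ?thesis by (rule M.is_cokernel_epi)
qed

lemma lw_epi:
  assumes V: "V \<in> Obj C" and e: "e \<in> Hom M X Y" and epi: "epi_arr M e"
  shows "epi_arr M (lw V e)"
proof -
  obtain K k where k: "k \<in> Hom M K X" "e \<star> k = ZeroA M K Y"
    and univ: "\<forall>U. \<forall>g\<in>Hom M X U. g \<star> k = ZeroA M K U \<longrightarrow> (\<exists>h\<in>Hom M Y U. h \<star> e = g)"
    using M.ker_ex[OF e] epi by blast
  have "is_cokernel M k e" by (rule M.is_cokernelI[OF k(1) e k(2) epi]) (use univ in blast)
  then have "is_cokernel M (lw V k) (lw V e)"
    using action_right_exact_right[OF V] by (simp add: right_exact_def)
  then show ?thesis by (rule M.is_cokernel_epi)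
qed

section \<open>The direct summand generated by one object\<close>

text \<open>A single \<open>V\<close> accounts for finite sums, since (V1 \<oplus> V2) \<otimes> X
  is the sum of V1 \<otimes> X and V2 \<otimes> X.\<close>

definition generated :: "'o \<Rightarrow> 'o set" where
  "generated X = {Y. \<exists>V\<in>Obj C. \<exists>e\<in>Hom M (ActO M V X) Y. epi_arr M e}"

text \<open>The complementary summand. Orthogonality is asked on one side; the other side is derived
  in \<open>indecomposable_generation\<close>.\<close>

definition generated_perp :: "'o \<Rightarrow> 'o set" where
  "generated_perp X = {N \<in> Obj M. \<forall>L\<in>generated X. \<forall>f\<in>Hom M L N. f = ZeroA M L N}"

lemma generated_obj: "Y \<in> generated X \<Longrightarrow> Y \<in> Obj M"
  unfolding generated_def using M.hom_obj by blast

lemma generated_quot: "Y \<in> generated X \<Longrightarrow> f \<in> Hom M Y Z \<Longrightarrow> epi_arr M f \<Longrightarrow> Z \<in> generated X"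
  unfolding generated_def using M.epi_cmp M.cmp_hom by blast

lemma generated_self:
  assumes X: "X \<in> Obj M"
  shows "X \<in> generated X"
  unfolding generated_def using munit[OF X] M.iso_epi C.unit_obj by blast

lemma generated_act:
  assumes W: "W \<in> Obj C" and Y: "Y \<in> generated X" and X: "X \<in> Obj M"
  shows "ActO M W Y \<in> generated X"
proof -
  obtain V e where V: "V \<in> Obj C" and e: "e \<in> Hom M (ActO M V X) Y" "epi_arr M e"
    using Y unfolding generated_def by blast
  note a = massoc[OF W V X]
  have "epi_arr M (lw W e \<star> MAssoc M W V X)"
    by (rule M.epi_cmp[OF M.iso_epi[OF a(2)] lw_epi[OF W e] a(1) lw_hom[OF W e(1)]])
  moreover have "lw W e \<star> MAssoc M W V X \<in> Hom M (ActO M (TenO C W V) X) (ActO M W Y)"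
    by (rule M.cmp_hom[OF a(1) lw_hom[OF W e(1)]])
  ultimately show ?thesis unfolding generated_def using ten_obj[OF W V] by blast
qed

lemma generated_sum:
  assumes Y1: "Y1 \<in> generated X" and Y2: "Y2 \<in> generated X" and Z: "is_direct_sum M Y1 Y2 Z"
    and X: "X \<in> Obj M"
  shows "Z \<in> generated X"
proof -
  obtain V1 e1 where 1: "V1 \<in> Obj C" "e1 \<in> Hom M (ActO M V1 X) Y1" "epi_arr M e1"
    using Y1 unfolding generated_def by blast
  obtain V2 e2 where 2: "V2 \<in> Obj C" "e2 \<in> Hom M (ActO M V2 X) Y2" "epi_arr M e2"
    using Y2 unfolding generated_def by blast
  obtain V where V: "is_direct_sum C V1 V2 V" using C.sum_ex 1 2 by blast
  then have VO: "V \<in> Obj C" by (simp add: is_direct_sum_def)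
  interpret L: linear_functor C M "\<lambda>V. ActO M V X" "\<lambda>f. rw f X" using action_linear_left[OF X] .
  obtain h where "h \<in> Hom M (ActO M V X) Z" "epi_arr M h"
    by (rule M.direct_sum_epi[OF L.map_direct_sum[OF V] Z 1(2,3) 2(2,3)])
  then show ?thesis unfolding generated_def using VO by blast
qed

text \<open>A projective object covering the unit gives a natural epimorphism from Q \<otimes> N to
  N. Along it, statements that hold after tensoring with \<open>Q\<close>, where short exact
  sequences split, are carried back.\<close>

lemma unit_cover:
  obtains Q \<epsilon> where "projective_object C Q" "Q \<in> Obj C"
    "\<And>N. N \<in> Obj M \<Longrightarrow> \<epsilon> N \<in> Hom M (ActO M Q N) N" "\<And>N. N \<in> Obj M \<Longrightarrow> epi_arr M (\<epsilon> N)"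
    "\<And>N N' f. f \<in> Hom M N N' \<Longrightarrow> f \<star> \<epsilon> N = \<epsilon> N' \<star> lw Q f"
proof -
  obtain Q e where Q: "projective_object C Q" and e: "e \<in> Hom C Q (UnitO C)" "epi_arr C e"
    using C.proj_ex[OF C.unit_obj] by blast
  have QO: "Q \<in> Obj C" using C.hom_obj[OF e(1)] by simp
  define \<epsilon> where "\<epsilon> N = MUnit M N \<star> rw e N" for N
  show ?thesis
  proof (rule that[OF Q QO, of \<epsilon>])
    fix N assume N: "N \<in> Obj M"
    show "\<epsilon> N \<in> Hom M (ActO M Q N) N" unfolding \<epsilon>_def by (rule M.cmp_hom[OF rw_hom[OF e(1) N] munit(1)[OF N]])
    show "epi_arr M (\<epsilon> N)" unfolding \<epsilon>_def
      by (rule M.epi_cmp[OF rw_epi[OF e N] M.iso_epi[OF munit(2)[OF N]] rw_hom[OF e(1) N] munit(1)[OF N]])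
  next
    fix N N' f assume f: "f \<in> Hom M N N'"
    have N: "N \<in> Obj M" "N' \<in> Obj M" using M.hom_obj[OF f] by auto
    show "f \<star> \<epsilon> N = \<epsilon> N' \<star> lw Q f"
      unfolding \<epsilon>_def
      using M.cmp_assoc[OF rw_hom[OF e(1) N(1)] munit(1)[OF N(1)] f] munit_nat[OF f]
        M.cmp_assoc[OF rw_hom[OF e(1) N(1)] lw_hom[OF C.unit_obj f] munit(1)[OF N(2)]]
        lw_rw[OF e(1) f] rw_lw[OF e(1) f]
        M.cmp_assoc[OF lw_hom[OF QO f] rw_hom[OF e(1) N(2)] munit(1)[OF N(2)]] by simp
  qed
qed

text \<open>After tensoring with \<open>Q\<close> the subobject is a retract, in particular a
  quotient, of an object in \<open>generated X\<close>.\<close>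

lemma generated_sub:
  assumes j: "j \<in> Hom M Z E" and mono: "mono_arr M j" and E: "E \<in> generated X" and X: "X \<in> Obj M"
  shows "Z \<in> generated X"
proof -
  obtain Q \<epsilon> where Q: "projective_object C Q" "Q \<in> Obj C"
    and \<epsilon>: "\<And>N. N \<in> Obj M \<Longrightarrow> \<epsilon> N \<in> Hom M (ActO M Q N) N" "\<And>N. N \<in> Obj M \<Longrightarrow> epi_arr M (\<epsilon> N)"
    by (rule unit_cover) blast
  have ZO: "Z \<in> Obj M" using M.hom_obj[OF j] by simp
  obtain r where r: "r \<in> Hom M (ActO M Q E) (ActO M Q Z)" "r \<star> lw Q j = Id M (ActO M Q Z)"
    by (rule cokernel_split[OF Q(1) j mono])
  have "epi_arr M r" by (rule M.split_epi[OF r(1) lw_hom[OF Q(2) j] r(2)])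
  then have "ActO M Q Z \<in> generated X" using generated_quot[OF generated_act[OF Q(2) E X] r(1)] by simp
  then show ?thesis using generated_quot \<epsilon> ZO by blast
qed

lemma projective_action_section:
  assumes Q: "projective_object C Q" and c: "c \<in> Hom M E B" and epi: "epi_arr M c"
  obtains s where "s \<in> Hom M (ActO M Q B) (ActO M Q E)" "lw Q c \<star> s = Id M (ActO M Q B)"
proof -
  have QO: "Q \<in> Obj C" using Q by (simp add: projective_object_def)
  have B: "B \<in> Obj M" using M.hom_obj[OF c] by simp
  show ?thesis
    by (rule M.projective_lift[OF action_projective[OF Q B] lw_epi[OF QO c epi] lw_hom[OF QO c]
          M.id_hom[OF act_obj[OF QO B]]]) (rule that)
qed

text \<open>A section of Q \<otimes> E \<rightarrow> Q \<otimes> B makes Q \<otimes> E a quotient of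
  the sum of Q \<otimes> A and Q \<otimes> B.\<close>

lemma generated_extension:
  assumes ck: "is_cokernel M a c" and a: "a \<in> Hom M A E" and c: "c \<in> Hom M E B"
    and A: "A \<in> generated X" and B: "B \<in> generated X" and X: "X \<in> Obj M"
  shows "E \<in> generated X"
proof -
  obtain Q \<epsilon> where Q: "projective_object C Q" "Q \<in> Obj C"
    and \<epsilon>: "\<And>N. N \<in> Obj M \<Longrightarrow> \<epsilon> N \<in> Hom M (ActO M Q N) N" "\<And>N. N \<in> Obj M \<Longrightarrow> epi_arr M (\<epsilon> N)"
    by (rule unit_cover) blast
  have EO: "E \<in> Obj M" using M.hom_obj[OF c] by simp
  have epi: "epi_arr M c" by (rule M.is_cokernel_epi[OF ck])
  have ckQ: "is_cokernel M (lw Q a) (lw Q c)"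
    using action_right_exact_right[OF Q(2)] ck by (simp add: right_exact_def)
  note Qa = lw_hom[OF Q(2) a] and Qc = lw_hom[OF Q(2) c]
  obtain s where s: "s \<in> Hom M (ActO M Q B) (ActO M Q E)" "lw Q c \<star> s = Id M (ActO M Q B)"
    by (rule projective_action_section[OF Q(1) c epi])
  obtain T where T: "is_direct_sum M (ActO M Q A) (ActO M Q B) T"
    using M.sum_ex M.hom_obj[OF Qa] M.hom_obj[OF Qc] by blast
  have TG: "T \<in> generated X"
    by (rule generated_sum[OF generated_act[OF Q(2) A X] generated_act[OF Q(2) B X] T X])
  obtain i j p q where ijpq: "i \<in> Hom M (ActO M Q A) T" "j \<in> Hom M (ActO M Q B) T"
      "p \<in> Hom M T (ActO M Q A)" "q \<in> Hom M T (ActO M Q B)"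
    and eq: "p \<star> i = Id M (ActO M Q A)" "q \<star> j = Id M (ActO M Q B)"
      "p \<star> j = ZeroA M (ActO M Q B) (ActO M Q A)" "q \<star> i = ZeroA M (ActO M Q A) (ActO M Q B)"
    by (rule M.direct_sumE[OF T])
  obtain h where h: "h \<in> Hom M T (ActO M Q E)" "h \<star> i = lw Q a" "h \<star> j = s"
    by (rule M.copair_exists[OF ijpq eq Qa s(1)])
  have dc: "Dom M (lw Q a) = ActO M Q A" "Cod M (lw Q a) = ActO M Q E" "Cod M (lw Q c) = ActO M Q B"
    using Qa Qc by (auto simp: M.Hom_iff)
  have "epi_arr M h"
  proof (rule M.epi_zeroI[OF h(1)])
    fix W g assume g: "g \<in> Hom M (ActO M Q E) W" and gh: "g \<star> h = ZeroA M T W"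
    have W: "W \<in> Obj M" using M.hom_obj[OF g] by simp
    have "g \<star> lw Q a = ZeroA M (ActO M Q A) W"
      using M.cmp_assoc[OF ijpq(1) h(1) g] h(2) gh M.cmp_zero_left[OF ijpq(1) W] by simp
    then obtain g' where g': "g' \<in> Hom M (ActO M Q B) W" "g' \<star> lw Q c = g"
      using ckQ g W unfolding is_cokernel_def dc by metis
    have "g \<star> s = ZeroA M (ActO M Q B) W"
      using M.cmp_assoc[OF ijpq(2) h(1) g] h(3) gh M.cmp_zero_left[OF ijpq(2) W] by simp
    then have "g' = ZeroA M (ActO M Q B) W"
      using g' M.cmp_assoc[OF s(1) Qc g'(1)] s(2) M.cmp_id_right[OF g'(1)] by simp
    then show "g = ZeroA M (ActO M Q E) W" using g'(2) M.cmp_zero_left[OF Qc W] by simp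
  qed
  then have "ActO M Q E \<in> generated X" using generated_quot[OF TG h(1)] by simp
  then show ?thesis using generated_quot \<epsilon> EO by blast
qed

lemma generated_perp_sub:
  assumes i: "i \<in> Hom M N' N" and mono: "mono_arr M i" and N: "N \<in> generated_perp X"
  shows "N' \<in> generated_perp X"
proof -
  have "f = ZeroA M L N'" if L: "L \<in> generated X" and f: "f \<in> Hom M L N'" for L f
  proof -
    have "i \<star> f = ZeroA M L N" using N L M.cmp_hom[OF f i] unfolding generated_perp_def by blast
    then show ?thesis by (rule M.mono_zeroD[OF mono i f])
  qed
  then show ?thesis unfolding generated_perp_def using M.hom_obj[OF i] by blast
qed

text \<open>An arrow from \<open>L\<close> to V \<otimes> N is determined by its transpose D
  \<otimes> L \<rightarrow> N, which vanishes because D \<otimes> L is again in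
  \<open>generated X\<close>.\<close>

lemma generated_perp_act:
  assumes V: "V \<in> Obj C" and N: "N \<in> generated_perp X" and X: "X \<in> Obj M"
  shows "ActO M V N \<in> generated_perp X"
proof -
  have NO: "N \<in> Obj M" using N by (simp add: generated_perp_def)
  have VN: "ActO M V N \<in> Obj M" using act_obj[OF V NO] .
  obtain D \<kappa> where D: "D \<in> Obj C" and \<kappa>: "\<And>X. X \<in> Obj M \<Longrightarrow> \<kappa> X \<in> Hom M (ActO M D (ActO M V X)) X"
    and inj: "\<And>W X g h. X \<in> Obj M \<Longrightarrow> g \<in> Hom M W (ActO M V X) \<Longrightarrow> h \<in> Hom M W (ActO M V X) \<Longrightarrow>
       \<kappa> X \<star> lw D g = \<kappa> X \<star> lw D h \<Longrightarrow> g = h"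
    using dual_evaluation[OF V] by metis
  have "f = ZeroA M L (ActO M V N)" if L: "L \<in> generated X" and f: "f \<in> Hom M L (ActO M V N)" for L f
  proof -
    have z: "ZeroA M L (ActO M V N) \<in> Hom M L (ActO M V N)" using M.zero_hom generated_obj[OF L] VN by blast
    have DL: "ActO M D L \<in> generated X" by (rule generated_act[OF D L X])
    have "\<kappa> N \<star> lw D g = ZeroA M (ActO M D L) N" if g: "g \<in> Hom M L (ActO M V N)" for g
      using N DL M.cmp_hom[OF lw_hom[OF D g] \<kappa>[OF NO]] unfolding generated_perp_def by blast
    then show ?thesis using inj[OF NO f z] f z by simp
  qed
  then show ?thesis unfolding generated_perp_def using VN by blast
qed

text \<open>As Q \<otimes> B is a retract of Q \<otimes> N, an arrow from \<open>generated X\<close>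
  to \<open>B\<close> becomes zero after tensoring with \<open>Q\<close>, and the natural
  epimorphism carries this back.\<close>

lemma generated_perp_quot:
  assumes c: "c \<in> Hom M N B" and epi: "epi_arr M c" and N: "N \<in> generated_perp X" and X: "X \<in> Obj M"
  shows "B \<in> generated_perp X"
proof -
  obtain Q \<epsilon> where Q: "projective_object C Q" "Q \<in> Obj C"
    and \<epsilon>: "\<And>N. N \<in> Obj M \<Longrightarrow> \<epsilon> N \<in> Hom M (ActO M Q N) N" "\<And>N. N \<in> Obj M \<Longrightarrow> epi_arr M (\<epsilon> N)"
    and \<epsilon>nat: "\<And>N N' f. f \<in> Hom M N N' \<Longrightarrow> f \<star> \<epsilon> N = \<epsilon> N' \<star> lw Q f"
    by (rule unit_cover) blast
  have B: "B \<in> Obj M" using M.hom_obj[OF c] by simp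
  obtain s where s: "s \<in> Hom M (ActO M Q B) (ActO M Q N)" "lw Q c \<star> s = Id M (ActO M Q B)"
    by (rule projective_action_section[OF Q(1) c epi])
  note Qc = lw_hom[OF Q(2) c]
  have "f = ZeroA M L B" if L: "L \<in> generated X" and f: "f \<in> Hom M L B" for L f
  proof -
    have LO: "L \<in> Obj M" using generated_obj[OF L] .
    note Qf = lw_hom[OF Q(2) f] and QL = act_obj[OF Q(2) LO]
    have "s \<star> lw Q f = ZeroA M (ActO M Q L) (ActO M Q N)"
      using generated_perp_act[OF Q(2) N X] generated_act[OF Q(2) L X] M.cmp_hom[OF Qf s(1)]
        unfolding generated_perp_def by blast
    then have "lw Q c \<star> (s \<star> lw Q f) = ZeroA M (ActO M Q L) (ActO M Q B)"
      using M.cmp_zero_right[OF Qc QL] by simp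
    then have "lw Q f = ZeroA M (ActO M Q L) (ActO M Q B)"
      using M.cmp_assoc[OF Qf s(1) Qc] s(2) M.cmp_id_left[OF Qf] by simp
    then have "f \<star> \<epsilon> L = ZeroA M (ActO M Q L) B"
      using \<epsilon>nat[OF f] M.cmp_zero_right[OF \<epsilon>(1)[OF B] QL] by simp
    then show ?thesis by (rule M.epi_zeroD[OF \<epsilon>(2)[OF LO] \<epsilon>(1)[OF LO] f])
  qed
  then show ?thesis unfolding generated_perp_def using B by blast
qed

lemma generated_perp_disjoint:
  assumes "N \<in> generated X" "N \<in> generated_perp X"
  shows "zero_object M N"
  using assms M.id_hom M.zero_object_iff unfolding generated_perp_def by blast

text \<open>\<open>A\<close> is a subobject of \<open>N\<close> of largest dimension in
  \<open>generated X\<close>; closure under extensions makes the quotient \<open>B\<close>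
  orthogonal. To split, the section of Q \<otimes> N \<rightarrow> Q \<otimes> B is pushed forward
  to \<open>N\<close>: its image \<open>B1\<close> is orthogonal too, so it meets \<open>A\<close>
  in zero and maps isomorphically to \<open>B\<close>.\<close>

lemma generated_decomposition:
  assumes X: "X \<in> Obj M" and N: "N \<in> Obj M"
  obtains A B where "A \<in> generated X" "B \<in> generated_perp X" "is_direct_sum M A B N"
proof -
  define P where "P = (\<lambda>(L, i). i \<in> Hom M L N \<and> mono_arr M i \<and> L \<in> generated X)"
  obtain Z where Z: "zero_object M Z" using M.zero_ex by blast
  then have ZO: "Z \<in> Obj M" by (simp add: zero_object_def)
  have "Z \<in> generated X"
    using generated_quot[OF generated_self[OF X] M.zero_hom[OF X ZO] M.zero_dim_epi[OF Z X]] .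
  then have "P (Z, ZeroA M Z N)" using M.zero_hom[OF ZO N] M.zero_dim_mono[OF Z N] by (simp add: P_def)
  moreover have "\<forall>x. P x \<longrightarrow> dM (fst x) < Suc (dM N)" using M.mono_dim by (fastforce simp: P_def less_Suc_eq_le)
  ultimately obtain x where x: "P x" "\<forall>x'. P x' \<longrightarrow> dM (fst x') \<le> dM (fst x)"
    using ex_has_greatest_nat[of P _ "\<lambda>x. dM (fst x)" "Suc (dM N)"] by blast
  obtain A j where "x = (A, j)" by (cases x)
  then have j: "j \<in> Hom M A N" "mono_arr M j" and A: "A \<in> generated X"
    and max: "\<And>L i. i \<in> Hom M L N \<Longrightarrow> mono_arr M i \<Longrightarrow> L \<in> generated X \<Longrightarrow> dM L \<le> dM A"
    using x by (auto simp: P_def)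
  have AO: "A \<in> Obj M" using generated_obj[OF A] .
  obtain B c where c: "c \<in> Hom M N B" "epi_arr M c" "c \<star> j = ZeroA M A B"
    and ker: "\<forall>W. \<forall>g\<in>Hom M W N. c \<star> g = ZeroA M W B \<longrightarrow> (\<exists>h\<in>Hom M W A. j \<star> h = g)"
    using M.coker_ex[OF j(1)] j(2) by blast
  have BO: "B \<in> Obj M" using M.hom_obj[OF c(1)] by simp
  have sub_gen: "K \<in> generated X"
    if k: "k \<in> Hom M K N" "mono_arr M k" "c \<star> k = ZeroA M K B" for K k
  proof -
    obtain k' where k': "k' \<in> Hom M K A" "j \<star> k' = k" using ker k by blast
    have "mono_arr M k'" by (rule M.mono_factor[OF _ k'(1) j(1)]) (simp add: k' k)
    then show ?thesis using generated_sub[OF k'(1) _ A X] by simp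
  qed
  have Bperp: "B \<in> generated_perp X"
  proof -
    have "f = ZeroA M L B" if L: "L \<in> generated X" and f: "f \<in> Hom M L B" for L f
    proof -
      obtain I e \<mu> where em: "e \<in> Hom M L I" "epi_arr M e" "\<mu> \<in> Hom M I B" "mono_arr M \<mu>" "\<mu> \<star> e = f"
        using M.image_ex[OF f] by blast
      have IG: "I \<in> generated X" using generated_quot[OF L em(1,2)] .
      have IO: "I \<in> Obj M" using generated_obj[OF IG] .
      \<comment> \<open>\<open>L3\<close> is the preimage of \<open>I\<close> in \<open>N\<close>,
        an extension of \<open>I\<close> by a subobject of \<open>A\<close>. It lies in
        \<open>generated X\<close> and contains \<open>A\<close>, so by maximality it is
        \<open>A\<close>, and \<open>I\<close> is zero.\<close>
      obtain L3 h b where pb: "h \<in> Hom M L3 I" "epi_arr M h" "b \<in> Hom M L3 N" "\<mu> \<star> h = c \<star> b"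
        and univ: "\<forall>W. \<forall>g\<in>Hom M W I. \<forall>h'\<in>Hom M W N. \<mu> \<star> g = c \<star> h' \<longrightarrow> (\<exists>u\<in>Hom M W L3. h \<star> u = g \<and> b \<star> u = h')"
        and jm: "\<forall>W. \<forall>u\<in>Hom M W L3. h \<star> u = ZeroA M W I \<longrightarrow> b \<star> u = ZeroA M W N \<longrightarrow> u = ZeroA M W L3"
        using M.pullback_exists[OF em(3) c(1,2)] by metis
      have bmono: "mono_arr M b"
      proof (rule M.mono_zeroI[OF pb(3)])
        fix W u assume u: "u \<in> Hom M W L3" and bu: "b \<star> u = ZeroA M W N"
        have "\<mu> \<star> (h \<star> u) = c \<star> (b \<star> u)"
          using M.cmp_assoc[OF u pb(1) em(3)] M.cmp_assoc[OF u pb(3) c(1)] pb(4) by simp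
        also have "\<dots> = ZeroA M W B" unfolding bu using M.cmp_zero_right[OF c(1)] M.hom_obj[OF u] by simp
        finally have "h \<star> u = ZeroA M W I" by (rule M.mono_zeroD[OF em(4,3) M.cmp_hom[OF u pb(1)]])
        then show "u = ZeroA M W L3" using jm u bu by blast
      qed
      obtain K k where k: "k \<in> Hom M K L3" "mono_arr M k" "h \<star> k = ZeroA M K I"
        and kcoker: "\<forall>W. \<forall>g\<in>Hom M L3 W. g \<star> k = ZeroA M K W \<longrightarrow> (\<exists>h'\<in>Hom M I W. h' \<star> h = g)"
        using M.ker_ex[OF pb(1)] pb(2) by blast
      have ck: "is_cokernel M k h" by (rule M.is_cokernelI[OF k(1) pb(1) k(3) pb(2)]) (use kcoker in blast)
      have "c \<star> (b \<star> k) = \<mu> \<star> (h \<star> k)"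
        using M.cmp_assoc[OF k(1) pb(3) c(1)] M.cmp_assoc[OF k(1) pb(1) em(3)] pb(4) by simp
      also have "\<dots> = ZeroA M K B" unfolding k(3) using M.cmp_zero_right[OF em(3)] M.hom_obj[OF k(1)] by simp
      finally have KG: "K \<in> generated X"
        by (rule sub_gen[OF M.cmp_hom[OF k(1) pb(3)] M.mono_cmp[OF k(2) bmono k(1) pb(3)]])
      have L3G: "L3 \<in> generated X" by (rule generated_extension[OF ck k(1) pb(1) KG IG X])
      have "\<mu> \<star> ZeroA M A I = c \<star> j" using M.cmp_zero_right[OF em(3) AO] c(3) by simp
      then obtain u where u: "u \<in> Hom M A L3" "h \<star> u = ZeroA M A I" "b \<star> u = j"
        using univ M.zero_hom[OF AO IO] j(1) by blast
      have umono: "mono_arr M u" by (rule M.mono_factor[OF _ u(1) pb(3)]) (simp add: u j)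
      have "dM A = dM L3" using M.mono_dim[OF u(1) umono] max[OF pb(3) bmono L3G] by simp
      then have "epi_arr M u" using M.mono_dim_iso[OF u(1) umono] M.iso_epi by blast
      then have h0: "h = ZeroA M L3 I" by (rule M.epi_zeroD[OF _ u(1) pb(1) u(2)])
      have "zero_object M I" using M.epi_zero_object pb(2) h0 generated_obj[OF L3G] IO by simp
      then have "e = ZeroA M L I" using M.zero_object_hom(1) em(1) by blast
      then show ?thesis using em(5) M.cmp_zero_right[OF em(3) generated_obj[OF L]] by simp
    qed
    then show ?thesis unfolding generated_perp_def using BO by blast
  qed
  obtain Q \<epsilon> where Q: "projective_object C Q" "Q \<in> Obj C"
    and \<epsilon>: "\<And>N. N \<in> Obj M \<Longrightarrow> \<epsilon> N \<in> Hom M (ActO M Q N) N" "\<And>N. N \<in> Obj M \<Longrightarrow> epi_arr M (\<epsilon> N)"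
    and \<epsilon>nat: "\<And>N N' f. f \<in> Hom M N N' \<Longrightarrow> f \<star> \<epsilon> N = \<epsilon> N' \<star> lw Q f"
    by (rule unit_cover) blast
  obtain s where s: "s \<in> Hom M (ActO M Q B) (ActO M Q N)" "lw Q c \<star> s = Id M (ActO M Q B)"
    by (rule projective_action_section[OF Q(1) c(1,2)])
  note QB = act_obj[OF Q(2) BO] and Qc = lw_hom[OF Q(2) c(1)]
  have es: "\<epsilon> N \<star> s \<in> Hom M (ActO M Q B) N" by (rule M.cmp_hom[OF s(1) \<epsilon>(1)[OF N]])
  obtain B1 e m
    where em: "e \<in> Hom M (ActO M Q B) B1" "epi_arr M e" "m \<in> Hom M B1 N" "mono_arr M m" "m \<star> e = \<epsilon> N \<star> s"
    using M.image_ex[OF es] by blast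
  have B1: "B1 \<in> generated_perp X"
    using generated_perp_quot[OF em(1,2) generated_perp_act[OF Q(2) Bperp X] X] .
  have cm: "c \<star> m \<in> Hom M B1 B" by (rule M.cmp_hom[OF em(3) c(1)])
  have "(c \<star> m) \<star> e = c \<star> (\<epsilon> N \<star> s)" using M.cmp_assoc[OF em(1,3) c(1)] em(5) by simp
  also have "\<dots> = \<epsilon> B \<star> (lw Q c \<star> s)"
    using M.cmp_assoc[OF s(1) \<epsilon>(1)[OF N] c(1)] \<epsilon>nat[OF c(1)] M.cmp_assoc[OF s(1) Qc \<epsilon>(1)[OF BO]] by simp
  also have "\<dots> = \<epsilon> B" unfolding s(2) using M.cmp_id_right[OF \<epsilon>(1)[OF BO]] .
  finally have "epi_arr M (c \<star> m)" using M.epi_factor[OF _ em(1) cm] \<epsilon>(2)[OF BO] by simp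
  moreover have "mono_arr M (c \<star> m)"
  proof -
    obtain K k where k: "k \<in> Hom M K B1" "mono_arr M k" "(c \<star> m) \<star> k = ZeroA M K B"
      and kuniv: "\<forall>W. \<forall>g\<in>Hom M W B1. (c \<star> m) \<star> g = ZeroA M W B \<longrightarrow> (\<exists>h\<in>Hom M W K. k \<star> h = g)"
      using M.ker_ex[OF cm] by blast
    have "c \<star> (m \<star> k) = ZeroA M K B" using M.cmp_assoc[OF k(1) em(3) c(1)] k(3) by simp
    then have "K \<in> generated X"
      by (rule sub_gen[OF M.cmp_hom[OF k(1) em(3)] M.mono_cmp[OF k(2) em(4) k(1) em(3)]])
    then have K0: "zero_object M K" using generated_perp_disjoint generated_perp_sub[OF k(1,2) B1] by blast
    show ?thesis
    proof (rule M.mono_zeroI[OF cm])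
      fix W g assume g: "g \<in> Hom M W B1" and "(c \<star> m) \<star> g = ZeroA M W B"
      then obtain h where h: "h \<in> Hom M W K" "k \<star> h = g" using kuniv by blast
      show "g = ZeroA M W B1"
        using M.zero_object_hom(1)[OF K0 h(1)] h(2) M.cmp_zero_right[OF k(1)] M.hom_obj[OF g] by simp
    qed
  qed
  ultimately have "iso_arr M (c \<star> m)" using M.mono_epi_iso[OF cm] by blast
  then obtain v where v: "v \<in> Hom M B B1" "(c \<star> m) \<star> v = Id M B" using M.isoE[OF _ cm] by metis
  let ?\<sigma> = "m \<star> v"
  have \<sigma>: "?\<sigma> \<in> Hom M B N" by (rule M.cmp_hom[OF v(1) em(3)])
  have c\<sigma>: "c \<star> ?\<sigma> = Id M B" using v M.cmp_assoc[OF v(1) em(3) c(1)] by simp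
  have \<sigma>c: "?\<sigma> \<star> c \<in> Hom M N N" by (rule M.cmp_hom[OF c(1) \<sigma>])
  note IN = M.id_hom[OF N] and IA = M.id_hom[OF AO]
  \<comment> \<open>\<open>?\<sigma>\<close> is a section of \<open>c\<close>; the complementary
    idempotent factors through \<open>j\<close> and supplies the projection to
    \<open>A\<close>.\<close>
  let ?d = "M.diff_arr (Id M N) (?\<sigma> \<star> c)"
  have d: "?d \<in> Hom M N N" by (rule M.diff_hom[OF IN \<sigma>c])
  have "c \<star> (?\<sigma> \<star> c) = c" using M.cmp_assoc[OF c(1) \<sigma> c(1)] c\<sigma> M.cmp_id_left[OF c(1)] by simp
  then have "c \<star> ?d = ZeroA M N B"
    using M.cmp_diff_right[OF IN \<sigma>c c(1)] M.cmp_id_right[OF c(1)] M.diff_self[OF c(1)] by simp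
  then obtain p where p: "p \<in> Hom M N A" "j \<star> p = ?d" using ker d by blast
  have "(?\<sigma> \<star> c) \<star> j = ZeroA M A N"
    using M.cmp_assoc[OF j(1) c(1) \<sigma>] c(3) M.cmp_zero_right[OF \<sigma> AO] by simp
  then have "?d \<star> j = M.diff_arr j (ZeroA M A N)"
    using M.cmp_diff_left[OF j(1) IN \<sigma>c] M.cmp_id_left[OF j(1)] by simp
  also have "\<dots> = j" using M.diff_diff[OF j(1,1)] M.diff_self[OF j(1)] by simp
  finally have "j \<star> (p \<star> j) = j \<star> Id M A"
    using M.cmp_assoc[OF j(1) p(1) j(1)] p(2) M.cmp_id_right[OF j(1)] by simp
  then have pj: "p \<star> j = Id M A" by (rule M.monoD[OF j(2,1) M.cmp_hom[OF j(1) p(1)] IA])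
  have "(?\<sigma> \<star> c) \<star> ?\<sigma> = ?\<sigma>"
    using M.cmp_assoc[OF \<sigma> c(1) \<sigma>] c\<sigma> M.cmp_id_right[OF \<sigma>] by simp
  then have "?d \<star> ?\<sigma> = ZeroA M B N"
    using M.cmp_diff_left[OF \<sigma> IN \<sigma>c] M.cmp_id_left[OF \<sigma>] M.diff_self[OF \<sigma>] by simp
  then have "j \<star> (p \<star> ?\<sigma>) = ZeroA M B N"
    using M.cmp_assoc[OF \<sigma> p(1) j(1)] p(2) by simp
  then have p\<sigma>: "p \<star> ?\<sigma> = ZeroA M B A" by (rule M.mono_zeroD[OF j(2,1) M.cmp_hom[OF \<sigma> p(1)]])
  have "AddA M (j \<star> p) (?\<sigma> \<star> c) = Id M N"
    unfolding p(2) using M.add_commute[OF d \<sigma>c] M.add_diff[OF IN \<sigma>c] by simp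
  then have "is_direct_sum M A B N"
    unfolding is_direct_sum_def using AO BO N j(1) \<sigma> p(1) c(1) pj c\<sigma> p\<sigma> c(3) by blast
  then show ?thesis by (rule that[OF A Bperp])
qed

text \<open>\<open>X\<close> is a nonzero member of \<open>generated X\<close>, so indecomposability
  leaves only zero objects in \<open>generated_perp X\<close>, and \<open>N\<close> is its own
  generated part.\<close>

lemma indecomposable_generation:
  assumes ind: "indecomposable C M" and X: "X \<in> Obj M" "\<not> zero_object M X" and N: "N \<in> Obj M"
  obtains V e where "V \<in> Obj C" "e \<in> Hom M (ActO M V X) N" "epi_arr M e"
proof -
  have 1: "module_full_subcat C M (generated X)"
    unfolding module_full_subcat_def using generated_obj generated_act X(1) by blast
  have 2: "module_full_subcat C M (generated_perp X)"
    unfolding module_full_subcat_def using generated_perp_act X(1) by (auto simp: generated_perp_def)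
  have H1: "Hom M L N' = {ZeroA M L N'}" if "L \<in> generated X" "N' \<in> generated_perp X" for L N'
    using that M.zero_hom[OF generated_obj[OF that(1)], of N'] unfolding generated_perp_def by blast
  \<comment> \<open>The image of such an arrow is a quotient of \<open>N'\<close> and a subobject of
    \<open>L\<close>, hence lies in both classes.\<close>
  have H2: "Hom M N' L = {ZeroA M N' L}" if L: "L \<in> generated X" and N': "N' \<in> generated_perp X" for L N'
  proof -
    have N'O: "N' \<in> Obj M" using N' by (simp add: generated_perp_def)
    have "f = ZeroA M N' L" if f: "f \<in> Hom M N' L" for f
    proof -
      obtain I e m where em: "e \<in> Hom M N' I" "epi_arr M e" "m \<in> Hom M I L" "mono_arr M m" "m \<star> e = f"
        using M.image_ex[OF f] by blast
      have "I \<in> generated X" by (rule generated_sub[OF em(3,4) L X(1)])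
      moreover have "I \<in> generated_perp X" by (rule generated_perp_quot[OF em(1,2) N' X(1)])
      ultimately have "zero_object M I" by (rule generated_perp_disjoint)
      then show ?thesis using M.zero_object_hom(1) em(1,5) M.cmp_zero_right[OF em(3) N'O] by metis
    qed
    then show ?thesis using M.zero_hom[OF N'O generated_obj[OF L]] by blast
  qed
  have "is_direct_sum_cat M (generated X) (generated_perp X)"
    unfolding is_direct_sum_cat_def
  proof (intro conjI ballI)
    show "generated X \<subseteq> Obj M" using generated_obj by blast
    show "generated_perp X \<subseteq> Obj M" by (auto simp: generated_perp_def)
    show "Hom M N N' = {ZeroA M N N'}" "Hom M N' N = {ZeroA M N' N}" if "N \<in> generated X"
      "N' \<in> generated_perp X" for N N'
      using H1 H2 that by auto
    show "\<exists>N\<in>generated X. \<exists>N'\<in>generated_perp X. is_direct_sum M N N' L" if "L \<in> Obj M" for L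
      using generated_decomposition[OF X(1) that] by blast
  qed
  then have perp0: "zero_object M B" if "B \<in> generated_perp X" for B
    using ind 1 2 generated_self[OF X(1)] X(2) that unfolding indecomposable_def by blast
  obtain A B where A: "A \<in> generated X" and B: "B \<in> generated_perp X" and S: "is_direct_sum M A B N"
    by (rule generated_decomposition[OF X(1) N])
  obtain i j p q where ijpq: "i \<in> Hom M A N" "j \<in> Hom M B N" "p \<in> Hom M N A" "q \<in> Hom M N B"
    and sum: "AddA M (i \<star> p) (j \<star> q) = Id M N" by (rule M.direct_sumE[OF S])
  have "q = ZeroA M N B" using M.zero_object_hom(1)[OF perp0[OF B] ijpq(4)] .
  then have "j \<star> q = ZeroA M N N" using M.cmp_zero_right[OF ijpq(2) N] by simp
  then have "i \<star> p = Id M N" using sum M.add_zero M.cmp_hom[OF ijpq(3,1)] by metis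
  then have "epi_arr M i" by (rule M.split_epi[OF ijpq(1,3)])
  then have "N \<in> generated X" using generated_quot[OF A ijpq(1)] by simp
  then show ?thesis using that unfolding generated_def by blast
qed

end

section \<open>Arrows to an end as natural families\<close>

locale exact_module_with_ihom = exact_module_data C M dC dM + ih: internal_hom C M Ho Ha adj
  for C :: "('k::alg_closed_field, 'co, 'ca, 'y) moncat_scheme"
    and M :: "('k, 'co, 'ca, 'o, 'a, 'z) modcat_scheme" and dC dM Ho Ha adj
begin

lemma Hom_full_subcat: "X \<in> S \<Longrightarrow> Y \<in> S \<Longrightarrow> Hom (full_subcat M S) X Y = Hom M X Y"
  by (auto simp: full_subcat_def Hom_def)

lemma full_subcat_simps: "Obj (full_subcat M S) = S" "Id (full_subcat M S) = Id M"
  by (simp_all add: full_subcat_def)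

lemma is_endD: "is_end (full_subcat M S) C Ho Ha E p \<Longrightarrow> is_dinatural (full_subcat M S) C Ho Ha E p"
  by (simp add: is_end_def)

lemma is_dinatural_subcatD:
  assumes "is_dinatural (full_subcat M S) C Ho Ha E p"
  shows "E \<in> Obj C" "X \<in> S \<Longrightarrow> p X \<in> Hom C E (Ho X X)"
    "X \<in> S \<Longrightarrow> Y \<in> S \<Longrightarrow> f \<in> Hom M X Y \<Longrightarrow> Ha (Id M X) f \<cdot>\<^bsub>C\<^esub> p X = Ha f (Id M Y) \<cdot>\<^bsub>C\<^esub> p Y"
  using assms Hom_full_subcat[of X S Y] by (simp_all add: is_dinatural_def full_subcat_simps)

lemma is_dinatural_subcatI:
  assumes "E \<in> Obj C" "\<And>X. X \<in> S \<Longrightarrow> p X \<in> Hom C E (Ho X X)"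
    "\<And>X Y f. X \<in> S \<Longrightarrow> Y \<in> S \<Longrightarrow> f \<in> Hom M X Y \<Longrightarrow> Ha (Id M X) f \<cdot>\<^bsub>C\<^esub> p X = Ha f (Id M Y) \<cdot>\<^bsub>C\<^esub> p Y"
  shows "is_dinatural (full_subcat M S) C Ho Ha E p"
  using assms Hom_full_subcat by (simp add: is_dinatural_def full_subcat_simps)

abbreviation "nat_act V S t \<equiv> natural_on M (\<lambda>N. ActO M V N) (\<lambda>g. lw V g) S t"

lemma adj_inj:
  assumes "V \<in> Obj C" "N \<in> Obj M" "L \<in> Obj M" "s \<in> Hom M (ActO M V N) L" "t \<in> Hom M (ActO M V N) L"
    "adj V N L s = adj V N L t"
  shows "s = t"
  using ih.adj_bij[OF assms(1-3)] assms(4-6) unfolding bij_betw_def inj_on_def by blast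

lemma adj_hom:
  assumes "V \<in> Obj C" "N \<in> Obj M" "L \<in> Obj M" "s \<in> Hom M (ActO M V N) L"
  shows "adj V N L s \<in> Hom C V (Ho N L)"
  using ih.adj_bij[OF assms(1-3)] assms(4) unfolding bij_betw_def by blast

text \<open>Naturality of \<open>adj\<close> in its second and third arguments rewrites both sides
  as \<open>adj\<close> of the two composites, and \<open>adj\<close> is injective.\<close>

lemma adj_dinatural:
  assumes V: "V \<in> Obj C" and f: "f \<in> Hom M X Y"
    and t: "t \<in> Hom M (ActO M V X) X" and t': "t' \<in> Hom M (ActO M V Y) Y"
  shows "Ha (Id M X) f \<cdot>\<^bsub>C\<^esub> adj V X X t = Ha f (Id M Y) \<cdot>\<^bsub>C\<^esub> adj V Y Y t' \<longleftrightarrow> f \<star> t = t' \<star> lw V f"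
proof -
  have X: "X \<in> Obj M" and Y: "Y \<in> Obj M" using M.hom_obj[OF f] by auto
  note IV = C.id_hom[OF V]
  have "adj V X Y (f \<star> t) = Ha (Id M X) f \<cdot>\<^bsub>C\<^esub> adj V X X t"
    using ih.adj_natural[OF IV M.id_hom[OF X] f t] act_id[OF V X] M.cmp_id_right[OF t]
      C.cmp_id_right[OF adj_hom[OF V X X t]] by simp
  moreover have "adj V X Y (t' \<star> lw V f) = Ha f (Id M Y) \<cdot>\<^bsub>C\<^esub> adj V Y Y t'"
    using ih.adj_natural[OF IV f M.id_hom[OF Y] t'] M.cmp_id_left[OF M.cmp_hom[OF lw_hom[OF V f] t']]
      C.cmp_id_right[OF adj_hom[OF V Y Y t']] by simp
  ultimately show ?thesis
    using adj_inj[OF V X Y M.cmp_hom[OF t f] M.cmp_hom[OF lw_hom[OF V f] t']] by metis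
qed

lemma natural_dinatural:
  assumes S: "S \<subseteq> Obj M" and V: "V \<in> Obj C" and t: "nat_act V S t"
  shows "is_dinatural (full_subcat M S) C Ho Ha V (\<lambda>X. adj V X X (t X))"
proof (rule is_dinatural_subcatI[OF V])
  note th = natural_onD(1)[OF t] and tn = natural_onD(2)[OF t]
  show "adj V X X (t X) \<in> Hom C V (Ho X X)" if "X \<in> S" for X
    using adj_hom[OF V _ _ th[OF that]] S that by blast
  show "Ha (Id M X) f \<cdot>\<^bsub>C\<^esub> adj V X X (t X) = Ha f (Id M Y) \<cdot>\<^bsub>C\<^esub> adj V Y Y (t Y)"
    if "X \<in> S" "Y \<in> S" "f \<in> Hom M X Y" for X Y f
    using adj_dinatural[OF V that(3) th[OF that(1)] th[OF that(2)]] tn[OF that] by simp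
qed

lemma end_arrow:
  assumes E: "is_end (full_subcat M S) C Ho Ha E p" and S: "S \<subseteq> Obj M" and V: "V \<in> Obj C"
    and t: "nat_act V S t"
  obtains h where "h \<in> Hom C V E" "\<And>X. X \<in> S \<Longrightarrow> p X \<cdot>\<^bsub>C\<^esub> h = adj V X X (t X)"
proof -
  show ?thesis
    using natural_dinatural[OF S V t] E that unfolding is_end_def full_subcat_simps by blast
qed

text \<open>The converse of \<open>end_arrow\<close>: surjectivity of \<open>adj\<close> turns the
  components of an arrow to the end into arrows of the module category.\<close>

lemma end_natural:
  assumes E: "is_end (full_subcat M S) C Ho Ha E p" and S: "S \<subseteq> Obj M" and h: "h \<in> Hom C V E"
  obtains t where "nat_act V S t" "\<And>X. X \<in> S \<Longrightarrow> adj V X X (t X) = p X \<cdot>\<^bsub>C\<^esub> h"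
proof -
  have V: "V \<in> Obj C" using C.hom_obj[OF h] by simp
  note D = is_endD[OF E]
  note p = is_dinatural_subcatD(2)[OF D] and din = is_dinatural_subcatD(3)[OF D]
  have "\<exists>s\<in>Hom M (ActO M V X) X. adj V X X s = p X \<cdot>\<^bsub>C\<^esub> h" if X: "X \<in> S" for X
  proof -
    have XO: "X \<in> Obj M" using X S by blast
    have "p X \<cdot>\<^bsub>C\<^esub> h \<in> adj V X X ` Hom M (ActO M V X) X"
      using bij_betw_imp_surj_on[OF ih.adj_bij[OF V XO XO]] C.cmp_hom[OF h p[OF X]] by simp
    then show ?thesis by auto
  qed
  then obtain t where t: "\<And>X. X \<in> S \<Longrightarrow> t X \<in> Hom M (ActO M V X) X"
    and at: "\<And>X. X \<in> S \<Longrightarrow> adj V X X (t X) = p X \<cdot>\<^bsub>C\<^esub> h" by metis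
  have "nat_act V S t"
    unfolding natural_on_def
  proof (intro conjI ballI)
    show "t X \<in> Hom M (ActO M V X) X" if "X \<in> S" for X using t[OF that] .
    fix X Y f assume X: "X \<in> S" and Y: "Y \<in> S" and f: "f \<in> Hom M X Y"
    have XO: "X \<in> Obj M" and YO: "Y \<in> Obj M" using M.hom_obj[OF f] by auto
    have Hf: "Ha (Id M X) f \<in> Hom C (Ho X X) (Ho X Y)" "Ha f (Id M Y) \<in> Hom C (Ho Y Y) (Ho X Y)"
      using bifunctorD(2)[OF ih.ihom_functor, of "Id M X" X X f X Y]
        bifunctorD(2)[OF ih.ihom_functor, of f Y X "Id M Y" Y Y] M.id_hom XO YO f
      by (auto simp: op_cat_def Hom_def)
    have "Ha (Id M X) f \<cdot>\<^bsub>C\<^esub> (p X \<cdot>\<^bsub>C\<^esub> h) = Ha f (Id M Y) \<cdot>\<^bsub>C\<^esub> (p Y \<cdot>\<^bsub>C\<^esub> h)"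
      using C.cmp_assoc[OF h p[OF X] Hf(1)] C.cmp_assoc[OF h p[OF Y] Hf(2)] din[OF X Y f] by simp
    then show "f \<star> t X = t Y \<star> lw V f" using adj_dinatural[OF V f t[OF X] t[OF Y]] at X Y by simp
  qed
  then show ?thesis using that at by blast
qed

text \<open>Uniqueness in \<open>is_end\<close> speaks of factorizations of a dinatural family, so
  \<open>h\<close> is first converted into the family it induces.\<close>

lemma end_arrow_unique:
  assumes E: "is_end (full_subcat M S) C Ho Ha E p" and S: "S \<subseteq> Obj M"
    and h: "h \<in> Hom C V E" and h': "h' \<in> Hom C V E"
      and eq: "\<And>X. X \<in> S \<Longrightarrow> p X \<cdot>\<^bsub>C\<^esub> h = p X \<cdot>\<^bsub>C\<^esub> h'"
  shows "h = h'"
proof -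
  have V: "V \<in> Obj C" using C.hom_obj[OF h] by simp
  obtain t where t: "nat_act V S t" "\<And>X. X \<in> S \<Longrightarrow> adj V X X (t X) = p X \<cdot>\<^bsub>C\<^esub> h"
    using end_natural[OF E S h] by blast
  have "\<exists>!k. k \<in> Hom C V E \<and> (\<forall>X\<in>S. p X \<cdot>\<^bsub>C\<^esub> k = adj V X X (t X))"
    using natural_dinatural[OF S V t(1)] E unfolding is_end_def full_subcat_simps by blast
  moreover have "\<forall>X\<in>S. p X \<cdot>\<^bsub>C\<^esub> h = adj V X X (t X)"
    "\<forall>X\<in>S. p X \<cdot>\<^bsub>C\<^esub> h' = adj V X X (t X)"
    using t(2) eq by auto
  ultimately show ?thesis using h h' by blast
qed

lemma end_restriction_props:
  assumes E1: "is_end (full_subcat M S1) C Ho Ha (A S1) (p S1)"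
    and E2: "is_end (full_subcat M S2) C Ho Ha (A S2) (p S2)"
    and S1: "S1 \<subseteq> Obj M" and S21: "S2 \<subseteq> S1"
  shows "end_restriction C A p S1 S2 \<in> Hom C (A S1) (A S2)"
    "\<And>X. X \<in> S2 \<Longrightarrow> p S2 X \<cdot>\<^bsub>C\<^esub> end_restriction C A p S1 S2 = p S1 X"
proof -
  have "is_dinatural (full_subcat M S2) C Ho Ha (A S1) (p S1)"
  proof (rule is_dinatural_subcatI)
    note D = is_dinatural_subcatD[OF is_endD[OF E1]]
    show "A S1 \<in> Obj C" by (rule D(1))
    show "p S1 X \<in> Hom C (A S1) (Ho X X)" if "X \<in> S2" for X using D(2) S21 that by blast
    show "Ha (Id M X) f \<cdot>\<^bsub>C\<^esub> p S1 X = Ha f (Id M Y) \<cdot>\<^bsub>C\<^esub> p S1 Y"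
      if "X \<in> S2" "Y \<in> S2" "f \<in> Hom M X Y" for X Y f
      by (rule D(3)[OF subsetD[OF S21 that(1)] subsetD[OF S21 that(2)] that(3)])
  qed
  then have "\<exists>!h. h \<in> Hom C (A S1) (A S2) \<and> (\<forall>X\<in>S2. p S2 X \<cdot>\<^bsub>C\<^esub> h = p S1 X)"
    using E2 unfolding is_end_def full_subcat_simps by blast
  from theI'[OF this] show "end_restriction C A p S1 S2 \<in> Hom C (A S1) (A S2)"
    "\<And>X. X \<in> S2 \<Longrightarrow> p S2 X \<cdot>\<^bsub>C\<^esub> end_restriction C A p S1 S2 = p S1 X"
    unfolding end_restriction_def by blast+
qed

section \<open>The quotients of the end and their order\<close>

context
  fixes A p
  assumes ends: "\<And>S. S \<in> Topologizing M \<Longrightarrow> is_end (full_subcat M S) C Ho Ha (A S) (p S)"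
begin

abbreviation "\<phi> S \<equiv> end_restriction C A p (Obj M) S"

lemma top_sub: "S \<in> Topologizing M \<Longrightarrow> S \<subseteq> Obj M"
  unfolding Topologizing_def by blast

lemma phi:
  assumes "S \<in> Topologizing M"
  shows "\<phi> S \<in> Hom C (A (Obj M)) (A S)" "\<And>X. X \<in> S \<Longrightarrow> p S X \<cdot>\<^bsub>C\<^esub> \<phi> S = p (Obj M) X"
  using end_restriction_props[OF ends[OF M.Obj_topologizing] ends[OF assms] subset_refl top_sub[OF assms]]
    by auto

lemma end_proj_hom:
  assumes "S \<in> Topologizing M" "X \<in> S"
  shows "p S X \<in> Hom C (A S) (Ho X X)"
  using ends[OF assms(1)] assms(2) unfolding is_end_def is_dinatural_def full_subcat_simps by blast

text \<open>One arrow is enough: an epimorphism \<open>e\<close> from a projective \<open>P\<close>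
  to \<open>A S\<close>. Extending its family to all objects yields \<open>u\<close> whose composite
  with \<open>\<phi> S\<close> is \<open>e\<close>, and then \<open>\<phi> S\<close> is an
  epimorphism as well.\<close>

lemma phi_quotient:
  assumes S: "S \<in> Topologizing M"
  shows "\<phi> S \<in> Quo C (A (Obj M))"
proof -
  note E = ends[OF S] and E0 = ends[OF M.Obj_topologizing]
  have AS: "A S \<in> Obj C" using C.hom_obj[OF phi(1)[OF S]] by simp
  obtain P e where P: "projective_object C P" and e: "e \<in> Hom C P (A S)" "epi_arr C e"
    using C.proj_ex[OF AS] by blast
  have PO: "P \<in> Obj C" using C.hom_obj[OF e(1)] by simp
  interpret F: exact_projective_functor M dM "\<lambda>N. ActO M P N" "\<lambda>g. lw P g"
    by (rule exact_projective_action[OF P])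
  obtain t where t: "nat_act P S t" "\<And>X. X \<in> S \<Longrightarrow> adj P X X (t X) = p S X \<cdot>\<^bsub>C\<^esub> e"
    using end_natural[OF E top_sub[OF S] e(1)] by blast
  obtain t' where t': "nat_act P (Obj M) t'" "\<And>X. X \<in> S \<Longrightarrow> t' X = t X"
    using F.natural_extension[OF S t(1)] by blast
  obtain u where u: "u \<in> Hom C P (A (Obj M))"
    "\<And>X. X \<in> Obj M \<Longrightarrow> p (Obj M) X \<cdot>\<^bsub>C\<^esub> u = adj P X X (t' X)"
    using end_arrow[OF E0 subset_refl PO t'(1)] by blast
  have "\<phi> S \<cdot>\<^bsub>C\<^esub> u = e"
  proof (rule end_arrow_unique[OF E top_sub[OF S] C.cmp_hom[OF u(1) phi(1)[OF S]] e(1)])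
    fix X assume X: "X \<in> S"
    then have XO: "X \<in> Obj M" using top_sub[OF S] by blast
    show "p S X \<cdot>\<^bsub>C\<^esub> (\<phi> S \<cdot>\<^bsub>C\<^esub> u) = p S X \<cdot>\<^bsub>C\<^esub> e"
      using C.cmp_assoc[OF u(1) phi(1)[OF S] end_proj_hom[OF S X]] phi(2)[OF S X] u(2)[OF XO] t'(2)[OF X] t(2)[OF X] by simp
  qed
  then have "epi_arr C (\<phi> S)" using C.epi_factor[OF _ u(1) phi(1)[OF S]] e(2) by simp
  then show ?thesis unfolding Quo_def using phi(1)[OF S] by (simp add: C.Hom_iff)
qed

lemma phi_order:
  assumes S1: "S1 \<in> Topologizing M" and S2: "S2 \<in> Topologizing M" and sub: "S2 \<subseteq> S1"
  shows "quo_ge C (\<phi> S1) (\<phi> S2)"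
proof -
  let ?h = "end_restriction C A p S1 S2"
  note h = end_restriction_props[OF ends[OF S1] ends[OF S2] top_sub[OF S1] sub]
  have "?h \<cdot>\<^bsub>C\<^esub> \<phi> S1 = \<phi> S2"
  proof (rule end_arrow_unique[OF ends[OF S2] top_sub[OF S2] C.cmp_hom[OF phi(1)[OF S1] h(1)] phi(1)[OF S2]])
    fix X assume X: "X \<in> S2"
    then have X1: "X \<in> S1" using sub by blast
    show "p S2 X \<cdot>\<^bsub>C\<^esub> (?h \<cdot>\<^bsub>C\<^esub> \<phi> S1) = p S2 X \<cdot>\<^bsub>C\<^esub> \<phi> S2"
      using C.cmp_assoc[OF phi(1)[OF S1] h(1) end_proj_hom[OF S2 X]] h(2)[OF X] phi(2)[OF S1 X1] phi(2)[OF S2 X] by simp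
  qed
  moreover have "Cod C (\<phi> S1) = A S1" "Cod C (\<phi> S2) = A S2"
    using phi(1)[OF S1] phi(1)[OF S2] by (auto simp: C.Hom_iff)
  ultimately show ?thesis unfolding quo_ge_def using h(1) by metis
qed

text \<open>If \<open>\<phi> S2\<close> factors through \<open>\<phi> S1\<close>, two arrows to
  \<open>A (Obj M)\<close> with the same components on \<open>S1\<close> have the same components on
  \<open>S2\<close>. The arrows compared come from the zero family and from a family that is zero on
  \<open>S1\<close> but not at an object \<open>N\<close> of \<open>S2\<close>.\<close>

lemma phi_reflects:
  assumes ind: "indecomposable C M" and S1: "S1 \<in> Topologizing M" and S2: "S2 \<in> Topologizing M"
    and ge: "quo_ge C (\<phi> S1) (\<phi> S2)"
  shows "S2 \<subseteq> S1"
proof (rule ccontr)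
  assume "\<not> S2 \<subseteq> S1"
  then have "\<exists>N. N \<in> S2 \<and> N \<notin> S1" by blast
  then obtain N where N: "N \<in> S2" "N \<notin> S1" and min: "\<And>L. L \<in> S2 \<Longrightarrow> L \<notin> S1 \<Longrightarrow> dM N \<le> dM L"
    using ex_has_least_nat[of "\<lambda>N. N \<in> S2 \<and> N \<notin> S1" _ dM] by blast
  have NO: "N \<in> Obj M" using N(1) top_sub[OF S2] by blast
  interpret mn: minimal_nonmember M dM S1 N
  proof
    show "L \<in> S1" if "i \<in> Hom M L N" "mono_arr M i" "dM L < dM N" for i L
      using min[OF M.topologizing_sub[OF S2 that(1,2) N(1)]] that(3) by force
    show "L \<in> S1" if "e \<in> Hom M N L" "epi_arr M e" "dM L < dM N" for e L
      using min[OF M.topologizing_quot[OF S2 that(1,2) N(1)]] that(3) by force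
  qed (use S1 NO N in auto)
  obtain N' n where n: "n \<in> Hom M N' N" "mono_arr M n" "N' \<in> S1"
    and nfac: "\<And>Z f. Z \<in> S1 \<Longrightarrow> f \<in> Hom M Z N \<Longrightarrow> \<exists>f'\<in>Hom M Z N'. n \<star> f' = f"
    using mn.radical_exists by metis
  obtain N'' y Y i where y: "y \<in> Hom M N N''" "epi_arr M y" "N'' \<in> S1"
    and yfac: "\<And>Z f. Z \<in> S1 \<Longrightarrow> f \<in> Hom M N Z \<Longrightarrow> \<exists>f'\<in>Hom M N'' Z. f' \<star> y = f"
    and i: "i \<in> Hom M Y N" "mono_arr M i" "y \<star> i = ZeroA M Y N''" and Ynz: "\<not> zero_object M Y"
    using mn.coradical_exists by metis
  have YO: "Y \<in> Obj M" using M.hom_obj[OF i(1)] by simp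
  \<comment> \<open>\<open>X\<close> is \<open>N\<close> modulo its largest proper subobject; it is
    nonzero because \<open>N'\<close> lies in \<open>S1\<close> and \<open>N\<close> does
    not.\<close>
  obtain X q where q: "q \<in> Hom M N X" "epi_arr M q" "q \<star> n = ZeroA M N' X"
    and qker: "\<forall>W. \<forall>g\<in>Hom M W N. q \<star> g = ZeroA M W X \<longrightarrow> (\<exists>h\<in>Hom M W N'. n \<star> h = g)"
    using M.coker_ex[OF n(1)] n(2) by blast
  have XO: "X \<in> Obj M" using M.hom_obj[OF q(1)] by simp
  have Xnz: "\<not> zero_object M X"
  proof
    assume z: "zero_object M X"
    have "q \<star> Id M N = ZeroA M N X" using M.cmp_id_right[OF q(1)] M.zero_object_hom(1)[OF z q(1)] by simp
    then obtain h where h: "h \<in> Hom M N N'" "n \<star> h = Id M N" using qker M.id_hom[OF NO] by blast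
    have "epi_arr M n" by (rule M.split_epi[OF n(1) h])
    then show False using M.topologizing_quot[OF S1 n(1) _ n(3)] N(2) by blast
  qed
  obtain V v where V: "V \<in> Obj C" and v: "v \<in> Hom M (ActO M V X) Y" "epi_arr M v"
    by (rule indecomposable_generation[OF ind XO Xnz YO])
  \<comment> \<open>Replacing \<open>V\<close> by a projective cover of it in the weak sense, any
    epimorphism from a projective, brings the extension results into play.\<close>
  obtain P e where P: "projective_object C P" and e: "e \<in> Hom C P V" "epi_arr C e"
    using C.proj_ex[OF V] by blast
  have PO: "P \<in> Obj C" using C.hom_obj[OF e(1)] by simp
  interpret F: exact_projective_functor M dM "\<lambda>N. ActO M P N" "\<lambda>g. lw P g"
    by (rule exact_projective_action[OF P])
  have zhom: "ZeroA M (ActO M P Z) Z \<in> Hom M (ActO M P Z) Z" if "Z \<in> Obj M" for Z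
    using M.zero_hom[OF act_obj[OF PO that] that] .
  have znat: "nat_act P S (\<lambda>Z. ZeroA M (ActO M P Z) Z)" if S: "S \<subseteq> Obj M" for S
    unfolding natural_on_def
  proof (intro conjI ballI)
    show "ZeroA M (ActO M P Z) Z \<in> Hom M (ActO M P Z) Z" if "Z \<in> S" for Z using zhom S that by blast
    fix Z W f assume "Z \<in> S" "W \<in> S" and f: "f \<in> Hom M Z W"
    have "Z \<in> Obj M" "W \<in> Obj M" using M.hom_obj[OF f] by auto
    then show "f \<star> ZeroA M (ActO M P Z) Z = ZeroA M (ActO M P W) W \<star> lw P f"
      using M.cmp_zero_right[OF f act_obj[OF PO]] M.cmp_zero_left[OF lw_hom[OF PO f]] by simp
  qed
  interpret es: extension_step M dM "\<lambda>N. ActO M P N" "\<lambda>g. lw P g" S1 N "\<lambda>Z. ZeroA M (ActO M P Z) Z"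
    by unfold_locales (rule znat[OF top_sub[OF S1]])
  note eX = rw_hom[OF e(1) XO] and Pq = lw_hom[OF PO q(1)] and PN = act_obj[OF PO NO]
  let ?b = "v \<star> rw e X"
  have b: "?b \<in> Hom M (ActO M P X) Y" "epi_arr M ?b"
    using M.cmp_hom[OF eX v(1)] M.epi_cmp[OF rw_epi[OF e XO] v(2) eX v(1)] by auto
  let ?w = "?b \<star> lw P q"
  have w: "?w \<in> Hom M (ActO M P N) Y" "epi_arr M ?w"
    using M.cmp_hom[OF Pq b(1)] M.epi_cmp[OF lw_epi[OF PO q(1,2)] b(2) Pq b(1)] by auto
  \<comment> \<open>\<open>?u\<close> enters through \<open>q\<close> and leaves through
    \<open>i\<close>. Arrows from \<open>S1\<close> to \<open>N\<close> are killed by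
    \<open>q\<close>, and arrows from \<open>N\<close> to \<open>S1\<close> kill \<open>i\<close>,
    so \<open>?u\<close> is compatible with the zero family without being zero.\<close>
  let ?u = "i \<star> ?w"
  have u: "?u \<in> Hom M (ActO M P N) N" by (rule M.cmp_hom[OF w(1) i(1)])
  have unz: "?u \<noteq> ZeroA M (ActO M P N) N"
  proof
    assume "?u = ZeroA M (ActO M P N) N"
    then have "?w = ZeroA M (ActO M P N) Y" by (rule M.mono_zeroD[OF i(2,1) w(1)])
    then have "zero_object M Y" using M.epi_zero_object w(2) PN YO by simp
    then show False using Ynz by simp
  qed
  have yu: "y \<star> ?u = ZeroA M (ActO M P N) N''"
    using M.cmp_assoc[OF w(1) i(1) y(1)] i(3) M.cmp_zero_left[OF w(1)] M.hom_obj[OF y(1)] by simp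
  have comp: "es.compatible ?u"
    unfolding es.compatible_def
  proof (intro conjI ballI u)
    fix Z f assume Z: "Z \<in> S1" and f: "f \<in> Hom M N Z"
    have ZO: "Z \<in> Obj M" using M.hom_obj[OF f] by simp
    obtain f' where f': "f' \<in> Hom M N'' Z" "f' \<star> y = f" using yfac[OF Z f] by blast
    have "f \<star> ?u = ZeroA M (ActO M P N) Z"
      using M.cmp_assoc[OF u y(1) f'(1)] f'(2) yu M.cmp_zero_right[OF f'(1) PN] by simp
    then show "f \<star> ?u = ZeroA M (ActO M P Z) Z \<star> lw P f"
      using M.cmp_zero_left[OF lw_hom[OF PO f] ZO] by simp
  next
    fix Z f assume Z: "Z \<in> S1" and f: "f \<in> Hom M Z N"
    have ZO: "Z \<in> Obj M" using M.hom_obj[OF f] by simp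
    note PZ = act_obj[OF PO ZO] and Pf = lw_hom[OF PO f]
    obtain f' where f': "f' \<in> Hom M Z N'" "n \<star> f' = f" using nfac[OF Z f] by blast
    have "q \<star> f = ZeroA M Z X"
      using M.cmp_assoc[OF f'(1) n(1) q(1)] f'(2) q(3) M.cmp_zero_left[OF f'(1) XO] by simp
    then have "lw P q \<star> lw P f = ZeroA M (ActO M P Z) (ActO M P X)"
      using lw_cmp[OF PO f q(1)] F.F.map_zero[OF ZO XO] by simp
    then have "?w \<star> lw P f = ZeroA M (ActO M P Z) Y"
      using M.cmp_assoc[OF Pf Pq b(1)] M.cmp_zero_right[OF b(1) PZ] by simp
    then have "?u \<star> lw P f = ZeroA M (ActO M P Z) N"
      using M.cmp_assoc[OF Pf w(1) i(1)] M.cmp_zero_right[OF i(1) PZ] by simp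
    then show "f \<star> ZeroA M (ActO M P Z) Z = ?u \<star> lw P f"
      using M.cmp_zero_right[OF f PZ] by simp
  qed
  obtain S' t' where S': "S' \<in> Topologizing M" "insert N S1 \<subseteq> S'" "nat_act P S' t'"
    and t'0: "\<And>Z. Z \<in> S1 \<Longrightarrow> t' Z = ZeroA M (ActO M P Z) Z" and t'N: "t' N = ?u"
    using es.extend_over_N[OF comp] by blast
  obtain t where t: "nat_act P (Obj M) t" and tt': "\<And>Z. Z \<in> S' \<Longrightarrow> t Z = t' Z"
    using F.natural_extension[OF S'(1,3)] by blast
  note E0 = ends[OF M.Obj_topologizing]
  obtain a where a: "a \<in> Hom C P (A (Obj M))"
    "\<And>Z. Z \<in> Obj M \<Longrightarrow> p (Obj M) Z \<cdot>\<^bsub>C\<^esub> a = adj P Z Z (t Z)"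
    using end_arrow[OF E0 subset_refl PO t] by blast
  \<comment> \<open>The zero family is sent through the end as well, and \<open>a\<close> is
    compared with the resulting \<open>z\<close>.\<close>
  obtain z where z: "z \<in> Hom C P (A (Obj M))"
      "\<And>Z. Z \<in> Obj M \<Longrightarrow> p (Obj M) Z \<cdot>\<^bsub>C\<^esub> z = adj P Z Z (ZeroA M (ActO M P Z) Z)"
    using end_arrow[OF E0 subset_refl PO znat[OF subset_refl]] by blast
  have "\<phi> S1 \<cdot>\<^bsub>C\<^esub> a = \<phi> S1 \<cdot>\<^bsub>C\<^esub> z"
  proof (rule end_arrow_unique[OF ends[OF S1] top_sub[OF S1] C.cmp_hom[OF a(1) phi(1)[OF S1]]
    C.cmp_hom[OF z(1) phi(1)[OF S1]]])
    fix Z assume Z: "Z \<in> S1"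
    then have ZO: "Z \<in> Obj M" using top_sub[OF S1] by blast
    have "t Z = ZeroA M (ActO M P Z) Z" using tt'[of Z] t'0[OF Z] S'(2) Z by auto
    then show "p S1 Z \<cdot>\<^bsub>C\<^esub> (\<phi> S1 \<cdot>\<^bsub>C\<^esub> a) = p S1 Z \<cdot>\<^bsub>C\<^esub> (\<phi> S1 \<cdot>\<^bsub>C\<^esub> z)"
      using C.cmp_assoc[OF a(1) phi(1)[OF S1] end_proj_hom[OF S1 Z]]
        C.cmp_assoc[OF z(1) phi(1)[OF S1] end_proj_hom[OF S1 Z]]
        phi(2)[OF S1 Z] a(2)[OF ZO] z(2)[OF ZO] by simp
  qed
  moreover obtain h where h: "h \<in> Hom C (A S1) (A S2)" "h \<cdot>\<^bsub>C\<^esub> \<phi> S1 = \<phi> S2"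
  proof -
    have "Cod C (\<phi> S1) = A S1" "Cod C (\<phi> S2) = A S2"
      using phi(1)[OF S1] phi(1)[OF S2] by (auto simp: C.Hom_iff)
    then show ?thesis using ge that unfolding quo_ge_def by auto
  qed
  ultimately have "\<phi> S2 \<cdot>\<^bsub>C\<^esub> a = \<phi> S2 \<cdot>\<^bsub>C\<^esub> z"
    using C.cmp_assoc[OF a(1) phi(1)[OF S1] h(1)] C.cmp_assoc[OF z(1) phi(1)[OF S1] h(1)] by simp
  then have "p (Obj M) N \<cdot>\<^bsub>C\<^esub> a = p (Obj M) N \<cdot>\<^bsub>C\<^esub> z"
    using C.cmp_assoc[OF a(1) phi(1)[OF S2] end_proj_hom[OF S2 N(1)]]
      C.cmp_assoc[OF z(1) phi(1)[OF S2] end_proj_hom[OF S2 N(1)]] phi(2)[OF S2 N(1)] by simp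
  then have "adj P N N (t N) = adj P N N (ZeroA M (ActO M P N) N)" using a(2)[OF NO] z(2)[OF NO] by simp
  then have "t N = ZeroA M (ActO M P N) N"
    using adj_inj[OF PO NO NO natural_onD(1)[OF t NO] zhom[OF NO]] by simp
  then show False using tt'[of N] t'N S'(2) unz by auto
qed

end

end

theorem theorem4p6:
  fixes C :: "('k::alg_closed_field, 'co, 'ca) moncat"
    and M :: "('k, 'co, 'ca, 'mo, 'ma) modcat"
    and Ho :: "'mo \<Rightarrow> 'mo \<Rightarrow> 'co" and Ha :: "'ma \<Rightarrow> 'ma \<Rightarrow> 'ca"
    and adj :: "'co \<Rightarrow> 'mo \<Rightarrow> 'mo \<Rightarrow> 'ma \<Rightarrow> 'ca"
    and A :: "'mo set \<Rightarrow> 'co" and p :: "'mo set \<Rightarrow> 'mo \<Rightarrow> 'ca"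
  assumes "finite_tensor_category C"
    and "exact_module_category C M"
    and "internal_hom C M Ho Ha adj"
    and "\<And>S. S \<in> Topologizing M \<Longrightarrow> is_end (full_subcat M S) C Ho Ha (A S) (p S)"
  defines "\<Phi> \<equiv> end_restriction C A p (Obj M)"
  shows "\<Phi> \<in> Topologizing M \<rightarrow> Quo C (A (Obj M)) \<and>
    (\<forall>S1 \<in> Topologizing M. \<forall>S2 \<in> Topologizing M.
       S1 \<supseteq> S2 \<longrightarrow> quo_ge C (\<Phi> S1) (\<Phi> S2)) \<and>
    (indecomposable C M \<longrightarrow>
       (\<forall>S1 \<in> Topologizing M. \<forall>S2 \<in> Topologizing M.
          quo_ge C (\<Phi> S1) (\<Phi> S2) \<longrightarrow> S1 \<supseteq> S2))"
proof -
  interpret C: finite_tensor_category C by fact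
  interpret M: exact_module_category C M by fact
  interpret ih: internal_hom C M Ho Ha adj by fact
  \<comment> \<open>Both categories acquire their dimension from an equivalence with modules over an
    algebra.\<close>
  obtain dC where "abelian_category_with_length C dC" using finite_abelian_length[OF C.finite_abelian] by blast
  then interpret dC: abelian_category_with_length C dC .
  obtain dM where "abelian_category_with_length M dM" using finite_abelian_length[OF M.finite_abelian] by blast
  then interpret dM: abelian_category_with_length M dM .
  interpret exact_module_with_ihom C M dC dM Ho Ha adj by unfold_locales
  show ?thesis
    unfolding \<Phi>_def
    using phi_quotient[OF assms(4)] phi_order[OF assms(4)] phi_reflects[OF assms(4)] by blast
qed

end
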